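(* Let $(M,g)$ be a connected quaternionic-Kähler manifold of dimension $4n\geq 8$, and let $\mathcal C_2(M)$ be the vector space of compatible conformal-Killing $2$-forms on $(M,g)$. Then $$\dim \mathcal C_{2}(M)\leq (n+1)(2n+3).$$ Equality holds on the standard quaternionic projective space $\mathbb{H}P^{n}$.
   Context: A quaternionic-Kähler manifold is a Riemannian manifold $(M,g)$ of dimension $4n\geq 8$ with holonomy group included in $\mathrm{Sp}(1)\mathrm{Sp}(n)$; equivalently, there is a rank three sub-bundle $Q\subset \mathrm{End}(TM)$, preserved by the Levi-Civita connection $\nabla$ of $g$, locally generated by three anti-commuting $g$-orthogonal almost complex structures $J_1,J_2,J_3$ with $J_3=J_1J_2$, with Kähler forms $\omega_i:=g(J_i\cdot,\cdot)$. $\mathbb HP^n$ carries its standard quaternionic-Kähler structure. As real bundles, $S^2H\subset\Lambda^2(M)$ is the bundle spanned locally by $\omega_1,\omega_2,\omega_3$, and $S^2E\subset\Lambda^2(M)$ is the bundle of $2$-forms $\psi$ with $\psi(J_i\cdot,J_i\cdot)=\psi$ for $i=1,2,3$. A $2$-form is compatible if it is a section of $S^2H\oplus S^2E$. Tangent vectors are identified with $1$-forms using $g$. A $2$-form $\psi$ on $(M,g)$ is conformal-Killing if $\nabla_Y\psi=\frac13 i_Yd\psi-\frac{1}{4n-1}Y\wedge\delta\psi$ for all $Y\in TM$, where $\delta\psi=-\sum_k i_{e_k}\nabla_{e_k}\psi$ is the codifferential ($\{e_k\}$ a local orthonormal frame). Dimension is over $\mathbb R$. *)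

theory Defs
  imports "HOL-Analysis.Analysis" "HOL-Library.Function_Algebras"
begin

section \<open>Pointwise vector space structure on functions\<close>

instantiation "fun" :: (type, real_vector) real_vector
begin

definition scaleR_fun :: "real \<Rightarrow> ('a \<Rightarrow> 'b) \<Rightarrow> 'a \<Rightarrow> 'b" where
  "scaleR_fun r f = (\<lambda>x. r *\<^sub>R f x)"

instance
  by standard (auto simp: scaleR_fun_def fun_eq_iff scaleR_add_right scaleR_add_left)

end

text \<open>The library function \<open>dim\<close> is 0 on infinite-dimensional spaces, so bounds on it
  have to be accompanied by finite-dimensionality.\<close>

definition finite_dim :: "'v::real_vector set \<Rightarrow> bool" where
  "finite_dim V \<longleftrightarrow> (\<exists>B. finite B \<and> V \<subseteq> span B)"


section \<open>Smooth maps between open subsets of Euclidean spaces\<close>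

definition pd :: "('e::real_normed_vector \<Rightarrow> 'f::real_normed_vector) \<Rightarrow> 'e \<Rightarrow> 'e \<Rightarrow> 'f" where
  "pd f x v = frechet_derivative f (at x) v"

primrec Ck_on :: "nat \<Rightarrow> 'e::euclidean_space set \<Rightarrow> ('e \<Rightarrow> 'f::real_normed_vector) \<Rightarrow> bool" where
  "Ck_on 0 S = (\<lambda>f. continuous_on S f)"
| "Ck_on (Suc k) S = (\<lambda>f. (\<forall>x\<in>S. f differentiable (at x)) \<and> (\<forall>v. Ck_on k S (\<lambda>x. pd f x v)))"

text \<open>Only used for open \<open>S\<close>.\<close>

definition smooth_on :: "'e::euclidean_space set \<Rightarrow> ('e \<Rightarrow> 'f::real_normed_vector) \<Rightarrow> bool" where
  "smooth_on S f \<longleftrightarrow> (\<forall>k. Ck_on k S f)"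


section \<open>Smooth manifolds\<close>

text \<open>A manifold modelled on \<open>'e\<close> is a topological space with an atlas of charts
  \<open>chart i : chart_dom i \<rightarrow> 'e\<close>, \<open>i \<in> idx\<close>. Tensor fields are given by their local
  components: a field \<open>T\<close> assigns to a chart \<open>i\<close> and a coordinate point \<open>x\<close> in the range of
  that chart a tensor on \<open>'e\<close>, the components in different charts being related by the
  usual transformation law.\<close>

record ('i, 'm, 'e) manifold =
  mtop :: "'m topology"
  idx :: "'i set"
  chart_dom :: "'i \<Rightarrow> 'm set"
  chart :: "'i \<Rightarrow> 'm \<Rightarrow> 'e"

definition cod :: "('i, 'm, 'e, 'z) manifold_scheme \<Rightarrow> 'i \<Rightarrow> 'e set" where
  "cod M i = chart M i ` chart_dom M i"

definition transition :: "('i, 'm, 'e, 'z) manifold_scheme \<Rightarrow> 'i \<Rightarrow> 'i \<Rightarrow> 'e \<Rightarrow> 'e" where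
  "transition M i j = chart M j \<circ> inv_into (chart_dom M i) (chart M i)"

definition smooth_manifold :: "('i, 'm, 'e::euclidean_space, 'z) manifold_scheme \<Rightarrow> bool" where
  "smooth_manifold M \<longleftrightarrow>
     Hausdorff_space (mtop M) \<and> second_countable (mtop M) \<and>
     (\<Union>i\<in>idx M. chart_dom M i) = topspace (mtop M) \<and>
     (\<forall>i\<in>idx M. openin (mtop M) (chart_dom M i) \<and> open (cod M i) \<and>
        homeomorphic_map (subtopology (mtop M) (chart_dom M i)) (top_of_set (cod M i)) (chart M i)) \<and>
     (\<forall>i\<in>idx M. \<forall>j\<in>idx M.
        smooth_on (chart M i ` (chart_dom M i \<inter> chart_dom M j)) (transition M i j))"

text \<open>Smooth covariant tensor fields of rank 2.\<close>

type_synonym ('i, 'e) tensor2 = "'i \<Rightarrow> 'e \<Rightarrow> 'e \<Rightarrow> 'e \<Rightarrow> real"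

definition tensor2_field ::
    "('i, 'm, 'e::euclidean_space, 'z) manifold_scheme \<Rightarrow> ('i, 'e) tensor2 \<Rightarrow> bool" where
  "tensor2_field M T \<longleftrightarrow>
     (\<forall>i\<in>idx M. \<forall>x\<in>cod M i. bilinear (T i x)) \<and>
     (\<forall>i\<in>idx M. \<forall>u v. smooth_on (cod M i) (\<lambda>x. T i x u v)) \<and>
     (\<forall>i\<in>idx M. \<forall>j\<in>idx M. \<forall>p\<in>chart_dom M i \<inter> chart_dom M j. \<forall>u v.
        T i (chart M i p) u v =
        T j (chart M j p) (pd (transition M i j) (chart M i p) u)
                          (pd (transition M i j) (chart M i p) v))"

text \<open>Components are normalised to 0 outside the charts, so that equality of 2-forms is
  equality of functions.\<close>

definition two_form ::
    "('i, 'm, 'e::euclidean_space, 'z) manifold_scheme \<Rightarrow> ('i, 'e) tensor2 \<Rightarrow> bool" where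
  "two_form M \<psi> \<longleftrightarrow> tensor2_field M \<psi> \<and>
     (\<forall>i\<in>idx M. \<forall>x\<in>cod M i. \<forall>u v. \<psi> i x u v = - \<psi> i x v u) \<and>
     (\<forall>i x. \<not> (i \<in> idx M \<and> x \<in> cod M i) \<longrightarrow> \<psi> i x = (\<lambda>u v. 0))"


section \<open>Riemannian manifolds and the Levi-Civita connection\<close>

record ('i, 'm, 'e) riem = "('i, 'm, 'e) manifold" +
  metric :: "('i, 'e) tensor2"

definition riemannian_manifold :: "('i, 'm, 'e::euclidean_space, 'z) riem_scheme \<Rightarrow> bool" where
  "riemannian_manifold M \<longleftrightarrow> smooth_manifold M \<and> tensor2_field M (metric M) \<and>
     (\<forall>i\<in>idx M. \<forall>x\<in>cod M i.
        (\<forall>u v. metric M i x u v = metric M i x v u) \<and>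
        (\<forall>u. u \<noteq> 0 \<longrightarrow> metric M i x u u > 0))"

text \<open>The Christoffel map of the unique torsion-free metric connection: for constant vector
  fields in the chart, \<open>\<nabla>\<^sub>u v = christoffel M i x u v\<close>.\<close>

definition christoffel ::
    "('i, 'm, 'e::euclidean_space, 'z) riem_scheme \<Rightarrow> 'i \<Rightarrow> 'e \<Rightarrow> 'e \<Rightarrow> 'e \<Rightarrow> 'e" where
  "christoffel M i x = (THE \<Gamma>. bilinear \<Gamma> \<and> (\<forall>u v. \<Gamma> u v = \<Gamma> v u) \<and>
     (\<forall>w u v. pd (\<lambda>y. metric M i y u v) x w
        = metric M i x (\<Gamma> w u) v + metric M i x u (\<Gamma> w v)))"

definition nabla_tensor2 ::
    "('i, 'm, 'e::euclidean_space, 'z) riem_scheme \<Rightarrow> ('i, 'e) tensor2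
      \<Rightarrow> 'i \<Rightarrow> 'e \<Rightarrow> 'e \<Rightarrow> 'e \<Rightarrow> 'e \<Rightarrow> real" where
  "nabla_tensor2 M \<psi> i x Y u v = pd (\<lambda>y. \<psi> i y u v) x Y
     - \<psi> i x (christoffel M i x Y u) v - \<psi> i x u (christoffel M i x Y v)"

text \<open>Covariant derivative of a local section \<open>A\<close> of \<open>End(TM)\<close>, given in the chart \<open>i\<close>.\<close>

definition nabla_end ::
    "('i, 'm, 'e::euclidean_space, 'z) riem_scheme \<Rightarrow> 'i \<Rightarrow> ('e \<Rightarrow> 'e \<Rightarrow> 'e)
      \<Rightarrow> 'e \<Rightarrow> 'e \<Rightarrow> 'e \<Rightarrow> 'e" where
  "nabla_end M i A x Y u = pd (\<lambda>y. A y u) x Y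
     + christoffel M i x Y (A x u) - A x (christoffel M i x Y u)"

definition ext_d :: "('i, 'e::euclidean_space) tensor2 \<Rightarrow> 'i \<Rightarrow> 'e \<Rightarrow> 'e \<Rightarrow> 'e \<Rightarrow> 'e \<Rightarrow> real" where
  "ext_d \<psi> i x u v w =
     pd (\<lambda>y. \<psi> i y v w) x u - pd (\<lambda>y. \<psi> i y u w) x v + pd (\<lambda>y. \<psi> i y u v) x w"

definition orthonormal_basis ::
    "('e::euclidean_space \<Rightarrow> 'e \<Rightarrow> real) \<Rightarrow> 'e set \<Rightarrow> bool" where
  "orthonormal_basis h B \<longleftrightarrow> finite B \<and> card B = DIM('e) \<and>
     (\<forall>a\<in>B. \<forall>b\<in>B. h a b = (if a = b then 1 else 0))"

definition codiff ::
    "('i, 'm, 'e::euclidean_space, 'z) riem_scheme \<Rightarrow> ('i, 'e) tensor2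
      \<Rightarrow> 'i \<Rightarrow> 'e \<Rightarrow> 'e \<Rightarrow> real" where
  "codiff M \<psi> i x v =
     - (\<Sum>e\<in>(SOME B. orthonormal_basis (metric M i x) B). nabla_tensor2 M \<psi> i x e e v)"

text \<open>The subtracted term contains \<open>(Y \<and> \<delta>\<psi>)(u, v) = g(Y, u) \<delta>\<psi>(v) - g(Y, v) \<delta>\<psi>(u)\<close>.\<close>

definition conformal_killing ::
    "('i, 'm, 'e::euclidean_space, 'z) riem_scheme \<Rightarrow> ('i, 'e) tensor2 \<Rightarrow> bool" where
  "conformal_killing M \<psi> \<longleftrightarrow> two_form M \<psi> \<and>
     (\<forall>i\<in>idx M. \<forall>x\<in>cod M i. \<forall>Y u v.
        nabla_tensor2 M \<psi> i x Y u v =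
          1 / 3 * ext_d \<psi> i x Y u v
          - 1 / (real DIM('e) - 1)
            * (metric M i x Y u * codiff M \<psi> i x v - metric M i x Y v * codiff M \<psi> i x u))"


section \<open>Quaternionic-Kaehler manifolds\<close>

record ('i, 'm, 'e) qriem = "('i, 'm, 'e) riem" +
  qbundle :: "'i \<Rightarrow> 'e \<Rightarrow> ('e \<Rightarrow> 'e) set"

definition quat_triple ::
    "('e::euclidean_space \<Rightarrow> 'e \<Rightarrow> real) \<Rightarrow> ('e \<Rightarrow> 'e) \<Rightarrow> ('e \<Rightarrow> 'e) \<Rightarrow> ('e \<Rightarrow> 'e) \<Rightarrow> bool" where
  "quat_triple h J1 J2 J3 \<longleftrightarrow>
     (\<forall>J\<in>{J1, J2, J3}. linear J \<and> (\<forall>u. J (J u) = - u) \<and> (\<forall>u v. h (J u) (J v) = h u v)) \<and>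
     (\<forall>u. J1 (J2 u) = - J2 (J1 u) \<and> J2 (J3 u) = - J3 (J2 u) \<and> J1 (J3 u) = - J3 (J1 u)) \<and>
     J3 = J1 \<circ> J2"

text \<open>The bundle \<open>Q\<close> has rank three because a quaternionic triple is linearly independent.\<close>

definition quaternionic_kaehler :: "('i, 'm, 'e::euclidean_space, 'z) qriem_scheme \<Rightarrow> bool" where
  "quaternionic_kaehler M \<longleftrightarrow> riemannian_manifold M \<and>
     (\<forall>i\<in>idx M. \<forall>j\<in>idx M. \<forall>p\<in>chart_dom M i \<inter> chart_dom M j.
        qbundle M j (chart M j p) =
        (\<lambda>A. pd (transition M i j) (chart M i p) \<circ> A \<circ> pd (transition M j i) (chart M j p))
          ` qbundle M i (chart M i p)) \<and>
     (\<forall>i\<in>idx M. \<forall>x\<in>cod M i. \<exists>W J1 J2 J3. open W \<and> x \<in> W \<and> W \<subseteq> cod M i \<and>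
        (\<forall>u. smooth_on W (\<lambda>y. J1 y u) \<and> smooth_on W (\<lambda>y. J2 y u) \<and> smooth_on W (\<lambda>y. J3 y u)) \<and>
        (\<forall>y\<in>W. quat_triple (metric M i y) (J1 y) (J2 y) (J3 y) \<and>
               qbundle M i y = span {J1 y, J2 y, J3 y})) \<and>
     (\<forall>i\<in>idx M. \<forall>W A. open W \<and> W \<subseteq> cod M i \<and> (\<forall>u. smooth_on W (\<lambda>y. A y u)) \<and>
        (\<forall>y\<in>W. A y \<in> qbundle M i y) \<longrightarrow>
        (\<forall>x\<in>W. \<forall>Y. nabla_end M i A x Y \<in> qbundle M i x))"

definition S2H ::
    "('i, 'm, 'e::euclidean_space, 'z) qriem_scheme \<Rightarrow> 'i \<Rightarrow> 'e \<Rightarrow> ('e \<Rightarrow> 'e \<Rightarrow> real) set" where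
  "S2H M i x = {\<lambda>u v. metric M i x (A u) v | A. A \<in> qbundle M i x}"

definition S2E ::
    "('i, 'm, 'e::euclidean_space, 'z) qriem_scheme \<Rightarrow> 'i \<Rightarrow> 'e \<Rightarrow> ('e \<Rightarrow> 'e \<Rightarrow> real) set" where
  "S2E M i x = {\<phi>. bilinear \<phi> \<and> (\<forall>u v. \<phi> u v = - \<phi> v u) \<and>
     (\<forall>J1 J2 J3. quat_triple (metric M i x) J1 J2 J3 \<and> qbundle M i x = span {J1, J2, J3} \<longrightarrow>
        (\<forall>J\<in>{J1, J2, J3}. \<forall>u v. \<phi> (J u) (J v) = \<phi> u v))}"

definition compatible ::
    "('i, 'm, 'e::euclidean_space, 'z) qriem_scheme \<Rightarrow> ('i, 'e) tensor2 \<Rightarrow> bool" where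
  "compatible M \<psi> \<longleftrightarrow> two_form M \<psi> \<and>
     (\<forall>i\<in>idx M. \<forall>x\<in>cod M i. \<exists>\<sigma>\<in>S2H M i x. \<exists>\<phi>\<in>S2E M i x. \<psi> i x = \<sigma> + \<phi>)"

definition compatible_CK2 ::
    "('i, 'm, 'e::euclidean_space, 'z) qriem_scheme \<Rightarrow> ('i, 'e) tensor2 set" where
  "compatible_CK2 M = {\<psi>. compatible M \<psi> \<and> conformal_killing M \<psi>}"


section \<open>Quaternionic projective space\<close>

text \<open>The pair \<open>(a, b)\<close> of complex numbers stands for the quaternion \<open>a + b j\<close>.\<close>

type_synonym quat = "complex \<times> complex"

definition qone :: quat where "qone = (1, 0)"

definition qmul :: "quat \<Rightarrow> quat \<Rightarrow> quat" where
  "qmul p q = (fst p * fst q - snd p * cnj (snd q), fst p * snd q + snd p * cnj (fst q))"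

definition qcnj :: "quat \<Rightarrow> quat" where
  "qcnj p = (cnj (fst p), - snd p)"

definition qscale :: "quat ^ 'k \<Rightarrow> quat \<Rightarrow> quat ^ 'k" where
  "qscale v q = (\<chi> l. qmul (v $ l) q)"

definition qherm :: "quat ^ 'k \<Rightarrow> quat ^ 'k::finite \<Rightarrow> quat" where
  "qherm v w = (\<Sum>l\<in>UNIV. qmul (qcnj (v $ l)) (w $ l))"

text \<open>With \<open>n = CARD('k)\<close>, points are the right quaternionic lines in
  \<open>\<H>\<^sup>n\<^sup>+\<^sup>1 = quat ^ 'k option\<close>, with the quotient topology.\<close>

definition qline :: "quat ^ 'k option \<Rightarrow> (quat ^ 'k::finite option) set" where
  "qline v = range (qscale v)"

definition HP_top :: "(quat ^ 'k::finite option) set topology" where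
  "HP_top = topology (\<lambda>U. U \<subseteq> qline ` (- {0}) \<and> open {v. v \<noteq> 0 \<and> qline v \<in> U})"

lemma istopology_HP:
  "istopology (\<lambda>U. U \<subseteq> qline ` (- {0}) \<and> open {v. v \<noteq> 0 \<and> qline v \<in> U})"
proof -
  have 1: "{v. v \<noteq> 0 \<and> qline v \<in> S \<inter> T} = {v. v \<noteq> 0 \<and> qline v \<in> S} \<inter> {v. v \<noteq> 0 \<and> qline v \<in> T}"
    for S T by auto
  have 2: "{v. v \<noteq> 0 \<and> qline v \<in> \<Union>K} = (\<Union>U\<in>K. {v. v \<noteq> 0 \<and> qline v \<in> U})" for K by auto
  show ?thesis
    unfolding istopology_def by (intro conjI allI impI) (auto simp only: 1 2 intro!: open_Int open_UN)
qed

lemma openin_HP_top: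
  "openin HP_top U \<longleftrightarrow> U \<subseteq> qline ` (- {0}) \<and> open {v. v \<noteq> 0 \<and> qline v \<in> U}"
  unfolding HP_top_def by (simp add: topology_inverse'[OF istopology_HP])

lemma quotient_map_HP:
  "quotient_map (top_of_set (- {0})) (HP_top :: (quat ^ 'k::finite option) set topology) qline"
proof -
  have ts: "topspace (HP_top :: (quat ^ 'k option) set topology) = qline ` (- {0})"
  proof
    show "topspace (HP_top :: (quat ^ 'k option) set topology) \<subseteq> qline ` (- {0})"
      using openin_HP_top openin_topspace by blast
    have "{v :: quat ^ 'k option. v \<noteq> 0 \<and> qline v \<in> qline ` (- {0})} = - {0}" by auto
    then have "openin (HP_top :: (quat ^ 'k option) set topology) (qline ` (- {0}))"
    proof -
      have "open (- {0 :: quat ^ 'k option})" by (rule open_Compl) (rule closed_singleton)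
      with \<open>_ = - {0}\<close> show ?thesis unfolding openin_HP_top by (simp only: subset_refl simp_thms)
    qed
    then show "qline ` (- {0}) \<subseteq> topspace (HP_top :: (quat ^ 'k option) set topology)"
      by (rule openin_subset)
  qed
  show ?thesis
    unfolding quotient_map_def
  proof (intro conjI allI impI)
    show "qline ` topspace (top_of_set (- {0})) = topspace (HP_top :: (quat ^ 'k option) set topology)"
      by (simp add: ts)
    fix U :: "(quat ^ 'k option) set set" assume "U \<subseteq> topspace HP_top"
    then have U: "U \<subseteq> qline ` (- {0})" by (simp only: ts)
    have eq: "{v \<in> topspace (top_of_set (- {0})). qline v \<in> U} = {v. v \<noteq> 0 \<and> qline v \<in> U}"
      by (simp only: topspace_euclidean_subtopology) blast
    have "open (- {0 :: quat ^ 'k option})" by (rule open_Compl) (rule closed_singleton)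
    then have "openin (top_of_set (- {0})) {v. v \<noteq> 0 \<and> qline v \<in> U}
        \<longleftrightarrow> open {v. v \<noteq> 0 \<and> qline v \<in> U} \<and> {v. v \<noteq> 0 \<and> qline v \<in> U} \<subseteq> - {0}"
      by (rule openin_open_eq)
    moreover have "{v. v \<noteq> 0 \<and> qline v \<in> U} \<subseteq> - {0}" by blast
    ultimately show "openin (top_of_set (- {0})) {v \<in> topspace (top_of_set (- {0})). qline v \<in> U}
        = openin HP_top U"
      unfolding eq openin_HP_top using U by argo
  qed
qed

text \<open>\<open>affine_lift i x\<close> has entry 1 at position \<open>i\<close>, the other entries being those of \<open>x\<close>
  (for \<open>i = Some m\<close>, the entry \<open>x $ m\<close> is moved to position \<open>None\<close>). The chart \<open>i\<close> is the
  inverse of \<open>x \<mapsto> qline (affine_lift i x)\<close>.\<close>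

definition affine_lift :: "'k option \<Rightarrow> quat ^ 'k::finite \<Rightarrow> quat ^ 'k option" where
  "affine_lift i x =
     (\<chi> l. if l = i then qone else case l of Some k \<Rightarrow> x $ k | None \<Rightarrow> x $ the i)"

text \<open>Metric: the tangent vector \<open>u\<close> at \<open>x\<close> lifts to \<open>(0, u)\<close> at \<open>s = (1, x)\<close>, and the metric of
  the Riemannian submersion \<open>S\<^sup>4\<^sup>n\<^sup>+\<^sup>3 \<rightarrow> \<H>P\<^sup>n\<close> is the inner product of the
  components orthogonal to the line of \<open>s\<close>, divided by \<open>s \<bullet> s = 1 + x \<bullet> x\<close>.
  Quaternionic structure: \<open>T\<^sub>L \<H>P\<^sup>n = Hom\<^sub>\<H>(L, \<H>\<^sup>n\<^sup>+\<^sup>1/L)\<close>, on which \<open>End\<^sub>\<H>(L)\<close> acts by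
  precomposition; in terms of the generator \<open>(1, x)\<close> of \<open>L\<close> this is right multiplication on \<open>u\<close>.\<close>

definition HP :: "('k option, (quat ^ 'k option) set, quat ^ 'k::finite) qriem" where
  "HP = \<lparr> mtop = HP_top,
          idx = UNIV,
          chart_dom = (\<lambda>i. range (\<lambda>x. qline (affine_lift i x))),
          chart = (\<lambda>i L. THE x. affine_lift i x \<in> L),
          metric = (\<lambda>i x u v.
            ((1 + x \<bullet> x) * (u \<bullet> v) - qherm x u \<bullet> qherm x v) / (1 + x \<bullet> x)\<^sup>2),
          qbundle = (\<lambda>i x. {\<lambda>u. qscale u q | q. Re (fst q) = 0}) \<rparr>"

end

theory Submission
  imports Defs
begin

text \<open>
  The conformal-Killing equation says that \<open>\<nabla>\<^sub>Y \<psi> = i\<^sub>Y \<alpha> + Y \<and> \<theta>\<close> with a 3-form \<open>\<alpha>\<close> and the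
  1-form \<open>\<theta> = - \<delta>\<psi> / (4n - 1)\<close>. If \<open>\<psi>\<close> is compatible then so is \<open>\<nabla>\<^sub>Y \<psi>\<close>, because the Levi-Civita
  connection preserves \<open>Q\<close>. In dimension greater than 4 this forces \<open>\<alpha> = - \<Sum>\<^sub>i (\<theta> \<circ> J\<^sub>i) \<and> \<omega>\<^sub>i\<close>, so
  \<open>\<nabla>\<psi>\<close> is an explicit algebraic expression \<open>T \<theta>\<close>, where \<open>T\<close> is parallel. By the symmetry of second
  partial derivatives, the skew part of \<open>T (\<nabla>\<theta>)\<close> is an algebraic expression in \<open>(\<psi>, \<theta>)\<close>; as the map
  from \<open>\<nabla>\<theta>\<close> to this skew part is injective, \<open>(\<psi>, \<theta>)\<close> solves a closed linear system of first order. On a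
  connected manifold \<open>\<psi>\<close> is therefore determined by the values of \<open>\<psi>\<close> and \<open>\<delta>\<psi>\<close> at one point, which are
  \<open>3 + n (2n + 1) + 4n = (n + 1) (2n + 3)\<close> real numbers.

  On \<open>HP\<^sup>n\<close> let \<open>S\<close> be a skew-hermitian matrix of size \<open>n + 1\<close>. At a line spanned by \<open>s\<close>, with horizontal
  lifts \<open>u\<^sup>h\<close>, \<open>v\<^sup>h\<close> of tangent vectors and \<open>\<mu> = \<langle>s, S s\<rangle> / |s|\<^sup>2\<close>, the 2-form
  \<open>\<psi>\<^sub>S (u, v) = (\<langle>S u\<^sup>h, v\<^sup>h\<rangle> + \<langle>u\<^sup>h \<mu>, v\<^sup>h\<rangle> / 2) / |s|\<^sup>2\<close> is well defined, compatible and conformal-Killing, and \<open>S\<close> can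
  be recovered from it. These matrices form a space of dimension \<open>(n + 1) (2n + 3)\<close>.
\<close>

section \<open>Smooth functions\<close>

text \<open>The upper bound avoids an explicit prolongation connection: inverting the symbol would
  bring in the curvature of M, whereas \<open>symbol_bound\<close> only estimates \<nabla>\<theta>
  by the skew part of T(\<nabla>\<theta>), and a linear differential inequality on compact sets is
  all that a Gronwall argument needs. Dimension greater than 4 enters through a vector u orthogonal
  to the quaternionic line of Y: pairing with u, J1 u, J2 u separates the coefficients of the 3-form
  as well as the values of \<nabla>\<theta>. The splitting of a compatible form and the 1-form
  \<theta> are given pointwise only; before anything can be differentiated, both are re-expressed as
  quotients of smooth functions. On the projective space everything is computed with homogeneous
  representatives s. Motion along the fibre always cancels against the normalisation by |s|^2. The
  weight 1/2 is the one for which the imaginary part of the hermitian product of S s and the lift of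
  Y drops out of the derivative in direction Y. Injectivity in S needs n >= 2, so that each
  off-diagonal entry is visible at the origin of a third chart.\<close>

lemma pd_eq: "(f has_derivative D) (at x) \<Longrightarrow> pd f x = D"
  unfolding pd_def by (auto simp: frechet_derivative_at[symmetric])

lemma pd_has_derivative: "f differentiable (at x) \<Longrightarrow> (f has_derivative pd f x) (at x)"
  using frechet_derivative_works[of f "at x"] by (simp add: pd_def[abs_def])

lemma pd_linear: "f differentiable (at x) \<Longrightarrow> linear (pd f x)"
  using pd_has_derivative has_derivative_linear by blast

lemma pd_cong:
  assumes "open S" "x \<in> S" "\<And>y. y \<in> S \<Longrightarrow> f y = g y"
  shows "pd f x = pd g x"
proof -
  have "(f has_derivative D) (at x) \<longleftrightarrow> (g has_derivative D) (at x)" for D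
    using assms has_derivative_transform_within_open[of f D x UNIV S g]
      has_derivative_transform_within_open[of g D x UNIV S f] by auto
  then show ?thesis by (simp add: pd_def frechet_derivative_def fun_eq_iff)
qed

lemma differentiable_cong_open:
  assumes "open S" "x \<in> S" "\<And>y. y \<in> S \<Longrightarrow> f y = g y" "f differentiable (at x)"
  shows "g differentiable (at x)"
  using assms has_derivative_transform_within_open[of f _ x UNIV S g]
  unfolding differentiable_def by blast

lemma Ck_on_cong:
  assumes "open S" "\<And>y. y \<in> S \<Longrightarrow> f y = g y" "Ck_on k S f"
  shows "Ck_on k S g"
  using assms
proof (induction k arbitrary: f g)
  case 0
  then show ?case using continuous_on_cong[of S S f g] by auto
next
  case (Suc k)
  have "Ck_on k S (\<lambda>x. pd g x v)" for v
  proof (rule Suc.IH[of "\<lambda>x. pd f x v"])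
    show "pd f y v = pd g y v" if "y \<in> S" for y
      using pd_cong[of S y f g] that Suc.prems by simp
  qed (use Suc.prems in auto)
  then show ?case using Suc.prems differentiable_cong_open[of S _ f g] by auto
qed

lemma Ck_on_subset: "Ck_on k S f \<Longrightarrow> T \<subseteq> S \<Longrightarrow> Ck_on k T f"
proof (induction k arbitrary: f)
  case 0
  then show ?case using continuous_on_subset by auto
qed auto

lemma Ck_on_imp_continuous_on: "Ck_on k S f \<Longrightarrow> continuous_on S f"
proof (cases k)
  case (Suc m)
  assume "Ck_on k S f"
  then show ?thesis using Suc
    by (auto intro!: differentiable_imp_continuous_on differentiable_at_imp_differentiable_on)
qed auto

text \<open>\<open>Ck_on (Suc k)\<close> speaks only of differentiability and of the directional
  derivatives, so lowering the order has to descend through the derivatives down to the case of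
  continuity.\<close>

lemma Ck_on_Suc_imp: "Ck_on (Suc k) S f \<Longrightarrow> Ck_on k S f"
proof (induction k arbitrary: f)
  case 0
  then show ?case using Ck_on_imp_continuous_on[OF 0] by simp
next
  case (Suc k)
  have "Ck_on k S (\<lambda>x. pd f x v)" for v
  proof (rule Suc.IH)
    show "Ck_on (Suc k) S (\<lambda>x. pd f x v)"
      using Suc.prems Ck_on.simps(2)[of "Suc k" S] by metis
  qed
  then show ?case using Suc.prems by auto
qed

lemma Ck_on_bounded_linear_comp:
  assumes "open S" "bounded_linear L" "Ck_on k S f"
  shows "Ck_on k S (\<lambda>x. L (f x))"
  using assms(3)
proof (induction k arbitrary: f)
  case 0
  then show ?case using assms(2) by (auto intro: bounded_linear.continuous_on)
next
  case (Suc k)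
  have d: "((\<lambda>x. L (f x)) has_derivative (\<lambda>v. L (pd f x v))) (at x)" if "x \<in> S" for x
    using bounded_linear.has_derivative[OF assms(2) pd_has_derivative] Suc.prems that by auto
  have "Ck_on k S (\<lambda>x. pd (\<lambda>x. L (f x)) x v)" for v
    by (rule Ck_on_cong[OF assms(1) _ Suc.IH[of "\<lambda>x. pd f x v"]])
       (use Suc.prems pd_eq[OF d] in auto)
  then show ?case using d by (auto simp: differentiable_def)
qed

lemma Ck_on_add:
  assumes "open S" "Ck_on k S f" "Ck_on k S g"
  shows "Ck_on k S (\<lambda>x. f x + g x)"
  using assms(2,3)
proof (induction k arbitrary: f g)
  case 0
  then show ?case by (auto intro: continuous_on_add)
next
  case (Suc k)
  have d: "((\<lambda>x. f x + g x) has_derivative (\<lambda>v. pd f x v + pd g x v)) (at x)" if "x \<in> S" for x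
    using has_derivative_add[OF pd_has_derivative[of f x] pd_has_derivative[of g x]] Suc.prems that by auto
  have "Ck_on k S (\<lambda>x. pd (\<lambda>x. f x + g x) x v)" for v
    by (rule Ck_on_cong[OF assms(1) _ Suc.IH[of "\<lambda>x. pd f x v" "\<lambda>x. pd g x v"]])
       (use Suc.prems pd_eq[OF d] in auto)
  then show ?case using d by (auto simp: differentiable_def)
qed

lemma Ck_on_const: "open S \<Longrightarrow> Ck_on k S (\<lambda>x. c)"
proof (induction k arbitrary: c)
  case (Suc k)
  have "pd (\<lambda>x. c) x v = 0" for x v :: 'a using pd_eq[OF has_derivative_const] by metis
  then show ?case using Suc by simp
qed auto

lemma Ck_on_bilinear:
  assumes "open S" "bounded_bilinear B" "Ck_on k S f" "Ck_on k S g"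
  shows "Ck_on k S (\<lambda>x. B (f x) (g x))"
  using assms(3,4)
proof (induction k arbitrary: f g)
  case 0
  then show ?case using bounded_bilinear.continuous_on[OF assms(2)] by auto
next
  case (Suc k)
  have d: "((\<lambda>x. B (f x) (g x)) has_derivative (\<lambda>v. B (f x) (pd g x v) + B (pd f x v) (g x))) (at x)"
    if "x \<in> S" for x
    using bounded_bilinear.FDERIV[OF assms(2) pd_has_derivative[of f x] pd_has_derivative[of g x]] Suc.prems that by auto
  have "Ck_on k S (\<lambda>x. pd (\<lambda>x. B (f x) (g x)) x v)" for v
    by (rule Ck_on_cong[OF assms(1) _ Ck_on_add[OF assms(1) Suc.IH[of "\<lambda>x. f x" "\<lambda>x. pd g x v"]
          Suc.IH[of "\<lambda>x. pd f x v" "\<lambda>x. g x"]]])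
       (use Suc.prems pd_eq[OF d] Ck_on_Suc_imp in auto)
  then show ?case using d by (auto simp: differentiable_def)
qed

lemma Ck_on_inverse:
  fixes f :: "'a::euclidean_space \<Rightarrow> real"
  assumes "open S" "\<And>x. x \<in> S \<Longrightarrow> f x \<noteq> 0" "Ck_on k S f"
  shows "Ck_on k S (\<lambda>x. inverse (f x))"
  using assms(3)
proof (induction k)
  case 0
  then show ?case using assms(2) by (auto intro!: continuous_on_inverse)
next
  case (Suc k)
  \<comment> \<open>Written as a product with two copies of the inverse, so that the product rule
    and the induction hypothesis apply.\<close>
  have d: "((\<lambda>x. inverse (f x)) has_derivative (\<lambda>v. (- pd f x v) * (inverse (f x) * inverse (f x)))) (at x)"
    if "x \<in> S" for x
  proof -
    have "f differentiable (at x)" using Suc.prems that by simp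
    from Deriv.has_derivative_inverse[OF assms(2)[OF that] pd_has_derivative[OF this]]
    show ?thesis by (rule has_derivative_eq_rhs) (simp add: mult_ac)
  qed
  have f: "Ck_on k S (\<lambda>x. inverse (f x))" by (rule Suc.IH[OF Ck_on_Suc_imp[OF Suc.prems]])
  have "Ck_on k S (\<lambda>x. pd (\<lambda>x. inverse (f x)) x v)" for v
    by (rule Ck_on_cong[OF assms(1) _ Ck_on_bilinear[OF assms(1) bounded_bilinear_mult
         Ck_on_bounded_linear_comp[OF assms(1) bounded_linear_minus[OF bounded_linear_ident], of k "\<lambda>x. pd f x v"]
         Ck_on_bilinear[OF assms(1) bounded_bilinear_mult f f]]])
       (use Suc.prems pd_eq[OF d] in auto)
  then show ?case using d by (auto simp: differentiable_def)
qed

lemma Ck_on_bounded_linear: "open S \<Longrightarrow> bounded_linear L \<Longrightarrow> Ck_on k S L"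
proof (cases k)
  case 0
  assume "bounded_linear L"
  then show ?thesis using 0 by (simp add: linear_continuous_on)
next
  case (Suc m)
  assume *: "open S" "bounded_linear L"
  have d: "(L has_derivative L) (at x)" for x
    by (rule bounded_linear_imp_has_derivative[OF *(2)])
  then show ?thesis using Suc pd_eq[OF d] Ck_on_const[OF *(1)] by (auto simp: differentiable_def)
qed

lemma Ck_on_uminus: "open S \<Longrightarrow> Ck_on k S f \<Longrightarrow> Ck_on k S (\<lambda>x. - f x)"
  by (rule Ck_on_bounded_linear_comp[OF _ bounded_linear_minus[OF bounded_linear_ident]])

lemma Ck_on_diff: "open S \<Longrightarrow> Ck_on k S f \<Longrightarrow> Ck_on k S g \<Longrightarrow> Ck_on k S (\<lambda>x. f x - g x)"
  using Ck_on_add[of S k f "\<lambda>x. - g x"] Ck_on_uminus[of S k g] by simp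

lemma Ck_on_sum:
  "open S \<Longrightarrow> (\<And>a. a \<in> I \<Longrightarrow> Ck_on k S (f a)) \<Longrightarrow> Ck_on k S (\<lambda>x. \<Sum>a\<in>I. f a x)"
  by (induction I rule: infinite_finite_induct) (auto intro: Ck_on_const Ck_on_add)

lemma smooth_on_pd: "smooth_on S f \<Longrightarrow> smooth_on S (\<lambda>x. pd f x v)"
  unfolding smooth_on_def using Ck_on.simps(2) by metis

lemma smooth_on_differentiable: "smooth_on S f \<Longrightarrow> x \<in> S \<Longrightarrow> f differentiable (at x)"
  unfolding smooth_on_def using Ck_on.simps(2) by metis

lemma smooth_on_continuous_on: "smooth_on S f \<Longrightarrow> continuous_on S f"
  unfolding smooth_on_def using Ck_on_imp_continuous_on by metis

lemma smooth_on_subset: "smooth_on S f \<Longrightarrow> T \<subseteq> S \<Longrightarrow> smooth_on T f"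
  unfolding smooth_on_def using Ck_on_subset by metis

lemma smooth_on_cong:
  "smooth_on S f \<Longrightarrow> open S \<Longrightarrow> (\<And>x. x \<in> S \<Longrightarrow> f x = g x) \<Longrightarrow> smooth_on S g"
  unfolding smooth_on_def using Ck_on_cong by metis

lemma smooth_on_const: "open S \<Longrightarrow> smooth_on S (\<lambda>x. c)"
  by (simp add: smooth_on_def Ck_on_const)

lemma smooth_on_bounded_linear: "open S \<Longrightarrow> bounded_linear L \<Longrightarrow> smooth_on S L"
  by (simp add: smooth_on_def Ck_on_bounded_linear)

lemma smooth_on_bounded_linear_comp:
  "open S \<Longrightarrow> bounded_linear L \<Longrightarrow> smooth_on S f \<Longrightarrow> smooth_on S (\<lambda>x. L (f x))"
  by (simp add: smooth_on_def Ck_on_bounded_linear_comp)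

lemma smooth_on_bilinear:
  "open S \<Longrightarrow> bounded_bilinear B \<Longrightarrow> smooth_on S f \<Longrightarrow> smooth_on S g \<Longrightarrow> smooth_on S (\<lambda>x. B (f x) (g x))"
  by (simp add: smooth_on_def Ck_on_bilinear)

lemma smooth_on_add: "open S \<Longrightarrow> smooth_on S f \<Longrightarrow> smooth_on S g \<Longrightarrow> smooth_on S (\<lambda>x. f x + g x)"
  by (simp add: smooth_on_def Ck_on_add)

lemma smooth_on_diff: "open S \<Longrightarrow> smooth_on S f \<Longrightarrow> smooth_on S g \<Longrightarrow> smooth_on S (\<lambda>x. f x - g x)"
  by (simp add: smooth_on_def Ck_on_diff)

lemma smooth_on_uminus: "open S \<Longrightarrow> smooth_on S f \<Longrightarrow> smooth_on S (\<lambda>x. - f x)"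
  by (simp add: smooth_on_def Ck_on_uminus)

lemma smooth_on_sum:
  "open S \<Longrightarrow> (\<And>a. a \<in> I \<Longrightarrow> smooth_on S (f a)) \<Longrightarrow> smooth_on S (\<lambda>x. \<Sum>a\<in>I. f a x)"
  by (simp add: smooth_on_def Ck_on_sum)

lemma smooth_on_inverse:
  fixes f :: "'a::euclidean_space \<Rightarrow> real"
  shows "open S \<Longrightarrow> (\<And>x. x \<in> S \<Longrightarrow> f x \<noteq> 0) \<Longrightarrow> smooth_on S f \<Longrightarrow> smooth_on S (\<lambda>x. inverse (f x))"
  by (simp add: smooth_on_def Ck_on_inverse)

lemmas smooth_on_mult = smooth_on_bilinear[OF _ bounded_bilinear_mult]
lemmas smooth_on_scaleR = smooth_on_bilinear[OF _ bounded_bilinear_scaleR]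
lemmas smooth_on_inner = smooth_on_bilinear[OF _ bounded_bilinear_inner]

lemma smooth_on_divide:
  fixes f g :: "'a::euclidean_space \<Rightarrow> real"
  shows "open S \<Longrightarrow> smooth_on S f \<Longrightarrow> smooth_on S g \<Longrightarrow> (\<And>x. x \<in> S \<Longrightarrow> g x \<noteq> 0)
    \<Longrightarrow> smooth_on S (\<lambda>x. f x / g x)"
  by (simp add: divide_inverse smooth_on_mult smooth_on_inverse)

text \<open>Schwarz's theorem: the second difference of f over a small parallelogram is symmetric in
  u and v, and the mean value theorem used twice expresses it through either mixed derivative at a
  nearby point. Continuity of both mixed derivatives at x finishes the argument.\<close>

lemma pd_commute:
  fixes f :: "'e::euclidean_space \<Rightarrow> real"
  assumes S: "open S" "x \<in> S" and f: "Ck_on 2 S f"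
  shows "pd (\<lambda>y. pd f y u) x v = pd (\<lambda>y. pd f y v) x u"
proof -
  have f1: "f differentiable (at y)" and f2: "(\<lambda>y. pd f y w) differentiable (at y)" if "y \<in> S" for y w
    using f that by (auto simp: numeral_2_eq_2)
  have f3: "continuous_on S (\<lambda>z. pd (\<lambda>y. pd f y w) z w')" for w w'
    using f by (auto simp: numeral_2_eq_2)
  obtain r where r: "r > 0" "ball x r \<subseteq> S" using S open_contains_ball by blast
  \<comment> \<open>\<open>a\<close> is the mean value point in direction u for the increment of f
    along v, and \<open>b\<close> the one in direction v for the resulting derivative.\<close>
  have key: "\<exists>a b. 0 \<le> a \<and> a \<le> h \<and> 0 \<le> b \<and> b \<le> h \<and>
      f (x + h *\<^sub>R u + h *\<^sub>R v) - f (x + h *\<^sub>R u) - (f (x + h *\<^sub>R v) - f x)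
      = h * h * pd (\<lambda>y. pd f y u) (x + a *\<^sub>R u + b *\<^sub>R v) v"
    if h: "h > 0" "h * (norm u + norm v) < r" for h u v
  proof -
    have inS: "x + a *\<^sub>R u + b *\<^sub>R v \<in> S" if "0 \<le> a" "a \<le> h" "0 \<le> b" "b \<le> h" for a b
    proof -
      have "norm (a *\<^sub>R u + b *\<^sub>R v) \<le> a * norm u + b * norm v"
        using norm_triangle_ineq[of "a *\<^sub>R u" "b *\<^sub>R v"] that by simp
      also have "\<dots> \<le> h * norm u + h * norm v" using that by (intro add_mono mult_right_mono) auto
      also have "\<dots> < r" using h by (simp add: algebra_simps)
      finally have "x + (a *\<^sub>R u + b *\<^sub>R v) \<in> ball x r"
        using dist_add_cancel[of x 0 "a *\<^sub>R u + b *\<^sub>R v"] by (simp only: mem_ball add_0_right dist_0_norm)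
      then have "x + (a *\<^sub>R u + b *\<^sub>R v) \<in> S" using r by blast
      then show ?thesis by (simp only: add.assoc)
    qed
    have dline: "((\<lambda>t. F (z + t *\<^sub>R w)) has_real_derivative pd F (z + t *\<^sub>R w) w) (at t)"
      if "F differentiable (at (z + t *\<^sub>R w))" for F :: "'e \<Rightarrow> real" and z w t
    proof -
      have "((\<lambda>t. z + t *\<^sub>R w) has_derivative (\<lambda>s. s *\<^sub>R w)) (at t)"
        by (auto intro!: derivative_eq_intros)
      from has_derivative_compose[OF this pd_has_derivative[OF that]]
      have "((\<lambda>t. F (z + t *\<^sub>R w)) has_derivative (\<lambda>s. pd F (z + t *\<^sub>R w) (s *\<^sub>R w))) (at t)" .
      moreover have "pd F (z + t *\<^sub>R w) (s *\<^sub>R w) = pd F (z + t *\<^sub>R w) w * s" for s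
        using pd_linear[OF that] linear_scale[of "pd F (z + t *\<^sub>R w)" s w] by simp
      ultimately show ?thesis by (simp add: has_field_derivative_def)
    qed
    let ?p = "\<lambda>t. f (x + h *\<^sub>R v + t *\<^sub>R u) - f (x + t *\<^sub>R u)"
    have "\<exists>a>0. a < h \<and> ?p h - ?p 0 = (h - 0) * (pd f (x + h *\<^sub>R v + a *\<^sub>R u) u - pd f (x + a *\<^sub>R u) u)"
    proof (rule MVT2[OF h(1)])
      fix t assume t: "0 \<le> t" "t \<le> h"
      have "x + h *\<^sub>R v + t *\<^sub>R u \<in> S" "x + t *\<^sub>R u \<in> S"
        using inS[of t h] inS[of t 0] t h by (auto simp: algebra_simps)
      then show "(?p has_real_derivative pd f (x + h *\<^sub>R v + t *\<^sub>R u) u - pd f (x + t *\<^sub>R u) u) (at t)"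
        by (intro DERIV_diff dline f1)
    qed
    then obtain a where a: "0 < a" "a < h"
      "?p h - ?p 0 = h * (pd f (x + h *\<^sub>R v + a *\<^sub>R u) u - pd f (x + a *\<^sub>R u) u)" by auto
    let ?q = "\<lambda>t. pd f (x + a *\<^sub>R u + t *\<^sub>R v) u"
    have "\<exists>b>0. b < h \<and> ?q h - ?q 0 = (h - 0) * (pd (\<lambda>y. pd f y u) (x + a *\<^sub>R u + b *\<^sub>R v) v)"
    proof (rule MVT2[OF h(1)])
      fix t assume t: "0 \<le> t" "t \<le> h"
      have "x + a *\<^sub>R u + t *\<^sub>R v \<in> S"
        using inS[of a t] t a by auto
      then show "(?q has_real_derivative pd (\<lambda>y. pd f y u) (x + a *\<^sub>R u + t *\<^sub>R v) v) (at t)"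
        by (intro dline f2)
    qed
    then obtain b where b: "0 < b" "b < h"
      "?q h - ?q 0 = h * (pd (\<lambda>y. pd f y u) (x + a *\<^sub>R u + b *\<^sub>R v) v)" by auto
    have e: "x + h *\<^sub>R v + a *\<^sub>R u = x + a *\<^sub>R u + h *\<^sub>R v" "x + h *\<^sub>R v + h *\<^sub>R u = x + h *\<^sub>R u + h *\<^sub>R v"
      by (auto simp: algebra_simps)
    have "f (x + h *\<^sub>R u + h *\<^sub>R v) - f (x + h *\<^sub>R u) - (f (x + h *\<^sub>R v) - f x)
        = h * (pd f (x + a *\<^sub>R u + h *\<^sub>R v) u - pd f (x + a *\<^sub>R u) u)"
      using a(3) unfolding e by simp
    also have "\<dots> = h * h * pd (\<lambda>y. pd f y u) (x + a *\<^sub>R u + b *\<^sub>R v) v"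
      using b(3) by simp
    finally show ?thesis using a(1,2) b(1,2) by (intro exI[of _ a] exI[of _ b]) simp
  qed
  have "\<bar>pd (\<lambda>y. pd f y u) x v - pd (\<lambda>y. pd f y v) x u\<bar> < e" if e: "e > 0" for e
  proof -
    have "continuous (at x) (\<lambda>z. pd (\<lambda>y. pd f y u) z v)" "continuous (at x) (\<lambda>z. pd (\<lambda>y. pd f y v) z u)"
      using f3 S continuous_on_eq_continuous_at by blast+
    note cont = this[unfolded continuous_at_eps_delta, rule_format, OF half_gt_zero[OF e]]
    obtain d1 where d1: "d1 > 0"
      "\<And>y. dist y x < d1 \<Longrightarrow> dist (pd (\<lambda>y. pd f y u) y v) (pd (\<lambda>y. pd f y u) x v) < e / 2"
      using cont(1) by blast
    obtain d2 where d2: "d2 > 0"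
      "\<And>y. dist y x < d2 \<Longrightarrow> dist (pd (\<lambda>y. pd f y v) y u) (pd (\<lambda>y. pd f y v) x u) < e / 2"
      using cont(2) by blast
    note d = d1(1) d2(1) d1(2) d2(2)
    define d where "d = min r (min d1 d2)"
    \<comment> \<open>The added 1 keeps the denominator positive when both directions vanish; the
      parallelogram of side \<open>h\<close> stays within distance \<open>d\<close> of x.\<close>
    define h where "h = d / (2 * (norm u + norm v + 1))"
    have dp: "d > 0" using d r by (simp add: d_def)
    have np: "norm u + norm v + 1 > 0" by (simp add: add_nonneg_pos)
    have hp: "h > 0" using dp np by (simp add: h_def)
    have "h * (norm u + norm v) < h * (2 * (norm u + norm v + 1))"
      by (rule mult_strict_left_mono) (use hp in \<open>auto simp: add_nonneg_pos\<close>)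
    also have "\<dots> = d" using np by (simp add: h_def)
    finally have hd: "h * (norm u + norm v) < d" .
    obtain a b where ab: "0 \<le> a" "a \<le> h" "0 \<le> b" "b \<le> h"
      "f (x + h *\<^sub>R u + h *\<^sub>R v) - f (x + h *\<^sub>R u) - (f (x + h *\<^sub>R v) - f x)
      = h * h * pd (\<lambda>y. pd f y u) (x + a *\<^sub>R u + b *\<^sub>R v) v"
      using key[of h u v] hp hd by (auto simp: d_def)
    have "h * (norm v + norm u) < r" using hd by (simp add: d_def add.commute)
    then obtain a' b' where ab': "0 \<le> a'" "a' \<le> h" "0 \<le> b'" "b' \<le> h"
      "f (x + h *\<^sub>R v + h *\<^sub>R u) - f (x + h *\<^sub>R v) - (f (x + h *\<^sub>R u) - f x)
      = h * h * pd (\<lambda>y. pd f y v) (x + a' *\<^sub>R v + b' *\<^sub>R u) u"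
      using key[of h v u] hp by blast
    have "x + h *\<^sub>R v + h *\<^sub>R u = x + h *\<^sub>R u + h *\<^sub>R v" by (simp add: algebra_simps)
    with ab'(5) have "f (x + h *\<^sub>R u + h *\<^sub>R v) - f (x + h *\<^sub>R v) - (f (x + h *\<^sub>R u) - f x)
      = h * h * pd (\<lambda>y. pd f y v) (x + a' *\<^sub>R v + b' *\<^sub>R u) u" by simp
    with ab(5) have "h * h * pd (\<lambda>y. pd f y u) (x + a *\<^sub>R u + b *\<^sub>R v) v
       = h * h * pd (\<lambda>y. pd f y v) (x + a' *\<^sub>R v + b' *\<^sub>R u) u" by linarith
    then have eq: "pd (\<lambda>y. pd f y u) (x + a *\<^sub>R u + b *\<^sub>R v) v
       = pd (\<lambda>y. pd f y v) (x + a' *\<^sub>R v + b' *\<^sub>R u) u" using hp by simp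
    have near: "dist (x + a *\<^sub>R u + b *\<^sub>R v) x < d" if "0 \<le> a" "a \<le> h" "0 \<le> b" "b \<le> h" 
         "h * (norm u + norm v) < d" for a b u v
    proof -
      have "dist (x + a *\<^sub>R u + b *\<^sub>R v) x = norm (a *\<^sub>R u + b *\<^sub>R v)" by (simp add: dist_norm algebra_simps)
      also have "\<dots> \<le> a * norm u + b * norm v"
        using norm_triangle_ineq[of "a *\<^sub>R u" "b *\<^sub>R v"] that by simp
      also have "\<dots> \<le> h * norm u + h * norm v" using that by (intro add_mono mult_right_mono) auto
      also have "\<dots> < d" using that by (simp add: algebra_simps)
      finally show ?thesis .
    qed
    have "dist (x + a *\<^sub>R u + b *\<^sub>R v) x < d1" "dist (x + a' *\<^sub>R v + b' *\<^sub>R u) x < d2"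
      using near[OF ab(1-4) hd] near[OF ab'(1-4), of v u] hd by (auto simp: d_def add.commute)
    from d(3)[OF this(1)] d(4)[OF this(2)] show ?thesis unfolding eq dist_real_def by linarith
  qed
  from this[of "\<bar>pd (\<lambda>y. pd f y u) x v - pd (\<lambda>y. pd f y v) x u\<bar>"] show ?thesis by auto
qed

text \<open>Gronwall with the integrating factor exp(-Ct): q(t) exp(-Ct) is nonincreasing and starts
  at 0.\<close>

lemma linear_growth_zero:
  fixes q :: "real \<Rightarrow> real"
  assumes d: "\<And>t. 0 \<le> t \<Longrightarrow> t \<le> 1 \<Longrightarrow> (q has_real_derivative q' t) (at t)"
    and b: "\<And>t. 0 \<le> t \<Longrightarrow> t \<le> 1 \<Longrightarrow> q' t \<le> C * q t"
    and nn: "q 1 \<ge> 0" and z: "q 0 = 0"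
  shows "q 1 = 0"
proof -
  have "q 1 * exp (- C * 1) \<le> q 0 * exp (- C * 0)"
  proof (rule DERIV_nonpos_imp_nonincreasing[of 0 1 "\<lambda>t. q t * exp (- C * t)"])
    fix t :: real assume t: "0 \<le> t" "t \<le> 1"
    have "((\<lambda>t. q t * exp (- C * t)) has_real_derivative (q' t - C * q t) * exp (- C * t)) (at t)"
      by (auto intro!: derivative_eq_intros d[OF t] simp: algebra_simps)
    moreover have "(q' t - C * q t) * exp (- C * t) \<le> 0"
      using b[OF t] by (simp add: mult_nonpos_nonneg)
    ultimately show "\<exists>y. ((\<lambda>t. q t * exp (- C * t)) has_real_derivative y) (at t) \<and> y \<le> 0" by blast
  qed simp
  then have "q 1 * exp (- C) \<le> 0" using z by simp
  then show ?thesis using nn by (simp add: mult_le_0_iff)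
qed

section \<open>Quaternionic linear algebra\<close>

text \<open>Each functional lowers the dimension by at most one: its kernel in \<open>V\<close> and
  a single vector outside the kernel span \<open>V\<close>. Linearity is demanded on
  \<open>V\<close> only, because the codifferential is linear on smooth forms but not on arbitrary
  component functions.\<close>

lemma dim_le_functionals:
  fixes V :: "'v::real_vector set" and F :: "('v \<Rightarrow> real) set"
  assumes "finite F" "subspace V"
    and "\<And>f x y. f \<in> F \<Longrightarrow> x \<in> V \<Longrightarrow> y \<in> V \<Longrightarrow> f (x + y) = f x + f y"
    and "\<And>f x c. f \<in> F \<Longrightarrow> x \<in> V \<Longrightarrow> f (c *\<^sub>R x) = c * f x"
    and "\<And>x. x \<in> V \<Longrightarrow> (\<And>f. f \<in> F \<Longrightarrow> f x = 0) \<Longrightarrow> x = 0"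
  shows "finite_dim V \<and> dim V \<le> card F"
proof -
  have "\<exists>B. finite B \<and> card B \<le> card F \<and> V \<subseteq> span B"
    using assms
  proof (induction F arbitrary: V rule: finite_induct)
    case empty
    then have "V \<subseteq> {0}" by auto
    then show ?case by (intro exI[of _ "{}"]) auto
  next
    case (insert f F)
    let ?W = "V \<inter> {x. f x = 0}"
    have f0: "f 0 = 0" using insert.prems(2)[of f 0 0] subspace_0[OF insert.prems(1)] by simp
    have W: "subspace ?W"
      using insert.prems(1) insert.prems(2)[of f] insert.prems(3)[of f] f0
      by (simp add: subspace_def)
    have "\<exists>B. finite B \<and> card B \<le> card F \<and> ?W \<subseteq> span B"
    proof (rule insert.IH[OF W])
      fix x assume x: "x \<in> ?W" and F: "\<And>f. f \<in> F \<Longrightarrow> f x = 0"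
      show "x = 0" by (rule insert.prems(4)) (use x F in auto)
    qed (use insert.prems(2,3) in auto)
    then obtain B where B: "finite B" "card B \<le> card F" "?W \<subseteq> span B" by blast
    show ?case
    proof (cases "V \<subseteq> {x. f x = 0}")
      case True
      then show ?thesis using B insert.hyps by (intro exI[of _ B]) (auto simp: card_insert_if)
    next
      case False
      then obtain v where v: "v \<in> V" "f v \<noteq> 0" by auto
      have "x \<in> span (insert v B)" if x: "x \<in> V" for x
      proof -
        \<comment> \<open>Subtracting \<open>?c\<close> times \<open>v\<close> projects
          \<open>x\<close> onto the kernel of \<open>f\<close> along \<open>v\<close>.\<close>
        let ?c = "f x / f v"
        have m: "- ?c *\<^sub>R v \<in> V" using v insert.prems(1) subspace_scale by blast
        have "x + (- ?c *\<^sub>R v) \<in> V" using m x insert.prems(1) subspace_add by blast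
        moreover have "f (x + (- ?c *\<^sub>R v)) = 0"
          using insert.prems(2)[of f x "- ?c *\<^sub>R v"] insert.prems(3)[of f v "- ?c"] m v x by simp
        ultimately have "x + (- ?c *\<^sub>R v) \<in> span B" using B by blast
        then have "x + (- ?c *\<^sub>R v) \<in> span (insert v B)" using span_mono[of B "insert v B"] by blast
        moreover have "?c *\<^sub>R v \<in> span (insert v B)" by (simp add: span_base span_scale)
        ultimately have "(x + (- ?c *\<^sub>R v)) + ?c *\<^sub>R v \<in> span (insert v B)" by (rule span_add)
        then show ?thesis by simp
      qed
      then show ?thesis using B insert.hyps
        by (intro exI[of _ "insert v B"]) (auto simp: card_insert_if)
    qed
  qed
  then show ?thesis unfolding finite_dim_def using dim_le_card by (metis le_trans)
qed

text \<open>\<open>G f\<close> represents the functional \<open>h _ f\<close> in the Euclidean inner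
  product; fewer vectors than the dimension do not span, so some nonzero vector is orthogonal to all
  of them.\<close>

lemma orthogonal_vector_exists:
  fixes h :: "'e::euclidean_space \<Rightarrow> 'e \<Rightarrow> real"
  assumes "bilinear h" "finite F" "card F < DIM('e)"
  shows "\<exists>u. u \<noteq> 0 \<and> (\<forall>f\<in>F. h u f = 0)"
proof -
  define G where "G f = (\<Sum>b\<in>Basis. h b f *\<^sub>R b)" for f
  have hG: "h u f = u \<bullet> G f" for u f
  proof -
    have "linear (\<lambda>u. h u f)" using assms(1) by (simp add: bilinear_def)
    then have "h (\<Sum>b\<in>Basis. (u \<bullet> b) *\<^sub>R b) f = (\<Sum>b\<in>Basis. (u \<bullet> b) *\<^sub>R h b f)"
      using linear_sum[of "\<lambda>u. h u f" "\<lambda>b. (u \<bullet> b) *\<^sub>R b" Basis]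
        linear_scale[of "\<lambda>u. h u f"] by simp
    then show ?thesis unfolding G_def euclidean_representation inner_sum_right by (simp add: mult.commute)
  qed
  have "dim (G ` F) \<le> card (G ` F)" by (rule dim_le_card) (auto simp: assms span_superset)
  also have "\<dots> \<le> card F" using assms by (simp add: card_image_le)
  finally have "dim (G ` F) < DIM('e)" using assms by simp
  from orthogonal_to_subspace_exists[OF this] obtain u where "u \<noteq> 0" "\<And>y. y \<in> span (G ` F) \<Longrightarrow> orthogonal u y"
    by blast
  then show ?thesis by (intro exI[of _ u]) (auto simp: hG orthogonal_def span_base)
qed

text \<open>Stated for an indexed family, so that injectivity of the indexing, needed to count the
  members, comes together with independence.\<close>

lemma orthonormal_family_independent:
  assumes h: "bilinear h" and f: "\<And>i j. i \<in> I \<Longrightarrow> j \<in> I \<Longrightarrow> h (f i) (f j) = (if i = j then 1 else 0 :: real)"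
    and I: "finite I"
  shows "inj_on f I \<and> independent (f ` I)"
proof
  show inj: "inj_on f I"
  proof (rule inj_onI)
    fix i j assume *: "i \<in> I" "j \<in> I" "f i = f j"
    show "i = j" using f[OF *(1) *(1)] f[OF *(1) *(2)] * by (metis zero_neq_one)
  qed
  have z: "u (f j) = 0" if s: "(\<Sum>v\<in>f ` I. u v *\<^sub>R v) = 0" and j: "j \<in> I" for u j
  proof -
    have lin: "linear (\<lambda>x. h x (f j))" using h by (simp add: bilinear_def)
    have "0 = h (\<Sum>i\<in>I. u (f i) *\<^sub>R f i) (f j)"
      using s linear_0[OF lin] by (simp add: sum.reindex[OF inj])
    also have "\<dots> = (\<Sum>i\<in>I. u (f i) * h (f i) (f j))"
      using linear_sum[OF lin, of "\<lambda>i. u (f i) *\<^sub>R f i" I] linear_scale[OF lin] by simp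
    also have "\<dots> = (\<Sum>i\<in>I. if i = j then u (f i) else 0)"
      by (rule sum.cong) (auto simp: f j)
    also have "\<dots> = u (f j)" using I j by simp
    finally show ?thesis by simp
  qed
  show "independent (f ` I)"
    by (rule independent_if_scalars_zero) (use I z in auto)
qed

section \<open>Linear algebra of an inner product with a quaternionic triple\<close>

locale quat_inner =
  fixes h :: "'e::euclidean_space \<Rightarrow> 'e \<Rightarrow> real" and J1 J2 J3 :: "'e \<Rightarrow> 'e"
  assumes bil: "bilinear h" and sym: "h u v = h v u" and pos: "u \<noteq> 0 \<Longrightarrow> h u u > 0"
    and tri: "quat_triple h J1 J2 J3"
begin

lemma lin: "linear J1" "linear J2" "linear J3"
  using tri[unfolded quat_triple_def, THEN conjunct1] by auto

lemma JJ [simp]: "J1 (J1 u) = - u" "J2 (J2 u) = - u" "J3 (J3 u) = - u"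
  using tri[unfolded quat_triple_def, THEN conjunct1] by auto

lemma J_minus [simp]: "J1 (- u) = - J1 u" "J2 (- u) = - J2 u" "J3 (- u) = - J3 u"
  using lin linear_neg by blast+

lemma J_add: "J1 (u + v) = J1 u + J1 v" "J2 (u + v) = J2 u + J2 v" "J3 (u + v) = J3 u + J3 v"
  using lin linear_add by blast+

lemma J_mult [simp]:
  "J1 (J2 u) = J3 u" "J2 (J1 u) = - J3 u" "J2 (J3 u) = J1 u" "J3 (J2 u) = - J1 u"
  "J3 (J1 u) = J2 u" "J1 (J3 u) = - J2 u"
proof -
  have a: "J3 v = J1 (J2 v)" for v
    using tri[unfolded quat_triple_def, THEN conjunct2, THEN conjunct2] by (rule ssubst) simp
  have "\<forall>v. J1 (J2 v) = - J2 (J1 v) \<and> J2 (J3 v) = - J3 (J2 v) \<and> J1 (J3 v) = - J3 (J1 v)"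
    by (rule tri[unfolded quat_triple_def, THEN conjunct2, THEN conjunct1])
  then have a: "J3 v = J1 (J2 v)" "J1 (J2 v) = - J2 (J1 v)" "J2 (J3 v) = - J3 (J2 v)"
    "J1 (J3 v) = - J3 (J1 v)" for v using a by blast+
  show 1: "J1 (J2 u) = J3 u" by (simp add: a(1))
  have "J3 u = - J2 (J1 u)" using a(1,2)[of u] by simp
  then show "J2 (J1 u) = - J3 u" by simp
  show 2: "J3 (J2 u) = - J1 u" using a(1)[of "J2 u"] by simp
  show "J2 (J3 u) = J1 u" using a(3)[of u] 2 by simp
  show 3: "J1 (J3 u) = - J2 u" using a(1)[of u] by simp
  show "J3 (J1 u) = J2 u" using a(4)[of u] 3 by simp
qed

lemma h_lin:
  "h (u + v) w = h u w + h v w" "h w (u + v) = h w u + h w v"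
  "h (- u) w = - h u w" "h w (- u) = - h w u"
  "h (c *\<^sub>R u) w = c * h u w" "h w (c *\<^sub>R u) = c * h w u"
  by (simp_all add: bilinear_ladd[OF bil] bilinear_radd[OF bil] bilinear_lneg[OF bil]
      bilinear_rneg[OF bil] bilinear_lmul[OF bil] bilinear_rmul[OF bil])

lemma h_minus [simp]: "h (- u) w = - h u w" "h w (- u) = - h w u"
  using h_lin by auto

lemma h_0 [simp]: "h 0 w = 0" "h w 0 = 0"
  using h_lin(5,6)[of 0 0 w] h_lin(6)[of w 0 0] by auto

lemma hJ: "h (J1 u) v = - h u (J1 v)" "h (J2 u) v = - h u (J2 v)" "h (J3 u) v = - h u (J3 v)"
proof -
  have a: "h (J1 x) (J1 y) = h x y" "h (J2 x) (J2 y) = h x y" "h (J3 x) (J3 y) = h x y" for x y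
    using tri[unfolded quat_triple_def, THEN conjunct1] by auto
  show "h (J1 u) v = - h u (J1 v)" using a(1)[of u "J1 v"] by simp
  show "h (J2 u) v = - h u (J2 v)" using a(2)[of u "J2 v"] by simp
  show "h (J3 u) v = - h u (J3 v)" using a(3)[of u "J3 v"] by simp
qed

lemma hJ_self [simp]: "h u (J1 u) = 0" "h u (J2 u) = 0" "h u (J3 u) = 0"
  using hJ(1)[of u u] sym[of u "J1 u"] hJ(2)[of u u] sym[of u "J2 u"] hJ(3)[of u u] sym[of u "J3 u"]
  by linarith+

lemma hJ_swap: "h u (J1 v) = - h v (J1 u)" "h u (J2 v) = - h v (J2 u)" "h u (J3 v) = - h v (J3 u)"
  using hJ sym by metis+

lemma nonneg: "h u u \<ge> 0"
  using pos[of u] by (cases "u = 0") auto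

text \<open>Allows the locale to be interpreted again at the permuted triples, so that a statement
  proved for one of the three structures holds for the other two.\<close>

lemma cyc: "quat_inner h J2 J3 J1"
proof
  show "quat_triple h J2 J3 J1"
    unfolding quat_triple_def using lin by (auto simp: hJ fun_eq_iff)
qed (use bil sym pos in auto)

text \<open>Each bracketed line is the wedge product of \<open>th\<close> composed with a structure
  J and its Kaehler form \<open>h (J _) _\<close>, evaluated on (Y, u, v); the last line is the
  wedge product of Y with \<open>th\<close>.\<close>

definition T_form :: "('e \<Rightarrow> real) \<Rightarrow> 'e \<Rightarrow> 'e \<Rightarrow> 'e \<Rightarrow> real" where
  "T_form th Y u v =
     - (th (J1 Y) * h (J1 u) v + th (J1 u) * h (J1 v) Y + th (J1 v) * h (J1 Y) u)
     - (th (J2 Y) * h (J2 u) v + th (J2 u) * h (J2 v) Y + th (J2 v) * h (J2 Y) u)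
     - (th (J3 Y) * h (J3 u) v + th (J3 u) * h (J3 v) Y + th (J3 v) * h (J3 Y) u)
     + h Y u * th v - h Y v * th u"

lemma T_form_cyc: "quat_inner.T_form h J2 J3 J1 = T_form"
  by (simp add: fun_eq_iff T_form_def quat_inner.T_form_def[OF cyc])

definition inv_form :: "('e \<Rightarrow> 'e \<Rightarrow> real) \<Rightarrow> bool" where
  "inv_form \<phi> \<longleftrightarrow> (\<forall>u v. \<phi> (J1 u) (J1 v) = \<phi> u v \<and> \<phi> (J2 u) (J2 v) = \<phi> u v \<and> \<phi> (J3 u) (J3 v) = \<phi> u v)"

lemma inv_form_cyc: "quat_inner.inv_form J2 J3 J1 \<phi> = inv_form \<phi>"
  by (auto simp: inv_form_def quat_inner.inv_form_def[OF cyc])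

definition compat_form :: "('e \<Rightarrow> 'e \<Rightarrow> real) \<Rightarrow> bool" where
  "compat_form \<psi> \<longleftrightarrow> (\<exists>a1 a2 a3 \<phi>. inv_form \<phi> \<and>
     (\<forall>u v. \<psi> u v = a1 * h (J1 u) v + a2 * h (J2 u) v + a3 * h (J3 u) v + \<phi> u v))"

text \<open>Passing from (u, v) to (J1 u, J1 v) leaves the invariant part and the J1 part of
  \<open>T Y\<close> unchanged, so the difference sees only \<open>a2\<close> and \<open>a3\<close>.
  Applying this at three places and using that \<open>al\<close> is alternating isolates
  \<open>al\<close> itself, without any reference to \<open>a1\<close>.\<close>

lemma three_form_half:
  assumes alt: "\<And>Y u v. al Y u v = - al u Y v" "\<And>Y u v. al Y u v = - al Y v u"
    and neg: "\<And>Y u v. al Y (- u) v = - al Y u v"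
    and tn: "\<And>u. th (- u) = - th u"
    and T: "\<And>Y u v. T Y u v = al Y u v + h Y u * th v - h Y v * th u"
    and inv: "\<And>Y. inv_form (\<phi> Y)"
    and dec: "\<And>Y u v. T Y u v = a1 Y * h (J1 u) v + a2 Y * h (J2 u) v + a3 Y * h (J3 u) v + \<phi> Y u v"
  shows "al Y u v = a2 Y * h (J2 u) v + a3 Y * h (J3 u) v + a2 v * h (J2 Y) u + a3 v * h (J3 Y) u
     + a2 (J1 u) * h (J2 (J1 v)) Y + a3 (J1 u) * h (J3 (J1 v)) Y
     - (th (J1 Y) * h (J1 u) v + th (J1 u) * h (J1 v) Y + th (J1 v) * h (J1 Y) u)"
proof -
  have E: "al Y u v - al Y (J1 u) (J1 v) = 2 * a2 Y * h (J2 u) v + 2 * a3 Y * h (J3 u) v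
     - (h Y u * th v - h Y v * th u - h Y (J1 u) * th (J1 v) + h Y (J1 v) * th (J1 u))" for Y u v
  proof -
    have p: "\<phi> Y (J1 u) (J1 v) = \<phi> Y u v" using inv by (simp add: inv_form_def)
    have "T Y u v - T Y (J1 u) (J1 v) = 2 * a2 Y * h (J2 u) v + 2 * a3 Y * h (J3 u) v"
      unfolding dec p by (simp add: hJ algebra_simps)
    then show ?thesis unfolding T by simp
  qed
  have c1: "al (J1 u) (J1 v) Y = al Y (J1 u) (J1 v)" using alt by metis
  have c2: "al (J1 u) (- v) (J1 Y) = - al v (J1 Y) (J1 u)" using alt neg by metis
  have c3: "al v Y u = al Y u v" using alt by metis
  \<comment> \<open>The three instances telescope: the second cancels al(Y, J1 u, J1 v) from the
    first and the third cancels al(v, J1 Y, J1 u) from the second, while the remaining two terms are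
    both al(Y, u, v).\<close>
  note e = E[of Y u v] E[of "J1 u" "J1 v" Y] E[of v Y u]
  have s: "h u (J1 v) = - h v (J1 u)" "h Y (J1 v) = - h v (J1 Y)" "h Y (J1 u) = - h u (J1 Y)"
    by (rule hJ_swap)+
  have s': "h v u = h u v" "h v Y = h Y v" "h u Y = h Y u" by (rule sym)+
  have "2 * al Y u v = 2 * a2 Y * h (J2 u) v + 2 * a3 Y * h (J3 u) v
     + 2 * a2 v * h (J2 Y) u + 2 * a3 v * h (J3 Y) u
     + 2 * a2 (J1 u) * h (J2 (J1 v)) Y + 2 * a3 (J1 u) * h (J3 (J1 v)) Y
     - (h Y u * th v - h Y v * th u - h Y (J1 u) * th (J1 v) + h Y (J1 v) * th (J1 u))
     - (h v Y * th u - h v u * th Y - h v (J1 Y) * th (J1 u) + h v (J1 u) * th (J1 Y))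
     - (h (J1 u) (J1 v) * th Y - h (J1 u) Y * th (J1 v) + h (J1 u) v * th (J1 Y) - h (J1 u) (J1 Y) * th v)"
    using e c1 c2 c3 by (simp add: tn)
  then show ?thesis by (simp add: hJ s s' algebra_simps)
qed

text \<open>The vectors Y, J1 Y, J2 Y, J3 Y impose at most four linear conditions. On a vector
  orthogonal to all of them most terms of \<open>T_form\<close> vanish, which is how single
  coefficients are read off below.\<close>

lemma perp_vector:
  assumes "DIM('e) > 4"
  shows "\<exists>u. u \<noteq> 0 \<and> h u Y = 0 \<and> h u (J1 Y) = 0 \<and> h u (J2 Y) = 0 \<and> h u (J3 Y) = 0"
proof -
  have "card {Y, J1 Y, J2 Y, J3 Y} \<le> 4" by (simp add: card_insert_if)
  with assms orthogonal_vector_exists[OF bil, of "{Y, J1 Y, J2 Y, J3 Y}"] show ?thesis by auto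
qed

text \<open>The value al(Y, u, J1 u), with u orthogonal to the quaternionic line of Y, is computed
  in two ways: relative to J1 only \<open>th\<close> contributes, relative to J2 only
  \<open>a1\<close> does.\<close>

lemma coeff_of_T:
  assumes D: "DIM('e) > 4"
    and alt: "\<And>Y u v. al Y u v = - al u Y v" "\<And>Y u v. al Y u v = - al Y v u"
    and neg: "\<And>Y u v. al Y (- u) v = - al Y u v"
    and tn: "\<And>u. th (- u) = - th u"
    and T: "\<And>Y u v. T Y u v = al Y u v + h Y u * th v - h Y v * th u"
    and inv: "\<And>Y. inv_form (\<phi> Y)"
    and dec: "\<And>Y u v. T Y u v = a1 Y * h (J1 u) v + a2 Y * h (J2 u) v + a3 Y * h (J3 u) v + \<phi> Y u v"
  shows "a1 Y = - th (J1 Y)"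
proof -
  interpret C: quat_inner h J2 J3 J1 by (rule cyc)
  obtain u where u: "u \<noteq> 0" "h u Y = 0" "h u (J1 Y) = 0" "h u (J2 Y) = 0" "h u (J3 Y) = 0"
    using perp_vector[OF D] by blast
  have u': "h Y u = 0" "h Y (J1 u) = 0" "h Y (J2 u) = 0" "h Y (J3 u) = 0"
    using u sym hJ_swap by (metis minus_zero)+
  have 1: "al Y u (J1 u) = - th (J1 Y) * h u u"
    using three_form_half[OF alt neg tn T inv dec, of Y u "J1 u"]
    by (simp add: hJ u u')
  have dec': "T Y u v = a2 Y * h (J2 u) v + a3 Y * h (J3 u) v + a1 Y * h (J1 u) v + \<phi> Y u v" for Y u v
    using dec by simp
  have 2: "al Y u (J1 u) = a1 Y * h u u"
    using C.three_form_half[OF alt neg tn T _ dec', of Y u "J1 u"] inv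
    by (simp add: hJ u u' inv_form_cyc)
  from 1 2 have "a1 Y * h u u = - th (J1 Y) * h u u" by simp
  with pos[OF u(1)] show ?thesis by (metis less_irrefl mult_cancel_right)
qed

text \<open>The three cyclic versions of \<open>coeff_of_T\<close> determine all coefficients, and
  \<open>three_form_half\<close> then expresses \<open>al\<close> through \<open>th\<close>
  alone.\<close>

lemma T_form_unique:
  assumes D: "DIM('e) > 4"
    and alt: "\<And>Y u v. al Y u v = - al u Y v" "\<And>Y u v. al Y u v = - al Y v u"
    and neg: "\<And>Y u v. al Y (- u) v = - al Y u v"
    and tn: "\<And>u. th (- u) = - th u"
    and T: "\<And>Y u v. T Y u v = al Y u v + h Y u * th v - h Y v * th u"
    and comp: "\<And>Y. compat_form (T Y)"
  shows "T Y u v = T_form th Y u v"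
proof -
  have "\<forall>Y. \<exists>a1 a2 a3 \<phi>. inv_form \<phi> \<and>
     (\<forall>u v. T Y u v = a1 * h (J1 u) v + a2 * h (J2 u) v + a3 * h (J3 u) v + \<phi> u v)"
    using comp unfolding compat_form_def by blast
  then obtain a1 a2 a3 \<phi> where i: "\<And>Y. inv_form (\<phi> Y)"
    and d: "\<And>Y u v. T Y u v = a1 Y * h (J1 u) v + a2 Y * h (J2 u) v + a3 Y * h (J3 u) v + \<phi> Y u v"
    by metis
  interpret C2: quat_inner h J2 J3 J1 by (rule cyc)
  interpret C3: quat_inner h J3 J1 J2 by (rule C2.cyc)
  have d2: "T Y u v = a2 Y * h (J2 u) v + a3 Y * h (J3 u) v + a1 Y * h (J1 u) v + \<phi> Y u v" for Y u v
    using d by simp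
  have d3: "T Y u v = a3 Y * h (J3 u) v + a1 Y * h (J1 u) v + a2 Y * h (J2 u) v + \<phi> Y u v" for Y u v
    using d by simp
  have a1: "a1 Y = - th (J1 Y)" for Y by (rule coeff_of_T[OF D alt neg tn T i d])
  have a2: "a2 Y = - th (J2 Y)" for Y
    by (rule C2.coeff_of_T[OF D alt neg tn T _ d2]) (simp add: inv_form_cyc i)
  have a3: "a3 Y = - th (J3 Y)" for Y
    by (rule C3.coeff_of_T[OF D alt neg tn T _ d3]) (simp add: C2.inv_form_cyc inv_form_cyc i)
  have s: "h u (J2 v) = - h v (J2 u)" "h Y (J2 v) = - h v (J2 Y)" "h Y (J2 u) = - h u (J2 Y)"
     "h u (J3 v) = - h v (J3 u)" "h Y (J3 v) = - h v (J3 Y)" "h Y (J3 u) = - h u (J3 Y)"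
    by (rule hJ_swap)+
  show ?thesis
    unfolding T T_form_def three_form_half[OF alt neg tn T i d, of Y u v] a2 a3
    by (simp add: hJ tn s)
qed

text \<open>The alternating part disappears on the diagonal; this is what recovers \<open>th\<close>
  from the covariant derivative.\<close>

lemma T_form_diag: "(\<And>u. th (- u) = - th u) \<Longrightarrow> T_form th Y Y v = h Y Y * th v - h Y v * th Y"
  unfolding T_form_def by (simp add: hJ hJ_swap[of v Y] algebra_simps)

text \<open>All tests use Z = J1 Y; the norm conditions in the hypothesis hold because the
  structures are isometries. With u orthogonal to the quaternionic line of Y, the pair (u, J1 u)
  yields A(Y, Y) + A(J1 Y, J1 Y) and the pair (u, J2 u) yields A(J1 Y, J2 Y) + A(Y, J3 Y). The pair
  (Y, J2 Y) yields A(J1 Y, J2 Y) - 3 A(Y, J3 Y), and the difference to the previous one isolates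
  A(Y, J3 Y).\<close>

lemma symbol_J3:
  assumes D: "DIM('e) > 4" and lin: "\<And>Y. linear (A Y)"
    and b: "\<And>Y Z u v. h Z Z = h Y Y \<Longrightarrow> h v v = h u u \<Longrightarrow>
       \<bar>T_form (A Z) Y u v - T_form (A Y) Z u v\<bar> \<le> \<epsilon> * h Y Y * h u u"
  shows "\<bar>A Y (J3 Y)\<bar> \<le> \<epsilon> * h Y Y" "\<bar>A Y Y + A (J1 Y) (J1 Y)\<bar> \<le> \<epsilon> * h Y Y"
proof -
  have m [simp]: "A Y (- u) = - A Y u" for Y u using lin linear_neg by blast
  obtain u where u: "u \<noteq> 0" "h u Y = 0" "h u (J1 Y) = 0" "h u (J2 Y) = 0" "h u (J3 Y) = 0"
    using perp_vector[OF D] by blast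
  have u': "h Y u = 0" "h Y (J1 u) = 0" "h Y (J2 u) = 0" "h Y (J3 u) = 0"
    using u sym hJ_swap by (metis minus_zero)+
  note up = pos[OF u(1)]
  have "\<bar>T_form (A (J1 Y)) Y u (J1 u) - T_form (A Y) (J1 Y) u (J1 u)\<bar> \<le> \<epsilon> * h Y Y * h u u"
    by (rule b) (auto simp: hJ)
  moreover have "T_form (A (J1 Y)) Y u (J1 u) - T_form (A Y) (J1 Y) u (J1 u)
      = - ((A Y Y + A (J1 Y) (J1 Y)) * h u u)"
    unfolding T_form_def by (simp add: hJ u u' algebra_simps)
  ultimately have "\<bar>A Y Y + A (J1 Y) (J1 Y)\<bar> * h u u \<le> \<epsilon> * h Y Y * h u u"
    using up by (simp add: abs_mult)
  then show "\<bar>A Y Y + A (J1 Y) (J1 Y)\<bar> \<le> \<epsilon> * h Y Y" using up by simp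
  have "\<bar>T_form (A (J1 Y)) Y u (J2 u) - T_form (A Y) (J1 Y) u (J2 u)\<bar> \<le> \<epsilon> * h Y Y * h u u"
    by (rule b) (auto simp: hJ)
  moreover have "T_form (A (J1 Y)) Y u (J2 u) - T_form (A Y) (J1 Y) u (J2 u)
      = - ((A (J1 Y) (J2 Y) + A Y (J3 Y)) * h u u)"
    unfolding T_form_def by (simp add: hJ u u' algebra_simps)
  ultimately have "\<bar>A (J1 Y) (J2 Y) + A Y (J3 Y)\<bar> * h u u \<le> \<epsilon> * h Y Y * h u u"
    using up by (simp add: abs_mult)
  then have 1: "\<bar>A (J1 Y) (J2 Y) + A Y (J3 Y)\<bar> \<le> \<epsilon> * h Y Y" using up by simp
  show "\<bar>A Y (J3 Y)\<bar> \<le> \<epsilon> * h Y Y"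
  proof (cases "Y = 0")
    case True
    then show ?thesis using linear_0[OF lin] linear_0[OF quat_inner.lin(3)[OF quat_inner_axioms]] by simp
  next
    case False
    note yp = pos[OF False]
    have "\<bar>T_form (A (J1 Y)) Y Y (J2 Y) - T_form (A Y) (J1 Y) Y (J2 Y)\<bar> \<le> \<epsilon> * h Y Y * h Y Y"
      by (rule b) (auto simp: hJ)
    moreover have "T_form (A (J1 Y)) Y Y (J2 Y) - T_form (A Y) (J1 Y) Y (J2 Y)
        = (A (J1 Y) (J2 Y) - 3 * A Y (J3 Y)) * h Y Y"
      unfolding T_form_def by (simp add: hJ algebra_simps)
    ultimately have "\<bar>A (J1 Y) (J2 Y) - 3 * A Y (J3 Y)\<bar> * h Y Y \<le> \<epsilon> * h Y Y * h Y Y"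
      using yp by (simp add: abs_mult)
    then have "\<bar>A (J1 Y) (J2 Y) - 3 * A Y (J3 Y)\<bar> \<le> \<epsilon> * h Y Y" using yp by simp
    with 1 show ?thesis by linarith
  qed
qed

text \<open>The injectivity of the symbol of the second-order system, in a quantitative form that gives a bound
  uniform on compact sets without solving for \<open>A\<close>.\<close>

lemma symbol_bound:
  assumes D: "DIM('e) > 4" and A: "bilinear A"
    and b: "\<And>Y Z u v. h Z Z = h Y Y \<Longrightarrow> h v v = h u u \<Longrightarrow>
       \<bar>T_form (A Z) Y u v - T_form (A Y) Z u v\<bar> \<le> \<epsilon> * h Y Y * h u u"
  shows "\<bar>A Y Z\<bar> \<le> 20 * \<epsilon> * (h Y Y + h Z Z)"
proof -
  interpret C2: quat_inner h J2 J3 J1 by (rule cyc)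
  interpret C3: quat_inner h J3 J1 J2 by (rule C2.cyc)
  have lA: "linear (A Y)" for Y using A by (simp add: bilinear_def)
  have Aadd: "A (x + y) z = A x z + A y z" "A z (x + y) = A z x + A z y" for x y z
    using A bilinear_ladd bilinear_radd by blast+
  have Am [simp]: "A x (- y) = - A x y" "A (- x) y = - A x y" for x y
    using A bilinear_lneg bilinear_rneg by blast+
  have b2: "\<bar>C2.T_form (A Z) Y u v - C2.T_form (A Y) Z u v\<bar> \<le> \<epsilon> * h Y Y * h u u"
    if "h Z Z = h Y Y" "h v v = h u u" for Y Z u v using b[OF that] by (simp add: T_form_cyc)
  have b3: "\<bar>C3.T_form (A Z) Y u v - C3.T_form (A Y) Z u v\<bar> \<le> \<epsilon> * h Y Y * h u u"
    if "h Z Z = h Y Y" "h v v = h u u" for Y Z u v using b[OF that] by (simp add: C2.T_form_cyc T_form_cyc)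
  have s1: "\<bar>A Y (J3 Y)\<bar> \<le> \<epsilon> * h Y Y" "\<bar>A Y Y + A (J1 Y) (J1 Y)\<bar> \<le> \<epsilon> * h Y Y" for Y
    by (rule symbol_J3[OF D lA b], assumption+)+
  have s2: "\<bar>A Y (J1 Y)\<bar> \<le> \<epsilon> * h Y Y" "\<bar>A Y Y + A (J2 Y) (J2 Y)\<bar> \<le> \<epsilon> * h Y Y" for Y
    by (rule C2.symbol_J3[OF D lA b2], assumption+)+
  have s3: "\<bar>A Y (J2 Y)\<bar> \<le> \<epsilon> * h Y Y" "\<bar>A Y Y + A (J3 Y) (J3 Y)\<bar> \<le> \<epsilon> * h Y Y" for Y
    by (rule C3.symbol_J3[OF D lA b3], assumption+)+
  \<comment> \<open>The J1 relation at J2 Y compares J2 Y with J3 Y. Subtracting it from the J2 and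
    J3 relations at Y leaves 2 A(Y, Y).\<close>
  have diag: "\<bar>A Y Y\<bar> \<le> 2 * \<epsilon> * h Y Y" for Y
  proof -
    have "\<bar>A (J2 Y) (J2 Y) + A (J3 Y) (J3 Y)\<bar> \<le> \<epsilon> * h Y Y"
      using s1(2)[of "J2 Y"] by (simp add: hJ)
    then show ?thesis using s2(2)[of Y] s3(2)[of Y] unfolding abs_le_iff by linarith
  qed
  have par: "h (Y + Z) (Y + Z) + h (Y - Z) (Y - Z) = 2 * h Y Y + 2 * h Z Z" for Y Z
    using h_lin(1)[of Y "- Z"] h_lin(2)[of _ Y "- Z"] by (simp add: h_lin sym[of Z Y])
  then have par: "h (Y + Z) (Y + Z) \<le> 2 * h Y Y + 2 * h Z Z" for Y Z
    using nonneg[of "Y - Z"] by (metis add.commute le_add_same_cancel2)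
  obtain w :: 'e where w: "w \<noteq> 0" using D by (metis perp_vector)
  have e0: "\<epsilon> \<ge> 0"
  proof -
    have "0 \<le> \<epsilon> * h w w" using s1(1)[of w] abs_ge_zero order_trans by blast
    then show ?thesis using pos[OF w] by (simp add: zero_le_mult_iff)
  qed
  have epar: "\<epsilon> * h (Y + Z) (Y + Z) \<le> 2 * (\<epsilon> * h Y Y) + 2 * (\<epsilon> * h Z Z)" for Y Z
    using mult_left_mono[OF par e0, of Y Z] by (simp add: algebra_simps)
  \<comment> \<open>Polarisation: the small diagonal makes \<open>A\<close> nearly skew. The 6 is 4
    from the diagonal at Y + Z, by the parallelogram bound, plus 2 from the diagonal at Y or
    Z.\<close>
  have skew: "\<bar>A Y Z + A Z Y\<bar> \<le> 6 * (\<epsilon> * h Y Y + \<epsilon> * h Z Z)" for Y Z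
    using diag[of "Y + Z"] diag[of Y] diag[of Z] epar[of Y Z] by (simp add: Aadd)
  have polar: "\<bar>A Y (J Z) + A Z (J Y)\<bar> \<le> 3 * (\<epsilon> * h Y Y + \<epsilon> * h Z Z)"
    if J: "\<And>Y. \<bar>A Y (J Y)\<bar> \<le> \<epsilon> * h Y Y" "linear J" for J Y Z
    using J(1)[of "Y + Z"] J(1)[of Y] J(1)[of Z] epar[of Y Z] by (simp add: Aadd linear_add[OF J(2)])
  \<comment> \<open>J can be moved from one argument to the other: \<open>polar\<close> costs 3 and
    exchanging the arguments by \<open>skew\<close> costs 6.\<close>
  have move: "\<bar>A Y (J Z) - A (J Y) Z\<bar> \<le> 9 * (\<epsilon> * h Y Y + \<epsilon> * h Z Z)"
    if J: "\<And>Y. \<bar>A Y (J Y)\<bar> \<le> \<epsilon> * h Y Y" "linear J" "h (J Y) (J Y) = h Y Y" for J Y Z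
  proof -
    have "\<bar>A Z (J Y) + A (J Y) Z\<bar> \<le> 6 * (\<epsilon> * h Y Y + \<epsilon> * h Z Z)"
      using skew[of Z "J Y"] unfolding J(3) by (simp only: add.commute)
    with polar[OF J(1,2), of Y Z] show ?thesis unfolding abs_le_iff by argo
  qed
  \<comment> \<open>Moving J1 and then J2 turns A(Y, J3 Z) into -A(J3 Y, Z), because J2 J1 = -J3,
    whereas moving J3 at once gives +A(J3 Y, Z). Hence 2 A(Y, J3 Z) is bounded by three errors of
    size 9.\<close>
  have J3: "\<bar>A Y (J3 Z)\<bar> \<le> 20 * (\<epsilon> * h Y Y + \<epsilon> * h Z Z)" for Z
  proof -
    have "\<bar>A Y (J3 Z) - A (J1 Y) (J2 Z)\<bar> \<le> 9 * (\<epsilon> * h Y Y + \<epsilon> * h Z Z)"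
      using move[of J1 Y "J2 Z", OF s2(1) lin(1)] by (simp add: hJ)
    moreover have "\<bar>A (J1 Y) (J2 Z) + A (J3 Y) Z\<bar> \<le> 9 * (\<epsilon> * h Y Y + \<epsilon> * h Z Z)"
      using move[of J2 "J1 Y" Z, OF s3(1) lin(2)] by (simp add: hJ)
    moreover have "\<bar>A Y (J3 Z) - A (J3 Y) Z\<bar> \<le> 9 * (\<epsilon> * h Y Y + \<epsilon> * h Z Z)"
      using move[of J3 Y Z, OF s1(1) lin(3)] by (simp add: hJ)
    moreover have "0 \<le> \<epsilon> * h Y Y + \<epsilon> * h Z Z" using e0 nonneg by simp
    ultimately show ?thesis by linarith
  qed
  show ?thesis using J3[of "J3 Z"] by (simp add: hJ algebra_simps)
qed

definition qJ :: "nat \<Rightarrow> 'e \<Rightarrow> 'e" where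
  "qJ k = (if k = 0 then id else if k = 1 then J1 else if k = 2 then J2 else J3)"

lemma qJ_simps: "qJ 0 u = u" "qJ (Suc 0) u = J1 u" "qJ 2 u = J2 u" "qJ 3 u = J3 u"
  by (auto simp: qJ_def)

text \<open>Gram-Schmidt over the quaternions: as long as the translates of \<open>e 0\<close>, ...,
  \<open>e (m - 1)\<close> do not fill the space, a unit vector orthogonal to them can be added, and
  its own translates are then orthogonal to them as well. That the dimension is divisible by 4 is
  part of the conclusion.\<close>

lemma quat_basis:
  obtains m and e :: "nat \<Rightarrow> 'e"
  where "4 * m = DIM('e)" "span ((\<lambda>(a, k). qJ k (e a)) ` ({..<m} \<times> {..<4})) = UNIV"
proof -
  define P where "P m e \<longleftrightarrow> (\<forall>a<m. \<forall>b<m. h (e a) (e b) = (if a = b then 1 else 0) \<and>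
      h (e a) (J1 (e b)) = 0 \<and> h (e a) (J2 (e b)) = 0 \<and> h (e a) (J3 (e b)) = 0)"
    for m and e :: "nat \<Rightarrow> 'e"
  let ?f = "\<lambda>e (a, k). qJ k (e a)"
  let ?I = "\<lambda>m::nat. {..<m} \<times> {..<4::nat}"
  have orth: "h (?f e i) (?f e j) = (if i = j then 1 else 0)"
    if P: "P m e" and ij: "i \<in> ?I m" "j \<in> ?I m" for m e i j
  proof -
    obtain a k b l where i: "i = (a, k)" "j = (b, l)" "a < m" "b < m" "k < 4" "l < 4" using ij by auto
    have k: "k = 0 \<or> k = Suc 0 \<or> k = 2 \<or> k = 3" "l = 0 \<or> l = Suc 0 \<or> l = 2 \<or> l = 3" using i by auto
    have "h (e a) (e b) = (if a = b then 1 else 0)" "h (e a) (J1 (e b)) = 0"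
      "h (e a) (J2 (e b)) = 0" "h (e a) (J3 (e b)) = 0" using P i unfolding P_def by blast+
    with k show ?thesis unfolding i by (elim disjE) (simp_all add: qJ_simps hJ)
  qed
  have ind: "inj_on (?f e) (?I m) \<and> independent (?f e ` ?I m)" if "P m e" for m e
    by (rule orthonormal_family_independent[OF bil orth[OF that]]) auto
  have card: "card (?f e ` ?I m) = 4 * m" if "P m e" for m e
    using ind[OF that] card_image by fastforce
  have bound: "4 * m \<le> DIM('e)" if "P m e" for m e
    using ind[OF that] card[OF that] independent_bound by metis
  have step: "\<exists>v. P (Suc m) (e(m := v))" if e: "P m e" and m: "4 * m < DIM('e)" for m e
  proof -
    have "card (?f e ` ?I m) < DIM('e)" using card[OF e] m by simp
    from orthogonal_vector_exists[OF bil _ this] obtain u where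
      u: "u \<noteq> 0" "\<And>x. x \<in> ?f e ` ?I m \<Longrightarrow> h u x = 0" by blast
    define v where "v = (1 / sqrt (h u u)) *\<^sub>R u"
    have vv: "h v v = 1" using pos[OF u(1)] by (simp add: v_def h_lin)
    have "h u (qJ k (e a)) = 0" if "a < m" "k < 4" for a k using u(2) that by force
    then have "h v (qJ k (e a)) = 0" if "a < m" "k < 4" for a k using that by (simp add: v_def h_lin)
    from this[of _ 0] this[of _ "Suc 0"] this[of _ 2] this[of _ 3]
    have ve: "h v (e a) = 0" "h v (J1 (e a)) = 0" "h v (J2 (e a)) = 0" "h v (J3 (e a)) = 0" if "a < m" for a
      using that by (auto simp: qJ_simps)
    have ev: "h (e a) v = 0" "h (e a) (J1 v) = 0" "h (e a) (J2 v) = 0" "h (e a) (J3 v) = 0" if "a < m" for a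
      using ve[OF that] sym[of v "e a"] hJ_swap[of v "e a"] by simp_all
    have "P (Suc m) (e(m := v))"
      using e vv ve ev by (auto simp: P_def less_Suc_eq)
    then show ?thesis by blast
  qed
  have "\<exists>e. P m e" if "4 * m \<le> DIM('e)" for m
    using that
  proof (induction m)
    case 0
    show ?case by (simp add: P_def)
  next
    case (Suc m)
    then obtain e where "P m e" by auto
    with step[of m e] Suc.prems show ?case by auto
  qed
  moreover define m where "m = DIM('e) div 4"
  ultimately obtain e where e: "P m e" by fastforce
  \<comment> \<open>A remainder in the division by 4 would permit one further step and so an
    independent family larger than the dimension.\<close>
  have "\<not> 4 * m < DIM('e)"
  proof
    assume "4 * m < DIM('e)"
    from step[OF e this] obtain v where "P (Suc m) (e(m := v))" by blast
    from bound[OF this] show False unfolding m_def by presburger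
  qed
  then have m: "4 * m = DIM('e)" using bound[OF e] by simp
  have "span (?f e ` ?I m) = UNIV"
    using ind[OF e] card[OF e] m card_ge_dim_independent[of "?f e ` ?I m" UNIV] by auto
  with m show ?thesis by (rule that)
qed

text \<open>On an invariant form the two summands cancel, since J2 w and J3 w = -J2 (J1 w) have the
  value of w and -J1 w; the Kaehler form of J1 contributes h w w twice, and those of J2 and J3
  contribute nothing. One vector w therefore suffices to read off the three coefficients.\<close>

lemma compat_coeff:
  assumes inv: "inv_form \<phi>"
    and d: "\<And>u v. \<psi> u v = a1 * h (J1 u) v + a2 * h (J2 u) v + a3 * h (J3 u) v + \<phi> u v"
    and neg: "\<And>u v. \<phi> u (- v) = - \<phi> u v"
  shows "\<psi> w (J1 w) + \<psi> (J2 w) (J3 w) = 2 * a1 * h w w"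
    "\<psi> w (J2 w) + \<psi> (J3 w) (J1 w) = 2 * a2 * h w w"
    "\<psi> w (J3 w) + \<psi> (J1 w) (J2 w) = 2 * a3 * h w w"
proof -
  have "\<phi> (J2 w) (J2 (J1 w)) = \<phi> w (J1 w)" "\<phi> (J3 w) (J3 (J2 w)) = \<phi> w (J2 w)"
    "\<phi> (J1 w) (J1 (J3 w)) = \<phi> w (J3 w)" using inv unfolding inv_form_def by blast+
  then have "\<phi> (J2 w) (J3 w) = - \<phi> w (J1 w)" "\<phi> (J3 w) (J1 w) = - \<phi> w (J2 w)"
    "\<phi> (J1 w) (J2 w) = - \<phi> w (J3 w)" using neg by simp_all
  then show "\<psi> w (J1 w) + \<psi> (J2 w) (J3 w) = 2 * a1 * h w w"
    "\<psi> w (J2 w) + \<psi> (J3 w) (J1 w) = 2 * a2 * h w w"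
    "\<psi> w (J3 w) + \<psi> (J1 w) (J2 w) = 2 * a3 * h w w"
    unfolding d by (simp_all add: hJ)
qed

lemma compat_neg:
  assumes inv: "inv_form \<phi>" and b: "bilinear \<psi>"
    and d: "\<And>u v. \<psi> u v = a1 * h (J1 u) v + a2 * h (J2 u) v + a3 * h (J3 u) v + \<phi> u v"
  shows "\<phi> u (- v) = - \<phi> u v"
  using d[of u "- v"] d[of u v] bilinear_rneg[OF b, of u v] by (simp add: algebra_simps)

text \<open>The three sums at w remove the part in S^2H. An invariant form satisfies \<psi>(J u, v)
  = -\<psi>(u, J v), so it is determined by its values on \<open>e a\<close> and
  \<open>qJ k (e b)\<close>, which are skew in (a, b) for k = 0 and symmetric for the other k. With
  m = n this leaves n(n-1)/2 + 3n(n+1)/2 = n(2n+1) numbers.\<close>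

lemma compat_zero:
  fixes e :: "nat \<Rightarrow> 'e"
  assumes c: "compat_form \<psi>" and b: "bilinear \<psi>" and a: "\<And>u v. \<psi> u v = - \<psi> v u"
    and w: "w \<noteq> 0" "\<psi> w (J1 w) + \<psi> (J2 w) (J3 w) = 0" "\<psi> w (J2 w) + \<psi> (J3 w) (J1 w) = 0"
      "\<psi> w (J3 w) + \<psi> (J1 w) (J2 w) = 0"
    and span: "span ((\<lambda>(a, k). qJ k (e a)) ` ({..<m} \<times> {..<4})) = UNIV"
    and z0: "\<And>a b. a < b \<Longrightarrow> b < m \<Longrightarrow> \<psi> (e a) (e b) = 0"
    and z1: "\<And>a b k. a \<le> b \<Longrightarrow> b < m \<Longrightarrow> k < 4 \<Longrightarrow> k \<noteq> 0 \<Longrightarrow> \<psi> (e a) (qJ k (e b)) = 0"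
  shows "\<psi> u v = 0"
proof -
  obtain a1 a2 a3 \<phi> where inv: "inv_form \<phi>"
    and d: "\<And>u v. \<psi> u v = a1 * h (J1 u) v + a2 * h (J2 u) v + a3 * h (J3 u) v + \<phi> u v"
    using c unfolding compat_form_def by blast
  have "a1 = 0" "a2 = 0" "a3 = 0"
    using compat_coeff[OF inv d compat_neg[OF inv b d], of w] w pos[OF w(1)] by auto
  then have "\<psi> = \<phi>" using d by (simp add: fun_eq_iff)
  then have I: "\<psi> (J1 u) (J1 v) = \<psi> u v" "\<psi> (J2 u) (J2 v) = \<psi> u v" "\<psi> (J3 u) (J3 v) = \<psi> u v" for u v
    using inv unfolding inv_form_def by blast+
  have neg: "\<psi> u (- v) = - \<psi> u v" "\<psi> (- u) v = - \<psi> u v" for u v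
    using bilinear_rneg[OF b] bilinear_lneg[OF b] by blast+
  have M: "\<psi> (J1 u) v = - \<psi> u (J1 v)" "\<psi> (J2 u) v = - \<psi> u (J2 v)" "\<psi> (J3 u) v = - \<psi> u (J3 v)" for u v
    using I(1)[of u "J1 v"] I(2)[of u "J2 v"] I(3)[of u "J3 v"] by (simp_all add: neg)
  have self: "\<psi> u u = 0" for u using a[of u u] by simp
  have sw: "\<psi> u (J1 v) = \<psi> v (J1 u)" "\<psi> u (J2 v) = \<psi> v (J2 u)" "\<psi> u (J3 v) = \<psi> v (J3 u)" for u v
    using M[of v u] a[of u "J1 v"] a[of u "J2 v"] a[of u "J3 v"] by simp_all
  have e: "\<psi> (e a) (e b) = 0 \<and> \<psi> (e a) (J1 (e b)) = 0 \<and> \<psi> (e a) (J2 (e b)) = 0 \<and> \<psi> (e a) (J3 (e b)) = 0"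
    if "a < m" "b < m" for a b
  proof (cases "a \<le> b")
    case True
    have "\<psi> (e a) (e b) = 0"
    proof (cases "a = b")
      case False
      with True have "a < b" by simp
      then show ?thesis using z0 that by blast
    qed (simp add: self)
    then show ?thesis using z1[OF True that(2), of "Suc 0"] z1[OF True that(2), of 2] z1[OF True that(2), of 3]
      by (simp add: qJ_simps)
  next
    case False
    then have "\<psi> (e b) (e a) = 0" "b \<le> a" using z0[of b a] that by auto
    then show ?thesis using z1[of b a, of "Suc 0"] z1[of b a 2] z1[of b a 3] that sw a[of "e a" "e b"]
      by (simp add: qJ_simps)
  qed
  let ?S = "(\<lambda>(a, k). qJ k (e a)) ` ({..<m} \<times> {..<4})"
  have S: "\<psi> x y = 0" if xy: "x \<in> ?S" "y \<in> ?S" for x y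
  proof -
    obtain a k b l where i: "x = qJ k (e a)" "y = qJ l (e b)" "a < m" "b < m" "k < 4" "l < 4"
      using xy by auto
    have k: "k = 0 \<or> k = Suc 0 \<or> k = 2 \<or> k = 3" "l = 0 \<or> l = Suc 0 \<or> l = 2 \<or> l = 3" using i by auto
    with e[OF i(3,4)] show ?thesis unfolding i by (elim disjE) (simp_all add: qJ_simps M neg)
  qed
  then have 1: "\<psi> x y = 0" if "x \<in> ?S" for x y
  proof -
    have "linear (\<psi> x)" using b by (simp add: bilinear_def)
    from linear_eq_0_on_span[OF this, of ?S y] show ?thesis
      using S that span by blast
  qed
  have "linear (\<lambda>x. \<psi> x v)" using b by (simp add: bilinear_def)
  from linear_eq_0_on_span[OF this, of ?S u] show ?thesis using 1 span by blast
qed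

end

section \<open>Fields of bilinear forms\<close>

lemma bilinear_expand:
  fixes B :: "'a::euclidean_space \<Rightarrow> 'b::euclidean_space \<Rightarrow> 'c::real_vector"
  assumes B: "bilinear B"
  shows "B u v = (\<Sum>a\<in>Basis. \<Sum>b\<in>Basis. ((u \<bullet> a) * (v \<bullet> b)) *\<^sub>R B a b)"
proof -
  have l1: "linear (\<lambda>x. B x y)" and l2: "linear (B x)" for x y using B by (auto simp: bilinear_def)
  have "B u v = B (\<Sum>a\<in>Basis. (u \<bullet> a) *\<^sub>R a) v" by (simp add: euclidean_representation)
  also have "\<dots> = (\<Sum>a\<in>Basis. (u \<bullet> a) *\<^sub>R B a v)"
    using linear_sum[OF l1, of "\<lambda>a. (u \<bullet> a) *\<^sub>R a" Basis v] by (simp add: linear_scale[OF l1])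
  also have "\<dots> = (\<Sum>a\<in>Basis. (u \<bullet> a) *\<^sub>R (\<Sum>b\<in>Basis. (v \<bullet> b) *\<^sub>R B a b))"
  proof (rule sum.cong[OF refl])
    fix a
    have "B a v = B a (\<Sum>b\<in>Basis. (v \<bullet> b) *\<^sub>R b)" by (simp add: euclidean_representation)
    also have "\<dots> = (\<Sum>b\<in>Basis. (v \<bullet> b) *\<^sub>R B a b)"
      using linear_sum[OF l2, of a "\<lambda>b. (v \<bullet> b) *\<^sub>R b" Basis] by (simp add: linear_scale[OF l2])
    finally show "(u \<bullet> a) *\<^sub>R B a v = (u \<bullet> a) *\<^sub>R (\<Sum>b\<in>Basis. (v \<bullet> b) *\<^sub>R B a b)" by simp
  qed
  finally show ?thesis by (simp add: scaleR_sum_right)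
qed

lemma linear_expand:
  fixes f :: "'a::euclidean_space \<Rightarrow> 'c::real_vector"
  assumes f: "linear f"
  shows "f u = (\<Sum>a\<in>Basis. (u \<bullet> a) *\<^sub>R f a)"
  using linear_sum[OF f, of "\<lambda>a. (u \<bullet> a) *\<^sub>R a" Basis]
  by (simp add: linear_scale[OF f] euclidean_representation)

lemma has_derivative_bilinear_field:
  fixes B :: "'x::euclidean_space \<Rightarrow> 'a::euclidean_space \<Rightarrow> 'b::euclidean_space \<Rightarrow> 'c::real_normed_vector"
  assumes W: "open W" "x \<in> W" and B: "\<And>y. y \<in> W \<Longrightarrow> bilinear (B y)"
    and d: "\<And>u v. (\<lambda>y. B y u v) differentiable (at x)"
    and f: "(f has_derivative f') (at x)" and g: "(g has_derivative g') (at x)"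
  shows "((\<lambda>y. B y (f y) (g y)) has_derivative
     (\<lambda>h. pd (\<lambda>y. B y (f x) (g x)) x h + B x (f' h) (g x) + B x (f x) (g' h))) (at x)"
proof -
  have 1: "((\<lambda>y. B y (f y) (g y)) has_derivative (\<lambda>h. \<Sum>a\<in>Basis. \<Sum>b\<in>Basis.
      ((f' h \<bullet> a) * (g x \<bullet> b) + (f x \<bullet> a) * (g' h \<bullet> b)) *\<^sub>R B x a b
      + ((f x \<bullet> a) * (g x \<bullet> b)) *\<^sub>R pd (\<lambda>y. B y a b) x h)) (at x)"
    if f: "(f has_derivative f') (at x)" and g: "(g has_derivative g') (at x)" for f g f' g'
  proof -
    have "((\<lambda>y. \<Sum>a\<in>Basis. \<Sum>b\<in>Basis. ((f y \<bullet> a) * (g y \<bullet> b)) *\<^sub>R B y a b) has_derivative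
      (\<lambda>h. \<Sum>a\<in>Basis. \<Sum>b\<in>Basis.
      ((f' h \<bullet> a) * (g x \<bullet> b) + (f x \<bullet> a) * (g' h \<bullet> b)) *\<^sub>R B x a b
      + ((f x \<bullet> a) * (g x \<bullet> b)) *\<^sub>R pd (\<lambda>y. B y a b) x h)) (at x)"
    proof (intro has_derivative_sum)
      fix a :: 'a and b :: 'b
      have fa: "((\<lambda>y. f y \<bullet> a) has_derivative (\<lambda>h. f' h \<bullet> a)) (at x)"
        and gb: "((\<lambda>y. g y \<bullet> b) has_derivative (\<lambda>h. g' h \<bullet> b)) (at x)"
        using f g by (auto intro: has_derivative_inner_left)
      from has_derivative_scaleR[OF has_derivative_mult[OF fa gb] pd_has_derivative[OF d[of a b]]]
      show "((\<lambda>y. ((f y \<bullet> a) * (g y \<bullet> b)) *\<^sub>R B y a b) has_derivative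
        (\<lambda>h. ((f' h \<bullet> a) * (g x \<bullet> b) + (f x \<bullet> a) * (g' h \<bullet> b)) *\<^sub>R B x a b
        + ((f x \<bullet> a) * (g x \<bullet> b)) *\<^sub>R pd (\<lambda>y. B y a b) x h)) (at x)"
        by (rule has_derivative_eq_rhs) (simp add: algebra_simps)
    qed
    then show ?thesis
      by (rule has_derivative_transform_within_open[OF _ W]) (rule bilinear_expand[OF B, symmetric])
  qed
  \<comment> \<open>The case of constant arguments identifies the terms that contain derivatives of
    the components of \<open>B\<close>.\<close>
  have 2: "pd (\<lambda>y. B y u v) x h = (\<Sum>a\<in>Basis. \<Sum>b\<in>Basis. ((u \<bullet> a) * (v \<bullet> b)) *\<^sub>R pd (\<lambda>y. B y a b) x h)"
    for u v h using pd_eq[OF 1[OF has_derivative_const[of u] has_derivative_const[of v]]] by simp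
  have 3: "B x u v = (\<Sum>a\<in>Basis. \<Sum>b\<in>Basis. ((u \<bullet> a) * (v \<bullet> b)) *\<^sub>R B x a b)" for u v
    by (rule bilinear_expand[OF B[OF W(2)]])
  show ?thesis
    by (rule has_derivative_eq_rhs[OF 1[OF f g]])
       (simp only: fun_eq_iff 2[of "f x" "g x"] 3[of _ "g x"] 3[of "f x"] sum.distrib[symmetric]
         scaleR_left_distrib ac_simps simp_thms)
qed

lemma smooth_on_bilinear_field:
  fixes B :: "'x::euclidean_space \<Rightarrow> 'a::euclidean_space \<Rightarrow> 'b::euclidean_space \<Rightarrow> 'c::real_normed_vector"
  assumes W: "open W" and B: "\<And>y. y \<in> W \<Longrightarrow> bilinear (B y)"
    and s: "\<And>u v. smooth_on W (\<lambda>y. B y u v)" and f: "smooth_on W f" and g: "smooth_on W g"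
  shows "smooth_on W (\<lambda>y. B y (f y) (g y))"
proof (rule smooth_on_cong[OF _ W bilinear_expand[OF B, symmetric]])
  show "smooth_on W (\<lambda>y. \<Sum>a\<in>Basis. \<Sum>b\<in>Basis. ((f y \<bullet> a) * (g y \<bullet> b)) *\<^sub>R B y a b)"
    by (intro smooth_on_sum smooth_on_scaleR smooth_on_mult smooth_on_inner smooth_on_const W f g s)
qed

lemma smooth_on_linear_field:
  fixes A :: "'x::euclidean_space \<Rightarrow> 'a::euclidean_space \<Rightarrow> 'c::real_normed_vector"
  assumes W: "open W" and A: "\<And>y. y \<in> W \<Longrightarrow> linear (A y)"
    and s: "\<And>u. smooth_on W (\<lambda>y. A y u)" and f: "smooth_on W f"
  shows "smooth_on W (\<lambda>y. A y (f y))"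
proof (rule smooth_on_cong[OF _ W linear_expand[OF A, symmetric]])
  show "smooth_on W (\<lambda>y. \<Sum>a\<in>Basis. (f y \<bullet> a) *\<^sub>R A y a)"
    by (intro smooth_on_sum smooth_on_scaleR smooth_on_inner smooth_on_const W f s)
qed

lemma pd_linear_field:
  assumes W: "open W" "x \<in> W" and A: "\<And>y. y \<in> W \<Longrightarrow> linear (A y)"
    and d: "\<And>u. (\<lambda>y. A y u) differentiable (at x)"
  shows "linear (\<lambda>u. pd (\<lambda>y. A y u) x Z)"
proof (rule linearI)
  fix u v c
  have "((\<lambda>y. A y u + A y v) has_derivative (\<lambda>h. pd (\<lambda>y. A y u) x h + pd (\<lambda>y. A y v) x h)) (at x)"
    by (intro has_derivative_add pd_has_derivative d)
  from pd_eq[OF this] show "pd (\<lambda>y. A y (u + v)) x Z = pd (\<lambda>y. A y u) x Z + pd (\<lambda>y. A y v) x Z"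
    using pd_cong[OF W, of "\<lambda>y. A y (u + v)" "\<lambda>y. A y u + A y v"] by (simp add: linear_add[OF A])
  have "((\<lambda>y. c *\<^sub>R A y u) has_derivative (\<lambda>h. c *\<^sub>R pd (\<lambda>y. A y u) x h)) (at x)"
    by (intro has_derivative_scaleR_right pd_has_derivative d)
  from pd_eq[OF this] show "pd (\<lambda>y. A y (c *\<^sub>R u)) x Z = c *\<^sub>R pd (\<lambda>y. A y u) x Z"
    using pd_cong[OF W, of "\<lambda>y. A y (c *\<^sub>R u)" "\<lambda>y. c *\<^sub>R A y u"] by (simp add: linear_scale[OF A])
qed

section \<open>Inner products, Riesz representation and smooth frames\<close>

definition inner_form :: "('e::euclidean_space \<Rightarrow> 'e \<Rightarrow> real) \<Rightarrow> bool" where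
  "inner_form h \<longleftrightarrow> bilinear h \<and> (\<forall>u v. h u v = h v u) \<and> (\<forall>u. u \<noteq> 0 \<longrightarrow> h u u > 0)"

lemma inner_form_eqI:
  assumes h: "inner_form h" and e: "\<And>w. h z w = h z' w"
  shows "z = z'"
proof (rule ccontr)
  assume "z \<noteq> z'"
  then have "h (z - z') (z - z') > 0" using h by (simp add: inner_form_def)
  moreover have "h (z - z') w = 0" for w
    using e[of w] h bilinear_lsub[of h z z' w] by (simp add: inner_form_def)
  ultimately show False by simp
qed

lemma inner_form_riesz:
  fixes h :: "'e::euclidean_space \<Rightarrow> 'e \<Rightarrow> real"
  assumes h: "inner_form h" and f: "linear f"
  shows "\<exists>z. \<forall>w. h z w = f w"
proof -
  have b: "bilinear h" using h by (simp add: inner_form_def)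
  \<comment> \<open>\<open>L z\<close> is the functional \<open>h z\<close> written as a Euclidean
    vector; an injective linear endomorphism is surjective.\<close>
  define L where "L z = (\<Sum>b\<in>Basis. h z b *\<^sub>R b)" for z
  have Lb: "L z \<bullet> b = h z b" if "b \<in> Basis" for z b
    using that by (simp add: L_def)
  have "linear L"
    unfolding L_def
    by (rule linearI) (simp_all add: bilinear_ladd[OF b] bilinear_lmul[OF b] scaleR_add_left
       sum.distrib scaleR_sum_right)
  moreover have "inj L"
  proof (rule injI)
    fix z z' assume "L z = L z'"
    then have e: "h z b = h z' b" if "b \<in> Basis" for b using Lb[OF that] by metis
    have lz: "linear (h z)" "linear (h z')" using b by (auto simp: bilinear_def)
    have "h z w = h z' w" for w
      unfolding linear_expand[OF lz(1), of w] linear_expand[OF lz(2), of w]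
      by (rule sum.cong) (simp_all add: e)
    then show "z = z'" by (rule inner_form_eqI[OF h])
  qed
  ultimately have "surj L" by (simp add: linear_injective_imp_surjective)
  then obtain z where z: "L z = (\<Sum>b\<in>Basis. f b *\<^sub>R b)" by (metis surjD)
  have fb: "h z b = f b" if "b \<in> Basis" for b
    using arg_cong[OF z, of "\<lambda>x. x \<bullet> b"] that Lb[OF that] by simp
  have "linear (h z)" using b by (simp add: bilinear_def)
  then have "h z w = f w" for w using linear_expand[of "h z" w] linear_expand[OF f, of w] fb by simp
  then show ?thesis by blast
qed

text \<open>Gram-Schmidt without normalisation produces a smooth frame by rational operations only.\<close>

lemma smooth_orthogonal_frame:
  fixes g :: "'e::euclidean_space \<Rightarrow> 'e \<Rightarrow> 'e \<Rightarrow> real"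
  assumes W: "open W" and g: "\<And>y. y \<in> W \<Longrightarrow> inner_form (g y)"
    and gs: "\<And>u v. smooth_on W (\<lambda>y. g y u v)"
    and S: "finite S" "independent S"
  shows "\<exists>V. \<forall>b\<in>S. smooth_on W (V b) \<and> (\<forall>y\<in>W. V b y \<noteq> 0 \<and> b \<in> span ((\<lambda>b. V b y) ` S) \<and>
     V b y \<in> span S \<and> (\<forall>c\<in>S. c \<noteq> b \<longrightarrow> g y (V b y) (V c y) = 0))"
  using S
proof (induction S rule: finite_induct)
  case empty
  then show ?case by auto
next
  case (insert s S)
  have gb: "bilinear (g y)" if "y \<in> W" for y using g[OF that] by (simp add: inner_form_def)
  have gsym: "g y u v = g y v u" if "y \<in> W" for y u v using g[OF that] by (simp add: inner_form_def)
  have gp: "g y u u \<noteq> 0" if "y \<in> W" "u \<noteq> 0" for y u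
    using g[OF that(1)] that(2) unfolding inner_form_def by fastforce
  have ins: "independent S" "s \<notin> span S"
    using insert.prems insert.hyps independent_insert[of s S] by auto
  obtain V where V: "\<And>b. b \<in> S \<Longrightarrow> smooth_on W (V b)"
    "\<And>b y. b \<in> S \<Longrightarrow> y \<in> W \<Longrightarrow> V b y \<noteq> 0"
    "\<And>b y. b \<in> S \<Longrightarrow> y \<in> W \<Longrightarrow> b \<in> span ((\<lambda>b. V b y) ` S)"
    "\<And>b y. b \<in> S \<Longrightarrow> y \<in> W \<Longrightarrow> V b y \<in> span S"
    "\<And>b c y. b \<in> S \<Longrightarrow> y \<in> W \<Longrightarrow> c \<in> S \<Longrightarrow> c \<noteq> b \<Longrightarrow> g y (V b y) (V c y) = 0"
    using insert.IH[OF ins(1)] by blast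
  define k where "k c y = g y s (V c y) / g y (V c y) (V c y)" for c y
  define v where "v y = s - (\<Sum>c\<in>S. k c y *\<^sub>R V c y)" for y
  define V' where "V' = V(s := v)"
  have V's: "V' s = v" and V'b: "\<And>b. b \<in> S \<Longrightarrow> V' b = V b" using insert.hyps by (auto simp: V'_def)
  have ks: "smooth_on W (k c)" if "c \<in> S" for c
    unfolding k_def
    by (intro smooth_on_divide W smooth_on_bilinear_field[OF W gb gs] smooth_on_const V that)
       (use gp V that in auto)
  have vs: "smooth_on W v"
    unfolding v_def by (intro smooth_on_diff W smooth_on_const smooth_on_sum smooth_on_scaleR V ks)
  have sumspan: "(\<Sum>c\<in>S. k c y *\<^sub>R V c y) \<in> span S" if "y \<in> W" for y
    by (intro span_sum span_scale V that)
  have v0: "v y \<noteq> 0" if "y \<in> W" for y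
    using sumspan[OF that] ins by (auto simp: v_def)
  have vspan: "v y \<in> span (insert s S)" if "y \<in> W" for y
    using sumspan[OF that] span_mono[of S "insert s S"] unfolding v_def
    by (intro span_diff) (auto simp: span_base)
  have orth: "g y (v y) (V c y) = 0" if y: "y \<in> W" and c: "c \<in> S" for y c
  proof -
    have l: "linear (\<lambda>u. g y u (V c y))" using gb[OF y] by (simp add: bilinear_def)
    have "g y (v y) (V c y) = g y s (V c y) - (\<Sum>d\<in>S. k d y * g y (V d y) (V c y))"
      unfolding v_def using linear_diff[OF l] linear_sum[OF l, of "\<lambda>d. k d y *\<^sub>R V d y" S]
      by (simp add: linear_scale[OF l])
    also have "(\<Sum>d\<in>S. k d y * g y (V d y) (V c y)) = (\<Sum>d\<in>S. if d = c then g y s (V c y) else 0)"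
    proof (rule sum.cong[OF refl])
      fix d assume d: "d \<in> S"
      show "k d y * g y (V d y) (V c y) = (if d = c then g y s (V c y) else 0)"
        using V(5)[OF d y c] gp[OF y V(2)[OF d y]] by (auto simp: k_def)
    qed
    also have "\<dots> = g y s (V c y)" using c insert.hyps by simp
    finally show ?thesis by simp
  qed
  have sp: "span ((\<lambda>b. V b y) ` S) \<subseteq> span ((\<lambda>b. V' b y) ` insert s S)" if "y \<in> W" for y
  proof (rule span_mono)
    show "(\<lambda>b. V b y) ` S \<subseteq> (\<lambda>b. V' b y) ` insert s S" using V'b by force
  qed
  have s_in: "s \<in> span ((\<lambda>b. V' b y) ` insert s S)" if y: "y \<in> W" for y
  proof -
    have "v y \<in> span ((\<lambda>b. V' b y) ` insert s S)" using V's by (intro span_base) auto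
    moreover have "(\<Sum>c\<in>S. k c y *\<^sub>R V c y) \<in> span ((\<lambda>b. V b y) ` S)"
      by (intro span_sum span_scale span_base) auto
    ultimately have "v y + (\<Sum>c\<in>S. k c y *\<^sub>R V c y) \<in> span ((\<lambda>b. V' b y) ` insert s S)"
      using sp[OF y] by (intro span_add) auto
    then show ?thesis by (simp add: v_def)
  qed
  show ?case
  proof (intro exI[of _ V'] ballI conjI impI)
    fix b assume b: "b \<in> insert s S"
    show "smooth_on W (V' b)" using b vs V(1) V's V'b by auto
    fix y assume y: "y \<in> W"
    show "V' b y \<noteq> 0" using b v0[OF y] V(2)[OF _ y] V's V'b by auto
    show "b \<in> span ((\<lambda>b. V' b y) ` insert s S)" using b s_in[OF y] V(3)[OF _ y] sp[OF y] by blast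
    show "V' b y \<in> span (insert s S)"
      using b vspan[OF y] V(4)[OF _ y] span_mono[OF subset_insertI[of S s]] V's V'b by auto
    fix c assume c: "c \<in> insert s S" "c \<noteq> b"
    show "g y (V' b y) (V' c y) = 0"
      using b c V(5)[OF _ y] orth[OF y] V's V'b gsym[OF y, of "V b y" "v y"] by auto
  qed
qed

text \<open>In an orthogonal frame V the solution is the sum of k(V_b) / g(V_b, V_b) times V_b,
  which is visibly smooth. Used with the Koszul formula as right-hand side to obtain smooth
  Christoffel maps.\<close>

lemma smooth_on_solution:
  fixes g :: "'e::euclidean_space \<Rightarrow> 'e \<Rightarrow> 'e \<Rightarrow> real"
  assumes W: "open W" and g: "\<And>y. y \<in> W \<Longrightarrow> inner_form (g y)"
    and gs: "\<And>u v. smooth_on W (\<lambda>y. g y u v)"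
    and f: "\<And>y w. y \<in> W \<Longrightarrow> g y (f y) w = k y w" and k: "\<And>w. smooth_on W (\<lambda>y. k y w)"
  shows "smooth_on W f"
proof -
  have "\<exists>V. \<forall>b\<in>Basis. smooth_on W (V b) \<and> (\<forall>y\<in>W. V b y \<noteq> 0 \<and>
     b \<in> span ((\<lambda>b. V b y) ` Basis) \<and> V b y \<in> span Basis \<and>
     (\<forall>c\<in>Basis. c \<noteq> b \<longrightarrow> g y (V b y) (V c y) = 0))"
    by (rule smooth_orthogonal_frame[OF W _ gs finite_Basis independent_Basis]) (rule g)
  then obtain V where F: "\<forall>b\<in>Basis. smooth_on W (V b) \<and> (\<forall>y\<in>W. V b y \<noteq> 0 \<and>
     b \<in> span ((\<lambda>b. V b y) ` Basis) \<and> V b y \<in> span Basis \<and>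
     (\<forall>c\<in>Basis. c \<noteq> b \<longrightarrow> g y (V b y) (V c y) = 0))" ..
  have V: "\<And>b. b \<in> Basis \<Longrightarrow> smooth_on W (V b)"
    "\<And>b y. b \<in> Basis \<Longrightarrow> y \<in> W \<Longrightarrow> V b y \<noteq> 0"
    "\<And>b y. b \<in> Basis \<Longrightarrow> y \<in> W \<Longrightarrow> b \<in> span ((\<lambda>b. V b y) ` Basis)"
    "\<And>b c y. b \<in> Basis \<Longrightarrow> y \<in> W \<Longrightarrow> c \<in> Basis \<Longrightarrow> c \<noteq> b \<Longrightarrow> g y (V b y) (V c y) = 0"
    using F by auto
  have gb: "bilinear (g y)" if "y \<in> W" for y using g[OF that] by (simp add: inner_form_def)
  have gp: "g y u u \<noteq> 0" if "y \<in> W" "u \<noteq> 0" for y u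
    using g[OF that(1)] that(2) unfolding inner_form_def by fastforce
  have kl: "linear (k y)" if "y \<in> W" for y
  proof -
    have "k y = g y (f y)" using f[OF that] by auto
    then show ?thesis using gb[OF that] by (simp add: bilinear_def)
  qed
  have "smooth_on W (\<lambda>y. \<Sum>b\<in>Basis. (k y (V b y) / g y (V b y) (V b y)) *\<^sub>R V b y)"
    by (intro smooth_on_sum smooth_on_scaleR smooth_on_divide W smooth_on_linear_field[OF W kl k]
      smooth_on_bilinear_field[OF W gb gs] V) (use gp V in auto)
  then show ?thesis
  proof (rule smooth_on_cong[OF _ W])
    fix y assume y: "y \<in> W"
    let ?s = "\<Sum>b\<in>Basis. (k y (V b y) / g y (V b y) (V b y)) *\<^sub>R V b y"
    have e: "g y ?s (V c y) = g y (f y) (V c y)" if c: "c \<in> Basis" for c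
    proof -
      have l: "linear (\<lambda>u. g y u (V c y))" using gb[OF y] by (simp add: bilinear_def)
      have "g y ?s (V c y) = (\<Sum>d\<in>Basis. k y (V d y) / g y (V d y) (V d y) * g y (V d y) (V c y))"
        using linear_sum[OF l, of "\<lambda>d. (k y (V d y) / g y (V d y) (V d y)) *\<^sub>R V d y" Basis]
        by (simp add: linear_scale[OF l])
      also have "\<dots> = (\<Sum>d\<in>Basis. if d = c then k y (V c y) else 0)"
      proof (rule sum.cong[OF refl])
        fix d :: 'e assume d: "d \<in> Basis"
        show "k y (V d y) / g y (V d y) (V d y) * g y (V d y) (V c y) = (if d = c then k y (V c y) else 0)"
          using V(4)[OF d y c] gp[OF y V(2)[OF d y]] by auto
      qed
      also have "\<dots> = k y (V c y)" using c by simp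
      finally show ?thesis using f[OF y] by simp
    qed
    show "?s = f y"
    proof (rule inner_form_eqI[OF g[OF y]])
      fix w
      have l: "linear (g y ?s)" "linear (g y (f y))" using gb[OF y] by (auto simp: bilinear_def)
      have "Basis \<subseteq> span ((\<lambda>b. V b y) ` Basis)" using V(3)[OF _ y] by blast
      then have "w \<in> span ((\<lambda>b. V b y) ` Basis)" using span_Basis span_mono span_span by blast
      from linear_eq_on[OF l this] e show "g y ?s w = g y (f y) w" by auto
    qed
  qed
qed

section \<open>Uniform bounds on compact sets and uniqueness for linear systems\<close>

lemma bounded_family:
  fixes f :: "'i \<Rightarrow> 'a::topological_space \<Rightarrow> real"
  assumes "finite I" "compact K" "\<And>i. i \<in> I \<Longrightarrow> continuous_on K (f i)"
  shows "\<exists>C\<ge>0. \<forall>i\<in>I. \<forall>x\<in>K. \<bar>f i x\<bar> \<le> C"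
  using assms
proof (induction I rule: finite_induct)
  case empty
  then show ?case by auto
next
  case (insert i I)
  then obtain C where C: "C \<ge> 0" "\<forall>i\<in>I. \<forall>x\<in>K. \<bar>f i x\<bar> \<le> C" by auto
  have "bounded (f i ` K)"
    using insert.prems compact_continuous_image compact_imp_bounded by blast
  then obtain B where "\<forall>x\<in>K. \<bar>f i x\<bar> \<le> B" unfolding bounded_iff by auto
  with C show ?case by (intro exI[of _ "max B C"]) (auto simp: le_max_iff_disj)
qed

lemma linear_Basis_bound:
  fixes f :: "'e::euclidean_space \<Rightarrow> real"
  assumes f: "linear f" and b: "\<And>b. b \<in> Basis \<Longrightarrow> \<bar>f b\<bar> \<le> E"
  shows "\<bar>f v\<bar> \<le> E * DIM('e) * norm v"
proof -
  have "\<bar>f v\<bar> \<le> (\<Sum>b\<in>Basis. \<bar>(v \<bullet> b) * f b\<bar>)"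
    unfolding linear_expand[OF f, of v] real_scaleR_def by (rule sum_abs)
  also have "\<dots> \<le> (\<Sum>b\<in>(Basis::'e set). norm v * E)"
    by (rule sum_mono) (auto simp: abs_mult intro!: mult_mono b Basis_le_norm)
  finally show ?thesis by (simp add: mult_ac)
qed

lemma four_linear_bound:
  fixes R :: "'e::euclidean_space \<Rightarrow> 'e \<Rightarrow> 'e \<Rightarrow> 'e \<Rightarrow> real"
  assumes l: "\<And>b c d. linear (\<lambda>a. R a b c d)" "\<And>a c d. linear (\<lambda>b. R a b c d)"
    "\<And>a b d. linear (\<lambda>c. R a b c d)" "\<And>a b c. linear (\<lambda>d. R a b c d)"
    and b: "\<And>a b c d. a \<in> Basis \<Longrightarrow> b \<in> Basis \<Longrightarrow> c \<in> Basis \<Longrightarrow> d \<in> Basis \<Longrightarrow> \<bar>R a b c d\<bar> \<le> E"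
  shows "\<bar>R u v w z\<bar> \<le> E * DIM('e)^4 * norm u * norm v * norm w * norm z"
proof -
  have 1: "\<bar>R u b c d\<bar> \<le> E * DIM('e) * norm u" if "b \<in> Basis" "c \<in> Basis" "d \<in> Basis" for b c d
    using linear_Basis_bound[OF l(1)] b that by blast
  have 2: "\<bar>R u v c d\<bar> \<le> E * DIM('e) * norm u * DIM('e) * norm v" if "c \<in> Basis" "d \<in> Basis" for c d
    using linear_Basis_bound[OF l(2)] 1 that by blast
  have 3: "\<bar>R u v w d\<bar> \<le> E * DIM('e) * norm u * DIM('e) * norm v * DIM('e) * norm w" if "d \<in> Basis" for d
    using linear_Basis_bound[OF l(3)] 2 that by blast
  have "\<bar>R u v w z\<bar> \<le> E * DIM('e) * norm u * DIM('e) * norm v * DIM('e) * norm w * DIM('e) * norm z"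
    using linear_Basis_bound[OF l(4)] 3 by blast
  then show ?thesis by (simp add: power4_eq_xxxx mult_ac)
qed

text \<open>A Gronwall argument along line segments.\<close>

lemma linear_system_unique:
  fixes s :: "'i \<Rightarrow> 'e::euclidean_space \<Rightarrow> real"
  assumes I: "finite I" and K: "convex K" "x0 \<in> K" "x1 \<in> K"
    and d: "\<And>i x. i \<in> I \<Longrightarrow> x \<in> K \<Longrightarrow> s i differentiable (at x)"
    and b: "\<And>i x c. i \<in> I \<Longrightarrow> x \<in> K \<Longrightarrow> c \<in> Basis \<Longrightarrow> \<bar>pd (s i) x c\<bar> \<le> C * (\<Sum>j\<in>I. \<bar>s j x\<bar>)"
    and z: "\<And>i. i \<in> I \<Longrightarrow> s i x0 = 0" and i: "i \<in> I"
  shows "s i x1 = 0"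
proof -
  define v where "v = x1 - x0"
  define c where "c t = x0 + t *\<^sub>R v" for t :: real
  define q where "q t = (\<Sum>j\<in>I. (s j (c t))\<^sup>2)" for t
  define N where "N t = (\<Sum>j\<in>I. \<bar>s j (c t)\<bar>)" for t
  define q' where "q' t = (\<Sum>j\<in>I. 2 * s j (c t) * pd (s j) (c t) v)" for t
  \<comment> \<open>The sign of \<open>C\<close> is not prescribed, hence the absolute value; the
    dimension comes from expanding the direction \<open>v\<close> in the standard basis.\<close>
  let ?D = "\<bar>C\<bar> * DIM('e) * norm v"
  have cK: "c t \<in> K" if "0 \<le> t" "t \<le> 1" for t
  proof -
    have "c t = (1 - t) *\<^sub>R x0 + t *\<^sub>R x1" by (simp add: c_def v_def algebra_simps)
    then show ?thesis using K that convexD_alt[of K x0 x1 t] by simp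
  qed
  have sc: "((\<lambda>t. s j (c t)) has_real_derivative pd (s j) (c t) v) (at t)"
    if "j \<in> I" "0 \<le> t" "t \<le> 1" for j t
  proof -
    have "(c has_derivative (\<lambda>r. r *\<^sub>R v)) (at t)"
      unfolding c_def by (auto intro!: derivative_eq_intros)
    from has_derivative_compose[OF this pd_has_derivative[OF d[OF that(1) cK[OF that(2,3)]]]]
    have "((\<lambda>t. s j (c t)) has_derivative (\<lambda>r. pd (s j) (c t) (r *\<^sub>R v))) (at t)" .
    moreover have "pd (s j) (c t) (r *\<^sub>R v) = pd (s j) (c t) v * r" for r
      using linear_scale[OF pd_linear[OF d[OF that(1) cK[OF that(2,3)]]], of r v] by simp
    ultimately show ?thesis by (simp add: has_field_derivative_def)
  qed
  have "q 1 = 0"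
  proof (rule linear_growth_zero[where q' = q' and C = "2 * ?D * card I"])
    fix t :: real assume t: "0 \<le> t" "t \<le> 1"
    show "(q has_real_derivative q' t) (at t)"
      unfolding q_def q'_def
      by (intro DERIV_sum) (use sc t in \<open>auto intro!: derivative_eq_intros\<close>)
    have N0: "0 \<le> N t" by (simp add: N_def sum_nonneg)
    have pb: "\<bar>pd (s j) (c t) v\<bar> \<le> ?D * N t" if j: "j \<in> I" for j
    proof -
      have "\<bar>pd (s j) (c t) a\<bar> \<le> \<bar>C\<bar> * N t" if "a \<in> Basis" for a
        using b[OF j cK[OF t] that] mult_right_mono[OF abs_ge_self N0, of C] by (simp add: N_def)
      from linear_Basis_bound[OF pd_linear[OF d[OF j cK[OF t]]] this, of v]
      show ?thesis by (simp add: mult_ac)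
    qed
    have "q' t \<le> (\<Sum>j\<in>I. 2 * \<bar>s j (c t)\<bar> * (?D * N t))"
      unfolding q'_def
    proof (rule sum_mono)
      fix j assume j: "j \<in> I"
      have "2 * s j (c t) * pd (s j) (c t) v \<le> 2 * (\<bar>s j (c t)\<bar> * \<bar>pd (s j) (c t) v\<bar>)"
        using abs_ge_self[of "s j (c t) * pd (s j) (c t) v"] by (simp add: abs_mult)
      also have "\<dots> \<le> 2 * (\<bar>s j (c t)\<bar> * (?D * N t))"
        using mult_left_mono[OF pb[OF j], of "\<bar>s j (c t)\<bar>"] by simp
      finally show "2 * s j (c t) * pd (s j) (c t) v \<le> 2 * \<bar>s j (c t)\<bar> * (?D * N t)" by simp
    qed
    also have "\<dots> = 2 * ?D * (N t * N t)"
      unfolding N_def by (simp add: sum_distrib_left sum_distrib_right mult_ac)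
    also have "\<dots> \<le> 2 * ?D * (card I * q t)"
    proof (rule mult_left_mono)
      \<comment> \<open>The hypothesis is in terms of the sum of absolute values, but only the sum
        of squares is differentiable; Cauchy-Schwarz compares the two at the price of
        \<open>card I\<close>.\<close>
      have "(N t)\<^sup>2 \<le> (\<Sum>j\<in>I. (\<bar>s j (c t)\<bar>)\<^sup>2) * (\<Sum>j\<in>I. 1\<^sup>2)"
        unfolding N_def using Cauchy_Schwarz_ineq_sum[of "\<lambda>j. \<bar>s j (c t)\<bar>" "\<lambda>j. 1" I] by simp
      then show "N t * N t \<le> card I * q t" by (simp add: q_def power2_eq_square mult.commute)
    qed simp
    finally show "q' t \<le> 2 * ?D * card I * q t" by (simp add: mult_ac)
  next
    show "0 \<le> q 1" by (simp add: q_def sum_nonneg)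
    show "q 0 = 0" by (simp add: q_def c_def z)
  qed
  then have "(s i (c 1))\<^sup>2 = 0" using I i by (simp add: q_def sum_nonneg_eq_0_iff)
  then show ?thesis by (simp add: c_def v_def)
qed

lemma inner_form_uniform:
  fixes g :: "'e::euclidean_space \<Rightarrow> 'e \<Rightarrow> 'e \<Rightarrow> real"
  assumes K: "compact K" and g: "\<And>y. y \<in> K \<Longrightarrow> inner_form (g y)"
    and c: "\<And>u v. continuous_on K (\<lambda>y. g y u v)"
  shows "\<exists>\<kappa>>0. \<forall>x\<in>K. \<forall>u. (norm u)\<^sup>2 \<le> \<kappa> * g x u u"
proof (cases "K = {}")
  case False
  let ?S = "K \<times> sphere (0::'e) 1"
  \<comment> \<open>The minimum is taken over K times the unit sphere. Continuity of g is known only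
    for fixed arguments, so joint continuity is obtained from the expansion in components.\<close>
  let ?f = "\<lambda>p. \<Sum>a\<in>Basis. \<Sum>b\<in>Basis. ((snd p \<bullet> a) * (snd p \<bullet> b)) *\<^sub>R g (fst p) a b"
  obtain b :: 'e where "b \<in> Basis" using nonempty_Basis by blast
  then have ne: "?S \<noteq> {}" using False by (auto intro!: exI[of _ b])
  have "continuous_on ?S (\<lambda>p. g (fst p) a b)" for a b
    by (rule continuous_on_compose2[OF c continuous_on_fst[OF continuous_on_id]]) auto
  then have "continuous_on ?S ?f"
    by (intro continuous_intros)
  then obtain p where p: "p \<in> ?S" "\<And>q. q \<in> ?S \<Longrightarrow> ?f p \<le> ?f q"
    using continuous_attains_inf[OF compact_Times[OF K compact_sphere] ne] by blast
  have fe: "?f q = g (fst q) (snd q) (snd q)" if "q \<in> ?S" for q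
    using bilinear_expand[of "g (fst q)" "snd q" "snd q"] g[of "fst q"] that
    by (auto simp: inner_form_def)
  have pos: "?f p > 0"
  proof -
    have "fst p \<in> K" "snd p \<noteq> 0" using p(1) by auto
    with fe[OF p(1)] g[of "fst p"] show ?thesis unfolding inner_form_def by auto
  qed
  have "(norm u)\<^sup>2 \<le> (1 / ?f p) * g x u u" if x: "x \<in> K" for x u
  proof (cases "u = 0")
    case True
    then show ?thesis using g[OF x] by (simp add: inner_form_def bilinear_lzero)
  next
    case False
    define n where "n = (1 / norm u) *\<^sub>R u"
    have "(x, n) \<in> ?S" using x False by (simp add: n_def)
    from p(2)[OF this] fe[OF this] have "?f p \<le> g x n n" by simp
    also have "g x n n = g x u u / (norm u)\<^sup>2"
      using g[OF x] by (simp add: n_def inner_form_def bilinear_lmul bilinear_rmul power2_eq_square)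
    finally show ?thesis using pos False by (simp add: field_simps)
  qed
  with pos show ?thesis by (intro exI[of _ "1 / ?f p"]) auto
qed (auto intro!: exI[of _ 1])

lemma pd_const [simp]: "pd (\<lambda>y. c) x v = 0"
  using pd_eq[OF has_derivative_const] by metis

lemma pd_add:
  "f differentiable (at x) \<Longrightarrow> g differentiable (at x) \<Longrightarrow> pd (\<lambda>y. f y + g y) x v = pd f x v + pd g x v"
  using pd_eq[OF has_derivative_add[OF pd_has_derivative pd_has_derivative]] by metis

lemma pd_diff:
  "f differentiable (at x) \<Longrightarrow> g differentiable (at x) \<Longrightarrow> pd (\<lambda>y. f y - g y) x v = pd f x v - pd g x v"
  using pd_eq[OF has_derivative_diff[OF pd_has_derivative pd_has_derivative]] by metis

lemma pd_mult:
  fixes f g :: "'a::real_normed_vector \<Rightarrow> real"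
  assumes "f differentiable (at x)" "g differentiable (at x)"
  shows "pd (\<lambda>y. f y * g y) x v = pd f x v * g x + f x * pd g x v"
  using pd_eq[OF has_derivative_mult[OF pd_has_derivative[OF assms(1)] pd_has_derivative[OF assms(2)]]]
  by simp

lemma pd_sum:
  assumes "\<And>i. i \<in> I \<Longrightarrow> f i differentiable (at x)"
  shows "pd (\<lambda>y. \<Sum>i\<in>I. f i y) x v = (\<Sum>i\<in>I. pd (f i) x v)"
proof -
  have "((\<lambda>y. \<Sum>i\<in>I. f i y) has_derivative (\<lambda>v. \<Sum>i\<in>I. pd (f i) x v)) (at x)"
    by (intro has_derivative_sum pd_has_derivative assms)
  from pd_eq[OF this] show ?thesis by simp
qed

section \<open>Covariant derivatives in a chart\<close>

definition smooth_tensor :: "'e::euclidean_space set \<Rightarrow> ('e \<Rightarrow> 'e \<Rightarrow> 'e \<Rightarrow> real) \<Rightarrow> bool" where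
  "smooth_tensor W \<psi> \<longleftrightarrow> (\<forall>y\<in>W. bilinear (\<psi> y)) \<and> (\<forall>u v. smooth_on W (\<lambda>y. \<psi> y u v))"

definition smooth_endo :: "'e::euclidean_space set \<Rightarrow> ('e \<Rightarrow> 'e \<Rightarrow> 'e) \<Rightarrow> bool" where
  "smooth_endo W J \<longleftrightarrow> (\<forall>y\<in>W. linear (J y)) \<and> (\<forall>u. smooth_on W (\<lambda>y. J y u))"

text \<open>The covariant derivative with the connection map as a parameter, so that the
  computations can be carried out on the domain of a local frame without reference to an
  atlas.\<close>

definition nab :: "('e::euclidean_space \<Rightarrow> 'e \<Rightarrow> 'e \<Rightarrow> 'e) \<Rightarrow> ('e \<Rightarrow> 'e \<Rightarrow> 'e \<Rightarrow> real)
    \<Rightarrow> 'e \<Rightarrow> 'e \<Rightarrow> 'e \<Rightarrow> 'e \<Rightarrow> real" where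
  "nab \<Gamma> \<psi> y Y u v = pd (\<lambda>z. \<psi> z u v) y Y - \<psi> y (\<Gamma> y Y u) v - \<psi> y u (\<Gamma> y Y v)"

definition nabE :: "('e::euclidean_space \<Rightarrow> 'e \<Rightarrow> 'e \<Rightarrow> 'e) \<Rightarrow> ('e \<Rightarrow> 'e \<Rightarrow> 'e)
    \<Rightarrow> 'e \<Rightarrow> 'e \<Rightarrow> 'e \<Rightarrow> 'e" where
  "nabE \<Gamma> J y Y u = pd (\<lambda>z. J z u) y Y + \<Gamma> y Y (J y u) - J y (\<Gamma> y Y u)"

lemma smooth_tensorD:
  assumes "smooth_tensor W \<psi>"
  shows "y \<in> W \<Longrightarrow> bilinear (\<psi> y)" "smooth_on W (\<lambda>y. \<psi> y u v)"
    "y \<in> W \<Longrightarrow> (\<lambda>y. \<psi> y u v) differentiable (at y)"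
  using assms smooth_on_differentiable unfolding smooth_tensor_def by blast+

lemma smooth_endoD:
  assumes "smooth_endo W J"
  shows "y \<in> W \<Longrightarrow> linear (J y)" "smooth_on W (\<lambda>y. J y u)" "y \<in> W \<Longrightarrow> (\<lambda>y. J y u) differentiable (at y)"
  using assms smooth_on_differentiable unfolding smooth_endo_def by blast+

lemma nab_cong:
  assumes "open W" "y \<in> W" "\<And>z u v. z \<in> W \<Longrightarrow> \<psi> z u v = \<psi>' z u v"
  shows "nab \<Gamma> \<psi> y Y u v = nab \<Gamma> \<psi>' y Y u v"
  unfolding nab_def using pd_cong[OF assms(1,2), of "\<lambda>z. \<psi> z u v" "\<lambda>z. \<psi>' z u v"] assms by simp

lemma nab_add:
  assumes "smooth_tensor W A" "smooth_tensor W B" "y \<in> W"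
  shows "nab \<Gamma> (\<lambda>z u v. A z u v + B z u v) y Y u v = nab \<Gamma> A y Y u v + nab \<Gamma> B y Y u v"
  unfolding nab_def using smooth_tensorD(3)[OF assms(1,3)] smooth_tensorD(3)[OF assms(2,3)]
  by (simp add: pd_add)

lemma nab_scale:
  assumes "smooth_tensor W A" "smooth_on W a" "y \<in> W"
  shows "nab \<Gamma> (\<lambda>z u v. a z * A z u v) y Y u v = pd a y Y * A y u v + a y * nab \<Gamma> A y Y u v"
  unfolding nab_def using smooth_tensorD(3)[OF assms(1,3)] smooth_on_differentiable[OF assms(2,3)]
  by (simp add: pd_mult algebra_simps)

lemma smooth_tensor_add:
  assumes "open W" "smooth_tensor W A" "smooth_tensor W B"
  shows "smooth_tensor W (\<lambda>z u v. A z u v + B z u v)"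
  unfolding smooth_tensor_def
proof (intro conjI ballI allI)
  fix y assume "y \<in> W"
  then have "bilinear (A y)" "bilinear (B y)" using assms smooth_tensorD by blast+
  then show "bilinear (\<lambda>u v. A y u v + B y u v)"
    by (auto simp: bilinear_def intro!: linear_compose_add)
qed (intro smooth_on_add assms smooth_tensorD)

lemma smooth_tensor_scale:
  assumes "open W" "smooth_tensor W A" "smooth_on W a"
  shows "smooth_tensor W (\<lambda>z u v. a z * A z u v)"
  unfolding smooth_tensor_def
proof (intro conjI ballI allI)
  fix y assume "y \<in> W"
  then have "bilinear (A y)" using assms smooth_tensorD by blast
  then show "bilinear (\<lambda>u v. a y * A y u v)"
    unfolding bilinear_def
    using linear_compose_scale_right[of "A y u" "a y" for u, unfolded real_scaleR_def]
      linear_compose_scale_right[of "\<lambda>u. A y u v" "a y" for v, unfolded real_scaleR_def]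
    by simp
qed (intro smooth_on_mult assms smooth_tensorD)

lemma smooth_tensor_comp:
  assumes W: "open W" and B: "smooth_tensor W B" and J: "smooth_endo W J" and K: "smooth_endo W K"
  shows "smooth_tensor W (\<lambda>z u v. B z (J z u) (K z v))"
  unfolding smooth_tensor_def
proof (intro conjI ballI allI)
  fix y assume y: "y \<in> W"
  have "linear (\<lambda>u. B y (J y u) v)" "linear (\<lambda>v. B y u (K y v))" for u v
    using smooth_tensorD(1)[OF B y] linear_compose[OF smooth_endoD(1)[OF J y], of "\<lambda>u. B y u v"]
      linear_compose[OF smooth_endoD(1)[OF K y], of "B y u"]
    by (auto simp: bilinear_def o_def)
  then show "bilinear (\<lambda>u v. B y (J y u) (K y v))" by (auto simp: bilinear_def)
qed (rule smooth_on_bilinear_field[OF W smooth_tensorD(1)[OF B] smooth_tensorD(2)[OF B]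
      smooth_endoD(2)[OF J] smooth_endoD(2)[OF K]], assumption)

lemma smooth_endo_id: "open W \<Longrightarrow> smooth_endo W (\<lambda>z u. u)"
  by (simp add: smooth_endo_def smooth_on_const linear_id[unfolded id_def])

lemma nabE_id [simp]: "nabE \<Gamma> (\<lambda>z u. u) y Y u = 0"
  by (simp add: nabE_def)

text \<open>Leibniz rule: the connection terms of the endomorphisms are added and subtracted, which
  turns their partial derivatives into covariant ones.\<close>

lemma nab_comp:
  assumes W: "open W" and B: "smooth_tensor W B" and J: "smooth_endo W J" and K: "smooth_endo W K"
    and y: "y \<in> W"
  shows "nab \<Gamma> (\<lambda>z u v. B z (J z u) (K z v)) y Y u v =
    nab \<Gamma> B y Y (J y u) (K y v) + B y (nabE \<Gamma> J y Y u) (K y v) + B y (J y u) (nabE \<Gamma> K y Y v)"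
proof -
  note b = smooth_tensorD(1)[OF B y]
  have "pd (\<lambda>z. B z (J z u) (K z v)) y Y = pd (\<lambda>z. B z (J y u) (K y v)) y Y
      + B y (pd (\<lambda>z. J z u) y Y) (K y v) + B y (J y u) (pd (\<lambda>z. K z v) y Y)"
    using pd_eq[OF has_derivative_bilinear_field[OF W y smooth_tensorD(1)[OF B] smooth_tensorD(3)[OF B y]
       pd_has_derivative[OF smooth_endoD(3)[OF J y]] pd_has_derivative[OF smooth_endoD(3)[OF K y]]]]
    by simp
  then show ?thesis
    unfolding nab_def nabE_def
    by (simp add: bilinear_ladd[OF b] bilinear_radd[OF b] bilinear_lsub[OF b] bilinear_rsub[OF b])
qed

section \<open>A metric connection preserving Q over the domain of a local frame\<close>

locale local_qk =
  fixes W :: "'e::euclidean_space set" and g :: "'e \<Rightarrow> 'e \<Rightarrow> 'e \<Rightarrow> real"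
    and J1 J2 J3 :: "'e \<Rightarrow> 'e \<Rightarrow> 'e" and \<Gamma> :: "'e \<Rightarrow> 'e \<Rightarrow> 'e \<Rightarrow> 'e"
  assumes W: "open W" and D: "DIM('e) > 4"
    and q: "y \<in> W \<Longrightarrow> quat_inner (g y) (J1 y) (J2 y) (J3 y)"
    and gs: "smooth_on W (\<lambda>y. g y u v)"
    and Js: "smooth_on W (\<lambda>y. J1 y u)" "smooth_on W (\<lambda>y. J2 y u)" "smooth_on W (\<lambda>y. J3 y u)"
    and \<Gamma>b: "y \<in> W \<Longrightarrow> bilinear (\<Gamma> y)" and \<Gamma>s: "smooth_on W (\<lambda>y. \<Gamma> y u v)"
    and gm: "y \<in> W \<Longrightarrow> pd (\<lambda>z. g z u v) y Y = g y (\<Gamma> y Y u) v + g y u (\<Gamma> y Y v)"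
    and par: "y \<in> W \<Longrightarrow> J \<in> {J1, J2, J3} \<Longrightarrow>
       \<exists>c1 c2 c3. \<forall>u. nabE \<Gamma> J y Y u = c1 *\<^sub>R J1 y u + c2 *\<^sub>R J2 y u + c3 *\<^sub>R J3 y u"
begin

lemma g_tensor: "smooth_tensor W g"
  unfolding smooth_tensor_def using gs q quat_inner.bil by blast

lemma J_endo: "smooth_endo W J1" "smooth_endo W J2" "smooth_endo W J3"
  unfolding smooth_endo_def using Js q quat_inner.lin by blast+

lemma nab_g: "y \<in> W \<Longrightarrow> nab \<Gamma> g y Y u v = 0"
  by (simp add: nab_def gm)

lemma cyc: "local_qk W g J2 J3 J1 \<Gamma>"
proof (rule local_qk.intro)
  fix y Y J assume y: "y \<in> W" and J: "J \<in> {J2, J3, J1}"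
  then obtain c1 c2 c3 where "\<forall>u. nabE \<Gamma> J y Y u = c1 *\<^sub>R J1 y u + c2 *\<^sub>R J2 y u + c3 *\<^sub>R J3 y u"
    using par[of y J Y] by auto
  then have "\<forall>u. nabE \<Gamma> J y Y u = c2 *\<^sub>R J2 y u + c3 *\<^sub>R J3 y u + c1 *\<^sub>R J1 y u"
    by (simp add: add_ac)
  then show "\<exists>c1 c2 c3. \<forall>u. nabE \<Gamma> J y Y u = c1 *\<^sub>R J2 y u + c2 *\<^sub>R J3 y u + c3 *\<^sub>R J1 y u"
    by blast
next
  show "quat_inner (g y) (J2 y) (J3 y) (J1 y)" if "y \<in> W" for y by (rule quat_inner.cyc[OF q[OF that]])
  show "smooth_on W (\<lambda>y. \<Gamma> y u v)" for u v by (rule \<Gamma>s)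
  show "smooth_on W (\<lambda>y. g y u v)" for u v by (rule gs)
  show "smooth_on W (\<lambda>y. J1 y u)" "smooth_on W (\<lambda>y. J2 y u)" "smooth_on W (\<lambda>y. J3 y u)" for u
    by (rule Js)+
  show "bilinear (\<Gamma> y)" if "y \<in> W" for y by (rule \<Gamma>b[OF that])
  show "pd (\<lambda>z. g z u v) y Y = g y (\<Gamma> y Y u) v + g y u (\<Gamma> y Y v)" if "y \<in> W" for y u v Y
    by (rule gm[OF that])
qed (rule W D)+

lemma nab_omega:
  assumes y: "y \<in> W"
  shows "\<exists>c1 c2 c3. \<forall>u v. nab \<Gamma> (\<lambda>z u v. g z (J1 z u) v) y Y u v
     = c1 * g y (J1 y u) v + c2 * g y (J2 y u) v + c3 * g y (J3 y u) v"
proof -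
  interpret Q: quat_inner "g y" "J1 y" "J2 y" "J3 y" by (rule q[OF y])
  obtain c1 c2 c3 where c: "\<And>u. nabE \<Gamma> J1 y Y u = c1 *\<^sub>R J1 y u + c2 *\<^sub>R J2 y u + c3 *\<^sub>R J3 y u"
    using par[OF y, of J1 Y] by auto
  have "nab \<Gamma> (\<lambda>z u v. g z (J1 z u) v) y Y u v = g y (nabE \<Gamma> J1 y Y u) v" for u v
    using nab_comp[OF W g_tensor J_endo(1) smooth_endo_id[OF W] y]
    by (simp add: nab_g[OF y])
  then have "nab \<Gamma> (\<lambda>z u v. g z (J1 z u) v) y Y u v
     = c1 * g y (J1 y u) v + c2 * g y (J2 y u) v + c3 * g y (J3 y u) v" for u v
    unfolding c by (simp add: Q.h_lin)
  then show ?thesis by blast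
qed

text \<open>Differentiating \<phi>(J1 u, J1 v) = \<phi>(u, v) produces terms with the covariant
  derivative of J1, a combination of the three structures. Its J1 component vanishes because J1
  stays orthogonal; the J2 and J3 components cancel because \<phi>(J2 u, J1 v) = -\<phi>(J1 u, J2
  v), and likewise for J3.\<close>

lemma nab_inv_J1:
  assumes y: "y \<in> W" and \<phi>: "smooth_tensor W \<phi>"
    and inv: "\<And>z. z \<in> W \<Longrightarrow> quat_inner.inv_form (J1 z) (J2 z) (J3 z) (\<phi> z)"
  shows "nab \<Gamma> \<phi> y Y (J1 y u) (J1 y v) = nab \<Gamma> \<phi> y Y u v"
proof -
  interpret Q: quat_inner "g y" "J1 y" "J2 y" "J3 y" by (rule q[OF y])
  note b = smooth_tensorD(1)[OF \<phi> y]
  obtain c1 c2 c3 where c: "\<And>u. nabE \<Gamma> J1 y Y u = c1 *\<^sub>R J1 y u + c2 *\<^sub>R J2 y u + c3 *\<^sub>R J3 y u"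
    using par[OF y, of J1 Y] by auto
  obtain w :: 'e where w: "w \<noteq> 0" using D by (metis Q.perp_vector)
  \<comment> \<open>Differentiating g(J1 w, J1 w) = g(w, w) gives twice c1 g(w, w), the other
    components being orthogonal to J1 w.\<close>
  have "nab \<Gamma> (\<lambda>z u v. g z (J1 z u) (J1 z v)) y Y w w = nab \<Gamma> g y Y w w"
    by (rule nab_cong[OF W y]) (use quat_inner.hJ(1)[OF q] quat_inner.JJ(1)[OF q]
       quat_inner.h_minus[OF q] in simp)
  then have "g y (nabE \<Gamma> J1 y Y w) (J1 y w) + g y (J1 y w) (nabE \<Gamma> J1 y Y w) = 0"
    unfolding nab_comp[OF W g_tensor J_endo(1) J_endo(1) y] by (simp add: nab_g[OF y])
  then have "c1 * g y w w = 0" unfolding c by (simp add: Q.h_lin Q.hJ)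
  then have c1: "c1 = 0" using Q.pos[OF w] by simp
  have inv_y: "\<phi> y (J1 y u) (J1 y v) = \<phi> y u v" "\<phi> y (J2 y u) (J2 y v) = \<phi> y u v"
    "\<phi> y (J3 y u) (J3 y v) = \<phi> y u v" for u v
    using inv[OF y] unfolding Q.inv_form_def by blast+
  note neg = bilinear_lneg[OF b] bilinear_rneg[OF b]
  have M: "\<phi> y (J1 y u) v = - \<phi> y u (J1 y v)" "\<phi> y (J2 y u) v = - \<phi> y u (J2 y v)"
    "\<phi> y (J3 y u) v = - \<phi> y u (J3 y v)" for u v
    using inv_y(1)[of u "J1 y v"] inv_y(2)[of u "J2 y v"] inv_y(3)[of u "J3 y v"] by (simp_all add: neg)
  have "nab \<Gamma> (\<lambda>z u v. \<phi> z (J1 z u) (J1 z v)) y Y u v = nab \<Gamma> \<phi> y Y u v"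
    by (rule nab_cong[OF W y]) (use inv quat_inner.inv_form_def[OF q] in blast)
  then show ?thesis
    unfolding nab_comp[OF W \<phi> J_endo(1) J_endo(1) y] c c1
    by (simp add: bilinear_ladd[OF b] bilinear_radd[OF b] bilinear_lmul[OF b] bilinear_rmul[OF b] M neg)
qed

definition compatW :: "('e \<Rightarrow> 'e \<Rightarrow> 'e \<Rightarrow> real) \<Rightarrow> bool" where
  "compatW \<psi> \<longleftrightarrow> smooth_tensor W \<psi> \<and>
     (\<forall>y\<in>W. quat_inner.compat_form (g y) (J1 y) (J2 y) (J3 y) (\<psi> y))"

text \<open>The connection preserves each of the two bundles. The coefficients in
  \<open>compat_form\<close> are chosen point by point, so they are first replaced by the smooth
  quotients from \<open>compat_coeff\<close> at a fixed vector w; the remainder is then a smooth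
  invariant form to which \<open>nab_inv_J1\<close> applies.\<close>

lemma nab_compat:
  assumes c: "compatW \<psi>" and y: "y \<in> W"
  shows "quat_inner.compat_form (g y) (J1 y) (J2 y) (J3 y) (nab \<Gamma> \<psi> y Y)"
proof -
  interpret Q: quat_inner "g y" "J1 y" "J2 y" "J3 y" by (rule q[OF y])
  interpret C2: local_qk W g J2 J3 J1 \<Gamma> by (rule cyc)
  interpret C3: local_qk W g J3 J1 J2 \<Gamma> by (rule C2.cyc)
  have \<psi>: "smooth_tensor W \<psi>" using c by (simp add: compatW_def)
  obtain w :: 'e where w: "w \<noteq> 0" using D by (metis Q.perp_vector)
  define a1 where "a1 z = (\<psi> z w (J1 z w) + \<psi> z (J2 z w) (J3 z w)) / (2 * g z w w)" for z
  define a2 where "a2 z = (\<psi> z w (J2 z w) + \<psi> z (J3 z w) (J1 z w)) / (2 * g z w w)" for z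
  define a3 where "a3 z = (\<psi> z w (J3 z w) + \<psi> z (J1 z w) (J2 z w)) / (2 * g z w w)" for z
  have gw: "g z w w \<noteq> 0" if "z \<in> W" for z using quat_inner.pos[OF q[OF that] w] by simp
  have as: "smooth_on W a1" "smooth_on W a2" "smooth_on W a3"
    unfolding a1_def a2_def a3_def
    by (intro smooth_on_divide smooth_on_add smooth_on_mult W gs smooth_on_const
       smooth_on_bilinear_field[OF W smooth_tensorD(1)[OF \<psi>] smooth_tensorD(2)[OF \<psi>]] Js;
       simp add: gw)+
  let ?o = "\<lambda>J z u v. g z (J z u) v"
  have ot: "smooth_tensor W (?o J1)" "smooth_tensor W (?o J2)" "smooth_tensor W (?o J3)"
    using smooth_tensor_comp[OF W g_tensor _ smooth_endo_id[OF W]] J_endo by blast+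
  \<comment> \<open>Written with sums of negated multiples instead of differences, so that the rules
    for sums and multiples cover smoothness and derivative.\<close>
  define \<phi> where "\<phi> z u v = \<psi> z u v + ((- a1 z) * ?o J1 z u v + ((- a2 z) * ?o J2 z u v + (- a3 z) * ?o J3 z u v))"
    for z u v
  have ast: "smooth_tensor W (\<lambda>z u v. (- a1 z) * ?o J1 z u v)"
    "smooth_tensor W (\<lambda>z u v. (- a2 z) * ?o J2 z u v)"
    "smooth_tensor W (\<lambda>z u v. (- a3 z) * ?o J3 z u v)"
    by (intro smooth_tensor_scale W ot smooth_on_uminus as)+
  have \<phi>t: "smooth_tensor W \<phi>"
    unfolding \<phi>_def by (intro smooth_tensor_add W \<psi> ast)
  have inv: "quat_inner.inv_form (J1 z) (J2 z) (J3 z) (\<phi> z)" if z: "z \<in> W" for z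
  proof -
    interpret Z: quat_inner "g z" "J1 z" "J2 z" "J3 z" by (rule q[OF z])
    obtain b1 b2 b3 \<eta> where i: "Z.inv_form \<eta>"
      and d: "\<And>u v. \<psi> z u v = b1 * g z (J1 z u) v + b2 * g z (J2 z u) v + b3 * g z (J3 z u) v + \<eta> u v"
    proof -
      have "Z.compat_form (\<psi> z)" using c z unfolding compatW_def by blast
      then show ?thesis using that unfolding Z.compat_form_def by blast
    qed
    have neg: "\<eta> u (- v) = - \<eta> u v" for u v
      by (rule Z.compat_neg[OF i smooth_tensorD(1)[OF \<psi> z]], rule d)
    have cc: "\<psi> z w (J1 z w) + \<psi> z (J2 z w) (J3 z w) = 2 * b1 * g z w w"
      "\<psi> z w (J2 z w) + \<psi> z (J3 z w) (J1 z w) = 2 * b2 * g z w w"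
      "\<psi> z w (J3 z w) + \<psi> z (J1 z w) (J2 z w) = 2 * b3 * g z w w"
      by (rule Z.compat_coeff[OF i], rule d, rule neg)+
    have "a1 z = b1" "a2 z = b2" "a3 z = b3"
      using cc gw[OF z] unfolding a1_def a2_def a3_def by simp_all
    then have "\<phi> z = \<eta>" unfolding \<phi>_def by (simp add: d fun_eq_iff)
    then show ?thesis using i by simp
  qed
  have inv2: "quat_inner.inv_form (J2 z) (J3 z) (J1 z) (\<phi> z)" if z: "z \<in> W" for z
    using inv[OF z] quat_inner.inv_form_cyc[OF q[OF z]] by simp
  have inv3: "quat_inner.inv_form (J3 z) (J1 z) (J2 z) (\<phi> z)" if z: "z \<in> W" for z
    using inv2[OF z] quat_inner.inv_form_cyc[OF C2.q[OF z]] by simp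
  have ninv: "Q.inv_form (nab \<Gamma> \<phi> y Y)"
    unfolding Q.inv_form_def
    using nab_inv_J1[OF y \<phi>t inv] C2.nab_inv_J1[OF y \<phi>t inv2] C3.nab_inv_J1[OF y \<phi>t inv3] by blast
  obtain c11 c12 c13 where o1: "\<And>u v. nab \<Gamma> (?o J1) y Y u v
      = c11 * g y (J1 y u) v + c12 * g y (J2 y u) v + c13 * g y (J3 y u) v" using nab_omega[OF y] by blast
  obtain c22 c23 c21 where o2: "\<And>u v. nab \<Gamma> (?o J2) y Y u v
      = c22 * g y (J2 y u) v + c23 * g y (J3 y u) v + c21 * g y (J1 y u) v" using C2.nab_omega[OF y] by blast
  obtain c33 c31 c32 where o3: "\<And>u v. nab \<Gamma> (?o J3) y Y u v
      = c33 * g y (J3 y u) v + c31 * g y (J1 y u) v + c32 * g y (J2 y u) v" using C3.nab_omega[OF y] by blast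
  have n\<phi>: "nab \<Gamma> \<phi> y Y u v = nab \<Gamma> \<psi> y Y u v
     + ((pd (\<lambda>z. - a1 z) y Y * ?o J1 y u v + - a1 y * nab \<Gamma> (?o J1) y Y u v)
     + ((pd (\<lambda>z. - a2 z) y Y * ?o J2 y u v + - a2 y * nab \<Gamma> (?o J2) y Y u v)
     + (pd (\<lambda>z. - a3 z) y Y * ?o J3 y u v + - a3 y * nab \<Gamma> (?o J3) y Y u v)))" for u v
    unfolding \<phi>_def[abs_def]
    using nab_add[OF \<psi> smooth_tensor_add[OF W ast(1) smooth_tensor_add[OF W ast(2) ast(3)]] y, of \<Gamma> Y u v]
      nab_add[OF ast(1) smooth_tensor_add[OF W ast(2) ast(3)] y, of \<Gamma> Y u v]
      nab_add[OF ast(2) ast(3) y, of \<Gamma> Y u v]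
      nab_scale[OF ot(1) smooth_on_uminus[OF W as(1)] y, of \<Gamma> Y u v]
      nab_scale[OF ot(2) smooth_on_uminus[OF W as(2)] y, of \<Gamma> Y u v]
      nab_scale[OF ot(3) smooth_on_uminus[OF W as(3)] y, of \<Gamma> Y u v]
    by linarith
  define p1 where "p1 = pd (\<lambda>z. - a1 z) y Y"
  define p2 where "p2 = pd (\<lambda>z. - a2 z) y Y"
  define p3 where "p3 = pd (\<lambda>z. - a3 z) y Y"
  have "nab \<Gamma> \<psi> y Y u v = (a1 y * c11 + a2 y * c21 + a3 y * c31 - p1) * g y (J1 y u) v
     + (a1 y * c12 + a2 y * c22 + a3 y * c32 - p2) * g y (J2 y u) v
     + (a1 y * c13 + a2 y * c23 + a3 y * c33 - p3) * g y (J3 y u) v + nab \<Gamma> \<phi> y Y u v" for u v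
    unfolding n\<phi> o1 o2 o3 p1_def[symmetric] p2_def[symmetric] p3_def[symmetric] by (simp add: algebra_simps)
  with ninv show ?thesis unfolding Q.compat_form_def by blast
qed

definition T :: "'e \<Rightarrow> ('e \<Rightarrow> real) \<Rightarrow> 'e \<Rightarrow> 'e \<Rightarrow> 'e \<Rightarrow> real" where
  "T y = quat_inner.T_form (g y) (J1 y) (J2 y) (J3 y)"

text \<open>Only the shape of the equation is recorded: at each point some alternating 3-form and
  some linear \<open>th y\<close>. Smoothness of \<open>th\<close> is derived in
  \<open>th_smooth\<close>.\<close>

definition ckW :: "('e \<Rightarrow> 'e \<Rightarrow> 'e \<Rightarrow> real) \<Rightarrow> ('e \<Rightarrow> 'e \<Rightarrow> real) \<Rightarrow> bool" where
  "ckW \<psi> th \<longleftrightarrow> compatW \<psi> \<and> (\<forall>y\<in>W. linear (th y)) \<and>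
     (\<forall>y\<in>W. \<exists>al. (\<forall>Y u v. al Y u v = - al u Y v) \<and> (\<forall>Y u v. al Y u v = - al Y v u) \<and>
        (\<forall>Y u v. nab \<Gamma> \<psi> y Y u v = al Y u v + g y Y u * th y v - g y Y v * th y u))"

lemma nab_neg:
  assumes \<psi>: "smooth_tensor W \<psi>" and y: "y \<in> W"
  shows "nab \<Gamma> \<psi> y Y (- u) v = - nab \<Gamma> \<psi> y Y u v"
proof -
  have l: "linear (\<lambda>u. pd (\<lambda>z. \<psi> z u v) y Y)"
    by (rule pd_linear_field[OF W y]) (use smooth_tensorD[OF \<psi>] y in \<open>auto simp: bilinear_def\<close>)
  note b = smooth_tensorD(1)[OF \<psi> y]
  show ?thesis unfolding nab_def
    using linear_neg[OF l, of u] bilinear_rneg[OF \<Gamma>b[OF y], of Y u] bilinear_lneg[OF b] by simp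
qed

lemma nab_T:
  assumes ck: "ckW \<psi> th" and y: "y \<in> W"
  shows "nab \<Gamma> \<psi> y Y u v = T y (th y) Y u v"
proof -
  interpret Q: quat_inner "g y" "J1 y" "J2 y" "J3 y" by (rule q[OF y])
  have c: "compatW \<psi>" and \<psi>: "smooth_tensor W \<psi>" and l: "linear (th y)"
    using ck y by (auto simp: ckW_def compatW_def)
  obtain al where al: "\<And>Y u v. al Y u v = - al u Y v" "\<And>Y u v. al Y u v = - al Y v u"
    "\<And>Y u v. nab \<Gamma> \<psi> y Y u v = al Y u v + g y Y u * th y v - g y Y v * th y u"
    using ck y unfolding ckW_def by blast
  have n: "al Y (- u) v = - al Y u v" for Y u v
    using al(3)[of Y "- u" v] al(3)[of Y u v] nab_neg[OF \<psi> y, of Y u v] linear_neg[OF l, of u]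
    by (simp add: algebra_simps)
  show ?thesis unfolding T_def
    by (rule Q.T_form_unique[OF D al(1,2) n linear_neg[OF l] al(3) nab_compat[OF c y]])
qed

text \<open>In the direction J1 w, orthogonal to w and of the same length,
  \<open>T_form_diag\<close> leaves only the value at w. This writes \<open>th\<close> as a quotient
  of smooth functions.\<close>

lemma th_formula:
  assumes ck: "ckW \<psi> th" and y: "y \<in> W" and w: "w \<noteq> 0"
  shows "th y w = nab \<Gamma> \<psi> y (J1 y w) (J1 y w) w / g y w w"
proof -
  interpret Q: quat_inner "g y" "J1 y" "J2 y" "J3 y" by (rule q[OF y])
  have l: "linear (th y)" using ck y by (auto simp: ckW_def)
  have "nab \<Gamma> \<psi> y (J1 y w) (J1 y w) w = g y w w * th y w"
    unfolding nab_T[OF ck y] T_def Q.T_form_diag[of "th y", OF linear_neg[OF l]] by (simp add: Q.hJ)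
  then show ?thesis using Q.pos[OF w] by simp
qed

lemma nab_comp_smooth:
  assumes \<psi>: "smooth_tensor W \<psi>"
  shows "smooth_on W (\<lambda>y. nab \<Gamma> \<psi> y Y u v)"
proof -
  note s = smooth_on_bilinear_field[OF W smooth_tensorD(1)[OF \<psi>] smooth_tensorD(2)[OF \<psi>]]
  have "smooth_on W (\<lambda>y. \<psi> y (\<Gamma> y Y u) v)" "smooth_on W (\<lambda>y. \<psi> y u (\<Gamma> y Y v))"
    by (rule s[OF _ \<Gamma>s smooth_on_const[OF W]] s[OF _ smooth_on_const[OF W] \<Gamma>s], assumption)+
  then show ?thesis
    unfolding nab_def by (intro smooth_on_diff W smooth_on_pd smooth_tensorD(2)[OF \<psi>])
qed

lemma nab_bilinear:
  assumes \<psi>: "smooth_tensor W \<psi>" and y: "y \<in> W"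
  shows "bilinear (\<lambda>Y u. nab \<Gamma> \<psi> y Y u v)"
proof -
  have 1: "linear (\<lambda>u. pd (\<lambda>z. \<psi> z u v) y Y)" for Y
    by (rule pd_linear_field[OF W y]) (use smooth_tensorD[OF \<psi>] y in \<open>auto simp: bilinear_def\<close>)
  have 2: "linear (\<lambda>Y. pd (\<lambda>z. \<psi> z u v) y Y)" for u
    by (rule pd_linear[OF smooth_tensorD(3)[OF \<psi> y]])
  note b = smooth_tensorD(1)[OF \<psi> y] and g = \<Gamma>b[OF y]
  show ?thesis
    unfolding nab_def bilinear_def linear_iff
    by (auto simp: linear_add[OF 1] linear_add[OF 2] linear_scale[OF 1] linear_scale[OF 2]
       bilinear_ladd[OF b] bilinear_radd[OF b] bilinear_lmul[OF b] bilinear_rmul[OF b]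
       bilinear_ladd[OF g] bilinear_radd[OF g] bilinear_lmul[OF g] bilinear_rmul[OF g] algebra_simps)
qed

lemma th_smooth:
  assumes ck: "ckW \<psi> th"
  shows "smooth_on W (\<lambda>y. th y w)"
proof (cases "w = 0")
  case True
  have "linear (th y)" if "y \<in> W" for y using ck that by (auto simp: ckW_def)
  then have "th y w = 0" if "y \<in> W" for y using linear_0 True that by metis
  then show ?thesis using smooth_on_cong[OF smooth_on_const[OF W, of 0] W] by metis
next
  case False
  have \<psi>: "smooth_tensor W \<psi>" using ck by (auto simp: ckW_def compatW_def)
  have "smooth_on W (\<lambda>y. nab \<Gamma> \<psi> y (J1 y w) (J1 y w) w / g y w w)"
  proof (intro smooth_on_divide W gs)
    show "smooth_on W (\<lambda>y. nab \<Gamma> \<psi> y (J1 y w) (J1 y w) w)"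
    proof (rule smooth_on_bilinear_field[where B = "\<lambda>y Y u. nab \<Gamma> \<psi> y Y u w", OF W])
      show "bilinear (\<lambda>Y u. nab \<Gamma> \<psi> y Y u w)" if "y \<in> W" for y by (rule nab_bilinear[OF \<psi> that])
      show "smooth_on W (\<lambda>y. nab \<Gamma> \<psi> y a b w)" for a b by (rule nab_comp_smooth[OF \<psi>])
    qed (rule Js(1))+
    show "g y w w \<noteq> 0" if "y \<in> W" for y using quat_inner.pos[OF q[OF that] False] by simp
  qed
  then show ?thesis by (rule smooth_on_cong[OF _ W]) (rule th_formula[OF ck _ False, symmetric])
qed

text \<open>The first-order system: the state consists of the components of \<open>\<psi>\<close> and of \<open>\<theta>\<close>, and
  \<open>coef\<close> collects the coefficients of the equation expressing the derivative of \<open>\<psi>\<close>.\<close>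

definition idxset :: "('e \<times> 'e + 'e) set" where
  "idxset = Inl ` (Basis \<times> Basis) \<union> Inr ` Basis"

definition state :: "('e \<Rightarrow> 'e \<Rightarrow> 'e \<Rightarrow> real) \<Rightarrow> ('e \<Rightarrow> 'e \<Rightarrow> real) \<Rightarrow> 'e \<times> 'e + 'e \<Rightarrow> 'e \<Rightarrow> real" where
  "state \<psi> th i = (case i of Inl (a, b) \<Rightarrow> (\<lambda>y. \<psi> y a b) | Inr a \<Rightarrow> (\<lambda>y. th y a))"

definition coef :: "'e \<times> 'e + 'e \<Rightarrow> 'e \<Rightarrow> 'e \<Rightarrow> 'e \<Rightarrow> 'e \<Rightarrow> real" where
  "coef i Y u v y = (case i of
     Inl (a, b) \<Rightarrow> (\<Gamma> y Y u \<bullet> a) * (v \<bullet> b) + (u \<bullet> a) * (\<Gamma> y Y v \<bullet> b)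
   | Inr a \<Rightarrow> T y (\<lambda>w. w \<bullet> a) Y u v)"

lemma idxset_finite: "finite idxset"
  by (simp add: idxset_def)

lemma sum_idxset: "(\<Sum>i\<in>idxset. f i) = (\<Sum>a\<in>Basis. \<Sum>b\<in>Basis. f (Inl (a, b))) + (\<Sum>a\<in>Basis. f (Inr a))"
  unfolding idxset_def
  by (subst sum.union_disjoint) (auto simp: sum.reindex inj_on_def sum.cartesian_product)

lemma T_smooth: "linear th \<Longrightarrow> smooth_on W (\<lambda>y. T y th Y u v)"
proof -
  assume l: "linear th"
  then have bl: "bounded_linear th" by (rule linear_conv_bounded_linear[THEN iffD1])
  have "smooth_on W (\<lambda>y.
     - (th (J1 y Y) * g y (J1 y u) v + th (J1 y u) * g y (J1 y v) Y + th (J1 y v) * g y (J1 y Y) u)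
     - (th (J2 y Y) * g y (J2 y u) v + th (J2 y u) * g y (J2 y v) Y + th (J2 y v) * g y (J2 y Y) u)
     - (th (J3 y Y) * g y (J3 y u) v + th (J3 y u) * g y (J3 y v) Y + th (J3 y v) * g y (J3 y Y) u)
     + g y Y u * th v - g y Y v * th u)"
    by (intro smooth_on_add smooth_on_diff smooth_on_uminus smooth_on_mult W gs Js smooth_on_const
       smooth_on_bounded_linear_comp[OF W bl]
       smooth_on_bilinear_field[OF W smooth_tensorD(1)[OF g_tensor] smooth_tensorD(2)[OF g_tensor]])
  then show ?thesis
    by (rule smooth_on_cong[OF _ W]) (simp add: T_def quat_inner.T_form_def[OF q])
qed

lemma coef_smooth: "smooth_on W (coef i Y u v)"
proof (cases i)
  case (Inl p)
  then show ?thesis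
    by (cases p) (auto simp: coef_def[abs_def] intro!: smooth_on_add smooth_on_mult smooth_on_inner
       smooth_on_const W \<Gamma>s)
next
  case (Inr a)
  have "linear (\<lambda>w. w \<bullet> a)" by (rule bounded_linear.linear[OF bounded_linear_inner_left])
  then show ?thesis using Inr T_smooth by (simp add: coef_def[abs_def])
qed

lemma T_sum:
  assumes y: "y \<in> W" and l: "linear th"
  shows "(\<Sum>a\<in>Basis. th a * T y (\<lambda>w. w \<bullet> a) Y u v) = T y th Y u v"
proof -
  have e: "th x = (\<Sum>a\<in>Basis. th a * (x \<bullet> a))" for x
    using linear_expand[OF l, of x] by (simp add: mult.commute)
  show ?thesis
    unfolding T_def quat_inner.T_form_def[OF q[OF y]] e[of "J1 y _"] e[of "J2 y _"] e[of "J3 y _"] e[of u] e[of v]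
    by (simp add: sum_distrib_left sum_distrib_right sum.distrib sum_subtractf sum_negf algebra_simps)
qed

lemma state_equation:
  assumes ck: "ckW \<psi> th" and y: "y \<in> W"
  shows "pd (\<lambda>z. \<psi> z u v) y Y = (\<Sum>i\<in>idxset. state \<psi> th i y * coef i Y u v y)"
proof -
  have \<psi>: "smooth_tensor W \<psi>" and l: "linear (th y)" using ck y by (auto simp: ckW_def compatW_def)
  have "pd (\<lambda>z. \<psi> z u v) y Y = T y (th y) Y u v + (\<psi> y (\<Gamma> y Y u) v + \<psi> y u (\<Gamma> y Y v))"
    using nab_T[OF ck y, of Y u v] by (simp add: nab_def)
  also have "\<psi> y (\<Gamma> y Y u) v + \<psi> y u (\<Gamma> y Y v) = (\<Sum>a\<in>Basis. \<Sum>b\<in>Basis.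
     \<psi> y a b * ((\<Gamma> y Y u \<bullet> a) * (v \<bullet> b) + (u \<bullet> a) * (\<Gamma> y Y v \<bullet> b)))"
    unfolding bilinear_expand[OF smooth_tensorD(1)[OF \<psi> y], of "\<Gamma> y Y u" v]
      bilinear_expand[OF smooth_tensorD(1)[OF \<psi> y], of u "\<Gamma> y Y v"]
    by (simp add: sum.distrib algebra_simps)
  finally show ?thesis
    unfolding sum_idxset T_sum[OF y l, symmetric] by (simp add: state_def coef_def)
qed

lemma state_smooth: "ckW \<psi> th \<Longrightarrow> smooth_on W (state \<psi> th i)"
  using th_smooth smooth_tensorD(2)[of W \<psi>]
  by (auto simp: state_def ckW_def compatW_def split: sum.splits prod.splits)

text \<open>The coefficient of the state variable \<open>j\<close> in the second derivative of
  \<psi>, once the first derivatives of \<psi> have been eliminated by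
  \<open>state_equation\<close>; derivatives of \<theta> are kept apart.\<close>

definition quad :: "'e \<times> 'e + 'e \<Rightarrow> 'e \<Rightarrow> 'e \<Rightarrow> 'e \<Rightarrow> 'e \<Rightarrow> 'e \<Rightarrow> real" where
  "quad j Z Y u v x = (\<Sum>a\<in>Basis. \<Sum>b\<in>Basis. coef j Z a b x * coef (Inl (a, b)) Y u v x)
     + pd (coef j Y u v) x Z"

lemma quad_continuous: "continuous_on W (quad j Z Y u v)"
  unfolding quad_def[abs_def]
  by (intro smooth_on_continuous_on smooth_on_add smooth_on_sum smooth_on_mult smooth_on_pd coef_smooth W)

text \<open>Differentiating \<open>state_equation\<close>, the derivatives of \<psi> are eliminated
  by the same equation, while those of \<theta> reassemble, by linearity of \<open>T\<close>, to
  \<open>T\<close> applied to the derivative of \<theta>.\<close>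

lemma second_derivative:
  assumes ck: "ckW \<psi> th" and x: "x \<in> W"
  shows "pd (\<lambda>y. pd (\<lambda>z. \<psi> z u v) y Y) x Z = T x (\<lambda>w. pd (\<lambda>y. th y w) x Z) Y u v
     + (\<Sum>j\<in>idxset. state \<psi> th j x * quad j Z Y u v x)"
proof -
  have \<psi>: "smooth_tensor W \<psi>" using ck by (auto simp: ckW_def compatW_def)
  have thl: "linear (th y)" if "y \<in> W" for y using ck that by (auto simp: ckW_def)
  have A: "linear (\<lambda>w. pd (\<lambda>y. th y w) x Z)"
    by (rule pd_linear_field[OF W x thl]) (auto intro: smooth_on_differentiable[OF th_smooth[OF ck] x])
  have ds: "state \<psi> th i differentiable (at x)" for i
    by (rule smooth_on_differentiable[OF state_smooth[OF ck] x])
  have dc: "coef i Y u v differentiable (at x)" for i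
    by (rule smooth_on_differentiable[OF coef_smooth x])
  have dm: "(\<lambda>y. state \<psi> th i y * coef i Y u v y) differentiable (at x)" for i
    using ds dc by (rule differentiable_mult)
  have "pd (\<lambda>y. pd (\<lambda>z. \<psi> z u v) y Y) x Z = pd (\<lambda>y. \<Sum>i\<in>idxset. state \<psi> th i y * coef i Y u v y) x Z"
    using pd_cong[OF W x, of "\<lambda>y. pd (\<lambda>z. \<psi> z u v) y Y"] state_equation[OF ck] by simp
  also have "\<dots> = (\<Sum>i\<in>idxset. pd (state \<psi> th i) x Z * coef i Y u v x + state \<psi> th i x * pd (coef i Y u v) x Z)"
    using pd_sum[of idxset "\<lambda>i y. state \<psi> th i y * coef i Y u v y" x Z, OF dm] pd_mult[OF ds dc] by simp
  also have "\<dots> = (\<Sum>i\<in>idxset. pd (state \<psi> th i) x Z * coef i Y u v x)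
     + (\<Sum>i\<in>idxset. state \<psi> th i x * pd (coef i Y u v) x Z)" by (rule sum.distrib)
  also have "(\<Sum>i\<in>idxset. pd (state \<psi> th i) x Z * coef i Y u v x)
     = (\<Sum>a\<in>Basis. \<Sum>b\<in>Basis. pd (\<lambda>y. \<psi> y a b) x Z * coef (Inl (a, b)) Y u v x)
       + (\<Sum>a\<in>Basis. pd (\<lambda>y. th y a) x Z * T x (\<lambda>w. w \<bullet> a) Y u v)"
    unfolding sum_idxset by (simp add: state_def coef_def)
  also have "(\<Sum>a\<in>Basis. pd (\<lambda>y. th y a) x Z * T x (\<lambda>w. w \<bullet> a) Y u v)
     = T x (\<lambda>w. pd (\<lambda>y. th y w) x Z) Y u v" by (rule T_sum[OF x A])
  also have "(\<Sum>a\<in>Basis. \<Sum>b\<in>Basis. pd (\<lambda>y. \<psi> y a b) x Z * coef (Inl (a, b)) Y u v x)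
     = (\<Sum>j\<in>idxset. state \<psi> th j x * (\<Sum>a\<in>Basis. \<Sum>b\<in>Basis. coef j Z a b x * coef (Inl (a, b)) Y u v x))"
    unfolding state_equation[OF ck x] sum_distrib_left sum_distrib_right
    unfolding mult.assoc by (rule trans[OF sum.cong[OF refl sum.swap] sum.swap])
  finally show ?thesis
    unfolding quad_def by (simp add: sum.distrib algebra_simps)
qed


lemma T_linear:
  assumes y: "y \<in> W" and A: "bilinear A"
  shows "linear (\<lambda>Z. T y (A Z) Y u v)"
  unfolding T_def quat_inner.T_form_def[OF q[OF y]] linear_iff
  by (auto simp: bilinear_ladd[OF A] bilinear_lmul[OF A] algebra_simps)

lemma T_linear_args:
  assumes y: "y \<in> W" and l: "linear th"
  shows "linear (\<lambda>Y. T y th Y u v)" "linear (\<lambda>u. T y th Y u v)" "linear (\<lambda>v. T y th Y u v)"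
proof -
  interpret Q: quat_inner "g y" "J1 y" "J2 y" "J3 y" by (rule q[OF y])
  have J: "J1 y (c *\<^sub>R a) = c *\<^sub>R J1 y a" "J2 y (c *\<^sub>R a) = c *\<^sub>R J2 y a" "J3 y (c *\<^sub>R a) = c *\<^sub>R J3 y a" for a c
    using Q.lin linear_scale by blast+
  show "linear (\<lambda>Y. T y th Y u v)" "linear (\<lambda>u. T y th Y u v)" "linear (\<lambda>v. T y th Y u v)"
    unfolding T_def Q.T_form_def linear_iff
    by (auto simp: Q.h_lin Q.J_add J linear_add[OF l] linear_scale[OF l] algebra_simps)
qed

text \<open>The \<psi> components are governed by \<open>state_equation\<close>. For \<theta>,
  symmetry of the second derivatives of \<psi> makes the skew part of \<open>T\<close> applied to
  the partial derivatives of \<theta> a linear expression in the state, and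
  \<open>symbol_bound\<close> converts this into a bound of these derivatives. The constant depends
  on K only and not on the solution.\<close>

lemma closed_system:
  assumes K: "compact K" "K \<subseteq> W"
  shows "\<exists>C. \<forall>\<psi> th. ckW \<psi> th \<longrightarrow> (\<forall>i\<in>idxset. \<forall>x\<in>K. \<forall>c\<in>Basis.
     \<bar>pd (state \<psi> th i) x c\<bar> \<le> C * (\<Sum>j\<in>idxset. \<bar>state \<psi> th j x\<bar>))"
proof -
  let ?B = "Basis :: 'e set"
  have "\<exists>C\<ge>0. \<forall>p\<in>idxset \<times> ?B \<times> ?B \<times> ?B. \<forall>x\<in>K.
      \<bar>(case p of (i, Y, u, v) \<Rightarrow> coef i Y u v) x\<bar> \<le> C"
    by (rule bounded_family[OF _ K(1)])
       (auto simp: idxset_finite intro: continuous_on_subset[OF smooth_on_continuous_on[OF coef_smooth] K(2)])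
  then obtain C1 where C1: "C1 \<ge> 0"
    "\<And>i Y u v x. i \<in> idxset \<Longrightarrow> Y \<in> Basis \<Longrightarrow> u \<in> Basis \<Longrightarrow> v \<in> Basis \<Longrightarrow> x \<in> K \<Longrightarrow>
       \<bar>coef i Y u v x\<bar> \<le> C1" by fastforce
  have "\<exists>C\<ge>0. \<forall>p\<in>idxset \<times> ?B \<times> ?B \<times> ?B \<times> ?B. \<forall>x\<in>K.
      \<bar>(case p of (i, Z, Y, u, v) \<Rightarrow> quad i Z Y u v) x\<bar> \<le> C"
    by (rule bounded_family[OF _ K(1)])
       (auto simp: idxset_finite intro: continuous_on_subset[OF quad_continuous K(2)])
  then obtain C2 where C2: "C2 \<ge> 0"
    "\<And>i Z Y u v x. i \<in> idxset \<Longrightarrow> Z \<in> Basis \<Longrightarrow> Y \<in> Basis \<Longrightarrow> u \<in> Basis \<Longrightarrow> v \<in> Basis \<Longrightarrow> x \<in> K \<Longrightarrow>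
       \<bar>quad i Z Y u v x\<bar> \<le> C2" by fastforce
  have "\<exists>C\<ge>0. \<forall>b\<in>?B. \<forall>x\<in>K. \<bar>g x b b\<bar> \<le> C"
    by (rule bounded_family[OF _ K(1)])
       (auto intro: continuous_on_subset[OF smooth_on_continuous_on[OF gs] K(2)])
  then obtain C3 where C3: "C3 \<ge> 0" "\<And>b x. b \<in> Basis \<Longrightarrow> x \<in> K \<Longrightarrow> \<bar>g x b b\<bar> \<le> C3" by blast
  have "\<exists>\<kappa>>0. \<forall>x\<in>K. \<forall>u. (norm u)\<^sup>2 \<le> \<kappa> * g x u u"
  proof (rule inner_form_uniform[where g = g, OF K(1)])
    show "inner_form (g y)" if "y \<in> K" for y
      using q[of y] K(2) that quat_inner.bil quat_inner.sym quat_inner.pos unfolding inner_form_def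
      by blast
  qed (rule continuous_on_subset[OF smooth_on_continuous_on[OF gs] K(2)])
  then obtain \<kappa> where \<kappa>: "\<kappa> > 0" "\<And>x u. x \<in> K \<Longrightarrow> (norm u)\<^sup>2 \<le> \<kappa> * g x u u" by blast
  \<comment> \<open>\<open>2 * C2\<close> bounds the difference of two \<open>quad\<close>
    coefficients, the fourth power comes from expanding four arguments in the standard basis, and
    each of the pairs (Y, Z) and (u, v) costs one factor \<open>\<kappa>\<close> for passing from
    the Euclidean norm to the metric.\<close>
  define E where "E = 2 * C2 * DIM('e)^4 * \<kappa>\<^sup>2"
  \<comment> \<open>\<open>C1\<close> serves the components of \<psi>; 40 is the 20 of
    \<open>symbol_bound\<close> times the two basis vectors whose metric length is at most
    \<open>C3\<close>.\<close>
  define C where "C = max C1 (40 * E * C3)"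
  have "\<bar>pd (state \<psi> th i) x c\<bar> \<le> C * (\<Sum>j\<in>idxset. \<bar>state \<psi> th j x\<bar>)"
    if ck: "ckW \<psi> th" and i: "i \<in> idxset" and xK: "x \<in> K" and c: "c \<in> Basis" for \<psi> th i x c
  proof -
    define N where "N = (\<Sum>j\<in>idxset. \<bar>state \<psi> th j x\<bar>)"
    have N0: "N \<ge> 0" by (simp add: N_def sum_nonneg)
    have x: "x \<in> W" using xK K by blast
    interpret Q: quat_inner "g x" "J1 x" "J2 x" "J3 x" by (rule q[OF x])
    have \<psi>: "smooth_tensor W \<psi>" using ck by (auto simp: ckW_def compatW_def)
    have thl: "linear (th y)" if "y \<in> W" for y using ck that by (auto simp: ckW_def)
    have td: "(\<lambda>y. th y w) differentiable (at x)" for w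
      by (rule smooth_on_differentiable[OF th_smooth[OF ck] x])
    define A where "A Z w = pd (\<lambda>y. th y w) x Z" for Z w
    have A: "bilinear A"
      using pd_linear_field[OF W x thl td] pd_linear[OF td] by (simp add: bilinear_def A_def)
    have Al: "linear (A Z)" for Z using A by (simp add: bilinear_def)
    have dd: "pd (\<lambda>y. pd (\<lambda>z. \<psi> z u v) y Y) x Z = pd (\<lambda>y. pd (\<lambda>z. \<psi> z u v) y Z) x Y" for u v Y Z
      using smooth_tensorD(2)[OF \<psi>] by (intro pd_commute[OF W x]) (simp add: smooth_on_def)
    \<comment> \<open>The skew part to be estimated; it is four-linear, so its coefficients on the
      standard basis control it.\<close>
    define R where "R Y Z u v = T x (A Z) Y u v - T x (A Y) Z u v" for Y Z u v
    have R: "R Y Z u v = (\<Sum>j\<in>idxset. state \<psi> th j x * (quad j Y Z u v x - quad j Z Y u v x))" for Y Z u v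
      using second_derivative[OF ck x, of u v Y Z] second_derivative[OF ck x, of u v Z Y] dd[of u v Y Z]
      unfolding R_def A_def[abs_def] by (simp add: right_diff_distrib sum_subtractf)
    have Rb: "\<bar>R a b c d\<bar> \<le> 2 * C2 * N" if "a \<in> Basis" "b \<in> Basis" "c \<in> Basis" "d \<in> Basis" for a b c d
    proof -
      have "\<bar>R a b c d\<bar> \<le> (\<Sum>j\<in>idxset. \<bar>state \<psi> th j x * (quad j a b c d x - quad j b a c d x)\<bar>)"
        unfolding R by (rule sum_abs)
      also have "\<dots> \<le> (\<Sum>j\<in>idxset. \<bar>state \<psi> th j x\<bar> * (2 * C2))"
      proof (rule sum_mono)
        fix j assume j: "j \<in> idxset"
        have "\<bar>quad j a b c d x - quad j b a c d x\<bar> \<le> 2 * C2"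
          using C2(2)[OF j that(1,2,3,4) xK] C2(2)[OF j that(2,1,3,4) xK] by linarith
        then show "\<bar>state \<psi> th j x * (quad j a b c d x - quad j b a c d x)\<bar> \<le> \<bar>state \<psi> th j x\<bar> * (2 * C2)"
          unfolding abs_mult by (rule mult_left_mono) simp
      qed
      also have "\<dots> = 2 * C2 * N" by (simp add: N_def sum_distrib_left mult_ac)
      finally show ?thesis .
    qed
    have Rl: "linear (\<lambda>a. R a b c d)" "linear (\<lambda>b. R a b c d)" "linear (\<lambda>c. R a b c d)" "linear (\<lambda>d. R a b c d)"
      for a b c d
      unfolding R_def by (intro linear_compose_sub T_linear[OF x A] T_linear_args[OF x Al])+
    have Rn: "\<bar>R Y Z u v\<bar> \<le> (E * N) * g x Y Y * g x u u"
      if e: "g x Z Z = g x Y Y" "g x v v = g x u u" for Y Z u v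
    proof -
      \<comment> \<open>The arithmetic-geometric mean inequality turns the product of two Euclidean
        norms into one metric length, as both vectors have the same length in the metric.\<close>
      have nn: "norm a * norm b \<le> \<kappa> * g x a a" if "g x b b = g x a a" for a b
      proof -
        have "2 * (norm a * norm b) \<le> (norm a)\<^sup>2 + (norm b)\<^sup>2"
          using sum_squares_bound[of "norm a" "norm b"] by simp
        then show ?thesis using \<kappa>(2)[OF xK, of a] \<kappa>(2)[OF xK, of b] that by simp
      qed
      have "\<bar>R Y Z u v\<bar> \<le> (2 * C2 * N) * DIM('e)^4 * norm Y * norm Z * norm u * norm v"
        by (rule four_linear_bound[OF Rl Rb])
      also have "\<dots> = ((2 * C2 * N) * DIM('e)^4) * ((norm Y * norm Z) * (norm u * norm v))" by simp
      also have "\<dots> \<le> ((2 * C2 * N) * DIM('e)^4) * ((\<kappa> * g x Y Y) * (\<kappa> * g x u u))"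
        by (rule mult_left_mono[OF mult_mono[OF nn[OF e(1)] nn[OF e(2)]]])
          (use C2(1) N0 \<kappa>(1) Q.nonneg in auto)
      finally show ?thesis by (simp add: E_def power2_eq_square mult_ac)
    qed
    have Ab: "\<bar>A Y Z\<bar> \<le> 20 * (E * N) * (g x Y Y + g x Z Z)" for Y Z
      by (rule Q.symbol_bound[OF D A]) (use Rn in \<open>simp add: R_def T_def\<close>)
    have E0: "E \<ge> 0" using C2(1) by (simp add: E_def)
    have "\<bar>pd (state \<psi> th i) x c\<bar> \<le> C * N"
    proof (cases i)
      case (Inl p)
      obtain a b where p: "i = Inl (a, b)" "a \<in> Basis" "b \<in> Basis" using i Inl by (auto simp: idxset_def)
      have "state \<psi> th i = (\<lambda>y. \<psi> y a b)" by (simp add: p state_def)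
      then have "pd (state \<psi> th i) x c = (\<Sum>j\<in>idxset. state \<psi> th j x * coef j c a b x)"
        using state_equation[OF ck x, of a b c] by simp
      then have "\<bar>pd (state \<psi> th i) x c\<bar> \<le> (\<Sum>j\<in>idxset. \<bar>state \<psi> th j x * coef j c a b x\<bar>)"
        by (simp add: sum_abs)
      also have "\<dots> \<le> (\<Sum>j\<in>idxset. \<bar>state \<psi> th j x\<bar> * C1)"
        unfolding abs_mult by (intro sum_mono mult_left_mono C1(2) c p xK) auto
      also have "\<dots> = C1 * N" by (simp add: N_def sum_distrib_left mult_ac)
      also have "\<dots> \<le> C * N" using N0 by (intro mult_right_mono) (auto simp: C_def)
      finally show ?thesis .
    next
      case (Inr a)
      then have a: "a \<in> Basis" using i by (auto simp: idxset_def)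
      have "\<bar>pd (state \<psi> th i) x c\<bar> = \<bar>A c a\<bar>" by (simp add: Inr state_def A_def)
      also have "\<dots> \<le> 20 * (E * N) * (g x c c + g x a a)" by (rule Ab)
      also have "\<dots> \<le> 20 * (E * N) * (C3 + C3)"
        using C3(2)[OF c xK] C3(2)[OF a xK] E0 N0 by (intro mult_left_mono) auto
      also have "\<dots> = (40 * E * C3) * N" by simp
      also have "\<dots> \<le> C * N" using N0 by (intro mult_right_mono) (auto simp: C_def)
      finally show ?thesis .
    qed
    then show ?thesis by (simp add: N_def)
  qed
  then show ?thesis by blast
qed

lemma local_uniqueness:
  assumes ck: "ckW \<psi> th" and K: "compact K" "convex K" "K \<subseteq> W" and x: "x0 \<in> K" "x1 \<in> K"
    and z: "\<And>u v. \<psi> x0 u v = 0" "\<And>v. th x0 v = 0"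
  shows "\<psi> x1 u v = 0"
proof -
  obtain C where C: "\<And>i x c. i \<in> idxset \<Longrightarrow> x \<in> K \<Longrightarrow> c \<in> Basis \<Longrightarrow>
     \<bar>pd (state \<psi> th i) x c\<bar> \<le> C * (\<Sum>j\<in>idxset. \<bar>state \<psi> th j x\<bar>)"
    using closed_system[OF K(1,3)] ck by blast
  have b: "bilinear (\<psi> x1)" using ck x K smooth_tensorD(1) by (auto simp: ckW_def compatW_def)
  have "state \<psi> th i x1 = 0" if "i \<in> idxset" for i
  proof (rule linear_system_unique[OF idxset_finite K(2) x _ C _ that])
    show "state \<psi> th i differentiable (at x)" if "x \<in> K" for i x
      using smooth_on_differentiable[OF state_smooth[OF ck]] that K by blast
    show "state \<psi> th i x0 = 0" for i
      by (auto simp: state_def z split: sum.splits)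
  qed
  then have "\<psi> x1 a b = 0" if "a \<in> Basis" "b \<in> Basis" for a b
    using that by (force simp: idxset_def state_def)
  then show ?thesis using bilinear_expand[OF b, of u v] by simp
qed

end

section \<open>The Levi-Civita connection of a quaternionic-Kaehler manifold\<close>

text \<open>Pointwise linear algebra: \<open>D w u v\<close> stands for the derivative of g(u, v) in
  direction w. The Koszul formula follows from symmetry and metricity, which gives uniqueness; Riesz
  representation of its right-hand side gives existence.\<close>

lemma levi_civita:
  fixes h :: "'e::euclidean_space \<Rightarrow> 'e \<Rightarrow> real" and D :: "'e \<Rightarrow> 'e \<Rightarrow> 'e \<Rightarrow> real"
  assumes h: "inner_form h" and D: "\<And>w. bilinear (D w)" "\<And>u v. linear (\<lambda>w. D w u v)"
    "\<And>w u v. D w u v = D w v u"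
  shows "\<exists>!\<Gamma>. bilinear \<Gamma> \<and> (\<forall>u v. \<Gamma> u v = \<Gamma> v u) \<and> (\<forall>w u v. D w u v = h (\<Gamma> w u) v + h u (\<Gamma> w v))"
    and "bilinear \<Gamma> \<and> (\<forall>u v. \<Gamma> u v = \<Gamma> v u) \<and> (\<forall>w u v. D w u v = h (\<Gamma> w u) v + h u (\<Gamma> w v))
      \<Longrightarrow> h (\<Gamma> u v) w = (D u v w + D v u w - D w u v) / 2"
proof -
  let ?P = "\<lambda>\<Gamma>. bilinear \<Gamma> \<and> (\<forall>u v. \<Gamma> u v = \<Gamma> v u) \<and> (\<forall>w u v. D w u v = h (\<Gamma> w u) v + h u (\<Gamma> w v))"
  have hb: "bilinear h" and hs: "\<And>u v. h u v = h v u" using h by (auto simp: inner_form_def)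
  have koszul: "h (\<Gamma> u v) w = (D u v w + D v u w - D w u v) / 2" if "?P \<Gamma>" for \<Gamma> u v w
  proof -
    have "D u v w = h (\<Gamma> u v) w + h v (\<Gamma> u w)" "D v u w = h (\<Gamma> v u) w + h u (\<Gamma> v w)"
      "D w u v = h (\<Gamma> w u) v + h u (\<Gamma> w v)" "\<Gamma> v u = \<Gamma> u v" "\<Gamma> w u = \<Gamma> u w" "\<Gamma> w v = \<Gamma> v w"
      using that by blast+
    then show ?thesis using hs[of v "\<Gamma> u w"] by simp
  qed
  show "?P \<Gamma> \<Longrightarrow> h (\<Gamma> u v) w = (D u v w + D v u w - D w u v) / 2" by (rule koszul)
  have Dl: "D (x + y) u v = D x u v + D y u v" "D (c *\<^sub>R x) u v = c * D x u v"
    "D w (x + y) v = D w x v + D w y v" "D w (c *\<^sub>R x) v = c * D w x v"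
    "D w v (x + y) = D w v x + D w v y" "D w v (c *\<^sub>R x) = c * D w v x" for x y u v w c
    using linear_add[OF D(2)] linear_scale[OF D(2)] bilinear_ladd[OF D(1)] bilinear_radd[OF D(1)]
      bilinear_lmul[OF D(1)] bilinear_rmul[OF D(1)] by auto
  have "\<forall>u v. \<exists>z. \<forall>w. h z w = (D u v w + D v u w - D w u v) / 2"
    by (intro allI inner_form_riesz[OF h]) (auto simp: linear_iff Dl field_simps)
  then obtain G where G: "\<And>u v w. h (G u v) w = (D u v w + D v u w - D w u v) / 2" by metis
  have "?P G"
  proof (intro conjI allI)
    show "G u v = G v u" for u v
      by (rule inner_form_eqI[OF h]) (simp add: G D(3)[of _ u v])
    show "D w u v = h (G w u) v + h u (G w v)" for w u v
      unfolding hs[of u "G w v"] G by (simp add: D(3)[of w v u] D(3)[of u v w] D(3)[of v w u] field_simps)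
    show "bilinear G"
      unfolding bilinear_def linear_iff
      by (auto intro!: inner_form_eqI[OF h] simp: G bilinear_ladd[OF hb] bilinear_lmul[OF hb] Dl field_simps)
  qed
  moreover have "\<Gamma> = G" if "?P \<Gamma>" for \<Gamma>
    by (intro ext inner_form_eqI[OF h]) (simp add: koszul[OF that] G)
  ultimately show "\<exists>!\<Gamma>. ?P \<Gamma>" by (rule ex1I)
qed

lemma tensor2_field_smooth:
  "tensor2_field M \<psi> \<Longrightarrow> i \<in> idx M \<Longrightarrow> smooth_tensor (cod M i) (\<psi> i)"
  by (auto simp: tensor2_field_def smooth_tensor_def)

lemma smooth_tensor_subset: "smooth_tensor W \<psi> \<Longrightarrow> V \<subseteq> W \<Longrightarrow> smooth_tensor V \<psi>"
  unfolding smooth_tensor_def using smooth_on_subset by blast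

lemma smooth_manifold_cod_open: "smooth_manifold M \<Longrightarrow> i \<in> idx M \<Longrightarrow> open (cod M i)"
  by (auto simp: smooth_manifold_def)

lemma metric_inner_form:
  "riemannian_manifold M \<Longrightarrow> i \<in> idx M \<Longrightarrow> x \<in> cod M i \<Longrightarrow> inner_form (metric M i x)"
  by (auto simp: riemannian_manifold_def tensor2_field_def inner_form_def)

text \<open>\<open>christoffel\<close> is a definite description, so its properties rest on unique
  existence at every point; smoothness comes from solving the Koszul formula by
  \<open>smooth_on_solution\<close>. The uniqueness clause later identifies the connection of the
  projective space.\<close>

lemma
  fixes M :: "('i, 'm, 'e::euclidean_space, 'z) riem_scheme"
  assumes M: "riemannian_manifold M" and i: "i \<in> idx M"
  shows christoffel_bilinear: "x \<in> cod M i \<Longrightarrow> bilinear (christoffel M i x)"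
    and christoffel_sym: "x \<in> cod M i \<Longrightarrow> christoffel M i x u v = christoffel M i x v u"
    and christoffel_metric: "x \<in> cod M i \<Longrightarrow> pd (\<lambda>y. metric M i y u v) x w
        = metric M i x (christoffel M i x w u) v + metric M i x u (christoffel M i x w v)"
    and christoffel_smooth: "smooth_on (cod M i) (\<lambda>y. christoffel M i y u v)"
    and christoffel_unique: "x \<in> cod M i \<Longrightarrow> bilinear G \<Longrightarrow> (\<And>u v. G u v = G v u) \<Longrightarrow>
       (\<And>w u v. pd (\<lambda>y. metric M i y u v) x w = metric M i x (G w u) v + metric M i x u (G w v))
       \<Longrightarrow> christoffel M i x = G"
proof -
  let ?W = "cod M i" and ?g = "metric M i"
  have W: "open ?W" using M i smooth_manifold_cod_open by (auto simp: riemannian_manifold_def)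
  have gt: "smooth_tensor ?W ?g" using M i tensor2_field_smooth by (auto simp: riemannian_manifold_def)
  have gi: "inner_form (?g y)" if "y \<in> ?W" for y using metric_inner_form[OF M i that] .
  let ?D = "\<lambda>x w u v. pd (\<lambda>y. ?g y u v) x w"
  have D: "bilinear (?D x w)" "linear (\<lambda>w. ?D x w u v)" "?D x w u v = ?D x w v u" if x: "x \<in> ?W" for x w u v
  proof -
    have "linear (\<lambda>u. pd (\<lambda>y. ?g y u v) x w)" "linear (\<lambda>u. pd (\<lambda>y. ?g y v u) x w)" for v
      by (rule pd_linear_field[OF W x]; use smooth_tensorD(1)[OF gt] smooth_tensorD(3)[OF gt x] in
          \<open>simp add: bilinear_def\<close>)+
    then show "bilinear (?D x w)" by (simp add: bilinear_def)
    show "linear (\<lambda>w. ?D x w u v)" by (rule pd_linear[OF smooth_tensorD(3)[OF gt x]])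
    show "?D x w u v = ?D x w v u"
      using pd_cong[OF W x, of "\<lambda>y. ?g y u v" "\<lambda>y. ?g y v u"] gi by (auto simp: inner_form_def)
  qed
  note lc = levi_civita[where h = "?g x" and D = "?D x" for x]
  have P: "bilinear (christoffel M i x) \<and> (\<forall>u v. christoffel M i x u v = christoffel M i x v u) \<and>
     (\<forall>w u v. ?D x w u v = ?g x (christoffel M i x w u) v + ?g x u (christoffel M i x w v))"
    if x: "x \<in> ?W" for x
    unfolding christoffel_def by (rule theI'[OF lc(1)[OF gi[OF x] D[OF x]]])
  show "x \<in> cod M i \<Longrightarrow> bilinear (christoffel M i x)"
    "x \<in> cod M i \<Longrightarrow> christoffel M i x u v = christoffel M i x v u"
    "x \<in> cod M i \<Longrightarrow> pd (\<lambda>y. metric M i y u v) x w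
        = metric M i x (christoffel M i x w u) v + metric M i x u (christoffel M i x w v)"
    using P by blast+
  show "christoffel M i x = G" if x: "x \<in> ?W" and "bilinear G" "\<And>u v. G u v = G v u"
     "\<And>w u v. pd (\<lambda>y. metric M i y u v) x w = metric M i x (G w u) v + metric M i x u (G w v)"
    unfolding christoffel_def
    by (rule the1_equality[OF lc(1)[OF gi[OF x] D[OF x]]]) (use that(2-) in blast)
  show "smooth_on (cod M i) (\<lambda>y. christoffel M i y u v)"
  proof (rule smooth_on_solution[where g = ?g and k = "\<lambda>x w. (?D x u v w + ?D x v u w - ?D x w u v) / 2", OF W gi])
    show "smooth_on ?W (\<lambda>y. ?g y a b)" for a b by (rule smooth_tensorD(2)[OF gt])
    show "?g y (christoffel M i y u v) w = (?D y u v w + ?D y v u w - ?D y w u v) / 2" if y: "y \<in> ?W" for y w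
      by (rule lc(2)[OF gi[OF y] D[OF y] P[OF y]])
    show "smooth_on ?W (\<lambda>x. (?D x u v w + ?D x v u w - ?D x w u v) / 2)" for w
      by (intro smooth_on_divide smooth_on_add smooth_on_diff smooth_on_pd smooth_on_const W
        smooth_tensorD(2)[OF gt]) auto
  qed
qed

lemma nabla_tensor2_nab: "nabla_tensor2 M \<psi> i = nab (christoffel M i) (\<psi> i)"
  by (simp add: fun_eq_iff nabla_tensor2_def nab_def)

lemma nabla_end_nabE: "nabla_end M i A = nabE (christoffel M i) A"
  by (simp add: fun_eq_iff nabla_end_def nabE_def)

lemma span_three:
  fixes a b c :: "'v::real_vector"
  assumes "f \<in> span {a, b, c}"
  shows "\<exists>c1 c2 c3. f = c1 *\<^sub>R a + c2 *\<^sub>R b + c3 *\<^sub>R c"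
proof -
  obtain k1 k2 k3 where "f - k1 *\<^sub>R a - k2 *\<^sub>R b - k3 *\<^sub>R c \<in> span {}"
    using assms unfolding span_breakdown_eq by blast
  then have "f = k1 *\<^sub>R a + k2 *\<^sub>R b + k3 *\<^sub>R c" by (simp add: algebra_simps)
  then show ?thesis by blast
qed

lemma quat_inner_metric:
  assumes M: "riemannian_manifold M" and i: "i \<in> idx M" "x \<in> cod M i"
    and t: "quat_triple (metric M i x) J1 J2 J3"
  shows "quat_inner (metric M i x) J1 J2 J3"
  using metric_inner_form[OF M i] t by (auto simp: inner_form_def quat_inner_def)

text \<open>The frame fields are themselves local sections of Q, so their covariant derivatives lie
  in the span of the frame; this is the last condition of \<open>local_qk\<close>.\<close>

lemma qk_frame:
  fixes M :: "('i, 'm, 'e::euclidean_space, 'z) qriem_scheme"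
  assumes M: "quaternionic_kaehler M" and D: "DIM('e) > 4" and i: "i \<in> idx M" and x: "x \<in> cod M i"
  obtains W J1 J2 J3 where "x \<in> W" "W \<subseteq> cod M i"
    "local_qk W (metric M i) J1 J2 J3 (christoffel M i)"
    "\<And>y. y \<in> W \<Longrightarrow> quat_triple (metric M i y) (J1 y) (J2 y) (J3 y)"
    "\<And>y. y \<in> W \<Longrightarrow> qbundle M i y = span {J1 y, J2 y, J3 y}"
proof -
  have R: "riemannian_manifold M" using M by (simp add: quaternionic_kaehler_def)
  note fr = M[unfolded quaternionic_kaehler_def, THEN conjunct2, THEN conjunct2, THEN conjunct1]
  have pr: "\<And>W A x Y. open W \<Longrightarrow> W \<subseteq> cod M i \<Longrightarrow> (\<And>u. smooth_on W (\<lambda>y. A y u)) \<Longrightarrow>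
        (\<And>y. y\<in>W \<Longrightarrow> A y \<in> qbundle M i y) \<Longrightarrow> x \<in> W \<Longrightarrow> nabla_end M i A x Y \<in> qbundle M i x"
    using M[unfolded quaternionic_kaehler_def, THEN conjunct2, THEN conjunct2, THEN conjunct2] i by blast
  obtain W J1 J2 J3 where W: "open W" "x \<in> W" "W \<subseteq> cod M i"
    and Js: "\<And>u. smooth_on W (\<lambda>y. J1 y u)" "\<And>u. smooth_on W (\<lambda>y. J2 y u)" "\<And>u. smooth_on W (\<lambda>y. J3 y u)"
    and t: "\<And>y. y \<in> W \<Longrightarrow> quat_triple (metric M i y) (J1 y) (J2 y) (J3 y)"
    and sp: "\<And>y. y \<in> W \<Longrightarrow> qbundle M i y = span {J1 y, J2 y, J3 y}"
    using fr[rule_format, OF i x] by blast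
  have gt: "smooth_tensor (cod M i) (metric M i)"
    using R i tensor2_field_smooth by (auto simp: riemannian_manifold_def)
  have "local_qk W (metric M i) J1 J2 J3 (christoffel M i)"
  proof (rule local_qk.intro)
    show "quat_inner (metric M i y) (J1 y) (J2 y) (J3 y)" if "y \<in> W" for y
      using quat_inner_metric[OF R i _ t[OF that]] W(3) that by blast
    show "smooth_on W (\<lambda>y. metric M i y u v)" for u v
      using smooth_tensorD(2)[OF gt] smooth_on_subset W(3) by blast
    show "smooth_on W (\<lambda>y. christoffel M i y u v)" for u v
      using christoffel_smooth[OF R i] smooth_on_subset W(3) by blast
    show "bilinear (christoffel M i y)" if "y \<in> W" for y
      using christoffel_bilinear[OF R i] W(3) that by blast
    show "pd (\<lambda>z. metric M i z u v) y Y
        = metric M i y (christoffel M i y Y u) v + metric M i y u (christoffel M i y Y v)" if "y \<in> W" for y Y u v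
      using christoffel_metric[OF R i] W(3) that by blast
    fix y Y J assume y: "y \<in> W" and J: "J \<in> {J1, J2, J3}"
    have "nabla_end M i J y Y \<in> qbundle M i y"
    proof (rule pr[OF W(1,3) _ _ y])
      show "smooth_on W (\<lambda>y. J y u)" for u using J Js by blast
      show "J z \<in> qbundle M i z" if "z \<in> W" for z
        unfolding sp[OF that] using J by (intro span_base) auto
    qed
    then have "nabE (christoffel M i) J y Y \<in> span {J1 y, J2 y, J3 y}" using sp[OF y] nabla_end_nabE by metis
    from span_three[OF this] obtain c1 c2 c3 where
      "nabE (christoffel M i) J y Y = c1 *\<^sub>R J1 y + c2 *\<^sub>R J2 y + c3 *\<^sub>R J3 y" by blast
    then have "\<forall>u. nabE (christoffel M i) J y Y u = c1 *\<^sub>R J1 y u + c2 *\<^sub>R J2 y u + c3 *\<^sub>R J3 y u"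
      by (simp add: scaleR_fun_def)
    then show "\<exists>c1 c2 c3. \<forall>u. nabE (christoffel M i) J y Y u = c1 *\<^sub>R J1 y u + c2 *\<^sub>R J2 y u + c3 *\<^sub>R J3 y u"
      by blast
  qed (rule W(1) D Js)+
  with W(2,3) t sp show ?thesis using that by blast
qed

lemma qbundle_subspace:
  fixes M :: "('i, 'm, 'e::euclidean_space, 'z) qriem_scheme"
  assumes M: "quaternionic_kaehler M" and i: "i \<in> idx M" "x \<in> cod M i"
  shows "subspace (qbundle M i x)"
proof -
  have "\<exists>J1 J2 J3. qbundle M i x = span {J1, J2, J3}"
    using M[unfolded quaternionic_kaehler_def, THEN conjunct2, THEN conjunct2, THEN conjunct1, rule_format, OF i]
    by blast
  then show ?thesis by auto
qed

lemma compatible_compat_form: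
  assumes M: "quaternionic_kaehler M" and i: "i \<in> idx M" "x \<in> cod M i" and c: "compatible M \<psi>"
    and t: "quat_triple (metric M i x) J1 J2 J3" and sp: "qbundle M i x = span {J1, J2, J3}"
  shows "quat_inner.compat_form (metric M i x) J1 J2 J3 (\<psi> i x)"
proof -
  have R: "riemannian_manifold M" using M by (simp add: quaternionic_kaehler_def)
  interpret Q: quat_inner "metric M i x" J1 J2 J3 by (rule quat_inner_metric[OF R i t])
  obtain \<sigma> \<phi> where s: "\<sigma> \<in> S2H M i x" and p: "\<phi> \<in> S2E M i x" and e: "\<psi> i x = \<sigma> + \<phi>"
    using c i unfolding compatible_def by blast
  obtain A where A: "A \<in> span {J1, J2, J3}" "\<sigma> = (\<lambda>u v. metric M i x (A u) v)"
    using s sp unfolding S2H_def by blast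
  obtain c1 c2 c3 where c: "A = c1 *\<^sub>R J1 + c2 *\<^sub>R J2 + c3 *\<^sub>R J3" using span_three[OF A(1)] by blast
  have "\<forall>J\<in>{J1, J2, J3}. \<forall>u v. \<phi> (J u) (J v) = \<phi> u v" using p t sp unfolding S2E_def by blast
  then have "Q.inv_form \<phi>" by (simp add: Q.inv_form_def)
  moreover have "\<psi> i x u v = c1 * metric M i x (J1 u) v + c2 * metric M i x (J2 u) v
     + c3 * metric M i x (J3 u) v + \<phi> u v" for u v
    unfolding e A(2) c by (simp add: scaleR_fun_def Q.h_lin)
  ultimately show ?thesis unfolding Q.compat_form_def by blast
qed

lemma codiff_linear:
  assumes "riemannian_manifold M" "two_form M \<psi>" "i \<in> idx M" "x \<in> cod M i"
  shows "linear (codiff M \<psi> i x)"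
proof -
  have W: "open (cod M i)" using assms smooth_manifold_cod_open by (auto simp: riemannian_manifold_def)
  have \<psi>: "smooth_tensor (cod M i) (\<psi> i)" using assms tensor2_field_smooth by (auto simp: two_form_def)
  note b = smooth_tensorD(1)[OF \<psi> assms(4)] and g = christoffel_bilinear[OF assms(1,3,4)]
  have 1: "linear (\<lambda>v. pd (\<lambda>y. \<psi> i y e v) x e)" for e
    by (rule pd_linear_field[OF W assms(4)])
       (use smooth_tensorD(1)[OF \<psi>] smooth_tensorD(3)[OF \<psi> assms(4)] in \<open>simp_all add: bilinear_def\<close>)
  have "linear (\<lambda>v. nabla_tensor2 M \<psi> i x e e v)" for e
    unfolding nabla_tensor2_def linear_iff
    by (auto simp: linear_add[OF 1] linear_scale[OF 1] bilinear_radd[OF b] bilinear_rmul[OF b]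
       bilinear_radd[OF g] bilinear_rmul[OF g] algebra_simps)
  then show ?thesis
    unfolding codiff_def linear_iff by (simp add: sum.distrib sum_distrib_left algebra_simps)
qed

lemma ext_d_alternating:
  assumes "riemannian_manifold M" "two_form M \<psi>" "i \<in> idx M" "x \<in> cod M i"
  shows "ext_d \<psi> i x u v w = - ext_d \<psi> i x v u w" "ext_d \<psi> i x u v w = - ext_d \<psi> i x u w v"
proof -
  have W: "open (cod M i)" using assms smooth_manifold_cod_open by (auto simp: riemannian_manifold_def)
  have \<psi>: "smooth_tensor (cod M i) (\<psi> i)" using assms tensor2_field_smooth by (auto simp: two_form_def)
  have m: "pd (\<lambda>y. \<psi> i y a b) x z = - pd (\<lambda>y. \<psi> i y b a) x z" for a b z
  proof -
    have "pd (\<lambda>y. \<psi> i y a b) x = pd (\<lambda>y. 0 - \<psi> i y b a) x"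
    proof (rule pd_cong[OF W assms(4)])
      fix y assume "y \<in> cod M i"
      then have "\<psi> i y a b = - \<psi> i y b a" using assms(2,3) unfolding two_form_def by blast
      then show "\<psi> i y a b = 0 - \<psi> i y b a" by simp
    qed
    then show ?thesis using pd_diff[OF differentiable_const smooth_tensorD(3)[OF \<psi> assms(4)], of 0 b a z] by simp
  qed
  show "ext_d \<psi> i x u v w = - ext_d \<psi> i x v u w" "ext_d \<psi> i x u v w = - ext_d \<psi> i x u w v"
    unfolding ext_d_def using m[of u v w] m[of v w u] by simp_all
qed

lemma ckW_of_compatible_CK2:
  fixes M :: "('i, 'm, 'e::euclidean_space, 'z) qriem_scheme"
  assumes M: "quaternionic_kaehler M" and i: "i \<in> idx M"
    and W: "W \<subseteq> cod M i" "local_qk W (metric M i) J1 J2 J3 (christoffel M i)"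
    and t: "\<And>y. y \<in> W \<Longrightarrow> quat_triple (metric M i y) (J1 y) (J2 y) (J3 y)"
    and sp: "\<And>y. y \<in> W \<Longrightarrow> qbundle M i y = span {J1 y, J2 y, J3 y}"
    and \<psi>: "\<psi> \<in> compatible_CK2 M"
  shows "local_qk.ckW W (metric M i) J1 J2 J3 (christoffel M i) (\<psi> i)
     (\<lambda>y v. - codiff M \<psi> i y v / (real DIM('e) - 1))"
proof -
  interpret L: local_qk W "metric M i" J1 J2 J3 "christoffel M i" by (rule W(2))
  have R: "riemannian_manifold M" using M by (simp add: quaternionic_kaehler_def)
  have c: "compatible M \<psi>" and ck: "conformal_killing M \<psi>" and tf: "two_form M \<psi>"
    using \<psi> by (auto simp: compatible_CK2_def compatible_def)
  have st: "smooth_tensor W (\<psi> i)"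
    using smooth_tensor_subset[OF tensor2_field_smooth[OF _ i] W(1)] tf by (auto simp: two_form_def)
  show ?thesis
    unfolding L.ckW_def L.compatW_def
  proof (intro conjI ballI st)
    fix y assume y: "y \<in> W"
    then have yc: "y \<in> cod M i" using W by blast
    show "quat_inner.compat_form (metric M i y) (J1 y) (J2 y) (J3 y) (\<psi> i y)"
      by (rule compatible_compat_form[OF M i yc c t[OF y] sp[OF y]])
    show "linear (\<lambda>v. - codiff M \<psi> i y v / (real DIM('e) - 1))"
      using codiff_linear[OF R tf i yc] unfolding linear_iff
      by (simp add: algebra_simps add_divide_distrib diff_divide_distrib)
    have "nab (christoffel M i) (\<psi> i) y Y u v = ext_d \<psi> i y Y u v / 3
        + metric M i y Y u * (- codiff M \<psi> i y v / (real DIM('e) - 1))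
        - metric M i y Y v * (- codiff M \<psi> i y u / (real DIM('e) - 1))" for Y u v
    proof -
      have "nabla_tensor2 M \<psi> i y Y u v = 1 / 3 * ext_d \<psi> i y Y u v - 1 / (real DIM('e) - 1)
            * (metric M i y Y u * codiff M \<psi> i y v - metric M i y Y v * codiff M \<psi> i y u)"
        using ck i yc unfolding conformal_killing_def by blast
      then show ?thesis unfolding nabla_tensor2_nab by (simp add: algebra_simps diff_divide_distrib)
    qed
    then show "\<exists>al. (\<forall>Y u v. al Y u v = - al u Y v) \<and> (\<forall>Y u v. al Y u v = - al Y v u) \<and>
        (\<forall>Y u v. nab (christoffel M i) (\<psi> i) y Y u v = al Y u v
          + metric M i y Y u * (- codiff M \<psi> i y v / (real DIM('e) - 1))
          - metric M i y Y v * (- codiff M \<psi> i y u / (real DIM('e) - 1)))"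
      using ext_d_alternating[OF R tf i yc]
      by (intro exI[of _ "\<lambda>Y u v. ext_d \<psi> i y Y u v / 3"]) (metis minus_divide_left)
  qed
qed

section \<open>Open sets in charts and access to the components of 2-forms\<close>

lemma smooth_manifold_chart:
  assumes "smooth_manifold M" "i \<in> idx M"
  shows "openin (mtop M) (chart_dom M i)" "chart_dom M i \<subseteq> topspace (mtop M)"
    "\<And>S. open S \<Longrightarrow> openin (mtop M) {p \<in> chart_dom M i. chart M i p \<in> S}"
    "\<And>U. openin (mtop M) U \<Longrightarrow> open (chart M i ` (U \<inter> chart_dom M i))"
proof -
  have o: "openin (mtop M) (chart_dom M i)" and oc: "open (cod M i)"
    and h: "homeomorphic_map (subtopology (mtop M) (chart_dom M i)) (top_of_set (cod M i)) (chart M i)"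
    using assms unfolding smooth_manifold_def by blast+
  show "openin (mtop M) (chart_dom M i)" by (rule o)
  show sub: "chart_dom M i \<subseteq> topspace (mtop M)" using o by (rule openin_subset)
  have ts: "topspace (subtopology (mtop M) (chart_dom M i)) = chart_dom M i" using sub by auto
  show "openin (mtop M) {p \<in> chart_dom M i. chart M i p \<in> S}" if "open S" for S
  proof -
    have "continuous_map (subtopology (mtop M) (chart_dom M i)) (top_of_set (cod M i)) (chart M i)"
      using h homeomorphic_imp_continuous_map by blast
    moreover have "openin (top_of_set (cod M i)) (cod M i \<inter> S)" using that by auto
    ultimately have "openin (subtopology (mtop M) (chart_dom M i))
        {p \<in> topspace (subtopology (mtop M) (chart_dom M i)). chart M i p \<in> cod M i \<inter> S}"
      by (rule openin_continuous_map_preimage)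
    moreover have "{p \<in> topspace (subtopology (mtop M) (chart_dom M i)). chart M i p \<in> cod M i \<inter> S}
        = {p \<in> chart_dom M i. chart M i p \<in> S}"
      unfolding ts by (auto simp: cod_def)
    ultimately have "openin (subtopology (mtop M) (chart_dom M i)) {p \<in> chart_dom M i. chart M i p \<in> S}"
      by (simp only:)
    from openin_trans_full[OF this o] show ?thesis .
  qed
  show "open (chart M i ` (U \<inter> chart_dom M i))" if "openin (mtop M) U" for U
  proof -
    have "open_map (subtopology (mtop M) (chart_dom M i)) (top_of_set (cod M i)) (chart M i)"
      using h homeomorphic_imp_open_map by blast
    moreover have "openin (subtopology (mtop M) (chart_dom M i)) (U \<inter> chart_dom M i)"
      using that by (simp add: openin_subtopology_Int)
    ultimately have "openin (top_of_set (cod M i)) (chart M i ` (U \<inter> chart_dom M i))"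
      by (simp add: open_map_def)
    then show ?thesis using oc by (simp add: openin_open_eq)
  qed
qed

lemma codiff_zero:
  assumes R: "riemannian_manifold M" and i: "i \<in> idx M" and S: "open S" "y \<in> S" "S \<subseteq> cod M i"
    and z: "\<And>x u v. x \<in> S \<Longrightarrow> \<psi> i x u v = 0"
  shows "codiff M \<psi> i y v = 0"
proof -
  have "nabla_tensor2 M \<psi> i y e e v = 0" for e
    unfolding nabla_tensor2_def using pd_cong[OF S(1,2), of "\<lambda>x. \<psi> i x e v" "\<lambda>x. 0"] z S by simp
  then show ?thesis by (simp add: codiff_def)
qed

lemma two_formD:
  assumes "two_form M \<psi>"
  shows "tensor2_field M \<psi>" "i \<in> idx M \<Longrightarrow> x \<in> cod M i \<Longrightarrow> bilinear (\<psi> i x)"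
    "i \<in> idx M \<Longrightarrow> smooth_on (cod M i) (\<lambda>x. \<psi> i x u v)"
    "i \<in> idx M \<Longrightarrow> j \<in> idx M \<Longrightarrow> p \<in> chart_dom M i \<inter> chart_dom M j \<Longrightarrow>
        \<psi> i (chart M i p) u v = \<psi> j (chart M j p)
          (pd (transition M i j) (chart M i p) u) (pd (transition M i j) (chart M i p) v)"
    "i \<in> idx M \<Longrightarrow> x \<in> cod M i \<Longrightarrow> \<psi> i x u v = - \<psi> i x v u"
    "\<not> (i \<in> idx M \<and> x \<in> cod M i) \<Longrightarrow> \<psi> i x u v = 0"
proof -
  have t: "tensor2_field M \<psi>"
    and a: "\<forall>i\<in>idx M. \<forall>x\<in>cod M i. \<forall>u v. \<psi> i x u v = - \<psi> i x v u"
    and z: "\<forall>i x. \<not> (i \<in> idx M \<and> x \<in> cod M i) \<longrightarrow> \<psi> i x = (\<lambda>u v. 0)"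
    using assms unfolding two_form_def by blast+
  note t' = t[unfolded tensor2_field_def]
  show "tensor2_field M \<psi>" by (rule t)
  show "i \<in> idx M \<Longrightarrow> x \<in> cod M i \<Longrightarrow> bilinear (\<psi> i x)" by (rule t'[THEN conjunct1, rule_format])
  show "i \<in> idx M \<Longrightarrow> smooth_on (cod M i) (\<lambda>x. \<psi> i x u v)"
    by (rule t'[THEN conjunct2, THEN conjunct1, rule_format])
  show "i \<in> idx M \<Longrightarrow> j \<in> idx M \<Longrightarrow> p \<in> chart_dom M i \<inter> chart_dom M j \<Longrightarrow>
        \<psi> i (chart M i p) u v = \<psi> j (chart M j p)
          (pd (transition M i j) (chart M i p) u) (pd (transition M i j) (chart M i p) v)"
    by (rule t'[THEN conjunct2, THEN conjunct2, rule_format])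
  show "i \<in> idx M \<Longrightarrow> x \<in> cod M i \<Longrightarrow> \<psi> i x u v = - \<psi> i x v u" by (rule a[rule_format])
  show "\<not> (i \<in> idx M \<and> x \<in> cod M i) \<Longrightarrow> \<psi> i x u v = 0" using z by metis
qed

section \<open>The upper bound\<close>

text \<open>Connectedness argument for the set \<open>Z\<close> of points near which \<psi>
  vanishes. Vanishing on a neighbourhood, and not only at a point, makes \<open>Z\<close> open and
  also forces the codifferential to vanish on \<open>Z\<close>, so that local uniqueness can be
  restarted at any point of \<open>Z\<close>.\<close>

lemma compatible_CK2_unique:
  fixes M :: "('i, 'm, 'e::euclidean_space, 'z) qriem_scheme"
  assumes M: "quaternionic_kaehler M" and conn: "connected_space (mtop M)" and D: "DIM('e) > 4"
    and \<psi>: "\<psi> \<in> compatible_CK2 M" and i0: "i0 \<in> idx M" "x0 \<in> cod M i0"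
    and z: "\<And>u v. \<psi> i0 x0 u v = 0" "\<And>v. codiff M \<psi> i0 x0 v = 0"
  shows "\<psi> = 0"
proof -
  have R: "riemannian_manifold M" using M by (simp add: quaternionic_kaehler_def)
  have SM: "smooth_manifold M" using R by (simp add: riemannian_manifold_def)
  have cover: "(\<Union>i\<in>idx M. chart_dom M i) = topspace (mtop M)"
    using SM unfolding smooth_manifold_def by blast
  have tf: "two_form M \<psi>" using \<psi> by (simp add: compatible_CK2_def compatible_def)
  note tr = two_formD(4)[OF tf]
  define Z where "Z = {p \<in> topspace (mtop M). \<exists>U. openin (mtop M) U \<and> p \<in> U \<and>
      (\<forall>i\<in>idx M. \<forall>q\<in>U \<inter> chart_dom M i. \<forall>u v. \<psi> i (chart M i q) u v = 0)}"
  \<comment> \<open>N is fixed before q: zero data at any point of N propagate to all of N. This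
    serves both for closedness of \<open>Z\<close> and for the start at the given point.\<close>
  have nbhd: "\<exists>N. openin (mtop M) N \<and> p \<in> N \<and> N \<subseteq> chart_dom M i \<and>
     (\<forall>q\<in>N. (\<forall>u v. \<psi> i (chart M i q) u v = 0) \<longrightarrow> (\<forall>v. codiff M \<psi> i (chart M i q) v = 0) \<longrightarrow> N \<subseteq> Z)"
    if i: "i \<in> idx M" and p: "p \<in> chart_dom M i" for i p
  proof -
    let ?x = "chart M i p"
    have "?x \<in> cod M i" using p by (simp add: cod_def)
    then obtain W J1 J2 J3 where W: "?x \<in> W" "W \<subseteq> cod M i"
      and L: "local_qk W (metric M i) J1 J2 J3 (christoffel M i)"
      and t: "\<And>y. y \<in> W \<Longrightarrow> quat_triple (metric M i y) (J1 y) (J2 y) (J3 y)"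
      and sp: "\<And>y. y \<in> W \<Longrightarrow> qbundle M i y = span {J1 y, J2 y, J3 y}"
      using qk_frame[OF M D i] by blast
    interpret L: local_qk W "metric M i" J1 J2 J3 "christoffel M i" by (rule L)
    obtain r where r: "r > 0" "cball ?x r \<subseteq> W" using L.W W(1) open_contains_cball by blast
    define N where "N = {q \<in> chart_dom M i. chart M i q \<in> ball ?x r}"
    have ck: "L.ckW (\<psi> i) (\<lambda>y v. - codiff M \<psi> i y v / (real DIM('e) - 1))"
      by (rule ckW_of_compatible_CK2[OF M i W(2) L t sp \<psi>])
    have No: "openin (mtop M) N" unfolding N_def by (rule smooth_manifold_chart(3)[OF SM i open_ball])
    have NZ: "N \<subseteq> Z" if q: "q \<in> N" and q0: "\<And>u v. \<psi> i (chart M i q) u v = 0"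
      "\<And>v. codiff M \<psi> i (chart M i q) v = 0" for q
    proof -
      have v: "\<psi> i y u v = 0" if "y \<in> ball ?x r" for y u v
      proof (rule L.local_uniqueness[OF ck compact_cball convex_cball r(2)])
        show "chart M i q \<in> cball ?x r" "y \<in> cball ?x r" using q that by (auto simp: N_def)
      qed (simp_all add: q0)
      \<comment> \<open>The transformation law carries the vanishing over to all other
        charts.\<close>
      have "\<psi> j (chart M j q') u v = 0" if "j \<in> idx M" "q' \<in> N \<inter> chart_dom M j" for j q' u v
        using tr[OF that(1) i, of q'] v[of "chart M i q'"] that(2) by (simp add: N_def)
      then show ?thesis
        unfolding Z_def using No openin_subset[OF No] by blast
    qed
    show ?thesis
    proof (intro exI[of _ N] conjI ballI impI No)
      show "p \<in> N" using p r by (simp add: N_def)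
      show "N \<subseteq> chart_dom M i" by (auto simp: N_def)
    qed (use NZ in blast)
  qed
  have Zz: "\<psi> i (chart M i q) u v = 0" "codiff M \<psi> i (chart M i q) v = 0"
    if i: "i \<in> idx M" and q: "q \<in> Z" "q \<in> chart_dom M i" for i q u v
  proof -
    obtain U where U: "openin (mtop M) U" "q \<in> U"
      "\<And>i q u v. i \<in> idx M \<Longrightarrow> q \<in> U \<inter> chart_dom M i \<Longrightarrow> \<psi> i (chart M i q) u v = 0"
      using q unfolding Z_def by blast
    show "\<psi> i (chart M i q) u v = 0" using U(3)[OF i] U(2) q by blast
    show "codiff M \<psi> i (chart M i q) v = 0"
      by (rule codiff_zero[OF R i smooth_manifold_chart(4)[OF SM i U(1)]])
         (use U q i in \<open>auto simp: cod_def\<close>)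
  qed
  have Zo: "openin (mtop M) Z"
  proof (subst openin_subopen, intro ballI)
    fix p assume p: "p \<in> Z"
    then obtain U where U: "openin (mtop M) U" "p \<in> U"
      "\<forall>i\<in>idx M. \<forall>q\<in>U \<inter> chart_dom M i. \<forall>u v. \<psi> i (chart M i q) u v = 0" unfolding Z_def by blast
    then have "U \<subseteq> Z" unfolding Z_def using openin_subset by blast
    then show "\<exists>T. openin (mtop M) T \<and> p \<in> T \<and> T \<subseteq> Z" using U by blast
  qed
  have "openin (mtop M) (topspace (mtop M) - Z)"
  proof (subst openin_subopen, intro ballI)
    fix p assume p: "p \<in> topspace (mtop M) - Z"
    then obtain i where i: "i \<in> idx M" "p \<in> chart_dom M i" using cover by blast
    then obtain N where N: "openin (mtop M) N" "p \<in> N" "N \<subseteq> chart_dom M i"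
     "\<And>q. q \<in> N \<Longrightarrow> (\<And>u v. \<psi> i (chart M i q) u v = 0) \<Longrightarrow> (\<And>v. codiff M \<psi> i (chart M i q) v = 0) \<Longrightarrow> N \<subseteq> Z"
      using nbhd by meson
    \<comment> \<open>A point of \<open>Z\<close> in N would put all of N, and with it p, into
      \<open>Z\<close>.\<close>
    have "N \<inter> Z = {}"
    proof (rule ccontr)
      assume "N \<inter> Z \<noteq> {}"
      then obtain q where q: "q \<in> N" "q \<in> Z" by blast
      have "N \<subseteq> Z" by (rule N(4)[OF q(1)]) (use Zz[OF i(1) q(2)] N(3) q(1) in blast)+
      then show False using p N(2) by blast
    qed
    then have "N \<subseteq> topspace (mtop M) - Z" using openin_subset[OF N(1)] by blast
    then show "\<exists>T. openin (mtop M) T \<and> p \<in> T \<and> T \<subseteq> topspace (mtop M) - Z" using N(1,2) by blast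
  qed
  then have Zc: "closedin (mtop M) Z" unfolding closedin_def using Z_def by blast
  obtain p0 where p0: "p0 \<in> chart_dom M i0" "x0 = chart M i0 p0" using i0 by (auto simp: cod_def)
  then obtain N where N: "p0 \<in> N" "N \<subseteq> Z" using nbhd[OF i0(1) p0(1)] z by blast
  then have "Z = topspace (mtop M)" using conn Zo Zc unfolding connected_space_clopen_in by blast
  then have "\<psi> i x u v = 0" if "i \<in> idx M" "x \<in> cod M i" for i x u v
    using that Zz(1)[OF that(1)] smooth_manifold_chart(2)[OF SM that(1)] unfolding cod_def by blast
  moreover have "\<psi> i x u v = 0" if "\<not> (i \<in> idx M \<and> x \<in> cod M i)" for i x u v
    using two_formD(6)[OF tf that] .
  ultimately show ?thesis unfolding fun_eq_iff zero_fun_def by blast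
qed

section \<open>The vector space structure on compatible conformal-Killing forms\<close>

lemma differentiable_component:
  assumes "two_form M \<psi>" "riemannian_manifold M" "i \<in> idx M" "x \<in> cod M i"
  shows "(\<lambda>y. \<psi> i y u v) differentiable (at x)"
  using smooth_tensorD(3)[OF tensor2_field_smooth[OF two_formD(1)[OF assms(1)] assms(3)] assms(4)] .

text \<open>The combination \<open>c *\<^sub>R \<psi> + \<psi>'\<close> covers sums and multiples at
  once; the following linearity statements keep this form.\<close>

lemma pd_component_linear:
  fixes M :: "('i, 'm, 'e::euclidean_space, 'z) riem_scheme"
  assumes "two_form M \<psi>" "two_form M \<psi>'" "riemannian_manifold M" "i \<in> idx M" "x \<in> cod M i"
  shows "pd (\<lambda>y. (c *\<^sub>R \<psi> + \<psi>') i y u v) x w = c * pd (\<lambda>y. \<psi> i y u v) x w + pd (\<lambda>y. \<psi>' i y u v) x w"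
proof -
  note d = differentiable_component[OF assms(1,3-5), of u v] differentiable_component[OF assms(2-5), of u v]
  have "((\<lambda>y. c * \<psi> i y u v + \<psi>' i y u v) has_derivative
      (\<lambda>w. c * pd (\<lambda>y. \<psi> i y u v) x w + pd (\<lambda>y. \<psi>' i y u v) x w)) (at x)"
    by (intro has_derivative_add has_derivative_mult_right pd_has_derivative d)
  from pd_eq[OF this] show ?thesis by (simp add: scaleR_fun_def)
qed

lemma nabla_tensor2_linear:
  fixes M :: "('i, 'm, 'e::euclidean_space, 'z) riem_scheme"
  assumes "two_form M \<psi>" "two_form M \<psi>'" "riemannian_manifold M" "i \<in> idx M" "x \<in> cod M i"
  shows "nabla_tensor2 M (c *\<^sub>R \<psi> + \<psi>') i x Y u v
     = c * nabla_tensor2 M \<psi> i x Y u v + nabla_tensor2 M \<psi>' i x Y u v"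
  unfolding nabla_tensor2_def pd_component_linear[OF assms] by (simp add: scaleR_fun_def algebra_simps)

lemma codiff_linear_form:
  fixes M :: "('i, 'm, 'e::euclidean_space, 'z) riem_scheme"
  assumes "two_form M \<psi>" "two_form M \<psi>'" "riemannian_manifold M" "i \<in> idx M" "x \<in> cod M i"
  shows "codiff M (c *\<^sub>R \<psi> + \<psi>') i x v = c * codiff M \<psi> i x v + codiff M \<psi>' i x v"
  unfolding codiff_def nabla_tensor2_linear[OF assms]
  by (simp add: sum.distrib sum_distrib_left)

lemma ext_d_linear_form:
  fixes M :: "('i, 'm, 'e::euclidean_space, 'z) riem_scheme"
  assumes "two_form M \<psi>" "two_form M \<psi>'" "riemannian_manifold M" "i \<in> idx M" "x \<in> cod M i"
  shows "ext_d (c *\<^sub>R \<psi> + \<psi>') i x u v w = c * ext_d \<psi> i x u v w + ext_d \<psi>' i x u v w"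
  unfolding ext_d_def pd_component_linear[OF assms] by (simp add: algebra_simps)

lemma two_form_linear:
  assumes SM: "smooth_manifold M" and a: "two_form M \<psi>" and b: "two_form M \<psi>'"
  shows "two_form M (c *\<^sub>R \<psi> + \<psi>')"
proof -
  have e: "(c *\<^sub>R \<psi> + \<psi>') i x u v = c * \<psi> i x u v + \<psi>' i x u v" for i x u v
    by (simp add: scaleR_fun_def)
  show ?thesis
    unfolding two_form_def tensor2_field_def
  proof (intro conjI ballI allI impI)
    fix i x assume i: "i \<in> idx M" "x \<in> cod M i"
    have "bilinear (\<psi> i x)" "bilinear (\<psi>' i x)"
      by (rule two_formD(2)[OF a i], rule two_formD(2)[OF b i])
    moreover have "(c *\<^sub>R \<psi> + \<psi>') i x = (\<lambda>u v. c * \<psi> i x u v + \<psi>' i x u v)" using e by blast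
    ultimately show "bilinear ((c *\<^sub>R \<psi> + \<psi>') i x)"
      by (simp add: bilinear_def linear_iff algebra_simps)
    show "(c *\<^sub>R \<psi> + \<psi>') i x u v = - (c *\<^sub>R \<psi> + \<psi>') i x v u" for u v
      unfolding e using two_formD(5)[OF a i, of u v] two_formD(5)[OF b i, of u v] by simp
  next
    fix i u v assume i: "i \<in> idx M"
    note o = smooth_manifold_cod_open[OF SM i]
    show "smooth_on (cod M i) (\<lambda>x. (c *\<^sub>R \<psi> + \<psi>') i x u v)"
      unfolding e
      by (intro smooth_on_add smooth_on_mult smooth_on_const o two_formD(3)[OF a i] two_formD(3)[OF b i])
  next
    fix i j p u v assume *: "i \<in> idx M" "j \<in> idx M" "p \<in> chart_dom M i \<inter> chart_dom M j"
    let ?d = "pd (transition M i j) (chart M i p)"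
    show "(c *\<^sub>R \<psi> + \<psi>') i (chart M i p) u v = (c *\<^sub>R \<psi> + \<psi>') j (chart M j p) (?d u) (?d v)"
      unfolding e two_formD(4)[OF a *] two_formD(4)[OF b *] by simp
  next
    fix i x assume "\<not> (i \<in> idx M \<and> x \<in> cod M i)"
    from two_formD(6)[OF a this] two_formD(6)[OF b this]
    show "(c *\<^sub>R \<psi> + \<psi>') i x = (\<lambda>u v. 0)" unfolding fun_eq_iff e by simp
  qed
qed

lemma S2H_linear:
  assumes R: "riemannian_manifold M" and i: "i \<in> idx M" "x \<in> cod M i" and q: "subspace (qbundle M i x)"
    and s: "\<sigma> \<in> S2H M i x" "\<sigma>' \<in> S2H M i x"
  shows "c *\<^sub>R \<sigma> + \<sigma>' \<in> S2H M i x"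
proof -
  obtain A B where A: "A \<in> qbundle M i x" "B \<in> qbundle M i x"
    "\<sigma> = (\<lambda>u v. metric M i x (A u) v)" "\<sigma>' = (\<lambda>u v. metric M i x (B u) v)"
    using s unfolding S2H_def by blast
  have b: "bilinear (metric M i x)" using metric_inner_form[OF R i] by (simp add: inner_form_def)
  have "c *\<^sub>R A + B \<in> qbundle M i x" using q A subspace_add subspace_scale by blast
  moreover have "c *\<^sub>R \<sigma> + \<sigma>' = (\<lambda>u v. metric M i x ((c *\<^sub>R A + B) u) v)"
    by (simp add: A fun_eq_iff scaleR_fun_def bilinear_ladd[OF b] bilinear_lmul[OF b])
  ultimately show ?thesis unfolding S2H_def by blast
qed

lemma S2E_linear:
  assumes s: "\<sigma> \<in> S2E M i x" "\<sigma>' \<in> S2E M i x"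
  shows "c *\<^sub>R \<sigma> + \<sigma>' \<in> S2E M i x"
  unfolding S2E_def
proof (intro CollectI conjI allI impI ballI)
  have e: "(c *\<^sub>R \<sigma> + \<sigma>') u v = c * \<sigma> u v + \<sigma>' u v" for u v by (simp add: scaleR_fun_def)
  have b: "bilinear \<sigma>" "bilinear \<sigma>'" and a: "\<And>u v. \<sigma> u v = - \<sigma> v u" "\<And>u v. \<sigma>' u v = - \<sigma>' v u"
    using s unfolding S2E_def by blast+
  have "c *\<^sub>R \<sigma> + \<sigma>' = (\<lambda>u v. c * \<sigma> u v + \<sigma>' u v)" using e by blast
  then show "bilinear (c *\<^sub>R \<sigma> + \<sigma>')" using b by (simp add: bilinear_def linear_iff algebra_simps)
  show "(c *\<^sub>R \<sigma> + \<sigma>') u v = - (c *\<^sub>R \<sigma> + \<sigma>') v u" for u v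
    unfolding e using a[of u v] by simp
  fix J1 J2 J3 J u v
  assume *: "quat_triple (metric M i x) J1 J2 J3 \<and> qbundle M i x = span {J1, J2, J3}" "J \<in> {J1, J2, J3}"
  have "\<sigma> (J u) (J v) = \<sigma> u v" "\<sigma>' (J u) (J v) = \<sigma>' u v" using s * unfolding S2E_def by blast+
  then show "(c *\<^sub>R \<sigma> + \<sigma>') (J u) (J v) = (c *\<^sub>R \<sigma> + \<sigma>') u v" unfolding e by simp
qed

lemma compatible_CK2_linear:
  fixes M :: "('i, 'm, 'e::euclidean_space, 'z) qriem_scheme"
  assumes M: "quaternionic_kaehler M" and a: "\<psi> \<in> compatible_CK2 M" and b: "\<psi>' \<in> compatible_CK2 M"
  shows "c *\<^sub>R \<psi> + \<psi>' \<in> compatible_CK2 M"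
proof -
  have R: "riemannian_manifold M" using M by (simp add: quaternionic_kaehler_def)
  have SM: "smooth_manifold M" using R by (simp add: riemannian_manifold_def)
  have ta: "two_form M \<psi>" and tb: "two_form M \<psi>'" using a b by (auto simp: compatible_CK2_def compatible_def)
  note tc = two_form_linear[OF SM ta tb, of c]
  have "compatible M (c *\<^sub>R \<psi> + \<psi>')"
    unfolding compatible_def
  proof (intro conjI tc ballI)
    fix i x assume i: "i \<in> idx M" "x \<in> cod M i"
    obtain \<sigma> \<phi> \<sigma>' \<phi>' where s: "\<sigma> \<in> S2H M i x" "\<phi> \<in> S2E M i x" "\<psi> i x = \<sigma> + \<phi>"
      "\<sigma>' \<in> S2H M i x" "\<phi>' \<in> S2E M i x" "\<psi>' i x = \<sigma>' + \<phi>'"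
      using a b i unfolding compatible_CK2_def compatible_def by blast
    have "(c *\<^sub>R \<psi> + \<psi>') i x = (c *\<^sub>R \<sigma> + \<sigma>') + (c *\<^sub>R \<phi> + \<phi>')"
      using s(3,6) by (simp add: fun_eq_iff scaleR_fun_def algebra_simps)
    with S2H_linear[OF R i qbundle_subspace[OF M i] s(1,4), of c] S2E_linear[OF s(2,5), of c]
    show "\<exists>\<sigma>\<in>S2H M i x. \<exists>\<phi>\<in>S2E M i x. (c *\<^sub>R \<psi> + \<psi>') i x = \<sigma> + \<phi>" by blast
  qed
  moreover have "conformal_killing M (c *\<^sub>R \<psi> + \<psi>')"
    unfolding conformal_killing_def
  proof (intro conjI tc ballI allI)
    fix i x Y u v assume i: "i \<in> idx M" "x \<in> cod M i"
    define k l :: real where "k = 1 / (real DIM('e) - 1)" and "l = 1 / 3"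
    have h: "nabla_tensor2 M \<psi> i x Y u v = l * ext_d \<psi> i x Y u v - k
            * (metric M i x Y u * codiff M \<psi> i x v - metric M i x Y v * codiff M \<psi> i x u)"
      "nabla_tensor2 M \<psi>' i x Y u v = l * ext_d \<psi>' i x Y u v - k
            * (metric M i x Y u * codiff M \<psi>' i x v - metric M i x Y v * codiff M \<psi>' i x u)"
      using a b i unfolding compatible_CK2_def conformal_killing_def k_def l_def by blast+
    show "nabla_tensor2 M (c *\<^sub>R \<psi> + \<psi>') i x Y u v = 1 / 3 * ext_d (c *\<^sub>R \<psi> + \<psi>') i x Y u v
        - 1 / (real DIM('e) - 1) * (metric M i x Y u * codiff M (c *\<^sub>R \<psi> + \<psi>') i x v
          - metric M i x Y v * codiff M (c *\<^sub>R \<psi> + \<psi>') i x u)"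
      unfolding nabla_tensor2_linear[OF ta tb R i] ext_d_linear_form[OF ta tb R i]
        codiff_linear_form[OF ta tb R i] h k_def[symmetric] l_def[symmetric]
      by (simp add: algebra_simps)
  qed
  ultimately show ?thesis by (simp add: compatible_CK2_def)
qed

lemma zero_compatible_CK2:
  fixes M :: "('i, 'm, 'e::euclidean_space, 'z) qriem_scheme"
  assumes M: "quaternionic_kaehler M"
  shows "0 \<in> compatible_CK2 M"
proof -
  have R: "riemannian_manifold M" using M by (simp add: quaternionic_kaehler_def)
  have SM: "smooth_manifold M" using R by (simp add: riemannian_manifold_def)
  have t: "two_form M 0"
    using smooth_manifold_cod_open[OF SM]
    by (auto simp: two_form_def tensor2_field_def bilinear_def linear_iff zero_fun_def intro: smooth_on_const)
  have n: "nabla_tensor2 M 0 i x Y u v = 0" "ext_d 0 i x Y u v = 0" for i x Y u v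
    by (simp_all add: nabla_tensor2_def ext_d_def zero_fun_def)
  have s: "0 \<in> S2H M i x" if i: "i \<in> idx M" "x \<in> cod M i" for i x
  proof -
    have b: "bilinear (metric M i x)" using metric_inner_form[OF R i] by (simp add: inner_form_def)
    have "0 \<in> qbundle M i x" using qbundle_subspace[OF M i] subspace_0 by blast
    moreover have "0 = (\<lambda>u v. metric M i x ((0 :: 'e \<Rightarrow> 'e) u) v)"
      by (simp add: fun_eq_iff bilinear_lzero[OF b])
    ultimately show ?thesis unfolding S2H_def by blast
  qed
  have e: "0 \<in> S2E M i x" for i x
    by (auto simp: S2E_def bilinear_def linear_iff)
  have "compatible M 0"
    unfolding compatible_def using t s e by (auto intro!: bexI[of _ 0])
  moreover have "conformal_killing M 0"
    unfolding conformal_killing_def using t by (auto simp: n codiff_def)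
  ultimately show ?thesis by (simp add: compatible_CK2_def)
qed

lemma compatible_CK2_subspace:
  assumes M: "quaternionic_kaehler M"
  shows "subspace (compatible_CK2 M)"
  unfolding subspace_def
proof (intro conjI ballI allI)
  show "0 \<in> compatible_CK2 M" by (rule zero_compatible_CK2[OF M])
  show "x + y \<in> compatible_CK2 M" if "x \<in> compatible_CK2 M" "y \<in> compatible_CK2 M" for x y
    using compatible_CK2_linear[OF M that, of 1] by simp
  show "c *\<^sub>R x \<in> compatible_CK2 M" if "x \<in> compatible_CK2 M" for c x
    using compatible_CK2_linear[OF M that zero_compatible_CK2[OF M], of c] by simp
qed

section \<open>Counting the evaluation functionals\<close>

lemma card_upper_pairs: "card {(a, b). a < b \<and> b < (m::nat)} * 2 = m * (m - 1)"
proof (induction m)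
  case (Suc m)
  have "{(a, b). a < b \<and> b < Suc m} = {(a, b). a < b \<and> b < m} \<union> (\<lambda>a. (a, m)) ` {..<m}"
    by (auto simp: less_Suc_eq)
  moreover have "finite {(a, b). a < b \<and> b < m}"
    by (rule finite_subset[of _ "{..<m} \<times> {..<m}"]) auto
  moreover have "card ((\<lambda>a. (a, m)) ` {..<m}) = m" by (simp add: card_image inj_on_def)
  ultimately have "card {(a, b). a < b \<and> b < Suc m} = card {(a, b). a < b \<and> b < m} + m"
    by (subst \<open>_ = _ \<union> _\<close>, subst card_Un_disjoint) auto
  then have "card {(a, b). a < b \<and> b < Suc m} * 2 = m * (m - 1) + 2 * m" using Suc by simp
  then show ?case by (cases m) (simp_all add: algebra_simps)
qed simp

lemma card_upper_eq_pairs: "card {(a, b). a \<le> b \<and> b < (m::nat)} * 2 = m * (m + 1)"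
proof -
  \<comment> \<open>Shifting the second index by one turns weak into strict inequalities.\<close>
  have "{(a, b). a < b \<and> b < Suc m} = (\<lambda>(a, b). (a, Suc b)) ` {(a, b). a \<le> b \<and> b < m}"
  proof (intro set_eqI iffI)
    fix p assume "p \<in> {(a, b). a < b \<and> b < Suc m}"
    then obtain a b where p: "p = (a, b)" "a < b" "b < Suc m" by blast
    then obtain c where "b = Suc c" by (cases b) auto
    with p show "p \<in> (\<lambda>(a, b). (a, Suc b)) ` {(a, b). a \<le> b \<and> b < m}"
      by (intro image_eqI[of _ _ "(a, c)"]) auto
  qed auto
  then have "card {(a, b). a < b \<and> b < Suc m} = card {(a, b). a \<le> b \<and> b < m}"
    by (simp add: card_image inj_on_def)
  then show ?thesis using card_upper_pairs[of "Suc m"] by simp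
qed

text \<open>The forms are separated by functionals at one point: \<open>F0\<close> reads the S^2H
  part, \<open>F1\<close> and \<open>F2\<close> the S^2E part in a quaternionic basis, and
  \<open>F3\<close> the codifferential. That they determine the form is \<open>compat_zero\<close>
  together with \<open>compatible_CK2_unique\<close>.\<close>

theorem compatible_CK2_dim_le:
  fixes M :: "('i, 'm, 'e::euclidean_space, 'z) qriem_scheme"
  assumes M: "quaternionic_kaehler M" and conn: "connected_space (mtop M)" and n: "n \<ge> 2" "DIM('e) = 4 * n"
  shows "finite_dim (compatible_CK2 M) \<and> dim (compatible_CK2 M) \<le> (n + 1) * (2 * n + 3)"
proof (cases "\<exists>i x. i \<in> idx M \<and> x \<in> cod M i")
  \<comment> \<open>No chart contains a point. Components are normalised to 0 outside the charts, so
    only the zero form exists.\<close>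
  case False
  have "\<psi> = 0" if "\<psi> \<in> compatible_CK2 M" for \<psi>
  proof -
    have t: "two_form M \<psi>" using that by (simp add: compatible_CK2_def compatible_def)
    have "\<psi> i x u v = 0" for i x u v by (rule two_formD(6)[OF t]) (use False in blast)
    then show ?thesis by (simp add: fun_eq_iff)
  qed
  then have "compatible_CK2 M \<subseteq> span {}" by auto
  then show ?thesis
    unfolding finite_dim_def using dim_le_card[of "compatible_CK2 M" "{}"]
    by (intro conjI exI[of _ "{}"]) auto
next
  case True
  then obtain i0 x0 where i: "i0 \<in> idx M" "x0 \<in> cod M i0" by blast
  have R: "riemannian_manifold M" using M by (simp add: quaternionic_kaehler_def)
  have D: "DIM('e) > 4" using n by simp
  obtain W J1 J2 J3 where x0: "x0 \<in> W" and W: "W \<subseteq> cod M i0"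
    and t: "\<And>y. y \<in> W \<Longrightarrow> quat_triple (metric M i0 y) (J1 y) (J2 y) (J3 y)"
    and sp: "\<And>y. y \<in> W \<Longrightarrow> qbundle M i0 y = span {J1 y, J2 y, J3 y}"
    by (rule qk_frame[OF M D i]) blast
  interpret Q: quat_inner "metric M i0 x0" "J1 x0" "J2 x0" "J3 x0"
    by (rule quat_inner_metric[OF R i t[OF x0]])
  obtain m e where m: "4 * m = DIM('e)" and e: "span ((\<lambda>(a, k). Q.qJ k (e a)) ` ({..<m} \<times> {..<4})) = UNIV"
    by (rule Q.quat_basis)
  have mn: "m = n" using m n by simp
  obtain w :: 'e where w: "w \<noteq> 0" using Q.perp_vector[OF D] by blast
  let ?c = "\<lambda>J K L \<psi>. (\<psi> :: ('i, 'e) tensor2) i0 x0 w (J x0 w) + \<psi> i0 x0 (K x0 w) (L x0 w)"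
  define F0 where "F0 = {?c J1 J2 J3, ?c J2 J3 J1, ?c J3 J1 J2}"
  define F1 where "F1 = (\<lambda>(a, b) \<psi>. (\<psi> :: ('i, 'e) tensor2) i0 x0 (e a) (e b)) ` {(a, b). a < b \<and> b < m}"
  define F2 where "F2 = (\<lambda>((a, b), k) \<psi>. (\<psi> :: ('i, 'e) tensor2) i0 x0 (e a) (Q.qJ k (e b)))
     ` ({(a, b). a \<le> b \<and> b < m} \<times> {1, 2, 3})"
  define F3 where "F3 = (\<lambda>b \<psi>. codiff M \<psi> i0 x0 b) ` Basis"
  let ?F = "F0 \<union> F1 \<union> F2 \<union> F3"
  have f1: "finite {(a, b). a < b \<and> b < m}" by (rule finite_subset[of _ "{..<m} \<times> {..<m}"]) auto
  have f2: "finite {(a, b). a \<le> b \<and> b < m}" by (rule finite_subset[of _ "{..<m} \<times> {..<m}"]) auto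
  have fin: "finite ?F" by (simp add: F0_def F1_def F2_def F3_def f1 f2)
  have tf: "two_form M \<psi>" if "\<psi> \<in> compatible_CK2 M" for \<psi>
    using that by (simp add: compatible_CK2_def compatible_def)
  have lin: "f (c *\<^sub>R \<psi> + \<psi>') = c * f \<psi> + f \<psi>'"
    if f: "f \<in> ?F" and \<psi>: "\<psi> \<in> compatible_CK2 M" "\<psi>' \<in> compatible_CK2 M" for f c \<psi> \<psi>'
    using f codiff_linear_form[OF tf[OF \<psi>(1)] tf[OF \<psi>(2)] R i]
    unfolding F0_def F1_def F2_def F3_def by (auto simp: scaleR_fun_def algebra_simps)
  have Z: "0 \<in> compatible_CK2 M" by (rule zero_compatible_CK2[OF M])
  have f0: "f 0 = 0" if "f \<in> ?F" for f using lin[OF that Z Z, of 1] by simp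
  have "finite_dim (compatible_CK2 M) \<and> dim (compatible_CK2 M) \<le> card ?F"
  proof (rule dim_le_functionals[OF fin compatible_CK2_subspace[OF M]])
    show "f (x + y) = f x + f y" if "f \<in> ?F" "x \<in> compatible_CK2 M" "y \<in> compatible_CK2 M" for f x y
      using lin[OF that, of 1] by simp
    show "f (c *\<^sub>R x) = c * f x" if "f \<in> ?F" "x \<in> compatible_CK2 M" for f x c
      using lin[OF that Z, of c] f0[OF that(1)] by simp
    fix \<psi> assume \<psi>: "\<psi> \<in> compatible_CK2 M" and z: "\<And>f. f \<in> ?F \<Longrightarrow> f \<psi> = 0"
    have z0: "?c J1 J2 J3 \<psi> = 0" "?c J2 J3 J1 \<psi> = 0" "?c J3 J1 J2 \<psi> = 0"
      by (rule z; simp add: F0_def)+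
    have z1: "\<psi> i0 x0 (e a) (e b) = 0" if "a < b" "b < m" for a b
      using z[of "\<lambda>\<psi>. \<psi> i0 x0 (e a) (e b)"] that by (force simp: F1_def)
    have z2: "\<psi> i0 x0 (e a) (Q.qJ k (e b)) = 0" if "a \<le> b" "b < m" "k < 4" "k \<noteq> 0" for a b k
    proof -
      have "((a, b), k) \<in> {(a, b). a \<le> b \<and> b < m} \<times> {1, 2, 3}" using that by auto
      then have "(\<lambda>\<psi>. \<psi> i0 x0 (e a) (Q.qJ k (e b))) \<in> F2" unfolding F2_def by (rule rev_image_eqI) simp
      then show ?thesis using z by blast
    qed
    have z3: "codiff M \<psi> i0 x0 b = 0" if "b \<in> Basis" for b
      using z[of "\<lambda>\<psi>. codiff M \<psi> i0 x0 b"] that by (auto simp: F3_def)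
    have cl: "linear (codiff M \<psi> i0 x0)" by (rule codiff_linear[OF R tf[OF \<psi>] i])
    have c: "compatible M \<psi>" using \<psi> by (simp add: compatible_CK2_def)
    have cf: "Q.compat_form (\<psi> i0 x0)" by (rule compatible_compat_form[OF M i c t[OF x0] sp[OF x0]])
    have b: "bilinear (\<psi> i0 x0)" and a: "\<And>u v. \<psi> i0 x0 u v = - \<psi> i0 x0 v u"
      by (rule two_formD(2)[OF tf[OF \<psi>] i], rule two_formD(5)[OF tf[OF \<psi>] i])
    show "\<psi> = 0"
    proof (rule compatible_CK2_unique[OF M conn D \<psi> i])
      show "\<psi> i0 x0 u v = 0" for u v by (rule Q.compat_zero[OF cf b a w z0 e z1 z2])
      show "codiff M \<psi> i0 x0 v = 0" for v
        using linear_expand[OF cl, of v] z3 by simp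
    qed
  qed
  moreover have "card ?F \<le> (n + 1) * (2 * n + 3)"
  proof -
    have "card F0 \<le> 3" by (simp add: F0_def card_insert_if)
    moreover have "card F1 \<le> card {(a, b). a < b \<and> b < m}" unfolding F1_def by (rule card_image_le[OF f1])
    moreover have "card F2 \<le> card {(a, b). a \<le> b \<and> b < m} * 3"
    proof -
      have "card ({(a, b). a \<le> b \<and> b < m} \<times> {1, 2, 3::nat}) = card {(a, b). a \<le> b \<and> b < m} * 3"
        by (simp add: card_cartesian_product)
      moreover have "card F2 \<le> card ({(a, b). a \<le> b \<and> b < m} \<times> {1, 2, 3::nat})"
        unfolding F2_def by (rule card_image_le) (simp add: f2)
      ultimately show ?thesis by simp
    qed
    moreover have "card F3 \<le> 4 * n" unfolding F3_def using card_image_le[of "Basis :: 'e set"] n by auto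
    moreover have "card ?F \<le> card F0 + card F1 + card F2 + card F3"
      by (meson card_Un_le le_trans add_le_mono le_refl)
    ultimately have "card ?F * 2 \<le> 2 * 3 + m * (m - 1) + 3 * (m * (m + 1)) + 8 * n"
      using card_upper_pairs[of m] card_upper_eq_pairs[of m] by linarith
    moreover have "2 * 3 + m * (m - 1) + 3 * (m * (m + 1)) + 8 * n = 2 * ((n + 1) * (2 * n + 3))"
      using n(1) by (cases n) (simp_all add: mn algebra_simps)
    ultimately show ?thesis by linarith
  qed
  ultimately show ?thesis by linarith
qed

section \<open>Quaternionic projective space\<close>

lemma inner_quat: "(p :: quat) \<bullet> q = Re (fst p) * Re (fst q) + Im (fst p) * Im (fst q)
    + Re (snd p) * Re (snd q) + Im (snd p) * Im (snd q)"
  by (simp add: inner_prod_def inner_complex_def)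

lemma qmul_assoc: "qmul (qmul p q) r = qmul p (qmul q r)"
  by (simp add: qmul_def algebra_simps)

lemma qmul_one [simp]: "qmul qone p = p" "qmul p qone = p"
  by (simp_all add: qmul_def qone_def)

lemma qmul_linear:
  "qmul (p + q) r = qmul p r + qmul q r" "qmul r (p + q) = qmul r p + qmul r q"
  "qmul (c *\<^sub>R p) r = c *\<^sub>R qmul p r" "qmul r (c *\<^sub>R p) = c *\<^sub>R qmul r p"
  by (auto simp: qmul_def prod_eq_iff algebra_simps)

lemma bilinear_qmul: "bilinear qmul"
  by (auto simp: bilinear_def linear_iff qmul_linear)

lemma linear_qcnj: "linear qcnj"
  by (auto simp: linear_iff qcnj_def)

lemma bounded_linear_qcnj: "bounded_linear qcnj"
  using linear_qcnj by (simp add: linear_conv_bounded_linear)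

lemma qcnj_qcnj [simp]: "qcnj (qcnj p) = p"
  by (simp add: qcnj_def)

lemma qcnj_qmul: "qcnj (qmul p q) = qmul (qcnj q) (qcnj p)"
  by (simp add: qmul_def qcnj_def algebra_simps)

lemma qcnj_linear [simp]: "qcnj (p + q) = qcnj p + qcnj q" "qcnj (c *\<^sub>R p) = c *\<^sub>R qcnj p"
  "qcnj (p - q) = qcnj p - qcnj q" "qcnj (- p) = - qcnj p" "qcnj 0 = 0" "qcnj qone = qone"
  using linear_qcnj by (auto simp: linear_iff linear_diff linear_neg linear_0 qcnj_def qone_def)

lemma qmul_qcnj: "qmul p (qcnj p) = (p \<bullet> p) *\<^sub>R qone" "qmul (qcnj p) p = (p \<bullet> p) *\<^sub>R qone"
  by (auto simp: qmul_def qcnj_def qone_def inner_quat prod_eq_iff complex_eq_iff algebra_simps)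

lemma inner_qcnj: "qcnj p \<bullet> q = p \<bullet> qcnj q"
  by (auto simp: inner_quat qcnj_def)

lemma inner_qmul_left: "qmul p q \<bullet> r = q \<bullet> qmul (qcnj p) r"
  and inner_qmul_right: "qmul p q \<bullet> r = p \<bullet> qmul r (qcnj q)"
  by (auto simp: inner_quat qmul_def qcnj_def algebra_simps)

lemma inner_qone: "qone \<bullet> p = Re (fst p)" "p \<bullet> qone = Re (fst p)" "qone \<bullet> qone = 1"
  by (auto simp: inner_quat qone_def)

lemma add_qcnj: "p + qcnj p = (2 * (qone \<bullet> p)) *\<^sub>R qone"
  by (auto simp: qcnj_def qone_def inner_quat prod_eq_iff complex_eq_iff)

lemma qcnj_eq_neg_iff: "qcnj p = - p \<longleftrightarrow> Re (fst p) = 0"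
  by (auto simp: qcnj_def prod_eq_iff complex_eq_iff)

lemma inner_qmul_self: "qmul p q \<bullet> qmul p r = (p \<bullet> p) * (q \<bullet> r)" "qmul q p \<bullet> qmul r p = (p \<bullet> p) * (q \<bullet> r)"
proof -
  show "qmul p q \<bullet> qmul p r = (p \<bullet> p) * (q \<bullet> r)"
    by (simp add: inner_qmul_left qmul_assoc[symmetric] qmul_qcnj qmul_linear)
  show "qmul q p \<bullet> qmul r p = (p \<bullet> p) * (q \<bullet> r)"
    by (simp add: inner_qmul_right qmul_assoc qmul_qcnj qmul_linear)
qed

definition qinv :: "quat \<Rightarrow> quat" where
  "qinv p = inverse (p \<bullet> p) *\<^sub>R qcnj p"

lemma qmul_qinv: "p \<noteq> 0 \<Longrightarrow> qmul p (qinv p) = qone" "p \<noteq> 0 \<Longrightarrow> qmul (qinv p) p = qone"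
  by (auto simp: qinv_def qmul_linear qmul_qcnj)

lemma qone_neq_0 [simp]: "qone \<noteq> 0" "0 \<noteq> qone"
  by (auto simp: qone_def zero_prod_def)

lemma qinv_neq_0: "p \<noteq> 0 \<Longrightarrow> qinv p \<noteq> 0"
  using qmul_qinv(1)[of p] bilinear_rzero[OF bilinear_qmul, of p] by auto

lemma qmul_zero [simp]: "qmul 0 p = 0" "qmul p 0 = 0"
  by (auto simp: bilinear_lzero bilinear_rzero bilinear_qmul)

lemma qmul_eq_0_iff: "qmul p q = 0 \<longleftrightarrow> p = 0 \<or> q = 0"
  by (metis qmul_assoc qmul_one(1) qmul_qinv(2) qmul_zero)

lemma qscale_nth [simp]: "qscale v q $ l = qmul (v $ l) q"
  by (simp add: qscale_def)

lemma bilinear_qscale: "bilinear qscale"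
  by (auto simp: bilinear_def linear_iff vec_eq_iff qmul_linear)

lemma bounded_bilinear_qscale: "bounded_bilinear (qscale :: quat ^ 'k::finite \<Rightarrow> _)"
  using bilinear_qscale by (simp add: bilinear_conv_bounded_bilinear)

lemmas qscale_linear = bilinear_ladd[OF bilinear_qscale] bilinear_radd[OF bilinear_qscale]
  bilinear_lmul[OF bilinear_qscale] bilinear_rmul[OF bilinear_qscale]
  bilinear_lsub[OF bilinear_qscale] bilinear_rsub[OF bilinear_qscale]
  bilinear_lneg[OF bilinear_qscale] bilinear_rneg[OF bilinear_qscale]
  bilinear_lzero[OF bilinear_qscale] bilinear_rzero[OF bilinear_qscale]

lemma qscale_qscale: "qscale (qscale v p) q = qscale v (qmul p q)"
  by (simp add: vec_eq_iff qmul_assoc)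

lemma qscale_qone [simp]: "qscale v qone = v"
  by (simp add: vec_eq_iff)

lemma inner_qscale_right: "qscale v q \<bullet> w = v \<bullet> qscale w (qcnj q)"
  by (simp add: inner_vec_def inner_qmul_right)

text \<open>Characterises the quaternionic hermitian form through the real inner product, which lets all
  computations below be carried out with real inner products.\<close>

lemma inner_qscale: "qscale v p \<bullet> w = p \<bullet> qherm v w"
  by (simp add: inner_vec_def qherm_def inner_sum_right inner_qmul_left)

lemma qherm_eqI: "(\<And>p. p \<bullet> q = p \<bullet> r) \<Longrightarrow> q = (r :: quat)"
  by (metis inner_eq_zero_iff inner_diff_right right_minus_eq)

lemma bilinear_qherm: "bilinear (qherm :: quat ^ 'k::finite \<Rightarrow> _)"
  by (auto simp: bilinear_def linear_iff qherm_def qmul_linear sum.distrib scaleR_sum_right)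

lemma bounded_bilinear_qherm: "bounded_bilinear (qherm :: quat ^ 'k::finite \<Rightarrow> _)"
  using bilinear_qherm by (simp add: bilinear_conv_bounded_bilinear)

lemmas qherm_linear = bilinear_ladd[OF bilinear_qherm] bilinear_radd[OF bilinear_qherm]
  bilinear_lmul[OF bilinear_qherm] bilinear_rmul[OF bilinear_qherm]
  bilinear_lsub[OF bilinear_qherm] bilinear_rsub[OF bilinear_qherm]
  bilinear_lneg[OF bilinear_qherm] bilinear_rneg[OF bilinear_qherm]
  bilinear_lzero[OF bilinear_qherm] bilinear_rzero[OF bilinear_qherm]

lemma qherm_qscale: "qherm v (qscale w q) = qmul (qherm v w) q" "qherm (qscale v q) w = qmul (qcnj q) (qherm v w)"
proof -
  have l: "qmul (\<Sum>l\<in>A. f l) q = (\<Sum>l\<in>A. qmul (f l) q)" "qmul q (\<Sum>l\<in>A. f l) = (\<Sum>l\<in>A. qmul q (f l))"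
    for A and f :: "'k \<Rightarrow> quat" and q
    by (rule linear_sum; simp add: linear_iff qmul_linear)+
  show "qherm v (qscale w q) = qmul (qherm v w) q" by (simp add: qherm_def l qmul_assoc)
  show "qherm (qscale v q) w = qmul (qcnj q) (qherm v w)" by (simp add: qherm_def l qmul_assoc qcnj_qmul)
qed

lemma qcnj_qherm: "qcnj (qherm v w) = qherm w v"
proof -
  have s: "qcnj (\<Sum>l\<in>A. f l) = (\<Sum>l\<in>A. qcnj (f l))" for A and f :: "'k \<Rightarrow> quat"
    using linear_sum[OF linear_qcnj] .
  show ?thesis by (simp add: qherm_def s qcnj_qmul)
qed

lemma qherm_self: "qherm v v = (v \<bullet> v) *\<^sub>R qone"
proof -
  have "(\<Sum>l\<in>UNIV. (v $ l \<bullet> v $ l) *\<^sub>R qone) = (\<Sum>l\<in>UNIV. v $ l \<bullet> v $ l) *\<^sub>R qone"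
    by (simp add: scaleR_sum_left)
  then show ?thesis by (simp add: qherm_def qmul_qcnj inner_vec_def)
qed

lemma inner_qherm: "qone \<bullet> qherm v w = v \<bullet> w" "qherm v w \<bullet> qone = v \<bullet> w"
  using inner_qscale[of v qone w] by (simp_all add: inner_commute)

lemma inner_qscale_qscale: "qscale v q \<bullet> qscale w q = (q \<bullet> q) * (v \<bullet> w)"
  by (simp add: inner_qscale_right qscale_qscale qmul_qcnj qscale_linear)

lemma qscale_cancel: "q \<noteq> 0 \<Longrightarrow> qscale v q = qscale w q \<longleftrightarrow> v = w"
  by (metis qmul_qinv(1) qscale_qone qscale_qscale)

lemma qscale_eq_0_iff: "qscale v q = 0 \<longleftrightarrow> v = 0 \<or> q = 0"
  by (metis qscale_cancel qscale_linear(9,10))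

text \<open>Horizontal part: the component of \<open>w\<close> orthogonal to the quaternionic line of \<open>s\<close>.\<close>

definition hor :: "quat ^ 'k::finite \<Rightarrow> quat ^ 'k \<Rightarrow> quat ^ 'k" where
  "hor s w = w - inverse (s \<bullet> s) *\<^sub>R qscale s (qherm s w)"

lemma linear_hor: "linear (hor s)"
  by (auto simp: linear_iff hor_def qherm_linear qscale_linear algebra_simps)

lemmas hor_linear = linear_add[OF linear_hor] linear_scale[OF linear_hor] linear_diff[OF linear_hor]
  linear_neg[OF linear_hor] linear_0[OF linear_hor]

lemma hor_qscale: "hor s (qscale w q) = qscale (hor s w) q"
  by (simp add: hor_def qherm_qscale qscale_linear qscale_qscale)

lemma hor_vertical: "s \<noteq> 0 \<Longrightarrow> hor s (qscale s q) = 0"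
  by (simp add: hor_def qherm_qscale qherm_self qmul_linear qscale_linear)

lemma qherm_hor: "s \<noteq> 0 \<Longrightarrow> qherm s (hor s w) = 0"
  by (simp add: hor_def qherm_linear qherm_qscale qherm_self qmul_linear)

lemma inner_vertical_hor: "s \<noteq> 0 \<Longrightarrow> qscale s q \<bullet> hor s w = 0"
  by (simp add: inner_qscale qherm_hor)

lemma inner_hor: "s \<noteq> 0 \<Longrightarrow> hor s v \<bullet> hor s w = hor s v \<bullet> w"
  unfolding hor_def[of s w] inner_diff_right inner_scaleR_right
  using inner_vertical_hor[of s "qherm s w" v] by (simp add: inner_commute)

lemma inner_hor_expand: "s \<noteq> 0 \<Longrightarrow> hor s v \<bullet> hor s w = v \<bullet> w - (qherm s v \<bullet> qherm s w) / (s \<bullet> s)"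
  unfolding inner_hor by (simp add: hor_def inner_diff_left inner_qscale divide_inverse)

lemma decompose_hor: "w = hor s w + inverse (s \<bullet> s) *\<^sub>R qscale s (qherm s w)"
  by (simp add: hor_def)

text \<open>The horizontal projection depends only on the line and not on the chosen
  generator.\<close>

lemma hor_scale_base: "l \<noteq> 0 \<Longrightarrow> hor (qscale s l) w = hor s w"
proof -
  assume l: "l \<noteq> 0"
  have "qscale (qscale s l) (qherm (qscale s l) w) = (l \<bullet> l) *\<^sub>R qscale s (qherm s w)"
    by (simp add: qherm_qscale qscale_qscale qmul_assoc[symmetric] qmul_qcnj qmul_linear qscale_linear)
  then show ?thesis using l by (simp add: hor_def inner_qscale_qscale)
qed

lemma Re_qone [simp]: "Re (fst qone) = 1"
  by (simp add: qone_def)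

section \<open>Affine charts and their lifts\<close>

definition rho :: "'k option \<Rightarrow> 'k \<Rightarrow> 'k option" where
  "rho i k = (if Some k = i then None else Some k)"

text \<open>The differential of \<open>affine_lift i\<close>: the constant entry 1 at position
  \<open>i\<close> becomes 0.\<close>

definition tlift :: "'k option \<Rightarrow> quat ^ 'k::finite \<Rightarrow> quat ^ 'k option" where
  "tlift i u = (\<chi> l. if l = i then 0 else case l of Some k \<Rightarrow> u $ k | None \<Rightarrow> u $ the i)"

definition proj :: "'k option \<Rightarrow> quat ^ 'k::finite option \<Rightarrow> quat ^ 'k" where
  "proj i w = (\<chi> k. w $ rho i k)"

text \<open>\<open>rho i\<close> enumerates the positions other than \<open>i\<close> in the layout
  of \<open>affine_lift\<close>, where for \<open>i = Some m\<close> the coordinate \<open>m\<close>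
  sits at position \<open>None\<close>. Sums over all positions can thus be split into position
  \<open>i\<close> and the affine coordinates.\<close>

lemma bij_rho: "bij_betw (rho i) UNIV (UNIV - {i})"
proof -
  have "l \<in> range (rho i)" if "l \<noteq> i" for l
  proof (cases l)
    case None
    with that obtain m where "i = Some m" by (cases i) auto
    with None show ?thesis by (intro image_eqI[of _ _ m]) (auto simp: rho_def)
  next
    case (Some k)
    with that show ?thesis by (intro image_eqI[of _ _ k]) (auto simp: rho_def)
  qed
  then show ?thesis by (auto simp: bij_betw_def inj_on_def rho_def split: if_splits)
qed

lemma sum_rho:
  fixes f :: "'k::finite option \<Rightarrow> 'b::comm_monoid_add"
  shows "(\<Sum>l\<in>UNIV. f l) = f i + (\<Sum>k\<in>UNIV. f (rho i k))"
  using sum.remove[of UNIV i f] sum.reindex_bij_betw[OF bij_rho, of f i] by simp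

lemma tlift_rho [simp]: "tlift i u $ rho i k = u $ k"
  by (auto simp: tlift_def rho_def)

lemma tlift_self [simp]: "tlift i u $ i = 0"
  by (simp add: tlift_def)

lemma affine_lift_rho [simp]: "affine_lift i u $ rho i k = u $ k"
  by (auto simp: affine_lift_def rho_def)

lemma affine_lift_self [simp]: "affine_lift i u $ i = qone"
  by (simp add: affine_lift_def)

lemma vec_rho_eqI:
  assumes "v $ i = w $ i" "\<And>k. v $ rho i k = w $ rho i k"
  shows "v = w"
proof -
  have "v $ l = w $ l" for l
  proof (cases "l = i")
    case False
    then have "l \<in> range (rho i)" using bij_rho[of i] by (simp add: bij_betw_def)
    then show ?thesis using assms(2) by blast
  qed (use assms(1) in simp)
  then show ?thesis by (simp add: vec_eq_iff)
qed

lemma proj_tlift [simp]: "proj i (tlift i u) = u"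
  by (simp add: proj_def vec_eq_iff)

lemma proj_affine_lift [simp]: "proj i (affine_lift i u) = u"
  by (simp add: proj_def vec_eq_iff)

lemma affine_lift_proj: "w $ i = qone \<Longrightarrow> affine_lift i (proj i w) = w"
  by (rule vec_rho_eqI[of _ i]) (simp_all add: proj_def)

lemma affine_lift_tlift: "affine_lift i x = affine_lift i 0 + tlift i x"
  by (rule vec_rho_eqI[of _ i]) simp_all

lemma linear_tlift: "linear (tlift i)"
  unfolding linear_iff by (auto intro: vec_rho_eqI[of _ i])

lemma bounded_linear_tlift: "bounded_linear (tlift i)"
  using linear_tlift by (simp add: linear_conv_bounded_linear)

lemmas tlift_linear = linear_add[OF linear_tlift] linear_scale[OF linear_tlift]
  linear_diff[OF linear_tlift] linear_neg[OF linear_tlift] linear_0[OF linear_tlift]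

lemma linear_proj: "linear (proj i)"
  by (auto simp: linear_iff proj_def vec_eq_iff)

lemma bounded_linear_proj: "bounded_linear (proj i)"
  using linear_proj by (simp add: linear_conv_bounded_linear)

lemma tlift_qscale: "tlift i (qscale u q) = qscale (tlift i u) q"
  by (rule vec_rho_eqI[of _ i]) simp_all

lemma inner_tlift: "tlift i u \<bullet> tlift i v = u \<bullet> v"
  by (simp add: inner_vec_def sum_rho[of _ i])

lemma inner_affine_lift: "affine_lift i x \<bullet> affine_lift i x = 1 + x \<bullet> x"
  by (simp add: inner_vec_def sum_rho[of _ i] inner_qone)

lemma qherm_affine_lift: "qherm (affine_lift i x) (tlift i u) = qherm x u"
  by (simp add: qherm_def sum_rho[of _ i])

lemma affine_lift_neq_0 [simp]: "affine_lift i x \<noteq> 0"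
  by (metis affine_lift_self qone_neq_0(1) zero_index)

lemma affine_lift_has_derivative: "(affine_lift i has_derivative tlift i) (at x)"
proof -
  have "((\<lambda>x. affine_lift i 0 + tlift i x) has_derivative (\<lambda>u. 0 + tlift i u)) (at x)"
    by (intro has_derivative_add has_derivative_const bounded_linear_imp_has_derivative bounded_linear_tlift)
  then show ?thesis by (simp add: affine_lift_tlift[symmetric] eta_contract_eq)
qed

lemma smooth_affine_lift: "open S \<Longrightarrow> smooth_on S (affine_lift i)"
  using smooth_on_add[of S "\<lambda>x. affine_lift i 0" "tlift i"]
  by (simp add: smooth_on_const smooth_on_bounded_linear[OF _ bounded_linear_tlift] affine_lift_tlift[symmetric])

lemma continuous_affine_lift: "continuous_on S (affine_lift i)"
  using continuous_on_subset[OF smooth_on_continuous_on[OF smooth_affine_lift[OF open_UNIV]]] by blast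

subsection \<open>Quaternionic lines\<close>

lemma qline_self [simp]: "v \<in> qline v"
  unfolding qline_def by (metis qscale_qone rangeI)

lemma qline_qscale: "l \<noteq> 0 \<Longrightarrow> qline (qscale v l) = qline v"
proof -
  assume l: "l \<noteq> 0"
  have "qscale v q = qscale (qscale v l) (qmul (qinv l) q)" for q
    using l by (simp add: qscale_qscale qmul_assoc[symmetric] qmul_qinv)
  then show ?thesis unfolding qline_def by (auto simp: qscale_qscale)
qed

lemma qline_eq:
  assumes "w \<in> qline v" "w \<noteq> 0"
  shows "qline w = qline v"
proof -
  obtain l where l: "w = qscale v l" using assms(1) unfolding qline_def by blast
  then have "l \<noteq> 0" using assms(2) by (auto simp: qscale_linear)
  then show ?thesis unfolding l by (rule qline_qscale)
qed

lemma qline_eq_iff: "v \<noteq> 0 \<Longrightarrow> w \<noteq> 0 \<Longrightarrow> qline v = qline w \<longleftrightarrow> (\<exists>l. l \<noteq> 0 \<and> w = qscale v l)"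
  by (metis qline_def qline_qscale qline_self qscale_eq_0_iff rangeE)

definition normalize_at :: "'k option \<Rightarrow> quat ^ 'k::finite option \<Rightarrow> quat ^ 'k" where
  "normalize_at i w = proj i (qscale w (qinv (w $ i)))"

lemma affine_lift_normalize: "w $ i \<noteq> 0 \<Longrightarrow> affine_lift i (normalize_at i w) = qscale w (qinv (w $ i))"
  unfolding normalize_at_def by (rule affine_lift_proj) (simp add: qmul_qinv)

text \<open>Resolves the definite description in the charts: a line meets the affine hyperplane of
  entry 1 at position \<open>i\<close> in a single point, found by right division by that
  entry.\<close>

lemma affine_lift_in_qline: "w $ i \<noteq> 0 \<Longrightarrow> affine_lift i x \<in> qline w \<longleftrightarrow> x = normalize_at i w"
proof
  assume w: "w $ i \<noteq> 0"
  show "affine_lift i x \<in> qline w" if "x = normalize_at i w"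
    unfolding that affine_lift_normalize[OF w] by (simp add: qline_def)
  assume "affine_lift i x \<in> qline w"
  then obtain q where q: "affine_lift i x = qscale w q" by (auto simp: qline_def)
  then have "qmul (w $ i) q = qone" by (metis affine_lift_self qscale_nth)
  then have "q = qinv (w $ i)" using w by (metis qmul_assoc qmul_one qmul_qinv(2))
  then have "x = proj i (qscale w (qinv (w $ i)))" using q by (metis proj_affine_lift)
  then show "x = normalize_at i w" by (simp add: normalize_at_def)
qed

lemma mtop_HP: "mtop HP = HP_top"
  by (simp add: HP_def)

lemma idx_HP: "idx HP = UNIV"
  by (simp add: HP_def)

lemma chart_dom_HP_range: "chart_dom HP i = range (\<lambda>x. qline (affine_lift i x))"
  by (simp add: HP_def)

lemma chart_HP_The: "chart HP i L = (THE x. affine_lift i x \<in> L)"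
  by (simp add: HP_def)

lemma metric_HP:
  "metric HP i x u v = ((1 + x \<bullet> x) * (u \<bullet> v) - qherm x u \<bullet> qherm x v) / (1 + x \<bullet> x)\<^sup>2"
  by (simp add: HP_def)

lemma qbundle_HP: "qbundle HP i x = {\<lambda>u. qscale u q | q. Re (fst q) = 0}"
  by (simp add: HP_def)

lemma chart_HP: "w $ i \<noteq> 0 \<Longrightarrow> chart HP i (qline w) = normalize_at i w"
  by (simp add: chart_HP_The affine_lift_in_qline)

lemma normalize_affine_lift: "normalize_at i (affine_lift i x) = x"
  using affine_lift_in_qline[of "affine_lift i x" i x] by simp

lemma chart_HP_affine_lift: "chart HP i (qline (affine_lift i x)) = x"
  by (simp add: chart_HP normalize_affine_lift)

lemma chart_dom_HP: "w \<noteq> 0 \<Longrightarrow> qline w \<in> chart_dom HP i \<longleftrightarrow> w $ i \<noteq> 0"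
proof
  assume w: "w \<noteq> 0"
  show "w $ i \<noteq> 0" if d: "qline w \<in> chart_dom HP i"
  proof -
    obtain x where "qline w = qline (affine_lift i x)" using d by (auto simp: chart_dom_HP_range)
    then have "affine_lift i x \<in> qline w" by (simp only: qline_self)
    then obtain l where "affine_lift i x = qscale w l" unfolding qline_def by blast
    then have "qone = qmul (w $ i) l" by (metis affine_lift_self qscale_nth)
    then show ?thesis by auto
  qed
  show "qline w \<in> chart_dom HP i" if "w $ i \<noteq> 0"
  proof -
    have "qline w = qline (affine_lift i (normalize_at i w))"
      unfolding affine_lift_normalize[OF that] using qline_qscale[OF qinv_neq_0[OF that], of w] by simp
    then show ?thesis by (auto simp: chart_dom_HP_range)
  qed
qed

lemma cod_HP: "cod HP i = UNIV"
  using chart_HP_affine_lift[of i] by (force simp: cod_def chart_dom_HP_range image_iff)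

lemma chart_HP_inj: "inj_on (chart HP i) (chart_dom HP i)"
  by (auto simp: inj_on_def chart_dom_HP_range chart_HP_affine_lift)

definition chart_change :: "'k option \<Rightarrow> 'k option \<Rightarrow> quat ^ 'k::finite \<Rightarrow> quat ^ 'k" where
  "chart_change i j x = normalize_at j (affine_lift i x)"

lemma transition_HP: "affine_lift i x $ j \<noteq> 0 \<Longrightarrow> transition HP i j x = chart_change i j x"
proof -
  assume "affine_lift i x $ j \<noteq> 0"
  have "inv_into (chart_dom HP i) (chart HP i) x = qline (affine_lift i x)"
    by (rule inv_into_f_eq[OF chart_HP_inj _ chart_HP_affine_lift]) (simp add: chart_dom_HP_range)
  then show ?thesis using \<open>affine_lift i x $ j \<noteq> 0\<close> by (simp add: transition_def chart_change_def chart_HP)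
qed

lemma chart_HP_overlap: "chart HP i ` (chart_dom HP i \<inter> chart_dom HP j) = {x. affine_lift i x $ j \<noteq> 0}"
proof -
  have "x \<in> chart HP i ` (chart_dom HP i \<inter> chart_dom HP j)" if "affine_lift i x $ j \<noteq> 0" for x
    using that chart_dom_HP[of "affine_lift i x"] chart_HP_affine_lift[of i x]
    by (intro image_eqI[of _ _ "qline (affine_lift i x)"]) auto
  moreover have "affine_lift i x $ j \<noteq> 0" if "qline (affine_lift i x) \<in> chart_dom HP j" for x
    using that chart_dom_HP[of "affine_lift i x" j] by simp
  ultimately show ?thesis by (auto simp: chart_dom_HP_range[of i] chart_HP_affine_lift)
qed

lemma open_overlap: "open {x. affine_lift i x $ j \<noteq> 0}"
proof -
  have "continuous_on UNIV (\<lambda>x. affine_lift i x $ j)"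
    by (intro continuous_intros continuous_affine_lift)
  from open_vimage[OF open_Compl[OF closed_singleton[of 0]] this]
  show ?thesis by (simp add: vimage_def Compl_eq)
qed

lemma smooth_on_qinv:
  "open S \<Longrightarrow> smooth_on S f \<Longrightarrow> (\<And>x. x \<in> S \<Longrightarrow> f x \<noteq> 0) \<Longrightarrow> smooth_on S (\<lambda>x. qinv (f x))"
  unfolding qinv_def
  by (intro smooth_on_scaleR smooth_on_inverse smooth_on_inner
      smooth_on_bounded_linear_comp[OF _ bounded_linear_qcnj]) auto

text \<open>The right factor by which the normalised representatives of one line in the charts
  \<open>i\<close> and \<open>j\<close> differ.\<close>

definition tfac :: "'k option \<Rightarrow> 'k option \<Rightarrow> quat ^ 'k::finite \<Rightarrow> quat" where
  "tfac i j x = qinv (affine_lift i x $ j)"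

lemma smooth_tfac: "smooth_on {x. affine_lift i x $ j \<noteq> 0} (tfac i j)"
  unfolding tfac_def[abs_def]
  by (rule smooth_on_qinv[OF open_overlap smooth_on_bounded_linear_comp[OF open_overlap bounded_linear_vec_nth
     smooth_affine_lift[OF open_overlap]]]) simp

lemma smooth_chart_change: "smooth_on {x. affine_lift i x $ j \<noteq> 0} (chart_change i j)"
  unfolding chart_change_def[abs_def] normalize_at_def tfac_def[symmetric]
  by (intro smooth_on_bounded_linear_comp[OF open_overlap bounded_linear_proj]
     smooth_on_bilinear[OF open_overlap bounded_bilinear_qscale] smooth_affine_lift smooth_tfac open_overlap)

lemma affine_lift_chart_change:
  "affine_lift i x $ j \<noteq> 0 \<Longrightarrow> affine_lift j (chart_change i j x) = qscale (affine_lift i x) (tfac i j x)"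
  by (simp add: chart_change_def affine_lift_normalize tfac_def)

lemma tfac_neq_0: "affine_lift i x $ j \<noteq> 0 \<Longrightarrow> tfac i j x \<noteq> 0"
  by (simp add: tfac_def qinv_neq_0)

text \<open>Differentiating \<open>affine_lift_chart_change\<close> shows that the tangent lift
  changes by the right factor \<open>tfac\<close> and by a vector along the line, which the
  horizontal projection discards.\<close>

lemma pd_transition_HP:
  assumes "affine_lift i x $ j \<noteq> 0"
  shows "pd (transition HP i j) x = pd (chart_change i j) x" "(chart_change i j has_derivative pd (transition HP i j) x) (at x)"
    "tlift j (pd (transition HP i j) x u)
      = qscale (tlift i u) (tfac i j x) + qscale (affine_lift i x) (pd (tfac i j) x u)"
proof -
  let ?S = "{x. affine_lift i x $ j \<noteq> 0}"
  have x: "x \<in> ?S" using assms by simp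
  show e: "pd (transition HP i j) x = pd (chart_change i j) x"
    by (rule pd_cong[OF open_overlap x]) (simp add: transition_HP)
  have d: "(chart_change i j has_derivative pd (chart_change i j) x) (at x)"
    by (rule pd_has_derivative[OF smooth_on_differentiable[OF smooth_chart_change x]])
  then show "(chart_change i j has_derivative pd (transition HP i j) x) (at x)" unfolding e .
  have "((\<lambda>x. qscale (affine_lift i x) (tfac i j x)) has_derivative
     (\<lambda>u. qscale (affine_lift i x) (pd (tfac i j) x u) + qscale (tlift i u) (tfac i j x))) (at x)"
    by (rule bounded_bilinear.FDERIV[OF bounded_bilinear_qscale affine_lift_has_derivative
       pd_has_derivative[OF smooth_on_differentiable[OF smooth_tfac x]]])
  moreover have "((\<lambda>x. affine_lift j (chart_change i j x)) has_derivative (\<lambda>u. tlift j (pd (chart_change i j) x u))) (at x)"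
    using has_derivative_compose[OF d affine_lift_has_derivative] .
  then have "((\<lambda>x. qscale (affine_lift i x) (tfac i j x)) has_derivative (\<lambda>u. tlift j (pd (chart_change i j) x u))) (at x)"
    by (rule has_derivative_transform_within_open[OF _ open_overlap x]) (simp add: affine_lift_chart_change)
  ultimately have "(\<lambda>u. qscale (affine_lift i x) (pd (tfac i j) x u) + qscale (tlift i u) (tfac i j x))
     = (\<lambda>u. tlift j (pd (chart_change i j) x u))" by (rule has_derivative_unique)
  from fun_cong[OF this, of u] show "tlift j (pd (transition HP i j) x u)
      = qscale (tlift i u) (tfac i j x) + qscale (affine_lift i x) (pd (tfac i j) x u)"
    by (simp add: e add.commute)
qed

subsection \<open>The topology of quaternionic projective space\<close>

lemma topspace_HP_top: "topspace (HP_top :: (quat ^ 'k::finite option) set topology) = qline ` (- {0})"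
  using quotient_imp_surjective_map[OF quotient_map_HP[where 'k = 'k]] by simp

lemma openin_HP_top_Collect:
  assumes "\<And>v l. v \<noteq> 0 \<Longrightarrow> l \<noteq> 0 \<Longrightarrow> P (qscale v l) \<longleftrightarrow> P v" "open {v. v \<noteq> 0 \<and> P v}"
  shows "openin HP_top (qline ` {v. v \<noteq> 0 \<and> P v})"
proof -
  have "{v. v \<noteq> 0 \<and> qline v \<in> qline ` {v. v \<noteq> 0 \<and> P v}} = {v. v \<noteq> 0 \<and> P v}"
    using assms(1) qline_eq_iff by fastforce
  with assms(2) show ?thesis unfolding openin_HP_top by auto
qed

lemma open_sublevel:
  fixes f :: "'a::{t1_space,zero} \<Rightarrow> real"
  assumes "continuous_on (- {0}) f"
  shows "open {v. v \<noteq> 0 \<and> f v < c}" "open {v. v \<noteq> 0 \<and> f v > c}"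
proof -
  have "open ((- {0}) \<inter> f -` {..<c})" "open ((- {0}) \<inter> f -` {c<..})"
    using continuous_open_preimage[OF assms open_Compl[OF closed_singleton]] by auto
  moreover have "(- {0}) \<inter> f -` {..<c} = {v. v \<noteq> 0 \<and> f v < c}" "(- {0}) \<inter> f -` {c<..} = {v. v \<noteq> 0 \<and> f v > c}"
    by auto
  ultimately show "open {v. v \<noteq> 0 \<and> f v < c}" "open {v. v \<noteq> 0 \<and> f v > c}" by simp_all
qed

text \<open>Lines are separated by F(x) = |<v, x>|^2 / |x|^2, which is constant on lines. It equals
  |v|^2 at v and is strictly smaller on any other line, because the part of w horizontal to v is
  then nonzero.\<close>

lemma Hausdorff_HP_top: "Hausdorff_space (HP_top :: (quat ^ 'k::finite option) set topology)"
  unfolding Hausdorff_space_def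
proof (intro allI impI, elim conjE)
  fix L L' :: "(quat ^ 'k option) set"
  assume L: "L \<in> topspace HP_top" "L' \<in> topspace HP_top" "L \<noteq> L'"
  then obtain v w where v: "v \<noteq> 0" "L = qline v" and w: "w \<noteq> 0" "L' = qline w"
    by (auto simp: topspace_HP_top)
  define F where "F x = (qherm v x \<bullet> qherm v x) / (x \<bullet> x)" for x
  have inv: "F (qscale x l) = F x" if "l \<noteq> 0" for x l
    using that by (simp add: F_def qherm_qscale inner_qscale_qscale inner_qmul_self)
  have cont: "continuous_on (- {0}) F"
    unfolding F_def
    by (intro continuous_intros bounded_bilinear.continuous_on[OF bounded_bilinear_qherm]) auto
  have Fv: "F v = v \<bullet> v" using v by (simp add: F_def qherm_self inner_qone)
  have "hor v w \<noteq> 0"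
  proof
    assume "hor v w = 0"
    then have "w = qscale v (inverse (v \<bullet> v) *\<^sub>R qherm v w)" using decompose_hor[of w v] by (simp add: qscale_linear)
    then have "w \<in> qline v" unfolding qline_def by blast
    then show False using L v w qline_eq by blast
  qed
  then have "hor v w \<bullet> hor v w > 0" by simp
  then have Fw: "F w < v \<bullet> v"
    unfolding inner_hor_expand[OF v(1)] F_def using v w by (simp add: field_simps)
  define c where "c = (F w + v \<bullet> v) / 2"
  let ?U = "qline ` {x. x \<noteq> 0 \<and> F x > c}" and ?V = "qline ` {x. x \<noteq> 0 \<and> F x < c}"
  have "openin HP_top ?U" "openin HP_top ?V"
    by (rule openin_HP_top_Collect; simp add: inv open_sublevel[OF cont])+
  moreover have "L \<in> ?U" "L' \<in> ?V" using v w Fv Fw by (auto simp: c_def)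
  moreover have "disjnt ?U ?V"
  proof -
    have "\<not> F y < c" if "x \<noteq> 0" "F x > c" "y \<noteq> 0" "qline x = qline y" for x y
      using that qline_eq_iff[of x y] inv by auto
    then show ?thesis unfolding disjnt_def by auto
  qed
  ultimately show "\<exists>U V. openin HP_top U \<and> openin HP_top V \<and> L \<in> U \<and> L' \<in> V \<and> disjnt U V" by blast
qed

text \<open>The saturation of an open set is the union of its right translates by nonzero
  quaternions. Openness of the projection is what transfers second countability to the
  quotient.\<close>

lemma open_map_qline:
  "open_map (top_of_set (- {0})) (HP_top :: (quat ^ 'k::finite option) set topology) qline"
  unfolding open_map_def
proof (intro allI impI)
  fix T :: "(quat ^ 'k option) set" assume "openin (top_of_set (- {0})) T"
  then have T: "open T" "T \<subseteq> - {0}"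
    using openin_open_eq[OF open_Compl[OF closed_singleton[of 0]]] by auto
  have "{v. v \<noteq> 0 \<and> qline v \<in> qline ` T} = (\<Union>l\<in>- {0}. (\<lambda>v. qscale v l) -` T)"
  proof (intro set_eqI iffI)
    fix v assume "v \<in> {v. v \<noteq> 0 \<and> qline v \<in> qline ` T}"
    then obtain w where "v \<noteq> 0" "w \<in> T" "qline v = qline w" by auto
    then obtain l where "l \<noteq> 0" "w = qscale v l" using T qline_eq_iff[of v w] by auto
    then show "v \<in> (\<Union>l\<in>- {0}. (\<lambda>v. qscale v l) -` T)" using \<open>w \<in> T\<close> by auto
  next
    fix v assume "v \<in> (\<Union>l\<in>- {0}. (\<lambda>v. qscale v l) -` T)"
    then obtain l where l: "l \<noteq> 0" "qscale v l \<in> T" by auto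
    then have "v \<noteq> 0" using T by (auto simp: qscale_linear)
    moreover have "qline v = qline (qscale v l)" by (rule qline_qscale[OF l(1), symmetric])
    ultimately show "v \<in> {v. v \<noteq> 0 \<and> qline v \<in> qline ` T}" using l by auto
  qed
  moreover have "open ((\<lambda>v. qscale v l) -` T)" for l
    by (rule open_vimage[OF T(1)])
       (intro bounded_bilinear.continuous_on[OF bounded_bilinear_qscale] continuous_intros)
  ultimately have "open {v. v \<noteq> 0 \<and> qline v \<in> qline ` T}" by auto
  then show "openin HP_top (qline ` T)" unfolding openin_HP_top using T by auto
qed

lemma second_countable_euclidean:
  "second_countable (euclidean :: 'a::second_countable_topology topology)"
proof -
  obtain B :: "'a set set" where B: "countable B" "topological_basis B" using ex_countable_basis by blast
  then show ?thesis
    unfolding second_countable_def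
  proof (intro exI[of _ B] conjI ballI allI impI B(1))
    show "openin euclidean V" if "V \<in> B" for V using topological_basis_open[OF B(2) that] by simp
    fix S :: "'a set" and x assume "openin euclidean S \<and> x \<in> S"
    then have "open S" "x \<in> S" by auto
    then obtain V where "V \<in> B" "x \<in> V" "V \<subseteq> S" by (rule topological_basisE[OF B(2)])
    then show "\<exists>V\<in>B. x \<in> V \<and> V \<subseteq> S" by blast
  qed
qed

lemma second_countable_HP_top: "second_countable (HP_top :: (quat ^ 'k::finite option) set topology)"
proof (rule second_countable_open_map_image)
  show "continuous_map (top_of_set (- {0})) (HP_top :: (quat ^ 'k option) set topology) qline"
    by (rule quotient_imp_continuous_map[OF quotient_map_HP])
  show "second_countable (top_of_set (- {0 :: quat ^ 'k option}))"
    by (rule second_countable_subtopology, rule second_countable_euclidean)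
qed (simp_all add: open_map_qline topspace_HP_top)

lemma connected_HP_top: "connected_space (HP_top :: (quat ^ 'k::finite option) set topology)"
proof (rule connected_space_quotient_map_image[OF quotient_map_HP])
  have "connected (- {0 :: quat ^ 'k option})"
    by (rule connected_punctured_universe) (simp add: Suc_leI)
  then show "connected_space (top_of_set (- {0 :: quat ^ 'k option}))"
    by (simp add: connectedin_def[symmetric] connectedin_subtopology connected_space_subtopology)
qed

lemma continuous_normalize_at: "continuous_on {w. w $ i \<noteq> 0} (normalize_at i)"
  unfolding normalize_at_def qinv_def
  by (intro linear_continuous_on_compose[OF _ linear_proj] bounded_bilinear.continuous_on[OF bounded_bilinear_qscale]
     continuous_intros linear_continuous_on_compose[OF _ linear_qcnj]) auto

lemma homeomorphic_chart_HP:
  fixes i :: "'k::finite option"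
  shows "homeomorphic_map (subtopology HP_top (chart_dom HP i)) (top_of_set (cod HP i)) (chart HP i)"
proof -
  let ?X = "subtopology HP_top (chart_dom HP i)"
  have sub: "chart_dom HP i \<subseteq> topspace HP_top" by (auto simp: chart_dom_HP_range topspace_HP_top)
  have oc: "open {w :: quat ^ 'k option. w $ i \<noteq> 0}"
  proof -
    have "continuous_on UNIV (\<lambda>w :: quat ^ 'k option. w $ i)" by (intro continuous_intros)
    from open_vimage[OF open_Compl[OF closed_singleton[of 0]] this]
    show ?thesis by (simp add: vimage_def Compl_eq)
  qed
  have "homeomorphic_maps ?X euclidean (chart HP i) (\<lambda>x. qline (affine_lift i x))"
    unfolding homeomorphic_maps_def
  proof (intro conjI ballI)
    show "continuous_map ?X euclidean (chart HP i)"
      unfolding continuous_map_def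
    proof (intro conjI allI impI)
      fix S :: "(quat ^ 'k) set" assume "openin euclidean S"
      then have S: "open S" by simp
      have "{L \<in> topspace ?X. chart HP i L \<in> S} \<subseteq> qline ` (- {0})" using sub by (auto simp: topspace_HP_top)
      moreover have "{v. v \<noteq> 0 \<and> qline v \<in> {L \<in> topspace ?X. chart HP i L \<in> S}}
          = {w. w $ i \<noteq> 0} \<inter> normalize_at i -` S"
      proof (intro set_eqI iffI)
        fix v assume "v \<in> {v. v \<noteq> 0 \<and> qline v \<in> {L \<in> topspace ?X. chart HP i L \<in> S}}"
        then show "v \<in> {w. w $ i \<noteq> 0} \<inter> normalize_at i -` S"
          using chart_dom_HP[of v i] chart_HP[of v i] by auto
      next
        fix v assume v: "v \<in> {w. w $ i \<noteq> 0} \<inter> normalize_at i -` S"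
        then have "v \<noteq> 0" by auto
        with v show "v \<in> {v. v \<noteq> 0 \<and> qline v \<in> {L \<in> topspace ?X. chart HP i L \<in> S}}"
          using chart_dom_HP[of v i] chart_HP[of v i] sub by auto
      qed
      ultimately have "openin HP_top {L \<in> topspace ?X. chart HP i L \<in> S}"
        unfolding openin_HP_top using continuous_open_preimage[OF continuous_normalize_at oc S] by simp
      then show "openin ?X {L \<in> topspace ?X. chart HP i L \<in> S}"
        unfolding openin_subtopology by (intro exI[of _ "{L \<in> topspace ?X. chart HP i L \<in> S}"]) auto
    qed simp
    show "continuous_map euclidean ?X (\<lambda>x. qline (affine_lift i x))"
    proof (rule continuous_map_into_subtopology)
      have "continuous_map euclidean (top_of_set (- {0})) (affine_lift i)"
        by (rule continuous_map_into_subtopology) (auto simp: continuous_affine_lift)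
      from continuous_map_compose[OF this quotient_imp_continuous_map[OF quotient_map_HP]]
      show "continuous_map euclidean HP_top (\<lambda>x. qline (affine_lift i x))" by (simp add: o_def)
    qed (auto simp: chart_dom_HP_range)
    show "qline (affine_lift i (chart HP i L)) = L" if "L \<in> topspace ?X" for L
      using that by (auto simp: chart_dom_HP_range chart_HP_affine_lift)
    show "chart HP i (qline (affine_lift i x)) = x" if "x \<in> topspace euclidean" for x
      by (rule chart_HP_affine_lift)
  qed
  then show ?thesis unfolding cod_HP homeomorphic_map_maps by auto
qed

lemma smooth_manifold_HP:
  "smooth_manifold (HP :: ('k option, (quat ^ 'k option) set, quat ^ 'k::finite) qriem)"
  unfolding smooth_manifold_def
proof (intro conjI ballI)
  let ?M = "HP :: ('k option, (quat ^ 'k option) set, quat ^ 'k) qriem"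
  show "Hausdorff_space (mtop ?M)" "second_countable (mtop ?M)"
    by (simp_all add: mtop_HP Hausdorff_HP_top second_countable_HP_top)
  have sub: "chart_dom ?M i \<subseteq> topspace HP_top" for i by (auto simp: chart_dom_HP_range topspace_HP_top)
  have "qline v \<in> (\<Union>i\<in>idx ?M. chart_dom ?M i)" if v: "v \<noteq> 0" for v
  proof -
    obtain i where "v $ i \<noteq> 0" using v by (auto simp: vec_eq_iff)
    then show ?thesis using chart_dom_HP[OF v] by (auto simp: idx_HP)
  qed
  then have "qline ` (- {0}) \<subseteq> (\<Union>i\<in>idx ?M. chart_dom ?M i)" by blast
  then show "(\<Union>i\<in>idx ?M. chart_dom ?M i) = topspace (mtop ?M)"
    using sub unfolding mtop_HP topspace_HP_top by blast
  fix i :: "'k option"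
  show "openin (mtop ?M) (chart_dom ?M i)"
  proof -
    have "{v. v \<noteq> 0 \<and> qline v \<in> chart_dom ?M i} = {w. w $ i \<noteq> 0}"
    proof (intro set_eqI iffI)
      fix w :: "quat ^ 'k option" assume w: "w \<in> {w. w $ i \<noteq> 0}"
      then have "w \<noteq> 0" by auto
      with w show "w \<in> {v. v \<noteq> 0 \<and> qline v \<in> chart_dom ?M i}" by (simp add: chart_dom_HP)
    qed (simp add: chart_dom_HP cong: conj_cong)
    moreover have "open {w :: quat ^ 'k option. w $ i \<noteq> 0}"
    proof -
      have "continuous_on UNIV (\<lambda>w :: quat ^ 'k option. w $ i)" by (intro continuous_intros)
      from open_vimage[OF open_Compl[OF closed_singleton[of 0]] this]
      show ?thesis by (simp add: vimage_def Compl_eq)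
    qed
    ultimately show ?thesis unfolding mtop_HP openin_HP_top using sub by (auto simp: topspace_HP_top)
  qed
  show "open (cod ?M i)" by (simp add: cod_HP)
  show "homeomorphic_map (subtopology (mtop ?M) (chart_dom ?M i)) (top_of_set (cod ?M i)) (chart ?M i)"
    unfolding mtop_HP by (rule homeomorphic_chart_HP)
  fix j :: "'k option"
  show "smooth_on (chart ?M i ` (chart_dom ?M i \<inter> chart_dom ?M j)) (transition ?M i j)"
    unfolding chart_HP_overlap
    by (rule smooth_on_cong[OF smooth_chart_change open_overlap]) (simp add: transition_HP)
qed

section \<open>The quotient metric through horizontal projections\<close>

lemma metric_HP_hor:
  "metric HP i x u v = hor (affine_lift i x) (tlift i u) \<bullet> hor (affine_lift i x) (tlift i v)
     / (affine_lift i x \<bullet> affine_lift i x)"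
proof -
  have "1 + x \<bullet> x \<noteq> 0" using inner_ge_zero[of x] by linarith
  then show ?thesis
    by (simp add: metric_HP inner_hor_expand inner_tlift qherm_affine_lift inner_affine_lift
        power2_eq_square field_simps)
qed

lemma hor_self [simp]: "s \<noteq> 0 \<Longrightarrow> hor s s = 0"
  using hor_vertical[of s qone] by simp

text \<open>Together with \<open>lift_transform\<close> this reduces invariance under changes of
  chart to the cancellation of |l|^2 between numerator and denominator.\<close>

lemma hor_transform: "s \<noteq> 0 \<Longrightarrow> l \<noteq> 0 \<Longrightarrow> hor (qscale s l) (qscale w l + qscale s c) = qscale (hor s w) l"
  by (simp add: hor_scale_base hor_linear hor_qscale qscale_linear(9))

lemma overlap_HP:
  assumes "p \<in> chart_dom HP i \<inter> chart_dom HP j"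
  shows "affine_lift i (chart HP i p) $ j \<noteq> 0" "chart HP j p = chart_change i j (chart HP i p)"
proof -
  obtain x where x: "p = qline (affine_lift i x)" using assms by (auto simp: chart_dom_HP_range)
  then have c: "chart HP i p = x" by (simp add: chart_HP_affine_lift)
  have n: "affine_lift i x $ j \<noteq> 0" using assms chart_dom_HP[of "affine_lift i x" j] by (simp add: x)
  then show "affine_lift i (chart HP i p) $ j \<noteq> 0" by (simp add: c)
  show "chart HP j p = chart_change i j (chart HP i p)" unfolding c unfolding x chart_change_def by (rule chart_HP[OF n])
qed

lemma lift_transform:
  assumes p: "p \<in> chart_dom HP i \<inter> chart_dom HP j" and x: "x = chart HP i p"
  obtains l c where "l \<noteq> 0" "affine_lift j (chart HP j p) = qscale (affine_lift i x) l"
     "\<And>u. tlift j (pd (transition HP i j) x u) = qscale (tlift i u) l + qscale (affine_lift i x) (c u)"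
proof (rule that)
  note a = overlap_HP[OF p, folded x]
  show "tfac i j x \<noteq> 0" by (rule tfac_neq_0[OF a(1)])
  show "affine_lift j (chart HP j p) = qscale (affine_lift i x) (tfac i j x)"
    unfolding a(2) by (rule affine_lift_chart_change[OF a(1)])
  show "tlift j (pd (transition HP i j) x u)
      = qscale (tlift i u) (tfac i j x) + qscale (affine_lift i x) (pd (tfac i j) x u)" for u
    by (rule pd_transition_HP(3)[OF a(1)])
qed

lemma smooth_id: "open S \<Longrightarrow> smooth_on S (\<lambda>x. x)"
  by (rule smooth_on_bounded_linear[OF _ bounded_linear_ident])

lemma smooth_metric_HP: "smooth_on UNIV (\<lambda>x. metric HP i x u v)"
proof -
  have "1 + x \<bullet> x \<noteq> 0" for x :: "quat ^ 'k" using inner_ge_zero[of x] by linarith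
  then show ?thesis
    unfolding metric_HP power2_eq_square
    by (intro smooth_on_divide smooth_on_diff smooth_on_mult smooth_on_add smooth_on_inner smooth_on_const
       smooth_on_bilinear[OF _ bounded_bilinear_qherm] smooth_id open_UNIV) auto
qed

lemma bilinear_metric_HP: "bilinear (metric HP i x)"
  unfolding metric_HP_hor bilinear_def linear_iff
  by (simp add: tlift_linear hor_linear inner_add_left inner_add_right add_divide_distrib)

text \<open>A vector along the line has entry q at position \<open>i\<close>, whereas the tangent
  lift has entry 0 there; hence q = 0. This gives definiteness of the metric.\<close>

lemma hor_tlift_eq_0:
  assumes "hor (affine_lift i x) (tlift i u) = 0"
  shows "u = 0"
proof -
  obtain q where q: "tlift i u = qscale (affine_lift i x) q"
    using decompose_hor[of "tlift i u" "affine_lift i x"] assms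
    by (metis add_0 qscale_linear(4))
  then have "q = 0" by (metis affine_lift_self qmul_one(1) qscale_nth tlift_self)
  then have "tlift i u = 0" using q by (simp add: qscale_linear)
  then show ?thesis by (metis proj_tlift tlift_linear(5))
qed

lemma riemannian_manifold_HP:
  "riemannian_manifold (HP :: ('k option, (quat ^ 'k option) set, quat ^ 'k::finite) qriem)"
  unfolding riemannian_manifold_def tensor2_field_def
proof (intro conjI ballI allI impI smooth_manifold_HP)
  let ?M = "HP :: ('k option, (quat ^ 'k option) set, quat ^ 'k) qriem"
  show "bilinear (metric ?M i x)" for i x by (rule bilinear_metric_HP)
  show "smooth_on (cod ?M i) (\<lambda>x. metric ?M i x u v)" for i u v
    unfolding cod_HP by (rule smooth_metric_HP)
  show "metric ?M i (chart ?M i p) u v = metric ?M j (chart ?M j p)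
      (pd (transition ?M i j) (chart ?M i p) u) (pd (transition ?M i j) (chart ?M i p) v)"
    if p: "p \<in> chart_dom ?M i \<inter> chart_dom ?M j" for i j p u v
  proof -
    obtain l c where l: "l \<noteq> 0" "affine_lift j (chart ?M j p) = qscale (affine_lift i (chart ?M i p)) l"
      "\<And>u. tlift j (pd (transition ?M i j) (chart ?M i p) u)
         = qscale (tlift i u) l + qscale (affine_lift i (chart ?M i p)) (c u)"
      using lift_transform[OF p refl] by blast
    show ?thesis
      unfolding metric_HP_hor l(2,3) hor_transform[OF affine_lift_neq_0 l(1)] inner_qscale_qscale
      using l(1) by simp
  qed
  show "metric ?M i x u v = metric ?M i x v u" for i x u v by (simp add: metric_HP_hor inner_commute)
  show "metric ?M i x u u > 0" if "u \<noteq> 0" for i x u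
    unfolding metric_HP_hor using hor_tlift_eq_0[of i x u] that by (intro divide_pos_pos) auto
qed

section \<open>Horizontal lifts and the Levi-Civita connection of the projective space\<close>

definition \<Gamma>HP :: "quat ^ 'k::finite \<Rightarrow> quat ^ 'k \<Rightarrow> quat ^ 'k \<Rightarrow> quat ^ 'k" where
  "\<Gamma>HP x u v = - (inverse (1 + x \<bullet> x) *\<^sub>R (qscale u (qherm x v) + qscale v (qherm x u)))"

definition hlift :: "'k option \<Rightarrow> quat ^ 'k::finite \<Rightarrow> quat ^ 'k \<Rightarrow> quat ^ 'k option" where
  "hlift i u x = hor (affine_lift i x) (tlift i u)"

lemma hlift_linear: "hlift i (u + v) x = hlift i u x + hlift i v x" "hlift i (c *\<^sub>R u) x = c *\<^sub>R hlift i u x"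
  by (simp_all add: hlift_def tlift_linear hor_linear)

lemma hlift_qscale: "hlift i (qscale u q) x = qscale (hlift i u x) q"
  by (simp add: hlift_def tlift_qscale hor_qscale)

lemma qherm_hor_hor:
  "s \<noteq> 0 \<Longrightarrow> qherm (hor s v) (hor s w)
     = qherm v w - inverse (s \<bullet> s) *\<^sub>R qmul (qcnj (qherm s v)) (qherm s w)"
proof -
  assume s: "s \<noteq> 0"
  have "qherm (hor s v) (hor s w) = qherm v (hor s w)"
    unfolding hor_def[of s v]
    using qherm_hor[OF s, of w] by (simp add: qherm_linear qherm_qscale)
  then show ?thesis by (simp add: hor_def qherm_linear qherm_qscale qcnj_qherm)
qed

text \<open>The component along the fibre: the tangent lift of Y is its horizontal lift plus the
  representative multiplied by \<open>lam x Y\<close> from the right.\<close>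

definition lam :: "quat ^ 'k::finite \<Rightarrow> quat ^ 'k \<Rightarrow> quat" where
  "lam x Y = inverse (1 + x \<bullet> x) *\<^sub>R qherm x Y"

text \<open>Up to sign, the vertical coefficient in the derivative of a horizontal lift.\<close>

definition kap :: "'k option \<Rightarrow> quat ^ 'k::finite \<Rightarrow> quat ^ 'k \<Rightarrow> quat ^ 'k \<Rightarrow> quat" where
  "kap i x Y u = inverse (1 + x \<bullet> x) *\<^sub>R qherm (hlift i Y x) (hlift i u x)"

text \<open>In the derivative of a horizontal lift, the first term is accounted for by the connection, the second
  one comes from moving along the fibre, and the third one is vertical.\<close>

lemma hlift_has_derivative:
  "(hlift i u has_derivative (\<lambda>Y. hlift i (\<Gamma>HP x Y u) x + qscale (hlift i u x) (lam x Y)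
     - qscale (affine_lift i x) (kap i x Y u))) (at x)"
proof -
  let ?s = "affine_lift i x" and ?N = "1 + x \<bullet> x"
  have N: "?N \<noteq> 0" using inner_ge_zero[of x] by linarith
  have dN: "((\<lambda>x. inverse (affine_lift i x \<bullet> affine_lift i x)) has_derivative
     (\<lambda>Y. - (inverse ?N * (2 * (?s \<bullet> tlift i Y)) * inverse ?N))) (at x)"
    using Deriv.has_derivative_inverse[OF _ has_derivative_inner[OF affine_lift_has_derivative[of i x]
       affine_lift_has_derivative[of i x]]] N
    by (simp add: inner_affine_lift inner_commute)
  have dq: "((\<lambda>x. qherm (affine_lift i x) (tlift i u)) has_derivative (\<lambda>Y. qherm (tlift i Y) (tlift i u))) (at x)"
    using bounded_bilinear.FDERIV[OF bounded_bilinear_qherm affine_lift_has_derivative[of i x]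
       has_derivative_const[of "tlift i u"]] by (simp add: qherm_linear)
  have ds: "((\<lambda>x. qscale (affine_lift i x) (qherm (affine_lift i x) (tlift i u))) has_derivative
     (\<lambda>Y. qscale ?s (qherm (tlift i Y) (tlift i u)) + qscale (tlift i Y) (qherm ?s (tlift i u)))) (at x)"
    by (rule bounded_bilinear.FDERIV[OF bounded_bilinear_qscale affine_lift_has_derivative dq])
  have "(hlift i u has_derivative (\<lambda>Y. 0 - (inverse ?N *\<^sub>R
        (qscale ?s (qherm (tlift i Y) (tlift i u)) + qscale (tlift i Y) (qherm ?s (tlift i u)))
      + (- (inverse ?N * (2 * (?s \<bullet> tlift i Y)) * inverse ?N)) *\<^sub>R qscale ?s (qherm ?s (tlift i u))))) (at x)"
    unfolding hlift_def[abs_def] hor_def inner_affine_lift[symmetric, of x i]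
    by (rule has_derivative_diff[OF has_derivative_const has_derivative_scaleR[OF dN[unfolded inner_affine_lift[symmetric, of x i]] ds]])
  then show ?thesis
  proof (rule has_derivative_eq_rhs, intro ext)
    fix Y
    define a where "a = tlift i Y"
    define w where "w = tlift i u"
    define p where "p = qherm ?s a"
    define r where "r = qherm ?s w"
    define c where "c = inverse ?N"
    have px: "qherm x Y = p" "qherm x u = r" by (simp_all add: p_def r_def a_def w_def qherm_affine_lift)
    have HG: "hlift i (\<Gamma>HP x Y u) x = - (c *\<^sub>R (qscale (hor ?s a) r + qscale (hor ?s w) p))"
      unfolding hlift_def \<Gamma>HP_def px c_def[symmetric]
      by (simp add: tlift_linear tlift_qscale hor_linear hor_qscale a_def w_def)
    have k: "kap i x Y u = c *\<^sub>R (qherm a w - c *\<^sub>R qmul (qcnj p) r)"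
      by (simp add: kap_def hlift_def qherm_hor_hor c_def a_def w_def p_def r_def inner_affine_lift)
    have ha: "hor ?s a = a - c *\<^sub>R qscale ?s p" by (simp add: hor_def c_def p_def inner_affine_lift)
    \<comment> \<open>The real part of p equals the inner product of the representative and a, so
      this matches the derivative of the normalising factor.\<close>
    have pp: "qmul p r + qmul (qcnj p) r = (2 * (?s \<bullet> a)) *\<^sub>R r"
      using arg_cong[OF add_qcnj[of p], of "\<lambda>z. qmul z r"] inner_qherm(1)[of ?s a]
      by (simp add: qmul_linear p_def)
    have "hlift i (\<Gamma>HP x Y u) x + qscale (hlift i u x) (lam x Y) - qscale ?s (kap i x Y u)
      = - (c *\<^sub>R (qscale a r + qscale ?s (qherm a w))) + (c * c) *\<^sub>R qscale ?s (qmul p r + qmul (qcnj p) r)"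
      unfolding HG k lam_def px c_def[symmetric] unfolding hlift_def w_def[symmetric] ha
      by (simp add: qscale_linear qscale_qscale scaleR_add_right scaleR_diff_right)
    also have "\<dots> = 0 - (c *\<^sub>R (qscale ?s (qherm a w) + qscale a r) + (- (c * (2 * (?s \<bullet> a)) * c)) *\<^sub>R qscale ?s r)"
      unfolding pp by (simp add: qscale_linear scaleR_add_right mult_ac)
    finally show "0 - (inverse ?N *\<^sub>R
        (qscale ?s (qherm (tlift i Y) (tlift i u)) + qscale (tlift i Y) (qherm ?s (tlift i u)))
      + (- (inverse ?N * (2 * (?s \<bullet> tlift i Y)) * inverse ?N)) *\<^sub>R qscale ?s (qherm ?s (tlift i u)))
      = hlift i (\<Gamma>HP x Y u) x + qscale (hlift i u x) (lam x Y) - qscale (affine_lift i x) (kap i x Y u)"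
      by (simp add: a_def w_def r_def c_def)
  qed
qed

lemma inverse_norm_has_derivative:
  "((\<lambda>x. inverse (1 + x \<bullet> x)) has_derivative (\<lambda>Y. - (2 * (qone \<bullet> lam x Y)) * inverse (1 + x \<bullet> x))) (at x)"
proof -
  have N: "1 + x \<bullet> x \<noteq> 0" using inner_ge_zero[of x] by linarith
  have "((\<lambda>x. 1 + x \<bullet> x) has_derivative (\<lambda>Y. 2 * (x \<bullet> Y))) (at x)"
    by (auto intro!: derivative_eq_intros simp: inner_commute)
  from Deriv.has_derivative_inverse[OF N this] show ?thesis
    by (rule has_derivative_eq_rhs) (simp add: lam_def inner_qherm fun_eq_iff)
qed

text \<open>Right multiplication by l acts on inner products as a derivation through its real part
  only; with l = \<open>lam x Y\<close> this is cancelled by the derivative of 1/|s|^2.\<close>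

lemma qscale_product_rule: "qscale v l \<bullet> w + v \<bullet> qscale w l = 2 * (qone \<bullet> l) * (v \<bullet> w)"
proof -
  have "qscale v l \<bullet> w + v \<bullet> qscale w l = v \<bullet> qscale w (l + qcnj l)"
    by (simp add: inner_qscale_right qscale_linear inner_add_right)
  then show ?thesis by (simp add: add_qcnj qscale_linear)
qed

text \<open>The bilinear form induced on the quotient by a right-linear endomorphism S of the
  ambient space, tested on horizontal lifts; the identity gives the metric, a skew S a form in
  S^2E.\<close>

definition FS :: "(quat ^ 'k::finite option \<Rightarrow> quat ^ 'k option) \<Rightarrow> 'k option \<Rightarrow> quat ^ 'k
    \<Rightarrow> quat ^ 'k \<Rightarrow> quat ^ 'k \<Rightarrow> real" where
  "FS S i x u v = (S (hlift i u x) \<bullet> hlift i v x) * inverse (1 + x \<bullet> x)"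

lemma metric_HP_FS: "metric HP i x u v = FS (\<lambda>w. w) i x u v"
  by (simp add: metric_HP_hor FS_def hlift_def inner_affine_lift divide_inverse)

text \<open>Inserting \<open>hlift_has_derivative\<close>, the first terms give the connection terms
  and the \<open>lam\<close> terms cancel against the normalisation by
  \<open>qscale_product_rule\<close>. What remains is the contribution of the vertical parts, which
  S need not keep vertical.\<close>

lemma FS_derivative:
  assumes S: "linear S" and Sq: "\<And>v q. S (qscale v q) = qscale (S v) q"
  shows "((\<lambda>x. FS S i x u v) has_derivative (\<lambda>Y. FS S i x (\<Gamma>HP x Y u) v + FS S i x u (\<Gamma>HP x Y v)
    - (S (qscale (affine_lift i x) (kap i x Y u)) \<bullet> hlift i v x + S (hlift i u x) \<bullet> qscale (affine_lift i x) (kap i x Y v))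
       * inverse (1 + x \<bullet> x))) (at x)"
proof -
  let ?s = "affine_lift i x"
  define c where "c = inverse (1 + x \<bullet> x)"
  have bS: "bounded_linear S" using S by (simp add: linear_conv_bounded_linear)
  note d = has_derivative_mult[OF has_derivative_inner[OF bounded_linear.has_derivative[OF bS hlift_has_derivative[of i u x]]
      hlift_has_derivative[of i v x]] inverse_norm_has_derivative]
  show ?thesis
    unfolding FS_def
  proof (rule has_derivative_eq_rhs[OF d], intro ext)
    fix Y
    let ?A = "hlift i u x" and ?B = "hlift i v x" and ?l = "lam x Y"
    have r: "qscale (S ?A) ?l \<bullet> ?B + S ?A \<bullet> qscale ?B ?l = 2 * (qone \<bullet> ?l) * (S ?A \<bullet> ?B)"
      by (rule qscale_product_rule)
    have e: "S (hlift i (\<Gamma>HP x Y u) x + qscale ?A ?l - qscale ?s (kap i x Y u))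
       = S (hlift i (\<Gamma>HP x Y u) x) + qscale (S ?A) ?l - S (qscale ?s (kap i x Y u))"
      by (simp only: linear_add[OF S] linear_diff[OF S] Sq)
    show "S ?A \<bullet> ?B * (- (2 * (qone \<bullet> ?l)) * inverse (1 + x \<bullet> x))
      + (S ?A \<bullet> (hlift i (\<Gamma>HP x Y v) x + qscale ?B ?l - qscale ?s (kap i x Y v))
        + S (hlift i (\<Gamma>HP x Y u) x + qscale ?A ?l - qscale ?s (kap i x Y u)) \<bullet> ?B) * inverse (1 + x \<bullet> x)
      = S (hlift i (\<Gamma>HP x Y u) x) \<bullet> ?B * inverse (1 + x \<bullet> x) + S ?A \<bullet> hlift i (\<Gamma>HP x Y v) x * inverse (1 + x \<bullet> x)
       - (S (qscale ?s (kap i x Y u)) \<bullet> ?B + S ?A \<bullet> qscale ?s (kap i x Y v)) * inverse (1 + x \<bullet> x)"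
      unfolding e inner_add_left inner_add_right inner_diff_left inner_diff_right c_def[symmetric]
      using arg_cong[OF r, of "\<lambda>z. z * c"] by (simp add: algebra_simps)
  qed
qed

lemma inner_vertical_hlift: "qscale (affine_lift i x) q \<bullet> hlift i v x = 0" "hlift i v x \<bullet> qscale (affine_lift i x) q = 0"
  using inner_vertical_hor[OF affine_lift_neq_0] by (simp_all add: hlift_def inner_commute)

lemma \<Gamma>HP_bilinear: "bilinear (\<Gamma>HP x)"
  by (auto simp: bilinear_def linear_iff \<Gamma>HP_def qscale_linear qherm_linear algebra_simps)

text \<open>Metricity is \<open>FS_derivative\<close> for the identity, where the vertical terms are
  orthogonal to horizontal lifts and drop out; symmetry is evident from the formula, and uniqueness
  does the rest.\<close>

lemma christoffel_HP:
  "christoffel (HP :: ('k option, (quat ^ 'k option) set, quat ^ 'k::finite) qriem) i x = \<Gamma>HP x"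
proof (rule christoffel_unique[OF riemannian_manifold_HP])
  show "bilinear (\<Gamma>HP x)" by (rule \<Gamma>HP_bilinear)
  show "\<Gamma>HP x u v = \<Gamma>HP x v u" for u v by (simp add: \<Gamma>HP_def add.commute)
  show "pd (\<lambda>y. metric (HP :: ('k option, (quat ^ 'k option) set, quat ^ 'k) qriem) i y u v) x w
      = metric HP i x (\<Gamma>HP x w u) v + metric HP i x u (\<Gamma>HP x w v)" for w u v
    unfolding metric_HP_FS
    using pd_eq[OF FS_derivative[OF linear_id[unfolded id_def], of i u v x]]
    by (simp add: inner_vertical_hlift)
qed (auto simp: idx_HP cod_HP)

subsection \<open>The quaternionic structure\<close>

lemma Re_qmul_commute: "Re (fst (qmul p q)) = Re (fst (qmul q p))"
  by (simp add: qmul_def algebra_simps)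

lemma Re_conj: "l \<noteq> 0 \<Longrightarrow> Re (fst (qmul (qmul (qinv l) q) l)) = Re (fst q)"
  by (subst Re_qmul_commute) (simp add: qmul_assoc[symmetric] qmul_qinv)

lemma qmul_qinv_cancel: "l \<noteq> 0 \<Longrightarrow> qmul (qinv l) (qmul l r) = r" "l \<noteq> 0 \<Longrightarrow> qmul (qmul r (qinv l)) l = r"
  by (simp add: qmul_assoc[symmetric] qmul_qinv) (simp add: qmul_assoc qmul_qinv)

lemma chart_change_inverse:
  assumes "affine_lift i x $ j \<noteq> 0"
  shows "affine_lift j (chart_change i j x) $ i \<noteq> 0" "chart_change j i (chart_change i j x) = x"
proof -
  note l = affine_lift_chart_change[OF assms] and n = tfac_neq_0[OF assms]
  show i: "affine_lift j (chart_change i j x) $ i \<noteq> 0" unfolding l by (simp add: n)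
  have "affine_lift i x \<in> qline (affine_lift j (chart_change i j x))"
    unfolding l qline_qscale[OF n] by simp
  then show "chart_change j i (chart_change i j x) = x"
    using affine_lift_in_qline[OF i] by (simp add: chart_change_def)
qed

lemma pd_transition_inverse:
  assumes a: "affine_lift i x $ j \<noteq> 0"
  shows "pd (transition HP j i) (chart_change i j x) (pd (transition HP i j) x u) = u"
proof -
  let ?S = "{x. affine_lift i x $ j \<noteq> 0}"
  have "((\<lambda>x. chart_change j i (chart_change i j x)) has_derivative
     (\<lambda>u. pd (transition HP j i) (chart_change i j x) (pd (transition HP i j) x u))) (at x)"
    by (rule has_derivative_compose[OF pd_transition_HP(2)[OF a] pd_transition_HP(2)[OF chart_change_inverse(1)[OF a]]])
  then have "((\<lambda>x. x) has_derivative
     (\<lambda>u. pd (transition HP j i) (chart_change i j x) (pd (transition HP i j) x u))) (at x)"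
    by (rule has_derivative_transform_within_open[OF _ open_overlap]) (use a chart_change_inverse in auto)
  from has_derivative_unique[OF this has_derivative_ident] show ?thesis by metis
qed

text \<open>A change of chart conjugates right multiplications by \<open>tfac\<close>. The lifts of
  the two sides differ by a vector along the line; lifts vanish at position \<open>j\<close>, where
  the representative does not, so this difference is zero.\<close>

lemma transition_right_mult:
  assumes a: "affine_lift i x $ j \<noteq> 0"
  shows "pd (transition HP i j) x (qscale (pd (transition HP j i) (chart_change i j x) w) q)
     = qscale w (qmul (qmul (qinv (tfac i j x)) q) (tfac i j x))"
proof -
  let ?s = "affine_lift i x" and ?l = "tfac i j x"
  let ?D = "pd (transition HP i j) x"
  define u where "u = pd (transition HP j i) (chart_change i j x) w"
  note l = tfac_neq_0[OF a]
  define q' where "q' = qmul (qmul (qinv ?l) q) ?l"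
  have "pd (transition HP i j) (chart_change j i (chart_change i j x)) u = w"
    unfolding u_def by (rule pd_transition_inverse[OF chart_change_inverse(1)[OF a]])
  then have Du: "?D u = w" unfolding chart_change_inverse(2)[OF a] .
  obtain c1 where c1: "tlift j (?D (qscale u q)) = qscale (qscale (tlift i u) q) ?l + qscale ?s c1"
    using pd_transition_HP(3)[OF a, of "qscale u q"] by (auto simp: tlift_qscale)
  obtain c2 where c2: "tlift j w = qscale (tlift i u) ?l + qscale ?s c2"
    using pd_transition_HP(3)[OF a, of u] by (auto simp: Du)
  have lq: "qmul ?l q' = qmul q ?l"
    by (simp add: q'_def qmul_assoc[symmetric] qmul_qinv l)
  have "tlift j (qscale w q') = qscale (qscale (tlift i u) q) ?l + qscale ?s (qmul c2 q')"
    unfolding tlift_qscale c2 by (simp add: qscale_linear qscale_qscale lq)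
  then have d: "tlift j (?D (qscale u q) - qscale w q') = qscale ?s (c1 - qmul c2 q')"
    unfolding tlift_linear c1 by (simp add: qscale_linear)
  then have "qmul (?s $ j) (c1 - qmul c2 q') = 0" by (metis qscale_nth tlift_self)
  then have "c1 - qmul c2 q' = 0" using a by (simp add: qmul_eq_0_iff)
  then have "tlift j (?D (qscale u q) - qscale w q') = 0" using d by (simp add: qscale_linear)
  then have "?D (qscale u q) - qscale w q' = 0" by (metis proj_tlift tlift_linear(5))
  then show ?thesis by (simp add: u_def q'_def)
qed

definition qI :: quat where "qI = (\<i>, 0)"
definition qJ :: quat where "qJ = (0, 1)"
text \<open>The reversed order is deliberate: right multiplications compose in the opposite order,
  so multiplying by \<open>qJ\<close> and then by \<open>qI\<close> is multiplication by this
  product, as \<open>J3 = J1 \<circ> J2\<close> demands. As a quaternion it is minus the usual third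
  unit, whence the sign in \<open>imaginary_expand\<close>.\<close>

definition qK :: quat where "qK = qmul qJ qI"

lemma q_units:
  "qmul qI qI = - qone" "qmul qJ qJ = - qone" "qmul qK qK = - qone"
  "qmul qI qJ = - qmul qJ qI" "qmul qJ qK = - qmul qK qJ" "qmul qI qK = - qmul qK qI"
  "qI \<bullet> qI = 1" "qJ \<bullet> qJ = 1" "qK \<bullet> qK = 1" "Re (fst qI) = 0" "Re (fst qJ) = 0" "Re (fst qK) = 0"
  by (simp_all add: qI_def qJ_def qK_def qmul_def qone_def inner_quat prod_eq_iff)

lemma imaginary_expand: "Re (fst q) = 0 \<Longrightarrow> q = Im (fst q) *\<^sub>R qI + Re (snd q) *\<^sub>R qJ + (- Im (snd q)) *\<^sub>R qK"
  by (simp add: qI_def qJ_def qK_def qmul_def prod_eq_iff complex_eq_iff)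

lemma metric_HP_qscale: "metric HP i x (qscale u q) (qscale v q) = (q \<bullet> q) * metric HP i x u v"
  by (simp add: metric_HP_FS FS_def hlift_qscale inner_qscale_qscale)

lemma quat_triple_HP:
  "quat_triple (metric HP i x) (\<lambda>u. qscale u qI) (\<lambda>u. qscale u qJ) (\<lambda>u. qscale u qK)"
  unfolding quat_triple_def
  by (auto simp: linear_iff qscale_linear qscale_qscale q_units metric_HP_qscale fun_eq_iff qK_def[symmetric])

lemma qbundle_HP_span:
  fixes x :: "quat ^ 'k::finite"
  shows "qbundle HP i x = span {\<lambda>u. qscale u qI, \<lambda>u. qscale u qJ, \<lambda>u. qscale u qK}"
proof
  let ?B = "{\<lambda>u :: quat ^ 'k. qscale u qI, \<lambda>u. qscale u qJ, \<lambda>u. qscale u qK}"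
  show "qbundle HP i x \<subseteq> span ?B"
  proof
    fix A :: "quat ^ 'k \<Rightarrow> quat ^ 'k" assume "A \<in> qbundle HP i x"
    then obtain q where q: "A = (\<lambda>u. qscale u q)" "Re (fst q) = 0" by (auto simp: qbundle_HP)
    have "A = Im (fst q) *\<^sub>R (\<lambda>u. qscale u qI) + Re (snd q) *\<^sub>R (\<lambda>u. qscale u qJ) + (- Im (snd q)) *\<^sub>R (\<lambda>u. qscale u qK)"
      unfolding q(1) by (subst imaginary_expand[OF q(2)]) (simp add: fun_eq_iff scaleR_fun_def qscale_linear)
    also have "\<dots> \<in> span ?B" by (intro span_add span_scale span_base) auto
    finally show "A \<in> span ?B" .
  qed
  have "subspace (qbundle HP i x :: (quat ^ 'k \<Rightarrow> quat ^ 'k) set)"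
    unfolding subspace_def qbundle_HP
  proof (intro conjI ballI allI)
    show "0 \<in> {\<lambda>u :: quat ^ 'k. qscale u q |q. Re (fst q) = 0}"
      by (intro CollectI exI[of _ 0]) (simp add: fun_eq_iff qscale_linear)
    fix A B c assume "A \<in> {\<lambda>u :: quat ^ 'k. qscale u q |q. Re (fst q) = 0}"
    then obtain q where q: "A = (\<lambda>u. qscale u q)" "Re (fst q) = 0" by auto
    show "c *\<^sub>R A \<in> {\<lambda>u. qscale u q |q. Re (fst q) = 0}"
      by (intro CollectI exI[of _ "c *\<^sub>R q"]) (simp add: q fun_eq_iff scaleR_fun_def qscale_linear)
    assume "B \<in> {\<lambda>u :: quat ^ 'k. qscale u q |q. Re (fst q) = 0}"
    then obtain r where r: "B = (\<lambda>u. qscale u r)" "Re (fst r) = 0" by auto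
    show "A + B \<in> {\<lambda>u. qscale u q |q. Re (fst q) = 0}"
      by (intro CollectI exI[of _ "q + r"]) (simp add: q r fun_eq_iff qscale_linear)
  qed
  moreover have "?B \<subseteq> qbundle HP i x" unfolding qbundle_HP using q_units(10-12) by blast
  ultimately show "span ?B \<subseteq> qbundle HP i x" by (simp add: span_minimal)
qed

text \<open>A section of Q is right multiplication by an imaginary function f. Its covariant
  derivative is right multiplication by the derivative of f corrected by a commutator with f, and
  both are imaginary.\<close>

lemma parallel_HP:
  fixes A :: "quat ^ 'k::finite \<Rightarrow> quat ^ 'k \<Rightarrow> quat ^ 'k"
  assumes W: "open W" "x \<in> W" and A: "\<And>u. smooth_on W (\<lambda>y. A y u)"
    and q: "\<And>y. y \<in> W \<Longrightarrow> A y \<in> qbundle HP i y"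
  shows "nabla_end HP i A x Y \<in> qbundle HP i x"
proof -
  define k :: 'k where "k = undefined"
  \<comment> \<open>The vector with all entries 1 reads f off from A, which yields differentiability
    of f.\<close>
  define u0 :: "quat ^ 'k" where "u0 = (\<chi> l. qone)"
  define f where "f y = A y u0 $ k" for y
  have f: "A y u = qscale u (f y)" "Re (fst (f y)) = 0" if y: "y \<in> W" for y u
  proof -
    obtain q where "A y = (\<lambda>u. qscale u q)" "Re (fst q) = 0" using q[OF y] by (auto simp: qbundle_HP)
    then show "A y u = qscale u (f y)" "Re (fst (f y)) = 0" by (simp_all add: f_def u0_def)
  qed
  have "(\<lambda>y. A y u0) differentiable (at x)" by (rule smooth_on_differentiable[OF A W(2)])
  then have "(f has_derivative (\<lambda>Y. pd (\<lambda>y. A y u0) x Y $ k)) (at x)"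
    unfolding f_def[abs_def]
    by (rule bounded_linear.has_derivative[OF bounded_linear_vec_nth pd_has_derivative])
  then obtain f' where f': "(f has_derivative f') (at x)" by blast
  have "((\<lambda>y. qone \<bullet> f y) has_derivative (\<lambda>Y. qone \<bullet> f' Y)) (at x)"
    by (rule has_derivative_inner_right[OF f'])
  moreover have "((\<lambda>y. qone \<bullet> f y) has_derivative (\<lambda>Y. 0)) (at x)"
    by (rule has_derivative_transform_within_open[OF has_derivative_const[of 0] W])
       (simp add: inner_qone f)
  ultimately have "(\<lambda>Y. qone \<bullet> f' Y) = (\<lambda>Y. 0)" by (rule has_derivative_unique)
  then have f'0: "Re (fst (f' Y)) = 0" by (metis inner_qone(1))
  have dA: "pd (\<lambda>y. A y u) x Y = qscale u (f' Y)" for u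
  proof -
    have "((\<lambda>y. qscale u (f y)) has_derivative (\<lambda>Y. qscale u (f' Y))) (at x)"
      using bounded_bilinear.FDERIV[OF bounded_bilinear_qscale has_derivative_const[of u] f']
      by (simp add: qscale_linear)
    then have "((\<lambda>y. A y u) has_derivative (\<lambda>Y. qscale u (f' Y))) (at x)"
      by (rule has_derivative_transform_within_open[OF _ W]) (simp add: f)
    from pd_eq[OF this] show ?thesis by simp
  qed
  define r where "r = f' Y - inverse (1 + x \<bullet> x) *\<^sub>R (qmul (f x) (qherm x Y) - qmul (qherm x Y) (f x))"
  have "nabla_end HP i A x Y = (\<lambda>u. qscale u r)"
    unfolding nabla_end_def dA christoffel_HP f(1)[OF W(2)]
    by (simp add: fun_eq_iff r_def \<Gamma>HP_def qherm_qscale qscale_linear qscale_qscale algebra_simps)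
  moreover have "Re (fst r) = 0"
    using f'0 Re_qmul_commute[of "f x" "qherm x Y"] by (simp add: r_def)
  ultimately show ?thesis unfolding qbundle_HP by blast
qed

lemma quaternionic_kaehler_HP:
  "quaternionic_kaehler (HP :: ('k option, (quat ^ 'k option) set, quat ^ 'k::finite) qriem)"
  unfolding quaternionic_kaehler_def
proof (intro conjI ballI allI impI riemannian_manifold_HP)
  let ?M = "HP :: ('k option, (quat ^ 'k option) set, quat ^ 'k) qriem"
  fix i j p assume p: "p \<in> chart_dom ?M i \<inter> chart_dom ?M j"
  let ?x = "chart ?M i p"
  note a = overlap_HP(1)[OF p] and y = overlap_HP(2)[OF p]
  let ?l = "tfac i j ?x"
  note l = tfac_neq_0[OF a]
  let ?c = "\<lambda>A. pd (transition ?M i j) ?x \<circ> A \<circ> pd (transition ?M j i) (chart ?M j p)"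
  have c: "?c (\<lambda>u. qscale u q) = (\<lambda>w. qscale w (qmul (qmul (qinv ?l) q) ?l))" for q
    unfolding y by (simp add: fun_eq_iff transition_right_mult[OF a])
  show "qbundle ?M j (chart ?M j p) = ?c ` qbundle ?M i ?x"
  proof
    show "?c ` qbundle ?M i ?x \<subseteq> qbundle ?M j (chart ?M j p)"
    proof
      fix B assume "B \<in> ?c ` qbundle ?M i ?x"
      then obtain A where A: "B = ?c A" "A \<in> qbundle ?M i ?x" by (rule imageE)
      then obtain q where q: "A = (\<lambda>u. qscale u q)" "Re (fst q) = 0" unfolding qbundle_HP by blast
      show "B \<in> qbundle ?M j (chart ?M j p)"
        unfolding A(1) q(1) c qbundle_HP
      proof (intro CollectI exI conjI)
        show "Re (fst (qmul (qmul (qinv ?l) q) ?l)) = 0" using Re_conj[OF l, of q] q(2) by simp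
      qed (rule refl)
    qed
    show "qbundle ?M j (chart ?M j p) \<subseteq> ?c ` qbundle ?M i ?x"
    proof
      fix B assume "B \<in> qbundle ?M j (chart ?M j p)"
      then obtain q where q: "B = (\<lambda>u. qscale u q)" "Re (fst q) = 0" unfolding qbundle_HP by blast
      let ?q = "qmul ?l (qmul q (qinv ?l))"
      have "qmul (qmul (qinv ?l) ?q) ?l = q" by (simp only: qmul_qinv_cancel[OF l])
      then have "B = ?c (\<lambda>u. qscale u ?q)" unfolding c q(1) by simp
      moreover have "Re (fst ?q) = 0"
        using q(2) by (subst Re_qmul_commute) (simp add: qmul_assoc qmul_qinv l)
      then have "(\<lambda>u. qscale u ?q) \<in> qbundle ?M i ?x" unfolding qbundle_HP by blast
      ultimately show "B \<in> ?c ` qbundle ?M i ?x" by (rule image_eqI)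
    qed
  qed
next
  let ?M = "HP :: ('k option, (quat ^ 'k option) set, quat ^ 'k) qriem"
  fix i x
  show "\<exists>W J1 J2 J3. open W \<and> x \<in> W \<and> W \<subseteq> cod ?M i \<and>
        (\<forall>u. smooth_on W (\<lambda>y. J1 y u) \<and> smooth_on W (\<lambda>y. J2 y u) \<and> smooth_on W (\<lambda>y. J3 y u)) \<and>
        (\<forall>y\<in>W. quat_triple (metric ?M i y) (J1 y) (J2 y) (J3 y) \<and>
               qbundle ?M i y = span {J1 y, J2 y, J3 y})"
    by (rule exI[of _ UNIV], rule exI[of _ "\<lambda>_ u. qscale u qI"], rule exI[of _ "\<lambda>_ u. qscale u qJ"],
        rule exI[of _ "\<lambda>_ u. qscale u qK"])
       (simp add: cod_HP smooth_on_const quat_triple_HP qbundle_HP_span)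
next
  let ?M = "HP :: ('k option, (quat ^ 'k option) set, quat ^ 'k) qriem"
  fix i W A x Y
  assume "open W \<and> W \<subseteq> cod ?M i \<and> (\<forall>u. smooth_on W (\<lambda>y. A y u)) \<and> (\<forall>y\<in>W. A y \<in> qbundle ?M i y)" "x \<in> W"
  then show "nabla_end ?M i A x Y \<in> qbundle ?M i x" using parallel_HP[of W x A i Y] by blast
qed

text \<open>The smooth Gram-Schmidt process applied to a constant field of inner products, followed
  by normalisation. It ensures that the choice in \<open>codiff\<close> picks an actual orthonormal
  basis.\<close>

lemma orthonormal_basis_exists:
  fixes h :: "'e::euclidean_space \<Rightarrow> 'e \<Rightarrow> real"
  assumes h: "inner_form h"
  shows "\<exists>B. orthonormal_basis h B"
proof -
  have b: "bilinear h" using h by (simp add: inner_form_def)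
  have "\<exists>V. \<forall>b\<in>Basis. smooth_on UNIV (V b) \<and> (\<forall>y\<in>UNIV. V b y \<noteq> 0 \<and>
     b \<in> span ((\<lambda>b. V b y) ` Basis) \<and> V b y \<in> span Basis \<and>
     (\<forall>c\<in>Basis. c \<noteq> b \<longrightarrow> (\<lambda>y :: 'e. h) y (V b y) (V c y) = 0))"
    by (rule smooth_orthogonal_frame[OF open_UNIV h smooth_on_const[OF open_UNIV] finite_Basis independent_Basis])
  then obtain V :: "'e \<Rightarrow> 'e \<Rightarrow> 'e" where V: "\<And>b. b \<in> Basis \<Longrightarrow> V b 0 \<noteq> 0"
    "\<And>b c. b \<in> Basis \<Longrightarrow> c \<in> Basis \<Longrightarrow> c \<noteq> b \<Longrightarrow> h (V b 0) (V c 0) = 0" by auto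
  define f where "f b = (1 / sqrt (h (V b 0) (V b 0))) *\<^sub>R V b 0" for b
  have o: "h (f b) (f c) = (if b = c then 1 else 0)" if "b \<in> Basis" "c \<in> Basis" for b c
  proof (cases "b = c")
    case True
    have "h (V b 0) (V b 0) > 0" using V(1)[OF that(1)] h by (simp add: inner_form_def)
    then show ?thesis using True by (simp add: f_def bilinear_lmul[OF b] bilinear_rmul[OF b])
  next
    case False
    then show ?thesis using V(2)[OF that] by (simp add: f_def bilinear_lmul[OF b] bilinear_rmul[OF b])
  qed
  then have "inj_on f Basis" using orthonormal_family_independent[OF b _ finite_Basis, of f] by blast
  then have "orthonormal_basis h (f ` Basis)"
    unfolding orthonormal_basis_def using o by (auto simp: card_image inj_on_eq_iff)
  then show ?thesis by blast
qed

lemma orthonormal_basis_sum: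
  fixes h :: "'e::euclidean_space \<Rightarrow> 'e \<Rightarrow> real" and th :: "'e \<Rightarrow> real"
  assumes h: "inner_form h" and B: "orthonormal_basis h B" and th: "linear th"
  shows "(\<Sum>e\<in>B. h e v * th e) = th v"
proof -
  have b: "bilinear h" using h by (simp add: inner_form_def)
  have f: "finite B" and c: "card B = DIM('e)" and o: "\<And>a b. a \<in> B \<Longrightarrow> b \<in> B \<Longrightarrow> h a b = (if a = b then 1 else 0)"
    using B by (auto simp: orthonormal_basis_def)
  have "independent B" using orthonormal_family_independent[OF b, of B "\<lambda>x. x"] o f by simp
  then have "UNIV \<subseteq> span B" using card_ge_dim_independent[of B UNIV] c by auto
  then have sp: "v \<in> span B" by blast
  have l1: "linear (h e)" for e using b by (simp add: bilinear_def)
  have "linear (\<lambda>v. \<Sum>e\<in>B. h e v * th e)"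
    by (auto simp: linear_iff linear_add[OF l1] linear_scale[OF l1] sum.distrib sum_distrib_left algebra_simps)
  then show ?thesis
  proof (rule linear_eq_on[OF _ th sp])
    fix a assume a: "a \<in> B"
    have "(\<Sum>e\<in>B. h e a * th e) = (\<Sum>e\<in>B. if e = a then th a else 0)"
      by (rule sum.cong) (auto simp: o a)
    then show "(\<Sum>e\<in>B. h e a * th e) = th a" using a f by simp
  qed
qed

section \<open>Conformal-Killing forms on quaternionic projective space\<close>

text \<open>It suffices to test the equation on \<open>u = Y\<close>: the difference to the \<open>\<theta>\<close>-terms is then alternating,
  hence one third of the exterior derivative.\<close>

lemma conformal_killingI:
  fixes M :: "('i, 'm, 'e::euclidean_space, 'z) riem_scheme"
  assumes R: "riemannian_manifold M" and D: "DIM('e) > 1" and \<psi>: "two_form M \<psi>"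
    and th: "\<And>i x. i \<in> idx M \<Longrightarrow> x \<in> cod M i \<Longrightarrow> linear (th i x)"
    and T: "\<And>i x Y v. i \<in> idx M \<Longrightarrow> x \<in> cod M i \<Longrightarrow> nabla_tensor2 M \<psi> i x Y Y v
       = metric M i x Y Y * th i x v - metric M i x Y v * th i x Y"
  shows "conformal_killing M \<psi>"
  unfolding conformal_killing_def
proof (intro conjI \<psi> ballI allI)
  fix i x Y u v assume i: "i \<in> idx M" "x \<in> cod M i"
  have W: "open (cod M i)" using smooth_manifold_cod_open R i by (auto simp: riemannian_manifold_def)
  let ?g = "metric M i x" and ?th = "th i x" and ?G = "christoffel M i x"
  let ?T = "nabla_tensor2 M \<psi> i x"
  have gi: "inner_form ?g" by (rule metric_inner_form[OF R i])
  have gb: "bilinear ?g" and gs: "?g a b = ?g b a" for a b using gi by (auto simp: inner_form_def)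
  note tl = th[OF i] and b = two_formD(2)[OF \<psi> i] and anti = two_formD(5)[OF \<psi> i]
  note G = christoffel_bilinear[OF R i] christoffel_sym[OF R i]
  have st: "smooth_tensor (cod M i) (\<psi> i)" by (rule tensor2_field_smooth[OF two_formD(1)[OF \<psi>] i(1)])
  have pa: "pd (\<lambda>y. \<psi> i y a b) x z = - pd (\<lambda>y. \<psi> i y b a) x z" for a b z
  proof -
    have "pd (\<lambda>y. \<psi> i y a b) x = pd (\<lambda>y. 0 - \<psi> i y b a) x"
    proof (rule pd_cong[OF W i(2)])
      show "\<psi> i y a b = 0 - \<psi> i y b a" if "y \<in> cod M i" for y
        using two_formD(5)[OF \<psi> i(1) that, of a b] by simp
    qed
    then show ?thesis using pd_diff[OF differentiable_const smooth_tensorD(3)[OF st i(2)], of 0 b a z] by simp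
  qed
  have Ta: "?T a b c = - ?T a c b" for a b c
    unfolding nabla_tensor2_def using pa[of b c a] anti[of "?G a b" c] anti[of b "?G a c"] by simp
  have Tb: "bilinear (\<lambda>a b. ?T a b c)" for c
  proof -
    have 1: "linear (\<lambda>u. pd (\<lambda>z. \<psi> i z u v) x Y)" for Y v
      by (rule pd_linear_field[OF W i(2)]) (use smooth_tensorD[OF st] i(2) in \<open>auto simp: bilinear_def\<close>)
    have 2: "linear (\<lambda>Y. pd (\<lambda>z. \<psi> i z u v) x Y)" for u v
      by (rule pd_linear[OF smooth_tensorD(3)[OF st i(2)]])
    show ?thesis
      unfolding nabla_tensor2_def bilinear_def linear_iff
      by (auto simp: linear_add[OF 1] linear_add[OF 2] linear_scale[OF 1] linear_scale[OF 2]
         bilinear_ladd[OF b] bilinear_radd[OF b] bilinear_lmul[OF b] bilinear_rmul[OF b]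
         bilinear_ladd[OF G(1)] bilinear_radd[OF G(1)] bilinear_lmul[OF G(1)] bilinear_rmul[OF G(1)] algebra_simps)
  qed
  define al where "al a b c = ?T a b c - (?g a b * ?th c - ?g a c * ?th b)" for a b c
  have al0: "al a a c = 0" for a c using T[OF i, of a c] by (simp add: al_def)
  \<comment> \<open>Polarisation of the vanishing diagonal.\<close>
  have al1: "al a b c = - al b a c" for a b c
  proof -
    have "al (a + b) (a + b) c = al a a c + al a b c + al b a c + al b b c"
      unfolding al_def bilinear_ladd[OF Tb] bilinear_radd[OF Tb] bilinear_ladd[OF gb] bilinear_radd[OF gb]
        linear_add[OF tl] by (simp add: algebra_simps)
    then show ?thesis by (simp add: al0)
  qed
  have al2: "al a b c = - al a c b" for a b c using Ta[of a b c] by (simp add: al_def)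
  \<comment> \<open>The connection is torsion-free, so its terms cancel and the exterior derivative
    is the alternation of the covariant one; the \<theta>-terms cancel there as well, and the
    alternating \<open>al\<close> is counted three times.\<close>
  have ext: "ext_d \<psi> i x a b c = 3 * al a b c" for a b c
  proof -
    have "ext_d \<psi> i x a b c = ?T a b c - ?T b a c + ?T c a b"
      unfolding ext_d_def nabla_tensor2_def
      using anti[of b "?G a c"] anti[of "?G c a" b] anti[of a "?G c b"] G(2)[of a b] G(2)[of a c] G(2)[of b c]
      by simp
    also have "\<dots> = al a b c - al b a c + al c a b"
      unfolding al_def using gs[of a b] gs[of a c] gs[of b c] by simp
    also have "\<dots> = 3 * al a b c" using al1[of b a c] al1[of c a b] al2[of a c b] by simp
    finally show ?thesis .
  qed
  \<comment> \<open>Trace over an orthonormal basis: the first term contributes the dimension, the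
    second removes one copy of \<theta>.\<close>
  have cod: "codiff M \<psi> i x c = - (real DIM('e) - 1) * ?th c" for c
  proof -
    define B where "B = (SOME B. orthonormal_basis ?g B)"
    have B: "orthonormal_basis ?g B"
      unfolding B_def by (rule someI_ex[OF orthonormal_basis_exists[OF gi]])
    have "codiff M \<psi> i x c = - (\<Sum>e\<in>B. ?g e e * ?th c - ?g e c * ?th e)"
      unfolding codiff_def B_def[symmetric] by (simp add: T[OF i])
    also have "(\<Sum>e\<in>B. ?g e e * ?th c - ?g e c * ?th e) = (\<Sum>e\<in>B. ?th c) - ?th c"
      unfolding sum_subtractf orthonormal_basis_sum[OF gi B tl]
      by (intro arg_cong2[of _ _ _ _ "(-)"] sum.cong) (use B in \<open>auto simp: orthonormal_basis_def\<close>)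
    also have "(\<Sum>e\<in>B. ?th c) = real DIM('e) * ?th c"
      using B by (simp add: orthonormal_basis_def)
    finally show ?thesis by (simp add: algebra_simps)
  qed
  have "real DIM('e) - 1 \<noteq> 0" using D by simp
  then show "?T Y u v = 1 / 3 * ext_d \<psi> i x Y u v - 1 / (real DIM('e) - 1)
            * (?g Y u * codiff M \<psi> i x v - ?g Y v * codiff M \<psi> i x u)"
    unfolding ext cod by (simp add: al_def field_simps)
qed

section \<open>The 2-form of a skew right-linear endomorphism\<close>

locale qskew =
  fixes S :: "quat ^ 'k::finite option \<Rightarrow> quat ^ 'k option"
  assumes lin: "linear S" and Sq: "S (qscale v q) = qscale (S v) q" and skew: "S v \<bullet> w = - (v \<bullet> S w)"
begin

definition mu :: "'k option \<Rightarrow> quat ^ 'k \<Rightarrow> quat" where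
  "mu i x = inverse (1 + x \<bullet> x) *\<^sub>R qherm (affine_lift i x) (S (affine_lift i x))"

definition sig :: "'k option \<Rightarrow> quat ^ 'k \<Rightarrow> quat ^ 'k \<Rightarrow> quat ^ 'k \<Rightarrow> real" where
  "sig i x u v = (qscale (hlift i u x) (mu i x) \<bullet> hlift i v x) * inverse (1 + x \<bullet> x)"

text \<open>The weight 1/2 is determined by the derivative: in \<open>psi_nabla\<close> it is the
  value for which imaginary parts cancel and only a product of real inner products survives.\<close>

definition psi :: "('k option, quat ^ 'k) tensor2" where
  "psi i x u v = FS S i x u v + sig i x u v / 2"

lemma qherm_skew: "qherm (S v) w = - qherm v (S w)"
  by (rule qherm_eqI) (simp add: inner_qscale[symmetric] Sq[symmetric] skew inner_minus_right)

lemma bounded_linear_S: "bounded_linear S"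
  using lin by (simp add: linear_conv_bounded_linear)

text \<open>Hence right multiplication by \<open>mu i x\<close> belongs to Q, so \<open>sig\<close>
  takes values in S^2H.\<close>

lemma Re_mu: "Re (fst (mu i x)) = 0"
proof -
  have "qcnj (mu i x) = - mu i x"
    unfolding mu_def qcnj_linear qcnj_qherm qherm_skew[of "affine_lift i x" "affine_lift i x"] by simp
  then show ?thesis by (simp add: qcnj_eq_neg_iff)
qed

lemma tlift_decompose: "tlift i Y = hlift i Y x + qscale (affine_lift i x) (lam x Y)"
  using decompose_hor[of "tlift i Y" "affine_lift i x"]
  by (simp add: hlift_def lam_def inner_affine_lift qherm_affine_lift qscale_linear)

text \<open>Motion along the fibre conjugates \<open>mu\<close>, which accounts for the commutator
  with \<open>lam\<close>. Horizontally, skewness of S leaves minus twice the imaginary part of the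
  hermitian product of S s with the lift of Y.\<close>

lemma mu_has_derivative:
  "(mu i has_derivative (\<lambda>Y. inverse (1 + x \<bullet> x) *\<^sub>R
      (qcnj (qherm (S (affine_lift i x)) (hlift i Y x)) - qherm (S (affine_lift i x)) (hlift i Y x))
     - qmul (lam x Y) (mu i x) + qmul (mu i x) (lam x Y))) (at x)"
proof -
  let ?s = "affine_lift i x"
  define c where "c = inverse (1 + x \<bullet> x)"
  have "((\<lambda>x. qherm (affine_lift i x) (S (affine_lift i x))) has_derivative
     (\<lambda>Y. qherm ?s (S (tlift i Y)) + qherm (tlift i Y) (S ?s))) (at x)"
    by (rule bounded_bilinear.FDERIV[OF bounded_bilinear_qherm affine_lift_has_derivative
       bounded_linear.has_derivative[OF bounded_linear_S affine_lift_has_derivative]])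
  from has_derivative_scaleR[OF inverse_norm_has_derivative[of x] this]
  show ?thesis
    unfolding mu_def[abs_def]
  proof (rule has_derivative_eq_rhs, intro ext)
    fix Y
    let ?l = "lam x Y"
    define m where "m = qherm ?s (S ?s)"
    define r where "r = qherm (S ?s) (hlift i Y x)"
    have 1: "qherm ?s (S (tlift i Y)) = - r + qmul m ?l"
      unfolding tlift_decompose[of i Y x] using qherm_skew[of ?s "hlift i Y x"]
      by (simp add: linear_add[OF lin] Sq qherm_linear qherm_qscale m_def r_def)
    have 2: "qherm (tlift i Y) (S ?s) = qcnj r + qmul (qcnj ?l) m"
      unfolding tlift_decompose[of i Y x] by (simp add: qherm_linear qherm_qscale m_def r_def qcnj_qherm)
    have 3: "qmul ?l m + qmul (qcnj ?l) m = (2 * (qone \<bullet> ?l)) *\<^sub>R m"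
      using arg_cong[OF add_qcnj[of ?l], of "\<lambda>z. qmul z m"] by (simp add: qmul_linear)
    have "inverse (1 + x \<bullet> x) *\<^sub>R (qherm ?s (S (tlift i Y)) + qherm (tlift i Y) (S ?s)) +
        (- (2 * (qone \<bullet> ?l)) * inverse (1 + x \<bullet> x)) *\<^sub>R qherm ?s (S ?s)
      = c *\<^sub>R (qcnj r - r + qmul m ?l + qmul (qcnj ?l) m - (2 * (qone \<bullet> ?l)) *\<^sub>R m)"
      unfolding 1 2 m_def[symmetric] c_def[symmetric] by (simp add: algebra_simps)
    also have "\<dots> = c *\<^sub>R (qcnj r - r) - qmul ?l (c *\<^sub>R m) + qmul (c *\<^sub>R m) ?l"
      unfolding 3[symmetric] by (simp add: qmul_linear algebra_simps)
    finally show "inverse (1 + x \<bullet> x) *\<^sub>R (qherm ?s (S (tlift i Y)) + qherm (tlift i Y) (S ?s)) +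
        (- (2 * (qone \<bullet> ?l)) * inverse (1 + x \<bullet> x)) *\<^sub>R qherm ?s (S ?s)
      = inverse (1 + x \<bullet> x) *\<^sub>R (qcnj (qherm (S ?s) (hlift i Y x)) - qherm (S ?s) (hlift i Y x))
        - qmul ?l (inverse (1 + x \<bullet> x) *\<^sub>R qherm ?s (S ?s))
        + qmul (inverse (1 + x \<bullet> x) *\<^sub>R qherm ?s (S ?s)) ?l"
      by (simp add: r_def c_def m_def)
  qed
qed

text \<open>The commutator in the derivative of \<open>mu\<close> moves the factor
  \<open>lam\<close> behind \<open>mu\<close>, where \<open>qscale_product_rule\<close> cancels it
  against the normalisation. Vertical terms stay vertical under right multiplication and pair to
  zero, so apart from the connection terms only the horizontal derivative of \<open>mu\<close> is
  left.\<close>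

lemma sig_has_derivative:
  "((\<lambda>x. sig i x u v) has_derivative (\<lambda>Y. sig i x (\<Gamma>HP x Y u) v + sig i x u (\<Gamma>HP x Y v)
    + (inverse (1 + x \<bullet> x))\<^sup>2 * ((qcnj (qherm (S (affine_lift i x)) (hlift i Y x))
         - qherm (S (affine_lift i x)) (hlift i Y x)) \<bullet> qherm (hlift i u x) (hlift i v x)))) (at x)"
proof -
  let ?s = "affine_lift i x"
  define c where "c = inverse (1 + x \<bullet> x)"
  note d = has_derivative_mult[OF has_derivative_inner[OF
      bounded_bilinear.FDERIV[OF bounded_bilinear_qscale hlift_has_derivative[of i u x] mu_has_derivative[of i x]]
      hlift_has_derivative[of i v x]] inverse_norm_has_derivative]
  show ?thesis
    unfolding sig_def
  proof (rule has_derivative_eq_rhs[OF d], intro ext)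
    fix Y
    let ?A = "hlift i u x" and ?B = "hlift i v x" and ?l = "lam x Y" and ?m = "mu i x"
    let ?Gu = "hlift i (\<Gamma>HP x Y u) x" and ?Gv = "hlift i (\<Gamma>HP x Y v) x"
    define r where "r = qherm (S ?s) (hlift i Y x)"
    have p: "qscale (qscale ?A ?m) ?l \<bullet> ?B + qscale ?A ?m \<bullet> qscale ?B ?l = 2 * (qone \<bullet> ?l) * (qscale ?A ?m \<bullet> ?B)"
      by (rule qscale_product_rule)
    have v1: "qscale (qscale ?s (kap i x Y u)) ?m \<bullet> ?B = 0"
      unfolding qscale_qscale by (rule inner_vertical_hlift)
    have v2: "qscale ?A ?m \<bullet> qscale ?s (kap i x Y v) = 0"
      unfolding inner_qscale_right qscale_qscale by (rule inner_vertical_hlift)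
    have 1: "qscale (?Gu + qscale ?A ?l - qscale ?s (kap i x Y u)) ?m \<bullet> ?B
       = qscale ?Gu ?m \<bullet> ?B + qscale ?A (qmul ?l ?m) \<bullet> ?B"
      unfolding qscale_linear inner_add_left inner_diff_left v1 by (simp add: qscale_qscale)
    have 2: "qscale ?A ?m \<bullet> (?Gv + qscale ?B ?l - qscale ?s (kap i x Y v))
       = qscale ?A ?m \<bullet> ?Gv + qscale ?A ?m \<bullet> qscale ?B ?l"
      unfolding inner_add_right inner_diff_right v2 by simp
    have 3: "qscale ?A (c *\<^sub>R (qcnj r - r) - qmul ?l ?m + qmul ?m ?l) \<bullet> ?B
      = c * ((qcnj r - r) \<bullet> qherm ?A ?B) - qscale ?A (qmul ?l ?m) \<bullet> ?B + qscale (qscale ?A ?m) ?l \<bullet> ?B"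
      unfolding qscale_linear(2,4,6) inner_add_left inner_diff_left inner_scaleR_left qscale_qscale
      by (simp add: inner_qscale inner_diff_left)
    show "qscale ?A ?m \<bullet> ?B * (- (2 * (qone \<bullet> ?l)) * inverse (1 + x \<bullet> x))
      + (qscale ?A ?m \<bullet> (?Gv + qscale ?B ?l - qscale ?s (kap i x Y v))
       + (qscale ?A (inverse (1 + x \<bullet> x) *\<^sub>R (qcnj (qherm (S ?s) (hlift i Y x)) - qherm (S ?s) (hlift i Y x))
          - qmul ?l ?m + qmul ?m ?l)
         + qscale (?Gu + qscale ?A ?l - qscale ?s (kap i x Y u)) ?m) \<bullet> ?B) * inverse (1 + x \<bullet> x)
      = qscale ?Gu ?m \<bullet> ?B * inverse (1 + x \<bullet> x) + qscale ?A ?m \<bullet> ?Gv * inverse (1 + x \<bullet> x)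
       + (inverse (1 + x \<bullet> x))\<^sup>2 * ((qcnj (qherm (S ?s) (hlift i Y x)) - qherm (S ?s) (hlift i Y x)) \<bullet> qherm ?A ?B)"
      unfolding c_def[symmetric] r_def[symmetric] inner_add_left[of _ "qscale _ ?m"] 1 2 3
      using arg_cong[OF p, of "\<lambda>z. z * c"] by (simp add: algebra_simps power2_eq_square)
  qed
qed

lemma qherm_hlift_self: "qherm (hlift i Y x) (hlift i Y x) = (hlift i Y x \<bullet> hlift i Y x) *\<^sub>R qone"
  by (rule qherm_self)

text \<open>This is the hypothesis of \<open>conformal_killingI\<close> with \<theta>(v) = -<S s,
  v^h> / |s|^2.\<close>

lemma psi_nabla:
  "nabla_tensor2 HP psi i x Y Y v = metric HP i x Y Y * (- inverse (1 + x \<bullet> x) * (S (affine_lift i x) \<bullet> hlift i v x))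
     - metric HP i x Y v * (- inverse (1 + x \<bullet> x) * (S (affine_lift i x) \<bullet> hlift i Y x))"
proof -
  let ?s = "affine_lift i x" and ?A = "hlift i Y x" and ?B = "hlift i v x"
  define c where "c = inverse (1 + x \<bullet> x)"
  define r where "r = qherm (S ?s) ?A"
  define z where "z = qherm ?A ?B"
  \<comment> \<open>On the diagonal \<open>kap\<close> is real, so the first vertical term is
    already the product of |Y^h|^2 with <S s, v^h>.\<close>
  have kY: "kap i x Y Y = (c * (?A \<bullet> ?A)) *\<^sub>R qone" by (simp add: kap_def qherm_hlift_self c_def)
  have kv: "kap i x Y v = c *\<^sub>R z" by (simp add: kap_def c_def z_def)
  have 1: "S (qscale ?s (kap i x Y Y)) \<bullet> ?B = c * (?A \<bullet> ?A) * (S ?s \<bullet> ?B)"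
    by (simp add: kY qscale_linear linear_scale[OF lin])
  have 2: "S ?A \<bullet> qscale ?s (kap i x Y v) = - (c * (z \<bullet> r))"
    by (simp add: skew Sq kv qscale_linear inner_qscale inner_commute[of ?A] r_def)
  have "((\<lambda>x. psi i x Y v) has_derivative
     (\<lambda>Z. (FS S i x (\<Gamma>HP x Z Y) v + FS S i x Y (\<Gamma>HP x Z v)
        - (S (qscale ?s (kap i x Z Y)) \<bullet> ?B + S ?A \<bullet> qscale ?s (kap i x Z v)) * inverse (1 + x \<bullet> x))
      + (sig i x (\<Gamma>HP x Z Y) v + sig i x Y (\<Gamma>HP x Z v)
        + (inverse (1 + x \<bullet> x))\<^sup>2 * ((qcnj (qherm (S ?s) (hlift i Z x)) - qherm (S ?s) (hlift i Z x)) \<bullet> qherm ?A ?B)) / 2)) (at x)"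
    unfolding psi_def
    using has_derivative_add[OF FS_derivative[OF lin Sq] has_derivative_mult_right[OF sig_has_derivative, of "1/2"]]
    by simp
  from pd_eq[OF this] have pd: "pd (\<lambda>x. psi i x Y v) x Y = psi i x (\<Gamma>HP x Y Y) v + psi i x Y (\<Gamma>HP x Y v)
     - (c * (?A \<bullet> ?A) * (S ?s \<bullet> ?B) - c * (z \<bullet> r)) * c + c\<^sup>2 * ((qcnj r - r) \<bullet> z) / 2"
    by (simp add: 1 2 psi_def c_def[symmetric] r_def[symmetric] z_def[symmetric] add_divide_distrib)
  \<comment> \<open>Half of \<open>qcnj r - r\<close> turns r into its real part, which is <S s,
    Y^h>; pairing a real quaternion with z then takes the real part of z.\<close>
  have rr: "z \<bullet> r + (qcnj r - r) \<bullet> z / 2 = (S ?s \<bullet> ?A) * (?A \<bullet> ?B)"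
  proof -
    have "z \<bullet> r + (qcnj r - r) \<bullet> z / 2 = ((r + qcnj r) \<bullet> z) / 2"
      by (simp add: inner_add_left inner_diff_left inner_commute[of z r] field_simps)
    also have "\<dots> = (qone \<bullet> r) * (qone \<bullet> z)" by (simp add: add_qcnj)
    finally show ?thesis by (simp add: r_def z_def inner_qherm)
  qed
  have g: "metric HP i x Y Y = (?A \<bullet> ?A) * c" "metric HP i x Y v = (?A \<bullet> ?B) * c"
    by (simp_all add: metric_HP_FS FS_def c_def)
  have "nabla_tensor2 HP psi i x Y Y v = c\<^sup>2 * (z \<bullet> r + (qcnj r - r) \<bullet> z / 2) - c\<^sup>2 * (?A \<bullet> ?A) * (S ?s \<bullet> ?B)"
    unfolding nabla_tensor2_def christoffel_HP pd by (simp add: power2_eq_square algebra_simps)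
  then show ?thesis unfolding rr g c_def[symmetric] by (simp add: power2_eq_square algebra_simps)
qed

lemma smooth_hlift: "smooth_on UNIV (hlift i (u :: quat ^ 'k))"
proof -
  have "1 + x \<bullet> x \<noteq> 0" for x :: "quat ^ 'k" using inner_ge_zero[of x] by linarith
  then show ?thesis
    unfolding hlift_def[abs_def] hor_def inner_affine_lift
    by (intro smooth_on_diff smooth_on_scaleR smooth_on_inverse smooth_on_add smooth_on_inner smooth_on_const
       smooth_on_bilinear[OF _ bounded_bilinear_qscale] smooth_on_bilinear[OF _ bounded_bilinear_qherm]
       smooth_affine_lift smooth_id open_UNIV) auto
qed

lemma smooth_psi: "smooth_on UNIV (\<lambda>x. psi i x u v)"
proof -
  have N: "1 + x \<bullet> x \<noteq> 0" for x :: "quat ^ 'k" using inner_ge_zero[of x] by linarith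
  have c: "smooth_on UNIV (\<lambda>x :: quat ^ 'k. inverse (1 + x \<bullet> x))"
    by (intro smooth_on_inverse smooth_on_add smooth_on_inner smooth_on_const smooth_id open_UNIV) (simp add: N)
  have m: "smooth_on UNIV (mu i)"
    unfolding mu_def[abs_def]
    by (intro smooth_on_scaleR c smooth_on_bilinear[OF _ bounded_bilinear_qherm]
       smooth_on_bounded_linear_comp[OF _ bounded_linear_S] smooth_affine_lift open_UNIV)
  show ?thesis
    unfolding psi_def FS_def sig_def
    by (intro smooth_on_add smooth_on_divide smooth_on_mult smooth_on_inner c smooth_hlift m smooth_on_const
       smooth_on_bounded_linear_comp[OF _ bounded_linear_S] smooth_on_bilinear[OF _ bounded_bilinear_qscale]
       open_UNIV) auto
qed

lemma FS_skew: "FS S i x u v = - FS S i x v u"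
  using skew[of "hlift i u x" "hlift i v x"] inner_commute[of "hlift i u x" "S (hlift i v x)"] by (simp add: FS_def)

lemma sig_skew: "sig i x u v = - sig i x v u"
proof -
  have "qcnj (mu i x) = - mu i x" using Re_mu by (simp add: qcnj_eq_neg_iff)
  then have "qscale (hlift i u x) (mu i x) \<bullet> hlift i v x = - (hlift i u x \<bullet> qscale (hlift i v x) (mu i x))"
    by (simp add: inner_qscale_right qscale_linear)
  then show ?thesis using inner_commute[of "hlift i u x"] by (simp add: sig_def)
qed

lemma FS_bilinear: "bilinear (FS S i x)"
  by (auto simp: bilinear_def linear_iff FS_def hlift_linear linear_add[OF lin] linear_scale[OF lin]
     inner_add_left inner_add_right algebra_simps)

lemma sig_bilinear: "bilinear (sig i x)"
  by (auto simp: bilinear_def linear_iff sig_def hlift_linear qscale_linear inner_add_left inner_add_right algebra_simps)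

lemma sig_metric: "sig i x u v = metric HP i x (qscale u (mu i x)) v"
  by (simp add: sig_def metric_HP_FS FS_def hlift_qscale)

lemma psi_two_form: "two_form (HP :: ('k option, (quat ^ 'k option) set, quat ^ 'k) qriem) psi"
  unfolding two_form_def tensor2_field_def
proof (intro conjI ballI allI impI)
  let ?M = "HP :: ('k option, (quat ^ 'k option) set, quat ^ 'k) qriem"
  show "bilinear (psi i x)" for i x
    unfolding psi_def using FS_bilinear[of i x] sig_bilinear[of i x]
    by (simp add: bilinear_def linear_iff add_divide_distrib algebra_simps)
  show "smooth_on (cod ?M i) (\<lambda>x. psi i x u v)" for i u v unfolding cod_HP by (rule smooth_psi)
  show "psi i x u v = - psi i x v u" for i x u v
    unfolding psi_def using FS_skew[of i x u v] sig_skew[of i x u v] by simp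
  show "psi i x = (\<lambda>u v. 0)" if "\<not> (i \<in> idx ?M \<and> x \<in> cod ?M i)" for i x
    using that by (simp add: idx_HP cod_HP)
  fix i j p u v assume p: "p \<in> chart_dom ?M i \<inter> chart_dom ?M j"
  let ?x = "chart ?M i p" and ?y = "chart ?M j p"
  let ?D = "pd (transition ?M i j) ?x"
  obtain l c where l: "l \<noteq> 0" and s: "affine_lift j ?y = qscale (affine_lift i ?x) l"
      and t: "\<And>u. tlift j (?D u) = qscale (tlift i u) l + qscale (affine_lift i ?x) (c u)"
    using lift_transform[OF p refl] by blast
  have ll: "inverse (l \<bullet> l) * (l \<bullet> l) = 1" using l by simp
  have N: "inverse (1 + ?y \<bullet> ?y) = inverse (l \<bullet> l) * inverse (1 + ?x \<bullet> ?x)"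
    unfolding inner_affine_lift[symmetric, of _ j] inner_affine_lift[symmetric, of ?x i] s
    by (simp add: inner_qscale_qscale inner_affine_lift)
  have h: "hlift j (?D u) ?y = qscale (hlift i u ?x) l" for u
    unfolding hlift_def s t by (rule hor_transform[OF affine_lift_neq_0 l])
  \<comment> \<open>\<open>mu\<close> is conjugated by l under the change of representative; stated
    without the inverse of l, in the form in which it meets the lifted vector.\<close>
  have m: "qmul l (mu j ?y) = qmul (mu i ?x) l"
    unfolding mu_def N s Sq
    using ll by (simp add: qherm_qscale qmul_linear qmul_assoc[symmetric] qmul_qcnj mult_ac)
  have "FS S j ?y (?D u) (?D v) = FS S i ?x u v"
    unfolding FS_def h N Sq inner_qscale_qscale using arg_cong[OF ll, of "\<lambda>t. t * FS S i ?x u v"]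
    by (simp add: FS_def mult_ac)
  moreover have "sig j ?y (?D u) (?D v) = sig i ?x u v"
    unfolding sig_def h N qscale_qscale m unfolding qscale_qscale[symmetric] inner_qscale_qscale
    using arg_cong[OF ll, of "\<lambda>t. t * sig i ?x u v"] by (simp add: sig_def mult_ac)
  ultimately show "psi i ?x u v = psi j ?y (?D u) (?D v)" by (simp add: psi_def)
qed

lemma psi_compatible_CK2:
  "psi \<in> compatible_CK2 (HP :: ('k option, (quat ^ 'k option) set, quat ^ 'k) qriem)"
proof -
  let ?M = "HP :: ('k option, (quat ^ 'k option) set, quat ^ 'k) qriem"
  have "compatible ?M psi"
    unfolding compatible_def
  proof (intro conjI psi_two_form ballI)
    fix i x
    have s: "(\<lambda>u v. sig i x u v / 2) \<in> S2H ?M i x"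
    proof -
      have "sig i x u v / 2 = metric ?M i x (qscale u ((1 / 2) *\<^sub>R mu i x)) v" for u v
        unfolding sig_metric by (simp add: qscale_linear bilinear_lmul[OF bilinear_metric_HP])
      moreover have "(\<lambda>u. qscale u ((1 / 2) *\<^sub>R mu i x)) \<in> qbundle ?M i x"
        unfolding qbundle_HP by (intro CollectI exI conjI, rule refl) (simp add: Re_mu)
      ultimately show ?thesis
        unfolding S2H_def by (intro CollectI exI[of _ "\<lambda>u. qscale u ((1 / 2) *\<^sub>R mu i x)"]) auto
    qed
    have e: "FS S i x \<in> S2E ?M i x"
      unfolding S2E_def
    proof (intro CollectI conjI allI impI ballI FS_bilinear FS_skew)
      fix J1 J2 J3 J u v
      assume t: "quat_triple (metric ?M i x) J1 J2 J3 \<and> qbundle ?M i x = span {J1, J2, J3}"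
        and J: "J \<in> {J1, J2, J3}"
      \<comment> \<open>\<open>S2E\<close> tests every admissible triple. Each of its members is
        right multiplication by some q, isometry forces |q| = 1, and S commutes with right
        multiplications.\<close>
      then have "J \<in> qbundle ?M i x" by (simp add: span_base)
      then obtain q where q: "J = (\<lambda>u. qscale u q)" unfolding qbundle_HP by blast
      obtain w :: "quat ^ 'k" where w: "w \<noteq> 0" using zero_neq_one[where 'a = real] by (metis vector_choose_size norm_zero zero_le_one)
      have "metric ?M i x (J w) (J w) = metric ?M i x w w"
        using t[THEN conjunct1, unfolded quat_triple_def, THEN conjunct1] J by blast
      then have "(q \<bullet> q) * metric ?M i x w w = metric ?M i x w w" unfolding q metric_HP_qscale .
      moreover have "metric ?M i x w w > 0"
        using metric_inner_form[OF riemannian_manifold_HP, of i x] w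
        by (simp add: idx_HP cod_HP inner_form_def)
      ultimately have "q \<bullet> q = 1" by simp
      then show "FS S i x (J u) (J v) = FS S i x u v"
        by (simp add: q FS_def hlift_qscale Sq inner_qscale_qscale)
    qed
    have "psi i x = (\<lambda>u v. sig i x u v / 2) + FS S i x" by (simp add: fun_eq_iff psi_def)
    with s e show "\<exists>\<sigma>\<in>S2H ?M i x. \<exists>\<phi>\<in>S2E ?M i x. psi i x = \<sigma> + \<phi>" by blast
  qed
  moreover have "conformal_killing ?M psi"
  proof (rule conformal_killingI[OF riemannian_manifold_HP _ psi_two_form])
    have "0 < CARD('k)" by simp
    then have "1 < CARD('k) * 4" by linarith
    then show "1 < DIM(quat ^ 'k)" by simp
    show "linear (\<lambda>v. - inverse (1 + x \<bullet> x) * (S (affine_lift i x) \<bullet> hlift i v x))" for i x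
      by (auto simp: linear_iff hlift_linear inner_add_right algebra_simps)
  qed (rule psi_nabla)
  ultimately show ?thesis by (simp add: compatible_CK2_def)
qed

end

section \<open>Skew-hermitian matrices and the lower bound\<close>

type_synonym 'k qmat = "(quat ^ 'k option) ^ 'k option"

definition mact :: "'k::finite qmat \<Rightarrow> quat ^ 'k option \<Rightarrow> quat ^ 'k option" where
  "mact A v = (\<chi> a. \<Sum>b\<in>UNIV. qmul (A $ a $ b) (v $ b))"

definition skew_herm :: "'k::finite qmat set" where
  "skew_herm = {A. \<forall>a b. A $ a $ b = - qcnj (A $ b $ a)}"

definition herm :: "'k::finite qmat set" where
  "herm = {A. \<forall>a b. A $ a $ b = qcnj (A $ b $ a)}"

lemma mact_linear: "mact (A + B) v = mact A v + mact B v" "mact (c *\<^sub>R A) v = c *\<^sub>R mact A v"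
  by (simp_all add: mact_def vec_eq_iff qmul_linear sum.distrib scaleR_sum_right)

lemma qmul_sum: "qmul (\<Sum>a\<in>I. f a) q = (\<Sum>a\<in>I. qmul (f a) q)"
  by (rule linear_sum) (simp add: linear_iff qmul_linear)

lemma qskew_mact:
  assumes A: "A \<in> skew_herm"
  shows "qskew (mact A)"
proof (rule qskew.intro)
  show "linear (mact A)"
    by (auto simp: linear_iff mact_def vec_eq_iff qmul_linear sum.distrib scaleR_sum_right)
  show "mact A (qscale v q) = qscale (mact A v) q" for v q
    by (simp add: mact_def vec_eq_iff qmul_sum qmul_assoc)
  show "mact A v \<bullet> w = - (v \<bullet> mact A w)" for v w
  proof -
    have e: "qmul (A $ a $ b) (v $ b) \<bullet> w $ a = - (v $ b \<bullet> qmul (A $ b $ a) (w $ a))" for a b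
    proof -
      have "A $ b $ a = - qcnj (A $ a $ b)" using A unfolding skew_herm_def by blast
      then show ?thesis
        by (simp add: inner_qmul_left bilinear_lneg[OF bilinear_qmul])
    qed
    have "mact A v \<bullet> w = (\<Sum>a\<in>UNIV. \<Sum>b\<in>UNIV. - (v $ b \<bullet> qmul (A $ b $ a) (w $ a)))"
      by (simp add: inner_vec_def mact_def inner_sum_left e)
    also have "\<dots> = (\<Sum>b\<in>UNIV. \<Sum>a\<in>UNIV. - (v $ b \<bullet> qmul (A $ b $ a) (w $ a)))" by (rule sum.swap)
    also have "\<dots> = - (v \<bullet> mact A w)"
      by (simp add: inner_vec_def mact_def inner_sum_right sum_negf)
    finally show ?thesis .
  qed
qed

text \<open>The formula of \<open>qskew.psi\<close> written out for all matrices, so that it is a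
  linear map on the whole matrix space; it is used as a conformal-Killing form on skew-hermitian
  matrices only.\<close>

definition Psi :: "'k::finite qmat \<Rightarrow> ('k option, quat ^ 'k) tensor2" where
  "Psi A i x u v = FS (mact A) i x u v
     + (qscale (hlift i u x) (inverse (1 + x \<bullet> x) *\<^sub>R qherm (affine_lift i x) (mact A (affine_lift i x)))
         \<bullet> hlift i v x) * inverse (1 + x \<bullet> x) / 2"

lemma Psi_psi: "A \<in> skew_herm \<Longrightarrow> Psi A = qskew.psi (mact A)"
  by (simp add: fun_eq_iff Psi_def qskew.psi_def[OF qskew_mact] qskew.sig_def[OF qskew_mact] qskew.mu_def[OF qskew_mact])

lemma Psi_in: "A \<in> skew_herm \<Longrightarrow>
   Psi A \<in> compatible_CK2 (HP :: ('k option, (quat ^ 'k option) set, quat ^ 'k::finite) qriem)"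
  using Psi_psi qskew.psi_compatible_CK2[OF qskew_mact] by metis

lemma linear_Psi: "linear Psi"
  by (auto simp: linear_iff fun_eq_iff Psi_def FS_def mact_linear qherm_linear qscale_linear scaleR_fun_def
     inner_add_left inner_add_right algebra_simps add_divide_distrib)

text \<open>At the origin of chart \<open>i\<close> the representative is the \<open>i\<close>-th
  unit vector and tangent lifts are horizontal. The entries outside row and column \<open>i\<close>
  appear directly, and the entry at (i, i) enters through \<open>mu\<close>, on equal axes
  only.\<close>

lemma Psi_at_origin:
  "Psi A i 0 (axis k p) (axis l r) = qmul (A $ rho i l $ rho i k) p \<bullet> r
     + (if k = l then qmul p (A $ i $ i) \<bullet> r / 2 else 0)"
proof -
  have h: "hlift i u 0 = tlift i u" for u
    using qherm_affine_lift[of i 0 u] by (simp add: hlift_def hor_def qherm_linear qscale_linear)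
  have inner: "w \<bullet> tlift i (axis l r) = w $ rho i l \<bullet> r" for w
  proof -
    have "w $ rho i m \<bullet> axis l r $ m = (if m = l then w $ rho i m \<bullet> r else 0)" for m
      by (simp add: axis_def)
    then have "w \<bullet> tlift i (axis l r) = (\<Sum>m\<in>UNIV. if m = l then w $ rho i m \<bullet> r else 0)"
      unfolding inner_vec_def sum_rho[of _ i] by simp
    then show ?thesis by simp
  qed
  have 1: "mact A (tlift i (axis k p)) $ a = qmul (A $ a $ rho i k) p" for a
  proof -
    have "qmul (A $ a $ rho i m) (axis k p $ m) = (if m = k then qmul (A $ a $ rho i m) p else 0)" for m
      by (simp add: axis_def)
    then have "mact A (tlift i (axis k p)) $ a = (\<Sum>m\<in>UNIV. if m = k then qmul (A $ a $ rho i m) p else 0)"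
      unfolding mact_def vec_lambda_beta sum_rho[of _ i] by simp
    then show ?thesis by simp
  qed
  have 2: "mact A (affine_lift i 0) $ a = A $ a $ i" for a
    unfolding mact_def vec_lambda_beta sum_rho[of _ i] by simp
  have 3: "qherm (affine_lift i 0) (mact A (affine_lift i 0)) = A $ i $ i"
    unfolding qherm_def sum_rho[of _ i] 2 by simp
  have 4: "axis k p $ l = (if k = l then p else 0)" by (simp add: axis_def)
  show ?thesis
    unfolding Psi_def FS_def h inner 3 by (simp add: 1 4)
qed

text \<open>Off-diagonal entries are read at the origin of a chart different from both positions.
  For a diagonal entry a and another diagonal entry b, the relation 2 b p + p a = 0 for all p gives
  2 b = -a and then a p = p a. So a is central, hence real, and being imaginary as well it
  vanishes.\<close>

lemma Psi_injective:
  fixes A :: "'k::finite qmat"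
  assumes n: "CARD('k) \<ge> 2" and A: "A \<in> skew_herm" and z: "Psi A = 0"
  shows "A = 0"
proof -
  have z': "qmul (A $ rho i l $ rho i k) p \<bullet> r + (if k = l then qmul p (A $ i $ i) \<bullet> r / 2 else 0) = 0"
    for i k l p r
    using Psi_at_origin[of A i k p l r] z by simp
  have off: "A $ rho i l $ rho i k = 0" if "k \<noteq> l" for i k l
  proof -
    have "qmul (A $ rho i l $ rho i k) qone \<bullet> r = 0" for r using z'[of i l k qone r] that by simp
    from this[of "A $ rho i l $ rho i k"] show ?thesis by simp
  qed
  have diag: "A $ i $ i = 0" for i
  proof -
    define k :: 'k where "k = undefined"
    let ?a = "A $ i $ i" and ?b = "A $ rho i k $ rho i k"
    have e: "2 *\<^sub>R qmul ?b p + qmul p ?a = 0" for p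
    proof -
      have "(2 *\<^sub>R qmul ?b p + qmul p ?a) \<bullet> r = 0" for r using z'[of i k k p r] by (simp add: inner_add_left)
      then show ?thesis by (metis inner_eq_zero_iff)
    qed
    have "2 *\<^sub>R ?b = - ?a" using e[of qone] by (simp add: eq_neg_iff_add_eq_0)
    then have b: "2 *\<^sub>R qmul ?b p = - qmul ?a p" for p
      using qmul_linear(3)[of 2 ?b p] by (simp add: bilinear_lneg[OF bilinear_qmul])
    have c: "qmul p ?a = qmul ?a p" for p
    proof -
      have "qmul p ?a - qmul ?a p = 0" using e[of p] unfolding b by simp
      then show ?thesis by simp
    qed
    have "?a = - qcnj ?a" using A unfolding skew_herm_def by blast
    then have "Re (fst ?a) = 0" by (metis qcnj_eq_neg_iff minus_minus)
    moreover have "Im (fst ?a) = 0 \<and> snd ?a = 0"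
      using c[of qI] c[of qJ] by (auto simp: qmul_def qI_def qJ_def prod_eq_iff complex_eq_iff)
    ultimately show ?thesis by (simp add: prod_eq_iff complex_eq_iff)
  qed
  have "A $ a $ b = 0" for a b
  proof (cases "a = b")
    case False
    \<comment> \<open>A third position exists because there are n + 1 >= 3 of them.\<close>
    have "card {a, b} < CARD('k option)" using n False by (simp add: card_option)
    then have "{a, b} \<noteq> UNIV" by (metis less_irrefl)
    then obtain i where i: "i \<noteq> a" "i \<noteq> b" by blast
    then have "a \<in> range (rho i)" "b \<in> range (rho i)" using bij_rho[of i] by (auto simp: bij_betw_def)
    then obtain k l where "a = rho i l" "b = rho i k" by auto
    with off[of k l i] False show ?thesis by auto
  qed (simp add: diag)
  then show ?thesis by (simp add: vec_eq_iff)
qed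

text \<open>A hermitian matrix is determined by its real diagonal and the four real components of
  each entry above it.\<close>

lemma dim_herm:
  "dim (herm :: 'k::finite qmat set) \<le> CARD('k option) + 2 * (CARD('k option) * (CARD('k option) - 1))"
proof -
  let ?m = "CARD('k option)"
  obtain e :: "nat \<Rightarrow> 'k option" where e: "bij_betw e {..<?m} UNIV"
    using ex_bij_betw_nat_finite[of "UNIV :: 'k option set"] by (auto simp: atLeast0LessThan)
  define F1 where "F1 = range (\<lambda>a (A :: 'k qmat). Re (fst (A $ a $ a)))"
  define F2 where "F2 = (\<lambda>((a, b), c) (A :: 'k qmat). A $ e a $ e b \<bullet> c) ` ({(a, b). a < b \<and> b < ?m} \<times> Basis)"
  have f: "finite {(a, b). a < b \<and> b < ?m}" by (rule finite_subset[of _ "{..<?m} \<times> {..<?m}"]) auto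
  have fin: "finite (F1 \<union> F2)"
    unfolding F1_def F2_def by (intro finite_UnI finite_imageI finite_cartesian_product f finite_Basis finite)
  have "finite_dim (herm :: 'k qmat set) \<and> dim (herm :: 'k qmat set) \<le> card (F1 \<union> F2)"
  proof (rule dim_le_functionals[OF fin])
    show "subspace (herm :: 'k qmat set)"
      unfolding subspace_def
    proof (intro conjI ballI allI)
      fix x y :: "'k qmat" and c :: real assume x: "x \<in> herm"
      have hx: "x $ a $ b = qcnj (x $ b $ a)" for a b using x unfolding herm_def by blast
      have "(c *\<^sub>R x) $ a $ b = qcnj ((c *\<^sub>R x) $ b $ a)" for a b using hx[of a b] by simp
      then show "c *\<^sub>R x \<in> herm" unfolding herm_def by blast
      assume y: "y \<in> herm"
      have hy: "y $ a $ b = qcnj (y $ b $ a)" for a b using y unfolding herm_def by blast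
      have "(x + y) $ a $ b = qcnj ((x + y) $ b $ a)" for a b using hx[of a b] hy[of a b] by simp
      then show "x + y \<in> herm" unfolding herm_def by blast
    qed (simp add: herm_def)
    show "f (x + y) = f x + f y" if "f \<in> F1 \<union> F2" for f x y
      using that by (auto simp: F1_def F2_def inner_add_left)
    show "f (c *\<^sub>R x) = c * f x" if "f \<in> F1 \<union> F2" for f x c
      using that by (auto simp: F1_def F2_def)
    fix A :: "'k qmat" assume A: "A \<in> herm" and z: "\<And>f. f \<in> F1 \<union> F2 \<Longrightarrow> f A = 0"
    have h: "A $ a $ b = qcnj (A $ b $ a)" for a b using A unfolding herm_def by blast
    have diag: "A $ a $ a = 0" for a
    proof -
      have "Re (fst (A $ a $ a)) = 0" using z[of "\<lambda>A. Re (fst (A $ a $ a))"] by (simp add: F1_def)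
      then show ?thesis using h[of a a] by (auto simp: qcnj_def prod_eq_iff complex_eq_iff)
    qed
    have up: "A $ e a $ e b = 0" if ab: "a < b" "b < ?m" for a b
    proof (rule euclidean_eqI)
      fix c :: quat assume "c \<in> Basis"
      then have "((a, b), c) \<in> {(a, b). a < b \<and> b < ?m} \<times> Basis" using ab by auto
      then have F: "(\<lambda>A :: 'k qmat. A $ e a $ e b \<bullet> c) \<in> F2" unfolding F2_def by (rule rev_image_eqI) simp
      have "A $ e a $ e b \<bullet> c = 0" using z[of "\<lambda>A. A $ e a $ e b \<bullet> c", OF UnI2[OF F]] .
      then show "A $ e a $ e b \<bullet> c = 0 \<bullet> c" by simp
    qed
    have "A $ a $ b = 0" for a b
    proof -
      obtain k l where k: "a = e k" "b = e l" "k < ?m" "l < ?m" using e unfolding bij_betw_def by blast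
      consider "k < l" | "l < k" | "k = l" by linarith
      then show ?thesis using k up[of k l] up[of l k] h[of "e k" "e l"] diag by cases auto
    qed
    then show "A = 0" by (simp add: vec_eq_iff)
  qed
  moreover have "card (F1 \<union> F2) \<le> ?m + 2 * (?m * (?m - 1))"
  proof -
    have "card F1 \<le> ?m" unfolding F1_def by (rule card_image_le) simp
    moreover have "card F2 \<le> card {(a, b). a < b \<and> b < ?m} * 4"
    proof -
      have "card (Basis :: quat set) = 4" by simp
      then have "card ({(a, b). a < b \<and> b < ?m} \<times> (Basis :: quat set)) = card {(a, b). a < b \<and> b < ?m} * 4"
        unfolding card_cartesian_product by (rule arg_cong)
      moreover have "card F2 \<le> card ({(a, b). a < b \<and> b < ?m} \<times> (Basis :: quat set))"
        unfolding F2_def by (rule card_image_le) (intro finite_cartesian_product f finite_Basis)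
      ultimately show ?thesis by linarith
    qed
    moreover have "card {(a, b). a < b \<and> b < ?m} * 4 = 2 * (?m * (?m - 1))" using card_upper_pairs[of ?m] by simp
    ultimately show ?thesis using card_Un_le[of F1 F2] by linarith
  qed
  ultimately show ?thesis by linarith
qed

text \<open>Every matrix is the sum of its skew-hermitian and its hermitian part, so the upper bound
  for \<open>herm\<close> gives a lower bound here: 4 m^2 - m - 2 m (m - 1) = m (2 m + 1), with m =
  n + 1.\<close>

lemma dim_skew_herm:
  "dim (skew_herm :: 'k::finite qmat set) \<ge> CARD('k option) * (2 * CARD('k option) + 1)"
proof -
  let ?m = "CARD('k option)"
  obtain B where B: "B \<subseteq> (skew_herm :: 'k qmat set)" "independent B" "skew_herm \<subseteq> span B" "card B = dim (skew_herm :: 'k qmat set)"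
    by (rule basis_exists)
  obtain C where C: "C \<subseteq> (herm :: 'k qmat set)" "independent C" "herm \<subseteq> span C" "card C = dim (herm :: 'k qmat set)"
    by (rule basis_exists)
  have fin: "finite B" "finite C" using B(2) C(2) independent_imp_finite by blast+
  have "A \<in> span (B \<union> C)" for A :: "'k qmat"
  proof -
    define P where "P = (\<chi> a b. (1 / 2) *\<^sub>R (A $ a $ b - qcnj (A $ b $ a)))"
    define Q where "Q = (\<chi> a b. (1 / 2) *\<^sub>R (A $ a $ b + qcnj (A $ b $ a)))"
    have "P \<in> skew_herm" by (simp add: skew_herm_def P_def algebra_simps)
    then have P: "P \<in> span (B \<union> C)" using B(3) span_mono[of B "B \<union> C"] by blast
    have "Q \<in> herm" by (simp add: herm_def Q_def algebra_simps)
    then have Q: "Q \<in> span (B \<union> C)" using C(3) span_mono[of C "B \<union> C"] by blast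
    have "A = P + Q" by (simp add: vec_eq_iff P_def Q_def algebra_simps flip: scaleR_add_left)
    then show ?thesis using P Q span_add by metis
  qed
  then have "dim (UNIV :: 'k qmat set) \<le> card (B \<union> C)" by (intro dim_le_card) (use fin in auto)
  also have "\<dots> \<le> card B + card C" by (rule card_Un_le)
  finally have "DIM('k qmat) \<le> dim (skew_herm :: 'k qmat set) + dim (herm :: 'k qmat set)"
    using B(4) C(4) by simp
  then have "?m * (?m * 4) \<le> dim (skew_herm :: 'k qmat set) + (?m + 2 * (?m * (?m - 1)))"
    using dim_herm[where 'k = 'k] by simp
  moreover have "?m * (?m * 4) = ?m * (2 * ?m + 1) + (?m + 2 * (?m * (?m - 1)))"
    by (cases "?m") (simp_all add: algebra_simps)
  ultimately show ?thesis by linarith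
qed

text \<open>The image under \<open>Psi\<close> of a basis of \<open>skew_herm\<close> is
  independent. Finite-dimensionality is required because \<open>dim\<close> is 0 on an
  infinite-dimensional space; it is supplied by the upper bound.\<close>

theorem compatible_CK2_HP_dim_ge:
  assumes n: "CARD('k::finite) \<ge> 2"
    and fd: "finite_dim (compatible_CK2 (HP :: ('k option, (quat ^ 'k option) set, quat ^ 'k) qriem))"
  shows "dim (compatible_CK2 (HP :: ('k option, (quat ^ 'k option) set, quat ^ 'k) qriem))
     \<ge> (CARD('k) + 1) * (2 * CARD('k) + 3)"
proof -
  let ?V = "compatible_CK2 (HP :: ('k option, (quat ^ 'k option) set, quat ^ 'k) qriem)"
  obtain B where B: "B \<subseteq> (skew_herm :: 'k qmat set)" "independent B" "card B = dim (skew_herm :: 'k qmat set)"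
    by (rule basis_exists)
  have fB: "finite B" using B(2) independent_imp_finite by blast
  have sub: "subspace (skew_herm :: 'k qmat set)"
    unfolding subspace_def
  proof (intro conjI ballI allI)
    fix x y :: "'k qmat" and c :: real assume x: "x \<in> skew_herm"
    have hx: "x $ a $ b = - qcnj (x $ b $ a)" for a b using x unfolding skew_herm_def by blast
    have "(c *\<^sub>R x) $ a $ b = - qcnj ((c *\<^sub>R x) $ b $ a)" for a b using hx[of a b] by simp
    then show "c *\<^sub>R x \<in> skew_herm" unfolding skew_herm_def by blast
    assume y: "y \<in> skew_herm"
    have hy: "y $ a $ b = - qcnj (y $ b $ a)" for a b using y unfolding skew_herm_def by blast
    have "(x + y) $ a $ b = - qcnj ((x + y) $ b $ a)" for a b using hx[of a b] hy[of a b] by simp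
    then show "x + y \<in> skew_herm" unfolding skew_herm_def by blast
  qed (simp add: skew_herm_def)
  have sB: "span B \<subseteq> skew_herm" using B(1) sub by (rule span_minimal)
  have inj: "inj_on Psi (span B)"
  proof (rule inj_onI)
    fix x y assume xy: "x \<in> span B" "y \<in> span B" "Psi x = Psi y"
    have "x - y \<in> skew_herm" using xy sB span_diff by blast
    moreover have "Psi (x - y) = 0" using xy(3) linear_diff[OF linear_Psi, of x y] by simp
    ultimately have "x - y = 0" using Psi_injective[OF n] by blast
    then show "x = y" by simp
  qed
  have ind: "independent (Psi ` B)"
    by (rule linear_independent_injective_image[OF linear_Psi B(2) inj])
  obtain F where F: "finite F" "?V \<subseteq> span F" using fd unfolding finite_dim_def by blast
  obtain C where C: "C \<subseteq> ?V" "independent C" "?V \<subseteq> span C" "card C = dim ?V" by (rule basis_exists)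
  have "finite C" using independent_span_bound[OF F(1) C(2)] C(1) F(2) by blast
  moreover have "Psi ` B \<subseteq> span C" using B(1) Psi_in C(3) by blast
  ultimately have "card (Psi ` B) \<le> card C" using independent_span_bound[OF _ ind] by blast
  moreover have "card (Psi ` B) = card B"
    by (rule card_image, rule inj_on_subset[OF inj span_superset])
  ultimately have "CARD('k option) * (2 * CARD('k option) + 1) \<le> dim ?V"
    using dim_skew_herm[where 'k = 'k] B(3) C(4) by linarith
  then show ?thesis by (simp add: card_option algebra_simps)
qed

theorem corollary7:
  fixes M :: "('i, 'm, 'e::euclidean_space) qriem" and n :: nat
  assumes "n \<ge> 2"
  shows "(quaternionic_kaehler M \<and> connected_space (mtop M) \<and> DIM('e) = 4 * n \<longrightarrow>
            finite_dim (compatible_CK2 M) \<and>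
            dim (compatible_CK2 M) \<le> (n + 1) * (2 * n + 3)) \<and>
         (CARD('k::finite) = n \<longrightarrow>
            quaternionic_kaehler (HP :: ('k option, (quat ^ 'k option) set, quat ^ 'k) qriem) \<and>
            connected_space (mtop (HP :: ('k option, (quat ^ 'k option) set, quat ^ 'k) qriem)) \<and>
            dim (compatible_CK2 (HP :: ('k option, (quat ^ 'k option) set, quat ^ 'k) qriem))
              = (n + 1) * (2 * n + 3))"
proof (intro conjI impI)
  assume "quaternionic_kaehler M \<and> connected_space (mtop M) \<and> DIM('e) = 4 * n"
  then show "finite_dim (compatible_CK2 M)" "dim (compatible_CK2 M) \<le> (n + 1) * (2 * n + 3)"
    using compatible_CK2_dim_le[of M n] assms by blast+
next
  let ?M = "HP :: ('k option, (quat ^ 'k option) set, quat ^ 'k) qriem"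
  show "quaternionic_kaehler ?M" by (rule quaternionic_kaehler_HP)
  show c: "connected_space (mtop ?M)" by (simp add: mtop_HP connected_HP_top)
  assume n: "CARD('k) = n"
  have "DIM(quat ^ 'k) = 4 * n" using n by simp
  from compatible_CK2_dim_le[OF quaternionic_kaehler_HP c assms this] compatible_CK2_HP_dim_ge[where 'k = 'k]
  show "dim (compatible_CK2 ?M) = (n + 1) * (2 * n + 3)" using assms unfolding n by (simp add: le_antisym)
qed

end
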